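(* Let $H$ be a cocommutative Hopf algebra over $\mathbf k$, let $L$ be a Lie $H$-pseudoalgebra, $M$ an $L$-module, and $\mathcal L=\mathcal A(L)$ the annihilation Lie algebra of $L$. Then the basic cohomology $\widetilde{\mathrm H}^\bullet(L,M)$ of $L$ with coefficients in $M$ is isomorphic to the Gelfand--Fuchs cohomology $\mathrm H^\bullet_{\mathrm{GF}}(\mathcal L,M)$ of its annihilation Lie algebra $\mathcal L$.
   Context: $\mathbf k$ is an algebraically closed field of characteristic $0$; vector spaces and unadorned $\otimes$ are over $\mathbf k$. $\Delta,\varepsilon,S$ are the coproduct, counit and antipode of $H$. $H^{\otimes n}$ is a right $H$-module via the iterated coproduct. Let $G$ be the group of group-like elements of $H$. Define subspaces $\mathrm F^nH$ inductively by $\mathrm F^nH=0$ for $n<0$, $\mathrm F^0H=\mathbf k[G]$, and, for $n\ge1$, $\mathrm F^nH$ is the span of all $h\in H$ with $\Delta(h)\in\mathrm F^0H\otimes h+h\otimes\mathrm F^0H+\sum_{i=1}^{n-1}\mathrm F^iH\otimes\mathrm F^{n-i}H$. $X=H^*$ is a commutative algebra (product dual to $\Delta$), an $H$-bimodule by $\langle hx,f\rangle=\langle x,S(h)f\rangle$, $\langle xh,f\rangle=\langle x,fS(h)\rangle$; $\mathrm F_nX=(\mathrm F^nH)^\perp$. A Lie $H$-pseudoalgebra is a left $H$-module $L$ with a linear map $L\otimes L\to(H\otimes H)\otimes_HL$, $a\otimes b\mapsto[a*b]$, with $[fa*gb]=((f\otimes g)\otimes_H1)[a*b]$; $[b*a]=-(\sigma\otimes_H\mathrm{id})[a*b]$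 ($\sigma$ the flip); $[a*[b*c]]-((\sigma\otimes\mathrm{id})\otimes_H\mathrm{id})[b*[a*c]]=[[a*b]*c]$ in $H^{\otimes3}\otimes_HL$. An $L$-module is a left $H$-module $M$ with a linear map $L\otimes M\to(H\otimes H)\otimes_HM$, $a\otimes m\mapsto a*m$, with $fa*gm=((f\otimes g)\otimes_H1)(a*m)$ and $a*(b*m)-((\sigma\otimes\mathrm{id})\otimes_H\mathrm{id})(b*(a*m))=[a*b]*m$. Compositions are as follows: if $a*m=\sum_i(f_i\otimes g_i)\otimes_Hc_i$, then for $f\in H^{\otimes2}$, $a*(f\otimes_Hm)=\sum_i(1\otimes f)(f_i\otimes\Delta(g_i))\otimes_Hc_i$ and $(f\otimes_Ha)*m=\sum_i(f\otimes1)(\Delta(f_i)\otimes g_i)\otimes_Hc_i$; the same rules apply to the bracket of $L$. $\mathcal L=\mathcal A(L)=X\otimes_HL$ is a Lie algebra with $[x\otimes_Ha,y\otimes_Hb]=\sum_i(xf_i)(yg_i)\otimes_He_i$ if $[a*b]=\sum_i(f_i\otimes g_i)\otimes_He_i$; it acts on $M$ by $(x\otimes_Ha)\cdot m=\sum_i\langle S(x),h_i\rangle v_i$ if $a*m=\sum_i(h_i\otimes1)\otimes_Hv_i$, where $\langle S(x),h\rangle=\langle x,S(h)\rangle$ (every element of $(H\otimes H)\otimes_HM$ has this form, uniquely once the $h_i$ are taken from a fixed basis of $H$). Basic cohomology: $\widetilde C^n(L,M)$ is the space of $\gamma\in\mathrm{Hom}_{H^{\otimes n}}(L^{\otimes n},H^{\otimes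 n}\otimes M)$ with $\gamma(\dots a_{i+1}\otimes a_i\dots)=-(\sigma_{i,i+1}\otimes\mathrm{id})\gamma(\dots a_i\otimes a_{i+1}\dots)$, where $\sigma_{i,i+1}$ transposes the $i$th and $(i+1)$st factors of $H^{\otimes n}$ ($\widetilde C^0(L,M)=M$). The differential is $(d\gamma)(a_1\otimes\cdots\otimes a_{n+1})=\sum_i(-1)^{i+1}(\sigma_{1\to i}\otimes\mathrm{id})\,a_i*\gamma(a_1\otimes\cdots\widehat{a_i}\cdots\otimes a_{n+1})+\sum_{i<j}(-1)^{i+j}(\sigma_{1\to i,2\to j}\otimes\mathrm{id})\,\gamma([a_i*a_j]\otimes a_1\otimes\cdots\widehat{a_i}\cdots\widehat{a_j}\cdots\otimes a_{n+1})$. Here $\sigma_{1\to i}$ moves the first factor of $H^{\otimes(n+1)}$ to position $i$; $\sigma_{1\to i,2\to j}$ moves the first two factors to positions $i,j$; for $f\in H^{\otimes n}$, $a*(f\otimes m)=\sum_ih_i\otimes f\otimes v_i$ if $a*m=\sum_i(h_i\otimes1)\otimes_Hv_i$; and $\gamma((g\otimes_Hb)\otimes a_2\otimes\cdots)=\sum_k(g\otimes1^{\otimes(n-1)})(\Delta\otimes\mathrm{id}^{\otimes(n-1)})(g_k)\otimes v_k$ if $\gamma(b\otimes a_2\otimes\cdots)=\sum_kg_k\otimes v_k$. $\widetilde{\mathrm H}^\bullet(L,M)$ is the cohomology of this complex. $\mathrm H^\bullet_{\mathrm{GF}}(\mathcal L,M)$ is the cohomology of the subcomplex of the Chevalley--Eilenberg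 complex $C^\bullet(\mathcal L,M)$ consisting of local cochains $c$, i.e. those such that for any fixed $x_2,\dots,x_n\in X$ and $a_1,\dots,a_n\in L$ one has $c((x_1\otimes_Ha_1)\otimes\cdots\otimes(x_n\otimes_Ha_n))=0$ for $x_1\in\mathrm F_kX$, $k\gg0$.
   Formalization: The formal theorem additionally assumes that every F^iH is finite-dimensional; without this the claim fails, e.g. for H = k[Z], L = H with zero bracket and M = k with trivial actions. *)

theory Defs
  imports
    "HOL-Library.Poly_Mapping"
    "HOL-Library.Set_Algebras"
    "HOL-Library.Function_Algebras"
    "HOL-Computational_Algebra.Polynomial"
begin

section \<open>Quotients of free vector spaces\<close>

text \<open>
  All tensor products are quotients of a free vector space (finitely supported functions on a
  type of generators) by the span of the defining relations, and their elements are cosets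
  \<open>p +o R\<close>. A map out of such a quotient is computed on an arbitrary representative
  \<open>rep\<close> of the coset; in every use below the result does not depend on the choice.
\<close>

definition fscale :: "'k::field \<Rightarrow> ('g \<Rightarrow>\<^sub>0 'k) \<Rightarrow> ('g \<Rightarrow>\<^sub>0 'k)"
  where "fscale c p = Poly_Mapping.map ((*) c) p"

lemma lookup_fscale: "Poly_Mapping.lookup (fscale c p) g = c * Poly_Mapping.lookup p g"
  by (simp add: fscale_def map.rep_eq when_def)

global_interpretation free: vector_space "fscale :: 'k::field \<Rightarrow> ('g \<Rightarrow>\<^sub>0 'k) \<Rightarrow> _"
  by unfold_locales
    (auto intro!: poly_mapping_eqI simp: lookup_fscale lookup_add algebra_simps)

definition gen :: "'g \<Rightarrow> ('g \<Rightarrow>\<^sub>0 'k::field)"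
  where "gen g = Poly_Mapping.single g 1"

definition lin_ext :: "('k::field \<Rightarrow> 'v \<Rightarrow> 'v) \<Rightarrow> ('g \<Rightarrow> 'v) \<Rightarrow> ('g \<Rightarrow>\<^sub>0 'k) \<Rightarrow> 'v::ab_group_add"
  where "lin_ext sc f p = (\<Sum>g\<in>Poly_Mapping.keys p. sc (Poly_Mapping.lookup p g) (f g))"

abbreviation free_ext :: "('g \<Rightarrow> ('e \<Rightarrow>\<^sub>0 'k::field)) \<Rightarrow> ('g \<Rightarrow>\<^sub>0 'k) \<Rightarrow> ('e \<Rightarrow>\<^sub>0 'k)"
  where "free_ext \<equiv> lin_ext fscale"

definition rep :: "'v set \<Rightarrow> 'v"
  where "rep C = (SOME p. p \<in> C)"

definition classes :: "('g \<Rightarrow>\<^sub>0 'k::field) set \<Rightarrow> 'g set \<Rightarrow> ('g \<Rightarrow>\<^sub>0 'k) set set"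
  where "classes R A = {p +o R |p. Poly_Mapping.keys p \<subseteq> A}"

text \<open>The summand \<open>R\<close> only matters for \<open>c = 0\<close>.\<close>

definition coset_scale :: "('k \<Rightarrow> 'v \<Rightarrow> 'v) \<Rightarrow> 'v::plus set \<Rightarrow> 'k \<Rightarrow> 'v set \<Rightarrow> 'v set"
  where "coset_scale sc R c C = sc c ` C + R"

definition quotient_space :: "'v::plus set \<Rightarrow> 'v set \<Rightarrow> 'v set set"
  where "quotient_space Z B = (\<lambda>z. z +o B) ` Z"

text \<open>Linear isomorphism between two vector spaces given by carrier sets, scalar multiplications
  and the ambient addition.\<close>

definition isomorphic_spaces ::
  "'v::plus set \<Rightarrow> ('k \<Rightarrow> 'v \<Rightarrow> 'v) \<Rightarrow> 'w::plus set \<Rightarrow> ('k \<Rightarrow> 'w \<Rightarrow> 'w) \<Rightarrow> bool"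
  where "isomorphic_spaces V sV W sW \<longleftrightarrow>
    (\<exists>\<phi>. bij_betw \<phi> V W \<and>
      (\<forall>u\<in>V. \<forall>v\<in>V. \<phi> (u + v) = \<phi> u + \<phi> v) \<and>
      (\<forall>c. \<forall>v\<in>V. \<phi> (sV c v) = sW c (\<phi> v)))"


section \<open>Cocommutative Hopf algebras\<close>

text \<open>Generators of \<open>H\<^sup>\<otimes>\<^sup>n\<close> are lists of length \<open>n\<close>.\<close>

definition tpow_rel :: "('k::field \<Rightarrow> 'h \<Rightarrow> 'h) \<Rightarrow> nat \<Rightarrow> ('h::ab_group_add list \<Rightarrow>\<^sub>0 'k) set"
  where "tpow_rel sc n = free.span
    ({gen (us @ (x + y) # vs) - gen (us @ x # vs) - gen (us @ y # vs) |us vs x y.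
        length us + length vs + 1 = n} \<union>
     {gen (us @ sc c x # vs) - fscale c (gen (us @ x # vs)) |us vs c x.
        length us + length vs + 1 = n})"

definition tpow :: "('k::field \<Rightarrow> 'h \<Rightarrow> 'h) \<Rightarrow> nat \<Rightarrow> ('h::ab_group_add list \<Rightarrow>\<^sub>0 'k) set set"
  where "tpow sc n = classes (tpow_rel sc n) {hs. length hs = n}"

definition tmult :: "('h::ring_1 list \<Rightarrow>\<^sub>0 'k::field) \<Rightarrow> ('h list \<Rightarrow>\<^sub>0 'k) \<Rightarrow> ('h list \<Rightarrow>\<^sub>0 'k)"
  where "tmult p q = free_ext (\<lambda>as. free_ext (\<lambda>bs. gen (map2 (*) as bs)) q) p"

locale cocommutative_hopf_algebra =
  vector_space scale for scale :: "'k::field \<Rightarrow> 'h::ring_1 \<Rightarrow> 'h" +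
  fixes \<Delta> :: "'h \<Rightarrow> ('h list \<Rightarrow>\<^sub>0 'k) set"
    and \<epsilon> :: "'h \<Rightarrow> 'k"
    and S :: "'h \<Rightarrow> 'h"
  assumes mult_scale_left: "scale c x * y = scale c (x * y)"
    and mult_scale_right: "x * scale c y = scale c (x * y)"
    and comult_closed: "\<Delta> h \<in> tpow scale 2"
    and comult_add: "\<Delta> (x + y) = \<Delta> x + \<Delta> y"
    and comult_scale: "\<Delta> (scale c x) = coset_scale fscale (tpow_rel scale 2) c (\<Delta> x)"
    and comult_one: "\<Delta> 1 = gen [1, 1] +o tpow_rel scale 2"
    and comult_mult: "\<Delta> (x * y) = tmult (rep (\<Delta> x)) (rep (\<Delta> y)) +o tpow_rel scale 2"
    and coassoc:
      "free_ext (\<lambda>hs. free_ext (\<lambda>ks. gen (ks @ [hs ! 1])) (rep (\<Delta> (hs ! 0)))) (rep (\<Delta> h))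
          +o tpow_rel scale 3 =
       free_ext (\<lambda>hs. free_ext (\<lambda>ks. gen (hs ! 0 # ks)) (rep (\<Delta> (hs ! 1)))) (rep (\<Delta> h))
          +o tpow_rel scale 3"
    and counit_linear: "Vector_Spaces.linear scale (*) \<epsilon>"
    and counit_one: "\<epsilon> 1 = 1"
    and counit_mult: "\<epsilon> (x * y) = \<epsilon> x * \<epsilon> y"
    and counit_left: "lin_ext scale (\<lambda>hs. scale (\<epsilon> (hs ! 0)) (hs ! 1)) (rep (\<Delta> h)) = h"
    and counit_right: "lin_ext scale (\<lambda>hs. scale (\<epsilon> (hs ! 1)) (hs ! 0)) (rep (\<Delta> h)) = h"
    and antipode_linear: "Vector_Spaces.linear scale scale S"
    and antipode_left: "lin_ext scale (\<lambda>hs. S (hs ! 0) * hs ! 1) (rep (\<Delta> h)) = scale (\<epsilon> h) 1"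
    and antipode_right: "lin_ext scale (\<lambda>hs. hs ! 0 * S (hs ! 1)) (rep (\<Delta> h)) = scale (\<epsilon> h) 1"
    and cocommutative:
      "free_ext (\<lambda>hs. gen [hs ! 1, hs ! 0]) (rep (\<Delta> h)) +o tpow_rel scale 2 = \<Delta> h"
begin

text \<open>A representative of the iterated coproduct in \<open>H\<^sup>\<otimes>\<^sup>n\<close>.\<close>

primrec comult_iter :: "nat \<Rightarrow> 'h \<Rightarrow> ('h list \<Rightarrow>\<^sub>0 'k)" where
  "comult_iter 0 h = fscale (\<epsilon> h) (gen [])"
| "comult_iter (Suc n) h =
     free_ext (\<lambda>hs. free_ext (\<lambda>ks. gen (hs ! 0 # ks)) (comult_iter n (hs ! 1))) (rep (\<Delta> h))"

definition grouplike :: "'h set"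
  where "grouplike = {g. \<Delta> g = gen [g, g] +o tpow_rel scale 2 \<and> \<epsilon> g = 1}"

fun filt :: "nat \<Rightarrow> 'h set" where
  "filt n =
    (if n = 0 then span grouplike
     else span {h. \<Delta> h \<in> (\<lambda>p. p +o tpow_rel scale 2) ` free.span
       ({gen [f, h] |f. f \<in> filt 0} \<union> {gen [h, f] |f. f \<in> filt 0} \<union>
        (\<Union>i\<in>{1..<n}. {gen [f, g] |f g. f \<in> filt i \<and> g \<in> filt (n - i)}))})"

declare filt.simps [simp del]


subsection \<open>The dual algebra \<open>X\<close>\<close>

definition dual :: "('h \<Rightarrow> 'k) set"
  where "dual = {x. Vector_Spaces.linear scale (*) x}"

definition dual_filt :: "nat \<Rightarrow> ('h \<Rightarrow> 'k) set"
  where "dual_filt n = {x\<in>dual. \<forall>h\<in>filt n. x h = 0}"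

text \<open>The convolution product, not to be confused with the pointwise product of functions.\<close>

definition dual_mult :: "('h \<Rightarrow> 'k) \<Rightarrow> ('h \<Rightarrow> 'k) \<Rightarrow> ('h \<Rightarrow> 'k)"
  where "dual_mult x y = (\<lambda>h. lin_ext (*) (\<lambda>hs. x (hs ! 0) * y (hs ! 1)) (rep (\<Delta> h)))"

definition dual_act :: "('h \<Rightarrow> 'k) \<Rightarrow> 'h \<Rightarrow> ('h \<Rightarrow> 'k)"
  where "dual_act x h = (\<lambda>f. x (f * S h))"


subsection \<open>Tensor products with an \<open>H\<close>-module\<close>

definition kscale :: "('h \<Rightarrow> 'm \<Rightarrow> 'm) \<Rightarrow> 'k \<Rightarrow> 'm \<Rightarrow> 'm"
  where "kscale act c m = act (scale c 1) m"

text \<open>\<open>H\<^sup>\<otimes>\<^sup>n \<otimes> M\<close>, and then \<open>H\<^sup>\<otimes>\<^sup>n \<otimes>\<^sub>H M\<close> as its quotient.\<close>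

definition tens_rel :: "('h \<Rightarrow> 'm::ab_group_add \<Rightarrow> 'm) \<Rightarrow> nat \<Rightarrow> ('h list \<times> 'm \<Rightarrow>\<^sub>0 'k) set"
  where "tens_rel act n = free.span
    ({gen (us @ (x + y) # vs, m) - gen (us @ x # vs, m) - gen (us @ y # vs, m) |us vs x y m.
        length us + length vs + 1 = n} \<union>
     {gen (us @ scale c x # vs, m) - fscale c (gen (us @ x # vs, m)) |us vs c x m.
        length us + length vs + 1 = n} \<union>
     {gen (hs, m + m') - gen (hs, m) - gen (hs, m') |hs m m'. length hs = n} \<union>
     {gen (hs, kscale act c m) - fscale c (gen (hs, m)) |hs c m. length hs = n})"

definition htens_rel :: "('h \<Rightarrow> 'm::ab_group_add \<Rightarrow> 'm) \<Rightarrow> nat \<Rightarrow> ('h list \<times> 'm \<Rightarrow>\<^sub>0 'k) set"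
  where "htens_rel act n = free.span
    (tens_rel act n \<union>
     {free_ext (\<lambda>ks. gen (map2 (*) hs ks, m)) (comult_iter n h) - gen (hs, act h m) |hs h m.
        length hs = n})"

definition tens :: "('h \<Rightarrow> 'm::ab_group_add \<Rightarrow> 'm) \<Rightarrow> nat \<Rightarrow> ('h list \<times> 'm \<Rightarrow>\<^sub>0 'k) set set"
  where "tens act n = classes (tens_rel act n) ({hs. length hs = n} \<times> UNIV)"

definition htens :: "('h \<Rightarrow> 'm::ab_group_add \<Rightarrow> 'm) \<Rightarrow> nat \<Rightarrow> ('h list \<times> 'm \<Rightarrow>\<^sub>0 'k) set set"
  where "htens act n = classes (htens_rel act n) ({hs. length hs = n} \<times> UNIV)"

definition lmult :: "'h list \<Rightarrow> ('h list \<times> 'm \<Rightarrow>\<^sub>0 'k) \<Rightarrow> ('h list \<times> 'm \<Rightarrow>\<^sub>0 'k)"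
  where "lmult fs = free_ext (\<lambda>(hs, m). gen (map2 (*) fs hs, m))"

definition permute :: "('h list \<Rightarrow> 'h list) \<Rightarrow> ('h list \<times> 'm \<Rightarrow>\<^sub>0 'k) \<Rightarrow> ('h list \<times> 'm \<Rightarrow>\<^sub>0 'k)"
  where "permute \<sigma> = free_ext (\<lambda>(hs, m). gen (\<sigma> hs, m))"

text \<open>The elements \<open>a * (f \<otimes>\<^sub>H m)\<close> and \<open>(f \<otimes>\<^sub>H a) * m\<close> of \<open>H\<^sup>\<otimes>\<^sup>3 \<otimes>\<^sub>H M\<close>,
  extended linearly to representatives \<open>p\<close> of elements of \<open>H\<^sup>\<otimes>\<^sup>2 \<otimes>\<^sub>H M\<close> and
  \<open>H\<^sup>\<otimes>\<^sup>2 \<otimes>\<^sub>H L\<close>.\<close>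

definition compose_right ::
  "('l \<Rightarrow> 'm \<Rightarrow> ('h list \<times> 'm \<Rightarrow>\<^sub>0 'k) set) \<Rightarrow>
   'l \<Rightarrow> ('h list \<times> 'm \<Rightarrow>\<^sub>0 'k) \<Rightarrow> ('h list \<times> 'm \<Rightarrow>\<^sub>0 'k)"
  where "compose_right ac a p =
    free_ext (\<lambda>(f, m).
      free_ext (\<lambda>(hs, c).
        free_ext (\<lambda>ks. gen (map2 (*) (1 # f) (hs ! 0 # ks), c)) (rep (\<Delta> (hs ! 1))))
      (rep (ac a m))) p"

definition compose_left ::
  "('l \<Rightarrow> 'm \<Rightarrow> ('h list \<times> 'm \<Rightarrow>\<^sub>0 'k) set) \<Rightarrow>
   ('h list \<times> 'l \<Rightarrow>\<^sub>0 'k) \<Rightarrow> 'm \<Rightarrow> ('h list \<times> 'm \<Rightarrow>\<^sub>0 'k)"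
  where "compose_left ac p m =
    free_ext (\<lambda>(f, a).
      free_ext (\<lambda>(hs, c).
        free_ext (\<lambda>ks. gen (map2 (*) (f @ [1]) (ks @ [hs ! 1]), c)) (rep (\<Delta> (hs ! 0))))
      (rep (ac a m))) p"

text \<open>For \<open>C = \<Sum>\<^sub>i (h\<^sub>i \<otimes> 1) \<otimes>\<^sub>H v\<^sub>i\<close> in \<open>(H \<otimes> H) \<otimes>\<^sub>H M\<close>, a
  representative of \<open>\<Sum>\<^sub>i h\<^sub>i \<otimes> v\<^sub>i\<close>; the latter is unique in \<open>H \<otimes> M\<close>.\<close>

definition straighten ::
  "('h \<Rightarrow> 'm::ab_group_add \<Rightarrow> 'm) \<Rightarrow> ('h list \<times> 'm \<Rightarrow>\<^sub>0 'k) set \<Rightarrow> ('h \<times> 'm \<Rightarrow>\<^sub>0 'k)"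
  where "straighten act C =
    (SOME p. free_ext (\<lambda>(h, v). gen ([h, 1], v)) p +o htens_rel act 2 = C)"

end


section \<open>Lie pseudoalgebras and their modules\<close>

locale left_module =
  fixes act :: "'h::ring_1 \<Rightarrow> 'm::ab_group_add \<Rightarrow> 'm"
  assumes act_add_left: "act (f + g) m = act f m + act g m"
    and act_add_right: "act f (m + m') = act f m + act f m'"
    and act_mult: "act (f * g) m = act f (act g m)"
    and act_one: "act 1 m = m"

locale lie_pseudoalgebra =
  cocommutative_hopf_algebra scale \<Delta> \<epsilon> S + L: left_module actL
  for scale :: "'k::field \<Rightarrow> 'h::ring_1 \<Rightarrow> 'h" and \<Delta> \<epsilon> S
    and actL :: "'h \<Rightarrow> 'l::ab_group_add \<Rightarrow> 'l" +
  fixes br :: "'l \<Rightarrow> 'l \<Rightarrow> ('h list \<times> 'l \<Rightarrow>\<^sub>0 'k) set"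
  assumes br_closed: "br a b \<in> htens actL 2"
    and br_add_left: "br (a + a') b = br a b + br a' b"
    and br_add_right: "br a (b + b') = br a b + br a b'"
    and br_scale_left:
      "br (kscale actL r a) b = coset_scale fscale (htens_rel actL 2) r (br a b)"
    and br_scale_right:
      "br a (kscale actL r b) = coset_scale fscale (htens_rel actL 2) r (br a b)"
    and br_hlinear:
      "br (actL f a) (actL g b) = lmult [f, g] (rep (br a b)) +o htens_rel actL 2"
    and br_skew:
      "br b a = (- permute (\<lambda>hs. [hs ! 1, hs ! 0]) (rep (br a b))) +o htens_rel actL 2"
    and br_jacobi:
      "(compose_right br a (rep (br b c))
         - permute (\<lambda>hs. [hs ! 1, hs ! 0, hs ! 2]) (compose_right br b (rep (br a c))))
         +o htens_rel actL 3 =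
       compose_left br (rep (br a b)) c +o htens_rel actL 3"

locale lie_pseudoalgebra_module =
  lie_pseudoalgebra scale \<Delta> \<epsilon> S actL br + M: left_module actM
  for scale :: "'k::field \<Rightarrow> 'h::ring_1 \<Rightarrow> 'h" and \<Delta> \<epsilon> S
    and actL :: "'h \<Rightarrow> 'l::ab_group_add \<Rightarrow> 'l" and br
    and actM :: "'h \<Rightarrow> 'm::ab_group_add \<Rightarrow> 'm" +
  fixes pact :: "'l \<Rightarrow> 'm \<Rightarrow> ('h list \<times> 'm \<Rightarrow>\<^sub>0 'k) set"
  assumes pact_closed: "pact a m \<in> htens actM 2"
    and pact_add_left: "pact (a + a') m = pact a m + pact a' m"
    and pact_add_right: "pact a (m + m') = pact a m + pact a m'"
    and pact_scale_left:
      "pact (kscale actL r a) m = coset_scale fscale (htens_rel actM 2) r (pact a m)"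
    and pact_scale_right:
      "pact a (kscale actM r m) = coset_scale fscale (htens_rel actM 2) r (pact a m)"
    and pact_hlinear:
      "pact (actL f a) (actM g m) = lmult [f, g] (rep (pact a m)) +o htens_rel actM 2"
    and pact_bracket:
      "(compose_right pact a (rep (pact b m))
         - permute (\<lambda>hs. [hs ! 1, hs ! 0, hs ! 2]) (compose_right pact b (rep (pact a m))))
         +o htens_rel actM 3 =
       compose_left pact (rep (br a b)) m +o htens_rel actM 3"


definition insert_at :: "nat \<Rightarrow> 'a \<Rightarrow> 'a list \<Rightarrow> 'a list"
  where "insert_at i x xs = take i xs @ x # drop i xs"

definition omit :: "nat \<Rightarrow> 'a list \<Rightarrow> 'a list"
  where "omit i xs = take i xs @ drop (Suc i) xs"


section \<open>The annihilation algebra\<close>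

context lie_pseudoalgebra
begin

text \<open>The relations of \<open>X \<otimes>\<^sub>H L\<close>.\<close>

definition ann_rel :: "(('h \<Rightarrow> 'k) \<times> 'l \<Rightarrow>\<^sub>0 'k) set"
  where "ann_rel = free.span
    ({gen (\<lambda>h. x h + y h, a) - gen (x, a) - gen (y, a) |x y a. x \<in> dual \<and> y \<in> dual} \<union>
     {gen (\<lambda>h. c * x h, a) - fscale c (gen (x, a)) |c x a. x \<in> dual} \<union>
     {gen (x, a + b) - gen (x, a) - gen (x, b) |x a b. x \<in> dual} \<union>
     {gen (dual_act x h, a) - gen (x, actL h a) |x h a. x \<in> dual})"

definition ann :: "(('h \<Rightarrow> 'k) \<times> 'l \<Rightarrow>\<^sub>0 'k) set set"
  where "ann = classes ann_rel (dual \<times> UNIV)"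

definition ann_elem :: "('h \<Rightarrow> 'k) \<Rightarrow> 'l \<Rightarrow> (('h \<Rightarrow> 'k) \<times> 'l \<Rightarrow>\<^sub>0 'k) set"
  where "ann_elem x a = gen (x, a) +o ann_rel"

definition ann_bracket ::
  "(('h \<Rightarrow> 'k) \<times> 'l \<Rightarrow>\<^sub>0 'k) set \<Rightarrow> (('h \<Rightarrow> 'k) \<times> 'l \<Rightarrow>\<^sub>0 'k) set \<Rightarrow>
   (('h \<Rightarrow> 'k) \<times> 'l \<Rightarrow>\<^sub>0 'k) set"
  where "ann_bracket P Q =
    free_ext (\<lambda>(x, a).
      free_ext (\<lambda>(y, b).
        free_ext (\<lambda>(hs, e). gen (dual_mult (dual_act x (hs ! 0)) (dual_act y (hs ! 1)), e))
          (rep (br a b))) (rep Q)) (rep P) +o ann_rel"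

end


context lie_pseudoalgebra_module
begin

definition ann_act :: "(('h \<Rightarrow> 'k) \<times> 'l \<Rightarrow>\<^sub>0 'k) set \<Rightarrow> 'm \<Rightarrow> 'm"
  where "ann_act P m =
    lin_ext (kscale actM) (\<lambda>(x, a).
      lin_ext (kscale actM) (\<lambda>(h, v). kscale actM (x (S h)) v) (straighten actM (pact a m)))
    (rep P)"


section \<open>Basic cohomology\<close>

text \<open>
  \<open>H\<^sup>\<otimes>\<^sup>n\<close>-linear maps on \<open>L\<^sup>\<otimes>\<^sup>n\<close> are given as multilinear functions of lists of length
  \<open>n\<close> (with value zero, the coset \<open>tens_rel actM n\<close>, on other lists); \<open>k\<close>-homogeneity is
  a case of \<open>H\<close>-linearity. For \<open>n = 0\<close> such a function amounts to an element of
  \<open>H\<^sup>\<otimes>\<^sup>0 \<otimes> M = M\<close>. Positions are counted from \<open>0\<close>.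
\<close>

definition basic_cochains :: "nat \<Rightarrow> ('l list \<Rightarrow> ('h list \<times> 'm \<Rightarrow>\<^sub>0 'k) set) set"
  where "basic_cochains n = {\<gamma>.
    (\<forall>as. length as = n \<longrightarrow> \<gamma> as \<in> tens actM n) \<and>
    (\<forall>as. length as \<noteq> n \<longrightarrow> \<gamma> as = tens_rel actM n) \<and>
    (\<forall>us vs a b. length us + length vs + 1 = n \<longrightarrow>
      \<gamma> (us @ (a + b) # vs) = \<gamma> (us @ a # vs) + \<gamma> (us @ b # vs)) \<and>
    (\<forall>hs as. length hs = n \<and> length as = n \<longrightarrow>
      \<gamma> (map2 actL hs as) = lmult hs (rep (\<gamma> as)) +o tens_rel actM n) \<and>
    (\<forall>us vs a b. length us + length vs + 2 = n \<longrightarrow>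
      \<gamma> (us @ b # a # vs) =
        (- permute (\<lambda>hs. hs[length us := hs ! Suc (length us), Suc (length us) := hs ! length us])
             (rep (\<gamma> (us @ a # b # vs)))) +o tens_rel actM n)}"

text \<open>\<open>a * p\<close> for a representative \<open>p\<close> of an element of \<open>H\<^sup>\<otimes>\<^sup>n \<otimes> M\<close>.\<close>

definition act_cochain :: "'l \<Rightarrow> ('h list \<times> 'm \<Rightarrow>\<^sub>0 'k) \<Rightarrow> ('h list \<times> 'm \<Rightarrow>\<^sub>0 'k)"
  where "act_cochain a p =
    free_ext (\<lambda>(f, m). free_ext (\<lambda>(h, v). gen (h # f, v)) (straighten actM (pact a m))) p"

text \<open>\<open>\<gamma>(q \<otimes> a\<^sub>2 \<otimes> \<dots>)\<close> for a representative \<open>q\<close> of an element of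
  \<open>H\<^sup>\<otimes>\<^sup>2 \<otimes>\<^sub>H L\<close>.\<close>

definition eval_cochain ::
  "('l list \<Rightarrow> ('h list \<times> 'm \<Rightarrow>\<^sub>0 'k) set) \<Rightarrow>
   ('h list \<times> 'l \<Rightarrow>\<^sub>0 'k) \<Rightarrow> 'l list \<Rightarrow> ('h list \<times> 'm \<Rightarrow>\<^sub>0 'k)"
  where "eval_cochain \<gamma> q as =
    free_ext (\<lambda>(g, b).
      free_ext (\<lambda>(hs, v).
        free_ext (\<lambda>ks. gen (map2 (*) g ks @ tl hs, v)) (rep (\<Delta> (hd hs))))
      (rep (\<gamma> (b # as)))) q"

definition basic_d ::
  "nat \<Rightarrow> ('l list \<Rightarrow> ('h list \<times> 'm \<Rightarrow>\<^sub>0 'k) set) \<Rightarrow> ('l list \<Rightarrow> ('h list \<times> 'm \<Rightarrow>\<^sub>0 'k) set)"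
  where "basic_d n \<gamma> = (\<lambda>as.
    if length as = Suc n then
      ((\<Sum>i<Suc n. fscale ((-1) ^ i)
          (permute (\<lambda>hs. insert_at i (hd hs) (tl hs))
            (act_cochain (as ! i) (rep (\<gamma> (omit i as)))))) +
       (\<Sum>j<Suc n. \<Sum>i<j. fscale ((-1) ^ (i + j))
          (permute (\<lambda>hs. insert_at j (hs ! 1) (insert_at i (hs ! 0) (drop 2 hs)))
            (eval_cochain \<gamma> (rep (br (as ! i) (as ! j))) (omit i (omit j as))))))
      +o tens_rel actM (Suc n)
    else tens_rel actM (Suc n))"

definition basic_cocycles :: "nat \<Rightarrow> ('l list \<Rightarrow> ('h list \<times> 'm \<Rightarrow>\<^sub>0 'k) set) set"
  where "basic_cocycles n =
    {\<gamma>\<in>basic_cochains n. basic_d n \<gamma> = (\<lambda>_. tens_rel actM (Suc n))}"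

definition basic_coboundaries :: "nat \<Rightarrow> ('l list \<Rightarrow> ('h list \<times> 'm \<Rightarrow>\<^sub>0 'k) set) set"
  where "basic_coboundaries n =
    (case n of 0 \<Rightarrow> {\<lambda>_. tens_rel actM 0} | Suc k \<Rightarrow> basic_d k ` basic_cochains k)"

definition basic_cohomology :: "nat \<Rightarrow> ('l list \<Rightarrow> ('h list \<times> 'm \<Rightarrow>\<^sub>0 'k) set) set set"
  where "basic_cohomology n = quotient_space (basic_cocycles n) (basic_coboundaries n)"

definition basic_scale ::
  "nat \<Rightarrow> 'k \<Rightarrow> ('l list \<Rightarrow> ('h list \<times> 'm \<Rightarrow>\<^sub>0 'k) set) set \<Rightarrow>
   ('l list \<Rightarrow> ('h list \<times> 'm \<Rightarrow>\<^sub>0 'k) set) set"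
  where "basic_scale n = coset_scale
    (\<lambda>c \<gamma> as. coset_scale fscale (tens_rel actM n) c (\<gamma> as)) (basic_coboundaries n)"


section \<open>Gelfand--Fuchs cohomology of the annihilation algebra\<close>

text \<open>Alternating multilinear functions of lists of length \<open>n\<close> in the carrier \<open>ann\<close>, with
  value zero on all other lists.\<close>

definition ce_cochains :: "nat \<Rightarrow> ((('h \<Rightarrow> 'k) \<times> 'l \<Rightarrow>\<^sub>0 'k) set list \<Rightarrow> 'm) set"
  where "ce_cochains n = {c.
    (\<forall>Ps. \<not> (length Ps = n \<and> set Ps \<subseteq> ann) \<longrightarrow> c Ps = 0) \<and>
    (\<forall>us vs P Q. length us + length vs + 1 = n \<and> set us \<union> set vs \<union> {P, Q} \<subseteq> ann \<longrightarrow>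
      c (us @ (P + Q) # vs) = c (us @ P # vs) + c (us @ Q # vs)) \<and>
    (\<forall>us vs t P. length us + length vs + 1 = n \<and> set us \<union> set vs \<union> {P} \<subseteq> ann \<longrightarrow>
      c (us @ coset_scale fscale ann_rel t P # vs) = kscale actM t (c (us @ P # vs))) \<and>
    (\<forall>Ps. length Ps = n \<and> set Ps \<subseteq> ann \<and> \<not> distinct Ps \<longrightarrow> c Ps = 0)}"

definition gf_cochains :: "nat \<Rightarrow> ((('h \<Rightarrow> 'k) \<times> 'l \<Rightarrow>\<^sub>0 'k) set list \<Rightarrow> 'm) set"
  where "gf_cochains n = {c\<in>ce_cochains n.
    \<forall>xs a as. set xs \<subseteq> dual \<and> length xs = length as \<and> Suc (length as) = n \<longrightarrow>
      (\<exists>K. \<forall>k\<ge>K. \<forall>x\<in>dual_filt k. c (ann_elem x a # map2 ann_elem xs as) = 0)}"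

definition ce_d ::
  "nat \<Rightarrow> ((('h \<Rightarrow> 'k) \<times> 'l \<Rightarrow>\<^sub>0 'k) set list \<Rightarrow> 'm) \<Rightarrow>
   ((('h \<Rightarrow> 'k) \<times> 'l \<Rightarrow>\<^sub>0 'k) set list \<Rightarrow> 'm)"
  where "ce_d n c = (\<lambda>Ps.
    if length Ps = Suc n \<and> set Ps \<subseteq> ann then
      (\<Sum>i<Suc n. kscale actM ((-1) ^ i) (ann_act (Ps ! i) (c (omit i Ps)))) +
      (\<Sum>j<Suc n. \<Sum>i<j. kscale actM ((-1) ^ (i + j))
         (c (ann_bracket (Ps ! i) (Ps ! j) # omit i (omit j Ps))))
    else 0)"

definition gf_cocycles :: "nat \<Rightarrow> ((('h \<Rightarrow> 'k) \<times> 'l \<Rightarrow>\<^sub>0 'k) set list \<Rightarrow> 'm) set"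
  where "gf_cocycles n = {c\<in>gf_cochains n. ce_d n c = (\<lambda>_. 0)}"

definition gf_coboundaries :: "nat \<Rightarrow> ((('h \<Rightarrow> 'k) \<times> 'l \<Rightarrow>\<^sub>0 'k) set list \<Rightarrow> 'm) set"
  where "gf_coboundaries n =
    (case n of 0 \<Rightarrow> {\<lambda>_. 0} | Suc k \<Rightarrow> ce_d k ` gf_cochains k)"

definition gf_cohomology :: "nat \<Rightarrow> ((('h \<Rightarrow> 'k) \<times> 'l \<Rightarrow>\<^sub>0 'k) set list \<Rightarrow> 'm) set set"
  where "gf_cohomology n = quotient_space (gf_cocycles n) (gf_coboundaries n)"

definition gf_scale ::
  "nat \<Rightarrow> 'k \<Rightarrow> ((('h \<Rightarrow> 'k) \<times> 'l \<Rightarrow>\<^sub>0 'k) set list \<Rightarrow> 'm) set \<Rightarrow>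
   ((('h \<Rightarrow> 'k) \<times> 'l \<Rightarrow>\<^sub>0 'k) set list \<Rightarrow> 'm) set"
  where "gf_scale n = coset_scale (\<lambda>t c Ps. kscale actM t (c Ps)) (gf_coboundaries n)"

end

end

theory Submission
  imports Defs
begin

text \<open>
  The isomorphism is induced by a bijection of cochains that commutes with the differentials. A basic
  cochain with \<open>\<gamma>(a\<^sub>1, \<dots>, a\<^sub>n) = \<Sum> f\<^sub>1 \<otimes> \<dots> \<otimes> f\<^sub>n \<otimes> v\<close> is sent to the cochain \<open>c\<close> of the annihilation algebra
  with \<open>c(x\<^sub>1 \<otimes>\<^sub>H a\<^sub>1, \<dots>, x\<^sub>n \<otimes>\<^sub>H a\<^sub>n) = \<Sum> \<langle>x\<^sub>1, S f\<^sub>1\<rangle> \<dots> \<langle>x\<^sub>n, S f\<^sub>n\<rangle> v\<close> (\<open>corresponds\<close>). Linearity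
  of \<open>\<gamma>\<close> over \<open>H\<^sup>\<otimes>\<^sup>n\<close> is what makes \<open>c\<close> well defined on \<open>X \<otimes>\<^sub>H L\<close>, since \<open>S\<close> reverses products and
  \<open>X\<close> is a right module through \<open>S\<close>. Functionals separate the elements of \<open>H\<^sup>\<otimes>\<^sup>n \<otimes> M\<close>
  (\<open>pairing_separates\<close>), so \<open>\<gamma>\<close> is determined by \<open>c\<close>. The differentials match term by term
  (\<open>corresponds_differential\<close>), which uses that \<open>S\<close> is compatible with the coproduct and that
  an element of \<open>(H \<otimes> H) \<otimes>\<^sub>H M\<close> may be evaluated on any representative (\<open>straighten_eval\<close>).

  Two points have substance. The cochain \<open>c\<close> is local because every element of \<open>H\<close> lies in some
  \<open>F\<^sup>n H\<close> (\<open>filt_exhaustive\<close>); this is where the base field has to be algebraically closed. A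
  finite-dimensional module over the commutative algebra \<open>X\<close>, acting on \<open>H\<close> by \<open>x h = \<Sum> h\<^sub>(\<^sub>1\<^sub>) \<langle>x, h\<^sub>(\<^sub>2\<^sub>)\<rangle>\<close>,
  is a sum of generalised simultaneous eigenspaces, the eigencharacters are evaluations at group-like
  elements \<open>g\<close>, and an element annihilated by all products of \<open>n + 1\<close> functionals vanishing at \<open>g\<close>
  belongs to \<open>F\<^sup>n H\<close>.

  Conversely, let \<open>c\<close> be local. For fixed \<open>a\<^sub>1, \<dots>, a\<^sub>n\<close> it is a multilinear map on \<open>X\<close> that is
  continuous in each argument separately. Since \<open>X\<close> is the inverse limit of the duals of the
  finite-dimensional spaces \<open>F\<^sup>n H\<close>, it satisfies a uniform boundedness principle
  (\<open>uniform_vanishing\<close>), so that \<open>c\<close> is jointly continuous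
  (\<open>multilinear_uniformly_continuous\<close>). Hence \<open>c\<close> factors through the dual of a single \<open>F\<^sup>K H\<close> in each
  argument, which means that it is given by an element of \<open>H\<^sup>\<otimes>\<^sup>n \<otimes> M\<close> (\<open>exists_tensor\<close>).

  The differential of a basic cochain is again one because its image is: \<open>dc\<close> is alternating by the
  usual cancellation (\<open>ce_d_adjacent_zero\<close>), it is local because it is given by tensors, and so it
  comes from a basic cochain, which can only be \<open>d\<gamma>\<close>.
\<close>

abbreviation keys :: "('g \<Rightarrow>\<^sub>0 'k::zero) \<Rightarrow> 'g set"
  where "keys \<equiv> Poly_Mapping.keys"


section \<open>Linear extensions, subspaces and cosets\<close>

lemma vector_space_field: "vector_space ((*) :: 'k::field \<Rightarrow> 'k \<Rightarrow> 'k)"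
  by unfold_locales (auto simp: algebra_simps)

lemma linearI_vs:
  assumes "vector_space s1" "vector_space s2"
    and "\<And>x y. f (x + y) = f x + f y" "\<And>c x. f (s1 c x) = s2 c (f x)"
  shows "Vector_Spaces.linear s1 s2 f"
  using assms by (auto simp: Vector_Spaces.linear_iff)

lemma
  assumes "Vector_Spaces.linear s1 s2 f"
  shows lin_add: "f (x + y) = f x + f y"
    and lin_scale: "f (s1 c x) = s2 c (f x)"
    and lin_zero: "f 0 = 0"
    and lin_minus: "f (- x) = - f x"
    and lin_diff: "f (x - y) = f x - f y"
    and lin_sum: "f (sum g A) = (\<Sum>a\<in>A. f (g a))"
proof -
  interpret Vector_Spaces.linear s1 s2 f by fact
  show "f (x + y) = f x + f y" "f (s1 c x) = s2 c (f x)" "f 0 = 0" "f (- x) = - f x"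
    "f (x - y) = f x - f y" "f (sum g A) = (\<Sum>a\<in>A. f (g a))"
    by (simp_all add: add scale neg diff sum)
qed

context vector_space
begin

lemma lin_ext_superset:
  assumes "finite A" "keys p \<subseteq> A"
  shows "lin_ext scale f p = (\<Sum>g\<in>A. scale (Poly_Mapping.lookup p g) (f g))"
  unfolding lin_ext_def
  by (rule sum.mono_neutral_left) (use assms in \<open>auto simp: in_keys_iff\<close>)

lemma linear_lin_ext:
  fixes f :: "'g \<Rightarrow> 'b"
  shows "Vector_Spaces.linear fscale scale (lin_ext scale f)"
proof (rule linearI_vs)
  show "vector_space (fscale :: 'a \<Rightarrow> ('g \<Rightarrow>\<^sub>0 'a) \<Rightarrow> _)" by unfold_locales
  show "vector_space scale" by unfold_locales
  fix p q :: "'g \<Rightarrow>\<^sub>0 'a" and c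
  let ?A = "keys p \<union> keys q"
  have "keys (p + q) \<subseteq> ?A" by (rule keys_add)
  then show "lin_ext scale f (p + q) = lin_ext scale f p + lin_ext scale f q"
    by (simp add: lin_ext_superset[of ?A] lookup_add scale_left_distrib sum.distrib)
  have "keys (fscale c p) \<subseteq> keys p"
    by (auto simp: in_keys_iff lookup_fscale)
  then show "lin_ext scale f (fscale c p) = scale c (lin_ext scale f p)"
    by (simp add: lin_ext_superset[of "keys p"] lookup_fscale scale_sum_right)
qed

lemmas lin_ext_add = lin_add[OF linear_lin_ext]
  and lin_ext_scale = lin_scale[OF linear_lin_ext]
  and lin_ext_minus = lin_minus[OF linear_lin_ext]
  and lin_ext_diff = lin_diff[OF linear_lin_ext]
  and lin_ext_sum = lin_sum[OF linear_lin_ext]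

lemma lin_ext_gen: "lin_ext scale f (gen g) = f g"
  by (simp add: lin_ext_def gen_def)

lemma lin_ext_fun_add: "lin_ext scale (\<lambda>g. f g + f' g) p = lin_ext scale f p + lin_ext scale f' p"
  by (simp add: lin_ext_def scale_right_distrib sum.distrib)

lemma lin_ext_fun_diff: "lin_ext scale (\<lambda>g. f g - f' g) p = lin_ext scale f p - lin_ext scale f' p"
  by (simp add: lin_ext_def scale_right_diff_distrib sum_subtractf)

lemma lin_ext_fun_minus: "lin_ext scale (\<lambda>g. - f g) p = - lin_ext scale f p"
  by (simp add: lin_ext_def sum_negf)

lemma lin_ext_fun_scale: "lin_ext scale (\<lambda>g. scale c (f g)) p = scale c (lin_ext scale f p)"
  by (simp add: lin_ext_def scale_sum_right mult.commute)

lemma lin_ext_fun_sum: "lin_ext scale (\<lambda>g. \<Sum>a\<in>A. f a g) p = (\<Sum>a\<in>A. lin_ext scale (f a) p)"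
  by (simp add: lin_ext_def scale_sum_right sum.swap[of _ _ A])

lemma lin_ext_fun_zero: "lin_ext scale (\<lambda>g. 0) p = 0"
  by (simp add: lin_ext_def)

lemma lin_ext_in_subspace:
  assumes "subspace W" "\<And>g. g \<in> keys p \<Longrightarrow> f g \<in> W"
  shows "lin_ext scale f p \<in> W"
  unfolding lin_ext_def using assms by (intro subspace_sum subspace_scale) auto

lemma lin_ext_swap:
  "lin_ext scale (\<lambda>a. lin_ext scale (\<lambda>b. F a b) q) p = lin_ext scale (\<lambda>b. lin_ext scale (\<lambda>a. F a b) p) q"
  by (simp add: lin_ext_def scale_sum_right mult.commute sum.swap[of _ "keys q"])

end

lemma lin_ext_cong:
  "(\<And>g. g \<in> keys p \<Longrightarrow> f g = f' g) \<Longrightarrow> lin_ext sc f p = lin_ext sc f' p"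
  by (simp add: lin_ext_def)

lemma lin_ext_comp:
  assumes "Vector_Spaces.linear s s' L"
  shows "L (lin_ext s f p) = lin_ext s' (\<lambda>g. L (f g)) p"
  by (simp add: lin_ext_def lin_sum[OF assms] lin_scale[OF assms])

lemma lin_ext_free_ext:
  assumes "vector_space s"
  shows "lin_ext s f (free_ext g p) = lin_ext s (\<lambda>x. lin_ext s f (g x)) p"
  using lin_ext_comp[OF vector_space.linear_lin_ext[OF assms]] .

lemma free_ext_gen_id: "free_ext gen p = p"
proof (rule poly_mapping_eqI)
  fix k
  have "Poly_Mapping.lookup (free_ext gen p) k
      = (\<Sum>g\<in>keys p. Poly_Mapping.lookup p g * Poly_Mapping.lookup (gen g) k)"
    by (simp add: lin_ext_def lookup_sum lookup_fscale)
  also have "\<dots> = (\<Sum>g\<in>keys p. if g = k then Poly_Mapping.lookup p g else 0)"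
    by (intro sum.cong) (auto simp: gen_def lookup_single when_def)
  also have "\<dots> = Poly_Mapping.lookup p k"
    by (auto simp: sum.delta in_keys_iff)
  finally show "Poly_Mapping.lookup (free_ext gen p) k = Poly_Mapping.lookup p k" .
qed

lemma lin_ext_linear:
  assumes "Vector_Spaces.linear fscale s L"
  shows "lin_ext s (\<lambda>g. L (gen g)) p = L p"
  using lin_ext_comp[OF assms, of gen p] by (simp add: free_ext_gen_id)

lemma linear_vanishes_on_span:
  assumes "Vector_Spaces.linear s1 s2 L" "\<And>g. g \<in> G \<Longrightarrow> L g = 0" "r \<in> module.span s1 G"
  shows "L r = 0"
proof -
  interpret Vector_Spaces.linear s1 s2 L by fact
  have "r \<in> {r. L r = 0}"
    using assms(3)
    using vs1.span_minimal[of G "{r. L r = 0}"] assms(2)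
      vs1.subspaceI[of "{r. L r = 0}"] by (auto simp: add scale zero)
  then show ?thesis by simp
qed

text \<open>A proper subspace is detected by linear functionals, because a basis of it together with a
  vector outside extends to a basis of the whole space. Congruences modulo the relations of a tensor
  product are proved below by evaluating functionals, which turns them into equations.\<close>

lemma (in vector_space) mem_subspace_if_functionals_vanish:
  assumes "subspace R"
    and "\<And>l. Vector_Spaces.linear scale (*) l \<Longrightarrow> (\<And>r. r \<in> R \<Longrightarrow> l r = 0) \<Longrightarrow> l v = 0"
  shows "v \<in> R"
proof (rule ccontr)
  assume v: "v \<notin> R"
  obtain B where B: "B \<subseteq> R" "independent B" "R \<subseteq> span B"
    using maximal_independent_subset by blast
  have RB: "span B = R" using B assms(1) span_minimal by blast
  have ind: "independent (insert v B)" using v B RB by (simp add: independent_insertI)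
  define C where "C = extend_basis (insert v B)"
  have C: "independent C" "span C = UNIV" "insert v B \<subseteq> C"
    using ind by (auto simp: C_def independent_extend_basis extend_basis_superset dest: subsetD[OF extend_basis_superset])
  have "representation C v v = 0"
  proof (rule assms(2)[of "\<lambda>w. representation C w v"])
    show "Vector_Spaces.linear scale (*) (\<lambda>w. representation C w v)"
      using C by (intro linear_representation)
    fix r assume "r \<in> R"
    then have "representation C r = representation B r"
      using C RB by (intro representation_extend) auto
    moreover have "v \<notin> B" using v B by auto
    ultimately show "representation C r v = 0" using representation_ne_zero by metis
  qed
  then show False using representation_basis[of C v] C by simp
qed


lemma rep_mem: "C \<noteq> {} \<Longrightarrow> rep C \<in> C"
  unfolding rep_def by (rule someI_ex) blast

lemma mem_coset_iff: "(q :: 'v::ab_group_add) \<in> p +o R \<longleftrightarrow> q - p \<in> R"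
  by (auto simp: elt_set_plus_def algebra_simps) (metis add.commute diff_add_cancel)

lemma sum_zero_coset: "(0::'v::ab_group_add) +o R = R"
  by (simp add: set_eq_iff mem_coset_iff)

context vector_space
begin

lemma coset_eq_iff:
  assumes "subspace R"
  shows "p +o R = q +o R \<longleftrightarrow> p - q \<in> R"
proof
  assume "p +o R = q +o R"
  moreover have "p \<in> p +o R" using assms by (simp add: mem_coset_iff subspace_0)
  ultimately show "p - q \<in> R" by (simp add: mem_coset_iff)
next
  assume d: "p - q \<in> R"
  show "p +o R = q +o R"
  proof (intro set_eqI iffI)
    fix z assume "z \<in> p +o R"
    then show "z \<in> q +o R" using subspace_add[OF assms, OF _ d, of "z - p"] by (simp add: mem_coset_iff)
  next
    fix z assume "z \<in> q +o R"
    then show "z \<in> p +o R" using subspace_diff[OF assms, OF _ d, of "z - q"] by (simp add: mem_coset_iff)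
  qed
qed

lemma rep_coset: assumes "subspace R" shows "rep (p +o R) - p \<in> R"
proof -
  have "p \<in> p +o R" using assms by (simp add: mem_coset_iff subspace_0)
  then have "rep (p +o R) \<in> p +o R" by (intro rep_mem) blast
  then show ?thesis by (simp add: mem_coset_iff)
qed

lemma rep_coset_eq: assumes "subspace R" shows "rep (p +o R) +o R = p +o R"
  using assms rep_coset[OF assms] by (simp add: coset_eq_iff)

lemma add_cosets: assumes "subspace R" shows "(p +o R) + (q +o R) = (p + q) +o R"
proof -
  have "R + R = R"
    using assms by (auto simp: set_plus_def subspace_add intro!: exI[of _ 0] subspace_0)
      (metis add_0_right assms subspace_0)
  then show ?thesis by (simp add: set_plus_rearrange)
qed

lemma scale_coset: assumes "subspace R" shows "coset_scale scale R c (p +o R) = scale c p +o R"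
proof (intro set_eqI iffI)
  fix z assume "z \<in> coset_scale scale R c (p +o R)"
  then obtain r r' where "r \<in> R" "r' \<in> R" "z = scale c (p + r) + r'"
    by (auto simp: coset_scale_def set_plus_def elt_set_plus_def)
  then show "z \<in> scale c p +o R"
    using assms by (simp add: mem_coset_iff scale_right_distrib subspace_add subspace_scale)
next
  fix z assume "z \<in> scale c p +o R"
  then have "z - scale c p \<in> R" by (simp add: mem_coset_iff)
  moreover have "p \<in> p +o R" using assms by (simp add: mem_coset_iff subspace_0)
  ultimately show "z \<in> coset_scale scale R c (p +o R)"
    by (force simp: coset_scale_def set_plus_def)
qed

end

lemma keys_supported_subspace:
  fixes A :: "'g set"
  shows "free.subspace {p :: 'g \<Rightarrow>\<^sub>0 'k::field. keys p \<subseteq> A}"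
proof (rule free.subspaceI)
  fix p q :: "'g \<Rightarrow>\<^sub>0 'k"
  assume "p \<in> {p. keys p \<subseteq> A}" "q \<in> {p. keys p \<subseteq> A}"
  then show "p + q \<in> {p. keys p \<subseteq> A}" using keys_add[of p q] by auto
next
  fix p :: "'g \<Rightarrow>\<^sub>0 'k" and c
  assume "p \<in> {p. keys p \<subseteq> A}"
  then show "fscale c p \<in> {p. keys p \<subseteq> A}"
    by (auto simp: in_keys_iff lookup_fscale)
qed simp

lemma keys_gen: "keys (gen g :: 'g \<Rightarrow>\<^sub>0 'k::field) = {g}"
  by (simp add: gen_def)

lemma keys_span_subset:
  assumes "\<And>r. r \<in> G \<Longrightarrow> keys r \<subseteq> A" "p \<in> free.span G"
  shows "keys p \<subseteq> A"
  using free.span_minimal[OF _ keys_supported_subspace[of A], of G] assms by auto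

lemma keys_add': "keys p \<subseteq> A \<Longrightarrow> keys q \<subseteq> A \<Longrightarrow> keys (p + q) \<subseteq> A"
  using keys_add[of p q] by auto

lemma keys_diff': "keys p \<subseteq> A \<Longrightarrow> keys (q::_ \<Rightarrow>\<^sub>0 'k::field) \<subseteq> A \<Longrightarrow> keys (p - q) \<subseteq> A"
  using free.subspace_diff[OF keys_supported_subspace[of A], of p q] by simp

lemma keys_fscale': "keys p \<subseteq> A \<Longrightarrow> keys (fscale c p) \<subseteq> A"
  by (auto simp: in_keys_iff lookup_fscale)

lemma in_keys_diffD: "x \<in> keys (p - (q :: _ \<Rightarrow>\<^sub>0 'k::field)) \<Longrightarrow> x \<in> keys p \<or> x \<in> keys q"
  using keys_diff'[of p "keys p \<union> keys q" q] by auto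

lemma in_keys_fscaleD: "x \<in> keys (fscale c p) \<Longrightarrow> x \<in> keys p"
  using keys_fscale'[of p "keys p" c] by auto

lemma keys_free_ext:
  assumes "\<And>g. g \<in> keys p \<Longrightarrow> keys (f g) \<subseteq> A"
  shows "keys (free_ext f p) \<subseteq> A"
  using free.lin_ext_in_subspace[OF keys_supported_subspace[of A], of p f] assms by auto

lemma
  assumes "free.subspace R" "\<And>r. r \<in> R \<Longrightarrow> keys r \<subseteq> A" "C \<in> classes R A"
  shows rep_classes: "rep C +o R = C" and keys_rep_classes: "keys (rep C) \<subseteq> A"
proof -
  obtain p where p: "C = p +o R" "keys p \<subseteq> A"
    using assms(3) by (auto simp: classes_def)
  show "rep C +o R = C" using free.rep_coset_eq[OF assms(1)] p by simp
  have "rep C - p \<in> R" using free.rep_coset[OF assms(1)] p by simp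
  then have "keys (rep C - p + p) \<subseteq> A"
    using assms(2) p by (intro keys_add') auto
  then show "keys (rep C) \<subseteq> A" by simp
qed


section \<open>Sweedler calculus in a cocommutative Hopf algebra\<close>

context cocommutative_hopf_algebra
begin

lemma subspace_tpow_rel: "free.subspace (tpow_rel scale n)"
  unfolding tpow_rel_def by (rule free.subspace_span)

lemma keys_tpow_rel: "r \<in> tpow_rel scale n \<Longrightarrow> keys r \<subseteq> {hs. length hs = n}"
  unfolding tpow_rel_def
  by (rule keys_span_subset) (auto dest!: in_keys_diffD in_keys_fscaleD simp: keys_gen)

lemma keys_tpow: "C \<in> tpow scale n \<Longrightarrow> keys (rep C) \<subseteq> {hs. length hs = n}"
  and rep_tpow: "C \<in> tpow scale n \<Longrightarrow> rep C +o tpow_rel scale n = C"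
  unfolding tpow_def
  by (rule keys_rep_classes[OF subspace_tpow_rel keys_tpow_rel] rep_classes[OF subspace_tpow_rel keys_tpow_rel]; assumption)+

lemma length_comult_keys: "hs \<in> keys (rep (\<Delta> h)) \<Longrightarrow> length hs = 2"
  using keys_tpow[OF comult_closed] by blast

definition homog :: "('k \<Rightarrow> 'v \<Rightarrow> 'v) \<Rightarrow> ('h \<Rightarrow> 'v::ab_group_add) \<Rightarrow> bool"
  where "homog sc f \<longleftrightarrow> (\<forall>x y. f (x + y) = f x + f y) \<and> (\<forall>c x. f (scale c x) = sc c (f x))"

definition bilin :: "('k \<Rightarrow> 'v \<Rightarrow> 'v) \<Rightarrow> ('h \<Rightarrow> 'h \<Rightarrow> 'v::ab_group_add) \<Rightarrow> bool"
  where "bilin sc F \<longleftrightarrow> (\<forall>y. homog sc (\<lambda>x. F x y)) \<and> (\<forall>x. homog sc (F x))"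

text \<open>Sweedler's notation: \<open>swd sc F h\<close> is \<open>\<Sum> F h\<^sub>(\<^sub>1\<^sub>) h\<^sub>(\<^sub>2\<^sub>)\<close> in a vector space with scalar
  multiplication \<open>sc\<close>. For bilinear \<open>F\<close> it does not depend on the representative of \<open>\<Delta> h\<close>.\<close>

definition swd :: "('k \<Rightarrow> 'v \<Rightarrow> 'v) \<Rightarrow> ('h \<Rightarrow> 'h \<Rightarrow> 'v::ab_group_add) \<Rightarrow> 'h \<Rightarrow> 'v"
  where "swd sc F h = lin_ext sc (\<lambda>hs. F (hs ! 0) (hs ! 1)) (rep (\<Delta> h))"

lemma bilinD:
  assumes "bilin sc F"
  shows "F (x + y) z = F x z + F y z" "F z (x + y) = F z x + F z y"
    "F (scale c x) y = sc c (F x y)" "F x (scale c y) = sc c (F x y)"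
  using assms by (auto simp: bilin_def homog_def)

lemma vector_space_scale: "vector_space scale" by unfold_locales

lemmas hlin_simps = mult_scale_left mult_scale_right distrib_left distrib_right
  scale_right_distrib scale_left_distrib
  lin_add[OF antipode_linear] lin_scale[OF antipode_linear]
  lin_add[OF counit_linear] lin_scale[OF counit_linear]

lemma linear_iff_homog: "vector_space sc \<Longrightarrow> Vector_Spaces.linear scale sc f \<longleftrightarrow> homog sc f"
  using vector_space_scale by (auto simp: Vector_Spaces.linear_iff homog_def)

lemma length_two_slot:
  fixes us vs :: "'a list"
  assumes "length us + length vs + 1 = 2"
  obtains v where "us = []" "vs = [v]" | u where "us = [u]" "vs = []"
  using assms by (cases us; cases vs) auto

lemma length_three_slot:
  fixes us vs :: "'a list"
  assumes "length us + length vs + 1 = 3"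
  obtains v w where "us = []" "vs = [v, w]" | u v where "us = [u]" "vs = [v]"
    | u v where "us = [u, v]" "vs = []"
proof -
  consider "length us = 0" "length vs = 2" | "length us = 1" "length vs = 1" | "length us = 2" "length vs = 0"
    using assms by linarith
  then show ?thesis
    by cases (auto simp: length_Suc_conv numeral_2_eq_2 intro: that)
qed

context
  fixes sc :: "'k \<Rightarrow> 'v \<Rightarrow> 'v::ab_group_add"
  assumes vs: "vector_space sc"
begin

interpretation V: vector_space sc by (rule vs)

text \<open>The universal property of \<open>H\<^sup>\<otimes>\<^sup>n\<close>: a map that is linear in every list entry kills the relations.\<close>

lemma lin_ext_tpow_rel:
  assumes "\<And>us vs x y. length us + length vs + 1 = n \<Longrightarrow> F (us @ (x + y) # vs) = F (us @ x # vs) + F (us @ y # vs)"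
    and "\<And>us vs c x. length us + length vs + 1 = n \<Longrightarrow> F (us @ scale c x # vs) = sc c (F (us @ x # vs))"
    and "r \<in> tpow_rel scale n"
  shows "lin_ext sc F r = 0"
  using assms(3) unfolding tpow_rel_def
  by (rule linear_vanishes_on_span[OF V.linear_lin_ext, rotated])
    (auto simp: V.lin_ext_diff V.lin_ext_scale V.lin_ext_gen assms(1,2))

lemma lin_ext_tpow_rel_two:
  assumes "bilin sc F" "p - q \<in> tpow_rel scale 2"
  shows "lin_ext sc (\<lambda>hs. F (hs ! 0) (hs ! 1)) p = lin_ext sc (\<lambda>hs. F (hs ! 0) (hs ! 1)) q"
proof -
  have "lin_ext sc (\<lambda>hs. F (hs ! 0) (hs ! 1)) (p - q) = 0"
    by (rule lin_ext_tpow_rel[OF _ _ assms(2)]; erule length_two_slot)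
      (simp_all add: bilinD[OF assms(1)])
  then show ?thesis by (simp add: V.lin_ext_diff)
qed

lemma lin_ext_tpow_rel_three:
  assumes "\<And>z. bilin sc (\<lambda>x y. F x y z)" "\<And>x. bilin sc (F x)" "p - q \<in> tpow_rel scale 3"
  shows "lin_ext sc (\<lambda>hs. F (hs ! 0) (hs ! 1) (hs ! 2)) p = lin_ext sc (\<lambda>hs. F (hs ! 0) (hs ! 1) (hs ! 2)) q"
proof -
  have "lin_ext sc (\<lambda>hs. F (hs ! 0) (hs ! 1) (hs ! 2)) (p - q) = 0"
    by (rule lin_ext_tpow_rel[OF _ _ assms(3)]; erule length_three_slot)
      (simp_all add: bilinD[OF assms(1)] bilinD[OF assms(2)])
  then show ?thesis by (simp add: V.lin_ext_diff)
qed

lemma swd_fun_add: "swd sc (\<lambda>a b. F a b + G a b) h = swd sc F h + swd sc G h"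
  by (simp add: swd_def V.lin_ext_fun_add)

lemma swd_fun_scale: "swd sc (\<lambda>a b. sc c (F a b)) h = sc c (swd sc F h)"
  by (simp add: swd_def V.lin_ext_fun_scale)

lemma swd_fun_sum: "swd sc (\<lambda>a b. \<Sum>i\<in>I. F i a b) h = (\<Sum>i\<in>I. swd sc (F i) h)"
  by (simp add: swd_def V.lin_ext_fun_sum)

lemma swd_add: assumes "bilin sc F" shows "swd sc F (x + y) = swd sc F x + swd sc F y"
proof -
  have "\<Delta> (x + y) = (rep (\<Delta> x) + rep (\<Delta> y)) +o tpow_rel scale 2"
    unfolding free.add_cosets[OF subspace_tpow_rel, symmetric] rep_tpow[OF comult_closed]
    by (rule comult_add)
  then have "rep (\<Delta> (x + y)) - (rep (\<Delta> x) + rep (\<Delta> y)) \<in> tpow_rel scale 2"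
    using free.rep_coset[OF subspace_tpow_rel] by metis
  from lin_ext_tpow_rel_two[OF assms this] show ?thesis by (simp add: swd_def V.lin_ext_add)
qed

lemma swd_scale: assumes "bilin sc F" shows "swd sc F (scale c x) = sc c (swd sc F x)"
proof -
  have "\<Delta> (scale c x) = fscale c (rep (\<Delta> x)) +o tpow_rel scale 2"
    unfolding free.scale_coset[OF subspace_tpow_rel, symmetric] rep_tpow[OF comult_closed]
    by (rule comult_scale)
  then have "rep (\<Delta> (scale c x)) - fscale c (rep (\<Delta> x)) \<in> tpow_rel scale 2"
    using free.rep_coset[OF subspace_tpow_rel] by metis
  from lin_ext_tpow_rel_two[OF assms this] show ?thesis by (simp add: swd_def V.lin_ext_scale)
qed

lemma swd_eqI:
  assumes "bilin sc F" "\<Delta> x = p +o tpow_rel scale 2"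
  shows "swd sc F x = lin_ext sc (\<lambda>hs. F (hs ! 0) (hs ! 1)) p"
  unfolding swd_def
  by (rule lin_ext_tpow_rel_two[OF assms(1)])
    (use assms(2) free.rep_coset[OF subspace_tpow_rel] in metis)

lemma swd_one: assumes "bilin sc F" shows "swd sc F 1 = F 1 1"
  using swd_eqI[OF assms comult_one] by (simp add: V.lin_ext_gen)

lemma swd_mult:
  assumes "bilin sc F"
  shows "swd sc F (x * y) = swd sc (\<lambda>a b. swd sc (\<lambda>c d. F (a * c) (b * d)) y) x"
  unfolding swd_eqI[OF assms comult_mult] unfolding tmult_def swd_def lin_ext_free_ext[OF vs] V.lin_ext_gen
  by (intro lin_ext_cong) (auto dest!: length_comult_keys simp: nth_map)

lemma swd_cocommutative: assumes "bilin sc F" shows "swd sc F h = swd sc (\<lambda>a b. F b a) h"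
  unfolding swd_eqI[OF assms cocommutative[symmetric]] 
  unfolding swd_def lin_ext_free_ext[OF vs] V.lin_ext_gen by simp

lemma swd_coassoc:
  assumes "\<And>z. bilin sc (\<lambda>x y. F x y z)" "\<And>x. bilin sc (F x)"
  shows "swd sc (\<lambda>u v. swd sc (\<lambda>a b. F a b v) u) h = swd sc (\<lambda>u v. swd sc (\<lambda>a b. F u a b) v) h"
proof -
  let ?p = "free_ext (\<lambda>hs. free_ext (\<lambda>ks. gen (ks @ [hs ! 1])) (rep (\<Delta> (hs ! 0)))) (rep (\<Delta> h))"
  let ?q = "free_ext (\<lambda>hs. free_ext (\<lambda>ks. gen (hs ! 0 # ks)) (rep (\<Delta> (hs ! 1)))) (rep (\<Delta> h))"
  let ?F = "lin_ext sc (\<lambda>hs. F (hs ! 0) (hs ! 1) (hs ! 2))"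
  have "?p - ?q \<in> tpow_rel scale 3"
    using coassoc[of h] by (simp add: free.coset_eq_iff[OF subspace_tpow_rel])
  then have "?F ?p = ?F ?q"
    by (rule lin_ext_tpow_rel_three[OF assms])
  moreover have "?F ?p = swd sc (\<lambda>u v. swd sc (\<lambda>a b. F a b v) u) h"
    unfolding swd_def lin_ext_free_ext[OF vs] V.lin_ext_gen
    by (intro lin_ext_cong) (auto dest!: length_comult_keys simp: nth_append)
  moreover have "?F ?q = swd sc (\<lambda>u v. swd sc (\<lambda>a b. F u a b) v) h"
    unfolding swd_def lin_ext_free_ext[OF vs] V.lin_ext_gen
    by (intro lin_ext_cong) (auto dest!: length_comult_keys simp: numeral_2_eq_2)
  ultimately show ?thesis by simp
qed

lemma swd_linear: "Vector_Spaces.linear s sc L \<Longrightarrow> L (swd s F h) = swd sc (\<lambda>a b. L (F a b)) h"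
  unfolding swd_def by (rule lin_ext_comp)

lemma homog_linear: "homog sc f \<Longrightarrow> Vector_Spaces.linear scale sc f"
  by (simp add: linear_iff_homog[OF vs])

lemma swd_counit_left: assumes "homog sc f" shows "swd sc (\<lambda>a b. sc (\<epsilon> a) (f b)) h = f h"
proof -
  have "f (swd scale (\<lambda>a b. scale (\<epsilon> a) b) h) = swd sc (\<lambda>a b. f (scale (\<epsilon> a) b)) h"
    by (rule swd_linear[OF homog_linear[OF assms]])
  then show ?thesis using assms counit_left[of h] by (simp add: homog_def swd_def)
qed

lemma swd_counit_right: assumes "homog sc f" shows "swd sc (\<lambda>a b. sc (\<epsilon> b) (f a)) h = f h"
proof -
  have "f (swd scale (\<lambda>a b. scale (\<epsilon> b) a) h) = swd sc (\<lambda>a b. f (scale (\<epsilon> b) a)) h"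
    by (rule swd_linear[OF homog_linear[OF assms]])
  then show ?thesis using assms counit_right[of h] by (simp add: homog_def swd_def)
qed

lemma swd_antipode_left: assumes "homog sc f" shows "swd sc (\<lambda>a b. f (S a * b)) h = sc (\<epsilon> h) (f 1)"
proof -
  have "f (swd scale (\<lambda>a b. S a * b) h) = swd sc (\<lambda>a b. f (S a * b)) h"
    by (rule swd_linear[OF homog_linear[OF assms]])
  then show ?thesis using assms antipode_left[of h] by (simp add: homog_def swd_def)
qed

lemma swd_antipode_right: assumes "homog sc f" shows "swd sc (\<lambda>a b. f (a * S b)) h = sc (\<epsilon> h) (f 1)"
proof -
  have "f (swd scale (\<lambda>a b. a * S b) h) = swd sc (\<lambda>a b. f (a * S b)) h"
    by (rule swd_linear[OF homog_linear[OF assms]])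
  then show ?thesis using assms antipode_right[of h] by (simp add: homog_def swd_def)
qed

lemma swd_swap: "swd sc (\<lambda>a b. swd sc (\<lambda>c d. G a b c d) k) h = swd sc (\<lambda>c d. swd sc (\<lambda>a b. G a b c d) h) k"
  unfolding swd_def by (rule V.lin_ext_swap)

lemma swd_fun_add_eta: "swd sc (\<lambda>a b. F a b + G a b) = (\<lambda>h. swd sc F h + swd sc G h)"
  and swd_fun_scale_eta: "swd sc (\<lambda>a b. sc c (F a b)) = (\<lambda>h. sc c (swd sc F h))"
  by (simp_all add: swd_fun_add swd_fun_scale fun_eq_iff)

text \<open>Rewriting with these rules proves that an iterated Sweedler sum is multilinear in its parameters.
  The versions with an abstracted argument are needed for nested sums, which are contracted by eta.\<close>

lemmas ml_simps = bilin_def homog_def hlin_simps swd_fun_add_eta swd_fun_scale_eta swd_add swd_scale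
  V.scale_right_distrib V.scale_left_commute V.scale_left_distrib

text \<open>A cocommutative coproduct is itself a map of coalgebras: in \<open>\<Sum> h\<^sub>(\<^sub>1\<^sub>) \<otimes> h\<^sub>(\<^sub>2\<^sub>) \<otimes> h\<^sub>(\<^sub>3\<^sub>) \<otimes> h\<^sub>(\<^sub>4\<^sub>)\<close> the two
  middle factors are the coproduct of one element and may be exchanged.\<close>

lemma swd_middle_swap:
  assumes "\<And>c d. bilin sc (\<lambda>a b. F a b c d)" "\<And>a b. bilin sc (\<lambda>c d. F a b c d)"
  shows "swd sc (\<lambda>u v. swd sc (\<lambda>a b. swd sc (\<lambda>c d. F a b c d) v) u) h
       = swd sc (\<lambda>u v. swd sc (\<lambda>a b. swd sc (\<lambda>c d. F a c b d) v) u) h"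
proof -
  note lin = bilinD[OF assms(1)] bilinD[OF assms(2)]
  have *: "swd sc (\<lambda>u v. swd sc (\<lambda>a b. swd sc (\<lambda>c d. F a b c d) v) u) h
       = swd sc (\<lambda>a u. swd sc (\<lambda>v d. swd sc (\<lambda>b c. F a b c d) v) u) h"
    if "\<And>c d. bilin sc (\<lambda>a b. F a b c d)" "\<And>a b. bilin sc (\<lambda>c d. F a b c d)" for F
  proof -
    note lin = bilinD[OF that(1)] bilinD[OF that(2)]
    have linf: "F (x + y) z = (\<lambda>c d. F x z c d + F y z c d)" "F z (x + y) = (\<lambda>c d. F z x c d + F z y c d)"
      "F (scale r x) y = (\<lambda>c d. sc r (F x y c d))" "F x (scale r y) = (\<lambda>c d. sc r (F x y c d))" for x y z r
      by (simp_all add: lin fun_eq_iff)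
    have "swd sc (\<lambda>u v. swd sc (\<lambda>a b. swd sc (\<lambda>c d. F a b c d) v) u) h
       = swd sc (\<lambda>a u. swd sc (\<lambda>b v. swd sc (\<lambda>c d. F a b c d) v) u) h"
      by (rule swd_coassoc) (simp_all add: ml_simps lin linf)
    also have "\<dots> = swd sc (\<lambda>a u. swd sc (\<lambda>v d. swd sc (\<lambda>b c. F a b c d) v) u) h"
      by (subst swd_coassoc[symmetric]) (simp_all add: ml_simps lin)
    finally show ?thesis .
  qed
  have "swd sc (\<lambda>u v. swd sc (\<lambda>a b. swd sc (\<lambda>c d. F a b c d) v) u) h
      = swd sc (\<lambda>a u. swd sc (\<lambda>v d. swd sc (\<lambda>b c. F a b c d) v) u) h"
    by (rule *[OF assms])
  also have "\<dots> = swd sc (\<lambda>a u. swd sc (\<lambda>v d. swd sc (\<lambda>b c. F a c b d) v) u) h"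
    by (subst swd_cocommutative) (simp_all add: ml_simps lin)
  also have "\<dots> = swd sc (\<lambda>u v. swd sc (\<lambda>a b. swd sc (\<lambda>c d. F a c b d) v) u) h"
    by (rule *[symmetric]) (simp_all add: ml_simps lin)
  finally show ?thesis .
qed

end


subsection \<open>The antipode\<close>

lemmas S_add = lin_add[OF antipode_linear] and S_scale = lin_scale[OF antipode_linear]
  and counit_scale = lin_scale[OF counit_linear]

lemmas mlH = ml_simps[OF vector_space_scale] mult.assoc

lemmas mlK = ml_simps[OF vector_space_field] mult.assoc mult.left_commute

lemma antipode_one: "S 1 = 1"
proof -
  have "S 1 * 1 = scale (\<epsilon> 1) 1"
    unfolding swd_antipode_left[OF vector_space_scale, of "\<lambda>u. u" 1, symmetric, unfolded homog_def, simplified]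
    by (subst swd_one[OF vector_space_scale]) (simp_all add: mlH)
  then show ?thesis by (simp add: counit_one)
qed

text \<open>Both sides are convolution inverses of the multiplication \<open>H \<otimes> H \<rightarrow> H\<close>. The sum
  \<open>\<Sum> S(h\<^sub>(\<^sub>1\<^sub>) k\<^sub>(\<^sub>1\<^sub>)) h\<^sub>(\<^sub>2\<^sub>) k\<^sub>(\<^sub>2\<^sub>) S(k\<^sub>(\<^sub>3\<^sub>)) S(h\<^sub>(\<^sub>3\<^sub>))\<close> collapses to either side, depending on which
  antipode axiom is applied first.\<close>

lemma antipode_mult: "S (h * k) = S k * S h"
proof -
  let ?s = "swd scale"
  let ?T = "\<lambda>h1 h2 h3 k1 k2 k3. S (h1 * k1) * h2 * (k2 * S k3) * S h3"
  have "?s (\<lambda>h1 h'. ?s (\<lambda>k1 k'. ?s (\<lambda>h2 h3. ?s (\<lambda>k2 k3. ?T h1 h2 h3 k1 k2 k3) k') h') k) h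
      = ?s (\<lambda>h1 h'. ?s (\<lambda>k1 k'. ?s (\<lambda>h2 h3. scale (\<epsilon> k') (S (h1 * k1) * (h2 * S h3))) h') k) h"
    by (subst swd_antipode_right[OF vector_space_scale, where f = "\<lambda>u. S (h1 * k1) * h2 * u * S h3" for h1 k1 h2 h3])
       (simp_all add: mlH)
  also have "\<dots> = ?s (\<lambda>h1 h'. ?s (\<lambda>k1 k'. scale (\<epsilon> k') (scale (\<epsilon> h') (S (h1 * k1)))) k) h"
    by (subst swd_fun_scale[OF vector_space_scale],
        subst swd_antipode_right[OF vector_space_scale, where f = "\<lambda>u. S (h1 * k1) * u" for h1 k1])
       (simp_all add: mlH)
  also have "\<dots> = ?s (\<lambda>h1 h'. scale (\<epsilon> h') (S (h1 * k))) h"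
    by (subst swd_counit_right[OF vector_space_scale]) (simp_all add: mlH)
  also have "\<dots> = S (h * k)"
    by (subst swd_counit_right[OF vector_space_scale]) (simp_all add: mlH)
  finally have 1: "?s (\<lambda>h1 h'. ?s (\<lambda>k1 k'. ?s (\<lambda>h2 h3. ?s (\<lambda>k2 k3. ?T h1 h2 h3 k1 k2 k3) k') h') k) h = S (h * k)" .
  \<comment> \<open>The same element with the product bracketed so that the left antipode axiom applies.\<close>
  let ?U = "\<lambda>h1 h2 h3 k1 k2 k3. S (h1 * k1) * (h2 * k2) * (S k3 * S h3)"
  have "?s (\<lambda>h1 h'. ?s (\<lambda>k1 k'. ?s (\<lambda>h2 h3. ?s (\<lambda>k2 k3. ?U h1 h2 h3 k1 k2 k3) k') h') k) h
      = ?s (\<lambda>h1 h'. ?s (\<lambda>h2 h3. ?s (\<lambda>k1 k'. ?s (\<lambda>k2 k3. ?U h1 h2 h3 k1 k2 k3) k') k) h') h"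
    by (subst swd_swap[OF vector_space_scale]) simp
  also have "\<dots> = ?s (\<lambda>h'' h3. ?s (\<lambda>h1 h2. ?s (\<lambda>k1 k'. ?s (\<lambda>k2 k3. ?U h1 h2 h3 k1 k2 k3) k') k) h'') h"
    by (rule swd_coassoc[OF vector_space_scale, symmetric]) (simp_all add: mlH)
  also have "\<dots> = ?s (\<lambda>h'' h3. ?s (\<lambda>h1 h2. ?s (\<lambda>k'' k3. ?s (\<lambda>k1 k2. ?U h1 h2 h3 k1 k2 k3) k'') k) h'') h"
    by (subst swd_coassoc[OF vector_space_scale]) (simp_all add: mlH)
  also have "\<dots> = ?s (\<lambda>h'' h3. ?s (\<lambda>k'' k3. ?s (\<lambda>h1 h2. ?s (\<lambda>k1 k2. ?U h1 h2 h3 k1 k2 k3) k'') h'') k) h"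
    by (subst swd_swap[OF vector_space_scale]) simp
  also have "\<dots> = ?s (\<lambda>h'' h3. ?s (\<lambda>k'' k3. ?s (\<lambda>u v. S u * v * (S k3 * S h3)) (h'' * k'')) k) h"
    by (subst swd_mult[OF vector_space_scale]) (simp_all add: mlH)
  also have "\<dots> = ?s (\<lambda>h'' h3. ?s (\<lambda>k'' k3. scale (\<epsilon> k'') (scale (\<epsilon> h'') (S k3 * S h3))) k) h"
    by (subst swd_antipode_left[OF vector_space_scale, where f = "\<lambda>u. u * (S k3 * S h3)" for h3 k3])
      (simp_all add: mlH counit_mult mult.commute)
  also have "\<dots> = ?s (\<lambda>h'' h3. scale (\<epsilon> h'') (S k * S h3)) h"
    by (subst swd_counit_left[OF vector_space_scale]) (simp_all add: mlH)
  also have "\<dots> = S k * S h"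
    by (subst swd_counit_left[OF vector_space_scale]) (simp_all add: mlH)
  finally show ?thesis using 1 by (simp add: mult.assoc)
qed

text \<open>Both \<open>S \<circ> S\<close> and the identity are convolution inverses of \<open>S\<close>: since the coproduct is
  symmetric, applying \<open>S\<close> to the antipode axiom gives \<open>\<Sum> S (S h\<^sub>(\<^sub>1\<^sub>)) S h\<^sub>(\<^sub>2\<^sub>) = \<epsilon> h\<close>.\<close>

lemma antipode_involution: "S (S h) = h"
proof -
  let ?s = "swd scale"
  have inner: "?s (\<lambda>a b. S (S a) * S b) u = scale (\<epsilon> u) 1" for u
  proof -
    have "?s (\<lambda>a b. S (S a) * S b) u = ?s (\<lambda>a b. S (b * S a)) u"
      by (simp add: antipode_mult)
    also have "\<dots> = ?s (\<lambda>a b. S (a * S b)) u"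
      by (rule swd_cocommutative[OF vector_space_scale]) (simp add: mlH)
    also have "\<dots> = scale (\<epsilon> u) 1"
      by (subst swd_antipode_right[OF vector_space_scale]) (simp_all add: mlH antipode_one)
    finally show ?thesis .
  qed
  have "?s (\<lambda>a v. ?s (\<lambda>b c. S (S a) * (S b * c)) v) h = ?s (\<lambda>a v. scale (\<epsilon> v) (S (S a))) h"
    by (subst swd_antipode_left[OF vector_space_scale, where f = "\<lambda>u. S (S a) * u" for a]) (simp_all add: mlH)
  also have "\<dots> = S (S h)"
    by (subst swd_counit_right[OF vector_space_scale]) (simp_all add: mlH)
  finally have 1: "?s (\<lambda>a v. ?s (\<lambda>b c. S (S a) * (S b * c)) v) h = S (S h)" .
  have "?s (\<lambda>a v. ?s (\<lambda>b c. S (S a) * (S b * c)) v) h = ?s (\<lambda>u c. ?s (\<lambda>a b. S (S a) * (S b * c)) u) h"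
    by (rule swd_coassoc[OF vector_space_scale, symmetric]) (simp_all add: mlH)
  also have "\<dots> = ?s (\<lambda>u c. (?s (\<lambda>a b. S (S a) * S b) u) * c) h"
    by (subst swd_linear[OF vector_space_scale, where L = "\<lambda>u. u * c" for c])
      (simp_all add: linear_iff_homog vector_space_scale mlH)
  also have "\<dots> = ?s (\<lambda>u c. scale (\<epsilon> u) c) h"
    by (simp add: inner mult_scale_left)
  also have "\<dots> = h"
    by (subst swd_counit_left[OF vector_space_scale]) (simp_all add: mlH)
  finally show ?thesis using 1 by simp
qed

text \<open>\<open>\<Delta> \<circ> S\<close> and \<open>(S \<otimes> S) \<circ> \<Delta>\<close> are both convolution inverses of \<open>\<Delta>\<close>; for the latter the two middle
  factors have to be exchanged first.\<close>

lemma swd_antipode: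
  assumes vs: "vector_space sc" and F: "bilin sc F"
  shows "swd sc F (S h) = swd sc (\<lambda>a b. F (S a) (S b)) h"
proof -
  let ?s = "swd sc"
  note ml = ml_simps[OF vs] bilinD[OF F] mult.assoc
  interpret V: vector_space sc by (rule vs)
  have split: "?s (\<lambda>h2 h3. ?s (\<lambda>c d. ?s (\<lambda>e f. F (a * c * S e) (b * d * S f)) h3) h2) v = sc (\<epsilon> v) (F a b)" for a b v
  proof -
    have "?s (\<lambda>h2 h3. ?s (\<lambda>c d. ?s (\<lambda>e f. F (a * c * S e) (b * d * S f)) h3) h2) v
      = ?s (\<lambda>h2 h3. ?s (\<lambda>c d. ?s (\<lambda>e f. F (a * c * S d) (b * e * S f)) h3) h2) v"
      by (rule swd_middle_swap[OF vs]) (simp_all add: ml)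
    also have "\<dots> = ?s (\<lambda>h2 h3. ?s (\<lambda>c d. sc (\<epsilon> h3) (F (a * c * S d) b)) h2) v"
      by (subst swd_antipode_right[OF vs, where f = "\<lambda>u. F (a * c * S d) (b * u)" for c d, unfolded mult.assoc[symmetric]])
        (simp_all add: ml)
    also have "\<dots> = ?s (\<lambda>h2 h3. sc (\<epsilon> h3) (sc (\<epsilon> h2) (F a b))) v"
      by (subst swd_fun_scale[OF vs],
          subst swd_antipode_right[OF vs, where f = "\<lambda>u. F (a * u) b", unfolded mult.assoc[symmetric]])
        (simp_all add: ml)
    also have "\<dots> = sc (\<epsilon> v) (F a b)"
      by (subst swd_counit_right[OF vs]) (simp_all add: ml)
    finally show ?thesis .
  qed
  let ?E = "\<lambda>h1 h2 h3. ?s (\<lambda>a b. ?s (\<lambda>c d. ?s (\<lambda>e f. F (a * c * S e) (b * d * S f)) h3) h2) (S h1)"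
  have "?s (\<lambda>u h3. ?s (\<lambda>h1 h2. ?E h1 h2 h3) u) h
     = ?s (\<lambda>u h3. ?s (\<lambda>h1 h2. ?s (\<lambda>m n. ?s (\<lambda>e f. F (m * S e) (n * S f)) h3) (S h1 * h2)) u) h"
    by (subst swd_mult[OF vs]) (simp_all add: ml)
  also have "\<dots> = ?s (\<lambda>u h3. sc (\<epsilon> u) (?s (\<lambda>e f. F (S e) (S f)) h3)) h"
    by (subst swd_antipode_left[OF vs, where f = "\<lambda>w. ?s (\<lambda>m n. ?s (\<lambda>e f. F (m * S e) (n * S f)) h3) w" for h3])
      (simp_all add: ml swd_one[OF vs])
  also have "\<dots> = ?s (\<lambda>e f. F (S e) (S f)) h"
    by (subst swd_counit_left[OF vs]) (simp_all add: ml)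
  finally have 1: "?s (\<lambda>u h3. ?s (\<lambda>h1 h2. ?E h1 h2 h3) u) h = ?s (\<lambda>e f. F (S e) (S f)) h" .
  have "?s (\<lambda>u h3. ?s (\<lambda>h1 h2. ?E h1 h2 h3) u) h = ?s (\<lambda>h1 v. ?s (\<lambda>h2 h3. ?E h1 h2 h3) v) h"
    by (rule swd_coassoc[OF vs]) (simp_all add: ml)
  also have "\<dots> = ?s (\<lambda>h1 v. ?s (\<lambda>a b. sc (\<epsilon> v) (F a b)) (S h1)) h"
    unfolding split[symmetric] by (subst swd_swap[OF vs]) simp
  also have "\<dots> = ?s (\<lambda>h1 v. sc (\<epsilon> v) (?s F (S h1))) h"
    by (subst swd_fun_scale[OF vs]) simp
  also have "\<dots> = ?s F (S h)"
    by (subst swd_counit_right[OF vs]) (simp_all add: ml)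
  finally show ?thesis using 1 by simp
qed


subsection \<open>The dual algebra\<close>

lemma dual_iff_homog: "x \<in> dual \<longleftrightarrow> homog (*) x"
  by (simp add: dual_def linear_iff_homog[OF vector_space_field])

lemma dual_mult_eq_swd: "dual_mult x y h = swd (*) (\<lambda>a b. x a * y b) h"
  by (simp add: dual_mult_def swd_def)

lemma
  assumes "x \<in> dual"
  shows dual_add: "x (a + b) = x a + x b" and dual_scale: "x (scale c a) = c * x a"
    and dual_zero: "x 0 = 0" and dual_diff: "x (a - b) = x a - x b"
    and dual_sum: "x (sum g A) = (\<Sum>a\<in>A. x (g a))"
  using assms unfolding dual_def
  by (auto simp: lin_add lin_scale lin_zero lin_diff lin_sum)

lemma dualI: "(\<And>a b. x (a + b) = x a + x b) \<Longrightarrow> (\<And>c a. x (scale c a) = c * x a) \<Longrightarrow> x \<in> dual"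
  by (simp add: dual_iff_homog homog_def)

abbreviation eval_prod :: "('h \<Rightarrow> 'k) list \<Rightarrow> 'h list \<Rightarrow> 'k"
  where "eval_prod xs hs \<equiv> prod_list (map2 (\<lambda>x h. x (S h)) xs hs)"

lemma counit_in_dual: "\<epsilon> \<in> dual"
  by (simp add: dual_def counit_linear)

lemma dual_sum_closed: "(\<And>i. i \<in> I \<Longrightarrow> f i \<in> dual) \<Longrightarrow> (\<lambda>h. \<Sum>i\<in>I. c i * f i h) \<in> dual"
  by (rule dualI) (simp_all add: dual_add dual_scale sum.distrib distrib_left sum_distrib_left mult.left_commute)

lemma dual_lincomb: "x \<in> dual \<Longrightarrow> y \<in> dual \<Longrightarrow> (\<lambda>h. c * x h + d * y h) \<in> dual"
  by (rule dualI) (simp_all add: dual_add dual_scale algebra_simps)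

lemma dual_plus: "x \<in> dual \<Longrightarrow> y \<in> dual \<Longrightarrow> (\<lambda>h. x h + y h) \<in> dual"
  and dual_minus: "x \<in> dual \<Longrightarrow> y \<in> dual \<Longrightarrow> (\<lambda>h. x h - y h) \<in> dual"
  and dual_times: "x \<in> dual \<Longrightarrow> (\<lambda>h. c * x h) \<in> dual"
  using dual_lincomb[of x y 1 1] dual_lincomb[of x y 1 "-1"] dual_lincomb[of x x c 0] by simp_all

lemma dual_act_closed: "x \<in> dual \<Longrightarrow> dual_act x h \<in> dual"
  by (rule dualI) (simp_all add: dual_act_def dual_add dual_scale distrib_right mult_scale_left)

lemma dual_antipode: "x \<in> dual \<Longrightarrow> (\<lambda>h. x (S h)) \<in> dual"
  by (rule dualI) (simp_all add: dual_add dual_scale S_add S_scale)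

lemma dual_mult_closed: "x \<in> dual \<Longrightarrow> y \<in> dual \<Longrightarrow> dual_mult x y \<in> dual"
  by (rule dualI) (simp_all add: dual_mult_eq_swd mlK dual_add dual_scale)

lemma dual_mult_commute: "x \<in> dual \<Longrightarrow> y \<in> dual \<Longrightarrow> dual_mult x y = dual_mult y x"
  unfolding fun_eq_iff dual_mult_eq_swd
  by (subst swd_cocommutative[OF vector_space_field]) (simp_all add: mlK dual_add dual_scale mult.commute)

lemma dual_act_act: "dual_act (dual_act x h) k = dual_act x (h * k)"
  by (simp add: dual_act_def antipode_mult mult.assoc fun_eq_iff)

lemma dual_act_one: "dual_act x 1 = x"
  by (simp add: dual_act_def antipode_one)

lemma dual_act_antipode: "dual_act x h (S f) = x (S (h * f))"
  by (simp add: dual_act_def antipode_mult)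

text \<open>The product \<open>X \<otimes> X \<rightarrow> X\<close> is a map of right \<open>H\<close>-modules, because \<open>\<Delta>\<close> is multiplicative and
  compatible with \<open>S\<close>. This makes the bracket of the annihilation algebra well defined on
  representatives in \<open>(H \<otimes> H) \<otimes>\<^sub>H L\<close>.\<close>

lemma dual_mult_act:
  assumes "x \<in> dual" "y \<in> dual"
  shows "swd (*) (\<lambda>a b. dual_mult (dual_act x (f * a)) (dual_act y (g * b)) u) h
    = dual_act (dual_mult (dual_act x f) (dual_act y g)) h u"
proof -
  let ?s = "swd ((*) :: 'k \<Rightarrow> 'k \<Rightarrow> 'k)"
  note ml = mlK dual_add[OF assms(1)] dual_add[OF assms(2)] dual_scale[OF assms(1)] dual_scale[OF assms(2)]
  have "dual_act (dual_mult (dual_act x f) (dual_act y g)) h u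
    = ?s (\<lambda>a b. x (a * S f) * y (b * S g)) (u * S h)"
    by (simp add: dual_act_def dual_mult_eq_swd)
  also have "\<dots> = ?s (\<lambda>c d. ?s (\<lambda>a b. x (c * a * S f) * y (d * b * S g)) (S h)) u"
    by (rule swd_mult[OF vector_space_field]) (simp add: ml)
  also have "\<dots> = ?s (\<lambda>c d. ?s (\<lambda>a b. x (c * S a * S f) * y (d * S b * S g)) h) u"
    by (subst swd_antipode[OF vector_space_field]) (simp_all add: ml)
  also have "\<dots> = ?s (\<lambda>a b. ?s (\<lambda>c d. x (c * S a * S f) * y (d * S b * S g)) u) h"
    by (rule swd_swap[OF vector_space_field])
  also have "\<dots> = ?s (\<lambda>a b. dual_mult (dual_act x (f * a)) (dual_act y (g * b)) u) h"
    by (simp add: dual_act_def dual_mult_eq_swd antipode_mult mult.assoc)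
  finally show ?thesis by simp
qed

text \<open>The identity \<open>\<langle>(x f)(y g), S h\<rangle> = \<Sum> \<langle>x, S(f h\<^sub>(\<^sub>1\<^sub>))\<rangle> \<langle>y, S(g h\<^sub>(\<^sub>2\<^sub>))\<rangle>\<close> translates the bracket of the
  annihilation algebra into the insertion of a coproduct into a basic cochain.\<close>

lemma dual_mult_antipode:
  assumes "x \<in> dual" "y \<in> dual"
  shows "dual_mult (dual_act x f) (dual_act y g) (S h) = swd (*) (\<lambda>a b. x (S (f * a)) * y (S (g * b))) h"
proof -
  note ml = mlK dual_add[OF assms(1)] dual_add[OF assms(2)] dual_scale[OF assms(1)] dual_scale[OF assms(2)]
  show ?thesis
    unfolding dual_mult_eq_swd dual_act_def
    by (subst swd_antipode[OF vector_space_field]) (simp_all add: ml antipode_mult)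
qed

lemma dual_basis_functional:
  assumes "independent B" "span B = UNIV"
  shows "(\<lambda>v. representation B v b) \<in> dual"
  using linear_representation[OF assms] by (simp add: dual_def)

lemma separated: assumes "\<And>x. x \<in> dual \<Longrightarrow> x h = 0" shows "h = 0"
  using mem_subspace_if_functionals_vanish[of "{0}" h] assms by (auto simp: dual_def)

end


section \<open>Chains of subspaces\<close>

context vector_space
begin

text \<open>Successive extension of bases; a basis vector outside \<open>V\<^sub>i\<close> then has a coordinate function that vanishes
  on \<open>V\<^sub>i\<close> (\<open>representation_vanishes\<close>).\<close>

lemma flag_basis:
  assumes "\<And>i. subspace (V i)" "\<And>i::nat. V i \<subseteq> V (Suc i)"
  obtains C where "independent C" "span C = UNIV" "\<And>i. span (C \<inter> V i) = V i"
proof -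
  have "\<exists>B. \<forall>i. (independent (B i) \<and> B i \<subseteq> V i \<and> V i \<subseteq> span (B i)) \<and> B i \<subseteq> B (Suc i)"
  proof (rule dependent_nat_choice)
    show "\<exists>B. independent B \<and> B \<subseteq> V 0 \<and> V 0 \<subseteq> span B"
      using maximal_independent_subset[of "V 0"] by metis
    fix B i assume "independent B \<and> B \<subseteq> V i \<and> V i \<subseteq> span B"
    then have "B \<subseteq> V (Suc i)" "independent B" using assms(2)[of i] by auto
    then show "\<exists>B'. (independent B' \<and> B' \<subseteq> V (Suc i) \<and> V (Suc i) \<subseteq> span B') \<and> B \<subseteq> B'"
      using maximal_independent_subset_extend[of B "V (Suc i)"] by metis
  qed
  then obtain B where B: "\<And>i. independent (B i)" "\<And>i. B i \<subseteq> V i" "\<And>i. V i \<subseteq> span (B i)"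
    and mono: "\<And>i. B i \<subseteq> B (Suc i)" by metis
  have le: "B i \<subseteq> B j" if "i \<le> j" for i j
    using lift_Suc_mono_le[of B, OF mono that] .
  have "independent (\<Union>(range B))"
    by (rule independent_Union_directed) (use B le in \<open>auto, meson nle_le subsetD\<close>)
  then obtain C where C: "\<Union>(range B) \<subseteq> C" "independent C" "span C = UNIV"
    using extend_basis_superset independent_extend_basis span_extend_basis by metis
  have "span (C \<inter> V i) = V i" for i
  proof
    show "span (C \<inter> V i) \<subseteq> V i" using assms(1) by (intro span_minimal) auto
    have "B i \<subseteq> C \<inter> V i" using C B by auto
    then show "V i \<subseteq> span (C \<inter> V i)" using B(3)[of i] span_mono by blast
  qed
  with C that show thesis by blast
qed

lemma representation_vanishes:
  assumes "independent C" "span (C \<inter> V) = V" "b \<notin> V" "v \<in> V"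
  shows "representation C v b = 0"
proof -
  have "representation C v = representation (C \<inter> V) v"
    using assms by (intro representation_extend) auto
  then show ?thesis using representation_ne_zero[of "C \<inter> V" v b] assms(3) by auto
qed

lemma finite_basis_of_subspace:
  assumes "subspace U" "U \<subseteq> span A" "finite A"
  obtains B where "finite B" "independent B" "span B = U" "B \<subseteq> U" "card B = dim U"
proof -
  obtain B where B: "B \<subseteq> U" "independent B" "U \<subseteq> span B"
    using maximal_independent_subset by blast
  have "finite B" using independent_span_bound[OF assms(3) B(2)] B(1) assms(2) by blast
  moreover have "span B = U" using B assms(1) span_minimal by blast
  ultimately show thesis using that B dim_eq_card[of B U] by (metis span_eq_iff assms(1))
qed

lemma dim_psubset_less:
  assumes "subspace U" "subspace V" "U \<subset> V" "V \<subseteq> span A" "finite A"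
  shows "dim U < dim V"
proof -
  obtain B where B: "finite B" "independent B" "span B = U" "B \<subseteq> U" "card B = dim U"
    using finite_basis_of_subspace[of U A] assms by auto
  obtain B' where B': "B \<subseteq> B'" "B' \<subseteq> V" "independent B'" "V \<subseteq> span B'"
    by (rule maximal_independent_subset_extend[of B V]) (use B assms in auto)
  have "finite B'" using independent_span_bound[OF assms(5) B'(3)] B'(2) assms(4) by blast
  moreover have "card B' = dim V"
    using B' assms(2) by (metis dim_eq_card span_eq_iff span_minimal subset_antisym)
  moreover have "B \<noteq> B'" using B B' assms(3) by auto
  ultimately show ?thesis using B B' psubset_card_mono[of B' B] by auto
qed

lemma dim_le_finite:
  assumes "subspace U" "U \<subseteq> span A" "finite A"
  shows "dim U \<le> card A"
proof -
  obtain B where "finite B" "independent B" "B \<subseteq> U" "card B = dim U"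
    using finite_basis_of_subspace[OF assms] by metis
  then show ?thesis using independent_span_bound[OF assms(3), of B] assms(2) by auto
qed

lemma finite_span_in_chain:
  assumes "\<And>n. subspace (W n)" "\<And>n::nat. W n \<subseteq> W (Suc n)" "finite A" "A \<subseteq> (\<Union>n. W n)"
  obtains n where "span A \<subseteq> W n"
proof -
  have le: "W i \<subseteq> W j" if "i \<le> j" for i j
    using lift_Suc_mono_le[of W, OF assms(2) that] .
  have "\<forall>a\<in>A. \<exists>n. a \<in> W n" using assms(4) by blast
  then obtain k where k: "\<forall>a\<in>A. a \<in> W (k a)" by (rule bchoice[THEN exE])
  have "a \<in> W (Max (insert 0 (k ` A)))" if "a \<in> A" for a
  proof -
    have "k a \<le> Max (insert 0 (k ` A))" using assms(3) that by (intro Max_ge) auto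
    then show ?thesis using le k that by blast
  qed
  then have "A \<subseteq> W (Max (insert 0 (k ` A)))" by blast
  then show thesis using that span_minimal assms(1) by blast
qed

lemma subspace_Union_chain:
  assumes "\<And>n. subspace (W n)" "\<And>n::nat. W n \<subseteq> W (Suc n)"
  shows "subspace (\<Union>n. W n)"
proof (rule subspaceI)
  have le: "W i \<subseteq> W j" if "i \<le> j" for i j
    using lift_Suc_mono_le[of W, OF assms(2) that] .
  show "0 \<in> (\<Union>n. W n)" using assms(1) subspace_0 by blast
  fix x y assume "x \<in> (\<Union>n. W n)" "y \<in> (\<Union>n. W n)"
  then obtain i j where "x \<in> W i" "y \<in> W j" by blast
  then have "x \<in> W (max i j)" "y \<in> W (max i j)"
    using le max.cobounded1 max.cobounded2 by blast+
  then show "x + y \<in> (\<Union>n. W n)" using assms(1) subspace_add by blast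
qed (use assms(1) subspace_scale in blast)

end


section \<open>Exhaustiveness of the filtration\<close>

context cocommutative_hopf_algebra
begin

lemma subspace_filt: "subspace (filt n)"
  by (subst filt.simps) simp

lemma grouplike_filt: "g \<in> grouplike \<Longrightarrow> g \<in> filt 0"
  by (subst filt.simps) (simp add: span_base)

definition comult_gens :: "nat \<Rightarrow> 'h \<Rightarrow> ('h list \<Rightarrow>\<^sub>0 'k) set"
  where "comult_gens n h = {gen [f, h] |f. f \<in> filt 0} \<union> {gen [h, f] |f. f \<in> filt 0} \<union>
    (\<Union>i\<in>{1..<n}. {gen [f, g] |f g. f \<in> filt i \<and> g \<in> filt (n - i)})"

lemma filt_pos: "n > 0 \<Longrightarrow>
  filt n = span {h. \<Delta> h \<in> (\<lambda>p. p +o tpow_rel scale 2) ` free.span (comult_gens n h)}"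
  unfolding comult_gens_def by (subst filt.simps) simp

lemma in_filtI: "n > 0 \<Longrightarrow> \<Delta> h = p +o tpow_rel scale 2 \<Longrightarrow> p \<in> free.span (comult_gens n h) \<Longrightarrow> h \<in> filt n"
  unfolding filt_pos by (rule span_base) blast

lemma filt_Suc: "filt n \<subseteq> filt (Suc n)"
proof (induction n rule: less_induct)
  case (less n)
  show ?case
  proof (cases "n = 0")
    case True
    have "grouplike \<subseteq> filt 1"
    proof
      fix g assume g: "g \<in> grouplike"
      then have "\<Delta> g = gen [g, g] +o tpow_rel scale 2" by (simp add: grouplike_def)
      then show "g \<in> filt 1"
        by (rule in_filtI[rotated]) (auto simp: comult_gens_def intro!: free.span_base grouplike_filt g)
    qed
    then have "span grouplike \<subseteq> filt 1" by (intro span_minimal subspace_filt)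
    then show ?thesis using True by (subst filt.simps) simp
  next
    case False
    have "comult_gens n h \<subseteq> comult_gens (Suc n) h" for h
    proof -
      have "gen [f, g] \<in> (\<Union>i\<in>{1..<Suc n}. {gen [f, g] |f g. f \<in> filt i \<and> g \<in> filt (Suc n - i)})"
        if "i \<in> {1..<n}" "f \<in> filt i" "g \<in> filt (n - i)" for i f g
      proof -
        have "g \<in> filt (Suc (n - i))" using less[of "n - i"] that by auto
        then have "g \<in> filt (Suc n - i)" using that by (simp add: Suc_diff_le)
        then show ?thesis using that by fastforce
      qed
      then show ?thesis unfolding comult_gens_def by blast
    qed
    then have "free.span (comult_gens n h) \<subseteq> free.span (comult_gens (Suc n) h)" for h
      by (rule free.span_mono)
    then show ?thesis using False unfolding filt_pos[OF zero_less_Suc] filt_pos[OF False[unfolded neq0_conv]]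
      by (intro span_mono) blast
  qed
qed

lemma filt_mono: "m \<le> n \<Longrightarrow> filt m \<subseteq> filt n"
  using lift_Suc_mono_le[of filt, OF filt_Suc] .


subsection \<open>The action of the dual algebra\<close>

text \<open>The action \<open>x h = \<Sum> h\<^sub>(\<^sub>1\<^sub>) \<langle>x, h\<^sub>(\<^sub>2\<^sub>)\<rangle>\<close>, whose invariant subspaces are the subcomodules of \<open>H\<close>.\<close>

definition xact :: "('h \<Rightarrow> 'k) \<Rightarrow> 'h \<Rightarrow> 'h"
  where "xact x h = swd scale (\<lambda>a b. scale (x b) a) h"

lemma
  assumes "x \<in> dual"
  shows xact_add: "xact x (h + k) = xact x h + xact x k"
    and xact_scale: "xact x (scale c h) = scale c (xact x h)"
  using assms unfolding xact_def
  by (subst swd_add[OF vector_space_scale] swd_scale[OF vector_space_scale];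
      simp add: mlH dual_add dual_scale mult.commute)+

lemma homog_xact: "x \<in> dual \<Longrightarrow> homog scale (xact x)"
  by (simp add: homog_def xact_add xact_scale)

lemma linear_xact: "x \<in> dual \<Longrightarrow> Vector_Spaces.linear scale scale (xact x)"
  by (simp add: linear_iff_homog vector_space_scale homog_xact)

lemma xact_zero: "x \<in> dual \<Longrightarrow> xact x 0 = 0"
  using linear_xact lin_zero by blast

lemma xact_lincomb: "xact (\<lambda>h. c * x h + d * y h) h = scale c (xact x h) + scale d (xact y h)"
  by (simp add: xact_def scale_left_distrib swd_fun_add[OF vector_space_scale] swd_fun_scale[OF vector_space_scale]
      flip: scale_scale)

lemma xact_counit: "xact \<epsilon> h = h"
  unfolding xact_def by (subst swd_counit_right[OF vector_space_scale]) (simp_all add: homog_def)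

lemma dual_xact: assumes "x \<in> dual" "y \<in> dual" shows "y (xact x h) = dual_mult y x h"
  unfolding xact_def dual_mult_eq_swd
  using swd_linear[OF vector_space_field, of scale y] assms
  by (simp add: dual_def dual_scale[unfolded dual_def] mult.commute)

text \<open>Both sides are the value of the product of \<open>x\<close> and \<open>y\<close> at \<open>h\<close>. Statements about \<open>xact x h\<close> thus
  reduce to the value of \<open>x\<close> on the submodule generated by \<open>h\<close>.\<close>

lemma xact_swap_functional: "x \<in> dual \<Longrightarrow> y \<in> dual \<Longrightarrow> y (xact x h) = x (xact y h)"
  by (simp add: dual_xact dual_mult_commute)

lemma counit_xact: assumes "x \<in> dual" shows "\<epsilon> (xact x h) = x h"
  using xact_swap_functional[OF assms counit_in_dual] by (simp add: xact_counit)

lemma xact_mult: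
  assumes "x \<in> dual" "y \<in> dual"
  shows "xact (dual_mult x y) h = xact x (xact y h)"
proof -
  note ml = mlH dual_add[OF assms(1)] dual_add[OF assms(2)] dual_scale[OF assms(1)] dual_scale[OF assms(2)]
  have lin: "Vector_Spaces.linear (*) scale (\<lambda>t. scale t a)" for a
    by (rule linearI_vs[OF vector_space_field vector_space_scale]) (simp_all add: scale_left_distrib)
  have "xact (dual_mult x y) h = swd scale (\<lambda>a b. swd scale (\<lambda>c d. scale (x c * y d) a) b) h"
    unfolding xact_def dual_mult_eq_swd by (subst swd_linear[OF vector_space_scale lin]) simp
  also have "\<dots> = swd scale (\<lambda>u d. swd scale (\<lambda>a c. scale (x c * y d) a) u) h"
    by (rule swd_coassoc[OF vector_space_scale, symmetric]) (simp_all add: ml mult.commute mult.left_commute)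
  also have "\<dots> = swd scale (\<lambda>u d. scale (y d) (xact x u)) h"
    unfolding xact_def by (subst swd_fun_scale[OF vector_space_scale, symmetric]) (simp add: mult.commute)
  also have "\<dots> = xact x (swd scale (\<lambda>u d. scale (y d) u) h)"
    by (subst swd_linear[OF vector_space_scale linear_xact[OF assms(1)]]) (simp add: xact_scale assms)
  finally show ?thesis by (simp add: xact_def)
qed

lemma xact_commute: "x \<in> dual \<Longrightarrow> y \<in> dual \<Longrightarrow> xact x (xact y h) = xact y (xact x h)"
  by (metis xact_mult dual_mult_commute)

lemma bilin_functional:
  assumes "Vector_Spaces.linear fscale (*) l" "\<And>r. r \<in> tpow_rel scale 2 \<Longrightarrow> l r = 0"
  shows "bilin (*) (\<lambda>u v. l (gen [u, v]))"
proof -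
  have add: "l (gen (us @ (x + y) # vs)) = l (gen (us @ x # vs)) + l (gen (us @ y # vs))"
    and scale: "l (gen (us @ scale c x # vs)) = c * l (gen (us @ x # vs))"
    if "length us + length vs + 1 = 2" for us vs x y c
  proof -
    have "l (gen (us @ (x + y) # vs) - gen (us @ x # vs) - gen (us @ y # vs)) = 0"
      by (intro assms(2), unfold tpow_rel_def, rule free.span_base) (use that in blast)
    then show "l (gen (us @ (x + y) # vs)) = l (gen (us @ x # vs)) + l (gen (us @ y # vs))"
      by (simp add: lin_diff[OF assms(1)] lin_add[OF assms(1)] algebra_simps)
    have "l (gen (us @ scale c x # vs) - fscale c (gen (us @ x # vs))) = 0"
      by (intro assms(2), unfold tpow_rel_def, rule free.span_base) (use that in blast)
    then show "l (gen (us @ scale c x # vs)) = c * l (gen (us @ x # vs))"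
      by (simp add: lin_diff[OF assms(1)] lin_scale[OF assms(1)])
  qed
  show ?thesis
    using add[of "[]" "[_]"] add[of "[_]" "[]"] scale[of "[]" "[_]"] scale[of "[_]" "[]"]
    by (simp add: bilin_def homog_def)
qed

text \<open>Elements of \<open>H \<otimes> H\<close> are equal if all functionals on it agree; as maps on generators these are the
  bilinear forms.\<close>

lemma tpow_two_eqI:
  assumes "\<And>l. Vector_Spaces.linear fscale (*) l \<Longrightarrow> (\<And>r. r \<in> tpow_rel scale 2 \<Longrightarrow> l r = 0) \<Longrightarrow>
    bilin (*) (\<lambda>u v. l (gen [u, v])) \<Longrightarrow> l p = l q"
  shows "p +o tpow_rel scale 2 = q +o tpow_rel scale 2"
  unfolding free.coset_eq_iff[OF subspace_tpow_rel]
proof (rule free.mem_subspace_if_functionals_vanish[OF subspace_tpow_rel])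
  fix l :: "('h list \<Rightarrow>\<^sub>0 'k) \<Rightarrow> 'k"
  assume l: "Vector_Spaces.linear fscale (*) l" "\<And>r. r \<in> tpow_rel scale 2 \<Longrightarrow> l r = 0"
  have "l p = l q" by (rule assms) (use l bilin_functional in auto)
  then show "l (p - q) = 0" by (simp add: lin_diff[OF l(1)])
qed

lemma functional_comult:
  assumes "Vector_Spaces.linear fscale (*) l"
  shows "l (rep (\<Delta> h)) = swd (*) (\<lambda>u v. l (gen [u, v])) h"
proof -
  have "l (rep (\<Delta> h)) = lin_ext (*) (\<lambda>hs. l (gen hs)) (rep (\<Delta> h))"
    using lin_ext_linear[OF assms] by metis
  also have "\<dots> = swd (*) (\<lambda>u v. l (gen [u, v])) h"
    unfolding swd_def
  proof (rule lin_ext_cong)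
    fix hs assume "hs \<in> keys (rep (\<Delta> h))"
    then have "length hs = 2" by (rule length_comult_keys)
    then have "hs = [hs ! 0, hs ! 1]" by (auto simp: length_Suc_conv numeral_2_eq_2)
    then show "l (gen hs) = l (gen [hs ! 0, hs ! 1])" by simp
  qed
  finally show ?thesis .
qed

text \<open>Expanding the second factor of \<open>\<Delta> h\<close> in a basis: the coefficient of \<open>b\<close> is the coordinate
  function of \<open>b\<close> acting on \<open>h\<close>. The last two equations are the counit axioms in this form.\<close>

lemma comult_expansion:
  assumes C: "independent C" "span C = UNIV"
  obtains F where "finite F" "F \<subseteq> C"
    "\<Delta> h = (\<Sum>b\<in>F. gen [xact (\<lambda>v. representation C v b) h, b]) +o tpow_rel scale 2"
    "(\<Sum>b\<in>F. scale (\<epsilon> (xact (\<lambda>v. representation C v b) h)) b) = h"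
    "(\<Sum>b\<in>F. scale (\<epsilon> b) (xact (\<lambda>v. representation C v b) h)) = h"
proof -
  let ?c = "\<lambda>b v. representation C v b"
  define F where "F = (\<Union>hs\<in>keys (rep (\<Delta> h)). {b. representation C (hs ! 1) b \<noteq> 0})"
  have fin: "finite F" unfolding F_def by (simp add: finite_representation)
  have sub: "F \<subseteq> C" unfolding F_def using representation_ne_zero by blast
  have expand: "v = (\<Sum>b\<in>F. scale (?c b v) b)" if "{b. representation C v b \<noteq> 0} \<subseteq> F" for v
  proof -
    have "v = (\<Sum>b | representation C v b \<noteq> 0. scale (?c b v) b)"
      using sum_nonzero_representation_eq[OF C(1), of v] C(2) by simp
    also have "\<dots> = (\<Sum>b\<in>F. scale (?c b v) b)"
      by (rule sum.mono_neutral_left) (use fin that in auto)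
    finally show ?thesis .
  qed
  let ?p = "\<Sum>b\<in>F. gen [xact (?c b) h, b]"
  have eq: "rep (\<Delta> h) +o tpow_rel scale 2 = ?p +o tpow_rel scale 2"
  proof (rule tpow_two_eqI)
    fix l :: "('h list \<Rightarrow>\<^sub>0 'k) \<Rightarrow> 'k"
    assume l: "Vector_Spaces.linear fscale (*) l" and bl: "bilin (*) (\<lambda>u v. l (gen [u, v]))"
    let ?G = "\<lambda>u v. l (gen [u, v])"
    have Gsum: "?G u (\<Sum>b\<in>F. scale (f b) b) = (\<Sum>b\<in>F. f b * ?G u b)" for u f
    proof -
      have "Vector_Spaces.linear scale (*) (?G u)"
        using bl by (simp add: linear_iff_homog[OF vector_space_field] bilin_def)
      note sum = lin_sum[OF this]
      show ?thesis by (simp add: sum bilinD[OF bl])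
    qed
    have Gx: "?G (xact (?c b) h) b = swd (*) (\<lambda>u v. ?c b v * ?G u b) h" for b
    proof -
      have "Vector_Spaces.linear scale (*) (\<lambda>u. ?G u b)"
        using bl by (simp add: linear_iff_homog[OF vector_space_field] bilin_def)
      from swd_linear[OF vector_space_field this] show ?thesis
        unfolding xact_def by (simp add: bilinD[OF bl])
    qed
    have "l (rep (\<Delta> h)) = swd (*) (\<lambda>u v. \<Sum>b\<in>F. ?c b v * ?G u b) h"
      unfolding functional_comult[OF l] swd_def
    proof (rule lin_ext_cong)
      fix hs assume "hs \<in> keys (rep (\<Delta> h))"
      then have "hs ! 1 = (\<Sum>b\<in>F. scale (?c b (hs ! 1)) b)"
        by (intro expand) (auto simp: F_def)
      then show "?G (hs ! 0) (hs ! 1) = (\<Sum>b\<in>F. ?c b (hs ! 1) * ?G (hs ! 0) b)"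
        using Gsum[of "hs ! 0" "\<lambda>b. ?c b (hs ! 1)"] by simp
    qed
    also have "\<dots> = l ?p"
      by (simp add: swd_fun_sum[OF vector_space_field] lin_sum[OF l] Gx)
    finally show "l (rep (\<Delta> h)) = l ?p" .
  qed
  then have \<Delta>: "\<Delta> h = ?p +o tpow_rel scale 2" by (simp add: rep_tpow[OF comult_closed])
  have "h = swd scale (\<lambda>a b. scale (\<epsilon> a) b) h"
    by (subst swd_counit_left[OF vector_space_scale]) (simp_all add: homog_def)
  also have "\<dots> = (\<Sum>b\<in>F. scale (\<epsilon> (xact (?c b) h)) b)"
    by (subst swd_eqI[OF vector_space_scale _ \<Delta>])
      (simp_all add: mlH lin_ext_sum lin_ext_gen)
  finally have 1: "(\<Sum>b\<in>F. scale (\<epsilon> (xact (?c b) h)) b) = h" ..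
  have "h = swd scale (\<lambda>a b. scale (\<epsilon> b) a) h"
    by (subst swd_counit_right[OF vector_space_scale]) (simp_all add: homog_def)
  also have "\<dots> = (\<Sum>b\<in>F. scale (\<epsilon> b) (xact (?c b) h))"
    by (subst swd_eqI[OF vector_space_scale _ \<Delta>])
      (simp_all add: mlH lin_ext_sum lin_ext_gen mult.commute)
  finally have 2: "(\<Sum>b\<in>F. scale (\<epsilon> b) (xact (?c b) h)) = h" ..
  from that[OF fin sub \<Delta> 1 2] show thesis .
qed


subsection \<open>The component of a group-like element\<close>

text \<open>The elements annihilated by all products of \<open>n\<close> functionals that vanish at \<open>g\<close>.\<close>

primrec component :: "'h \<Rightarrow> nat \<Rightarrow> 'h set" where
  "component g 0 = {0}"
| "component g (Suc n) = {h. \<forall>x\<in>dual. x g = 0 \<longrightarrow> xact x h \<in> component g n}"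

lemma subspace_component: "subspace (component g n)"
proof (induction n)
  case 0 show ?case by simp
next
  case (Suc n)
  then show ?case
    by (intro subspaceI) (auto simp: xact_add xact_scale xact_zero subspace_0 subspace_add subspace_scale)
qed

lemma component_Suc: "component g n \<subseteq> component g (Suc n)"
proof (induction n)
  case 0 show ?case by (auto simp: xact_zero)
qed auto

lemma component_mono: "m \<le> n \<Longrightarrow> component g m \<subseteq> component g n"
  using lift_Suc_mono_le[of "component g", OF component_Suc] .

lemma xact_component: "x \<in> dual \<Longrightarrow> h \<in> component g n \<Longrightarrow> xact x h \<in> component g n"
proof (induction n arbitrary: h)
  case 0 then show ?case by (simp add: xact_zero)
next
  case (Suc n) then show ?case by (auto simp: xact_commute[of _ x])
qed

text \<open>The base case is \<open>xact_swap_functional\<close>: for every functional \<open>y\<close> the element \<open>xact y h\<close> stays in the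
  component, where \<open>x\<close> vanishes. The induction step holds because the action is commutative.\<close>

lemma xact_lowers_component:
  assumes "x \<in> dual" "\<And>h. h \<in> component g d \<Longrightarrow> x h = 0" "h \<in> component g (d + k)"
  shows "xact x h \<in> component g k"
  using assms(3)
proof (induction k arbitrary: h)
  case 0
  have "xact x h = 0"
  proof (rule separated)
    fix y assume y: "y \<in> dual"
    have "xact y h \<in> component g d" using 0 y by (simp add: xact_component)
    then show "y (xact x h) = 0"
      using assms by (simp add: xact_swap_functional[OF _ y])
  qed
  then show ?case by simp
next
  case (Suc k)
  then show ?case using assms(1) by (auto simp: xact_commute[of _ x])
qed

text \<open>Every functional \<open>x\<close> differs from \<open>\<langle>x, g\<rangle> \<epsilon>\<close> by one that vanishes at \<open>g\<close>.\<close>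

lemma component_one:
  assumes "g \<in> grouplike" "h \<in> component g 1"
  shows "h = scale (\<epsilon> h) g"
proof -
  have "h - scale (\<epsilon> h) g = 0"
  proof (rule separated)
    fix x assume x: "x \<in> dual"
    let ?y = "\<lambda>h. 1 * x h + (- x g) * \<epsilon> h"
    have y: "?y \<in> dual" by (rule dual_lincomb[OF x counit_in_dual])
    have "?y g = 0" using assms(1) by (simp add: grouplike_def)
    then have "xact ?y h = 0" using assms(2) y by auto
    then have "?y h = 0" using counit_xact[OF y, of h] by (simp add: dual_zero[OF counit_in_dual])
    then show "x (h - scale (\<epsilon> h) g) = 0"
      using x by (simp add: dual_diff dual_scale mult.commute)
  qed
  then show ?thesis by simp
qed

text \<open>Expand \<open>\<Delta> h = \<Sum> u\<^sub>b \<otimes> b\<close> in a basis adapted to the components. The coordinate function of a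
  basis vector outside the \<open>d\<close>-th component lowers the component by \<open>d\<close>, so \<open>u\<^sub>b\<close> and \<open>b\<close> lie in
  complementary steps. The two extreme steps are multiples of \<open>g\<close> and are corrected to
  \<open>g \<otimes> h + h \<otimes> g\<close> by the counit.\<close>

lemma component_subset_filt:
  assumes g: "g \<in> grouplike"
  shows "component g (Suc N) \<subseteq> filt N"
proof (induction N rule: less_induct)
  case (less N)
  show ?case
  proof
    fix h assume h: "h \<in> component g (Suc N)"
    show "h \<in> filt N"
    proof (cases "N = 0")
      case True
      have "h = scale (\<epsilon> h) g"
        by (rule component_one[OF g]) (use h True in simp)
      then show ?thesis using True subspace_scale[OF subspace_filt grouplike_filt[OF g]] by metis
    next
      case False
      obtain C where C: "independent C" "span C = UNIV" "\<And>i. span (C \<inter> component g i) = component g i"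
        using flag_basis[of "component g", OF subspace_component component_Suc] by blast
      define u where "u b = xact (\<lambda>v. representation C v b) h" for b
      obtain F where F: "finite F" "F \<subseteq> C" "\<Delta> h = (\<Sum>b\<in>F. gen [u b, b]) +o tpow_rel scale 2"
        and eps: "(\<Sum>b\<in>F. scale (\<epsilon> (u b)) b) = h" "(\<Sum>b\<in>F. scale (\<epsilon> b) (u b)) = h"
        unfolding u_def by (rule comult_expansion[OF C(1,2), of h]) blast
      have low: "u b \<in> component g (Suc N - d)" if "b \<notin> component g d" "d \<le> Suc N" for b d
        unfolding u_def
      proof (rule xact_lowers_component)
        show "(\<lambda>v. representation C v b) \<in> dual" by (rule dual_basis_functional[OF C(1,2)])
        show "representation C v b = 0" if "v \<in> component g d" for v
          using representation_vanishes[OF C(1,3) \<open>b \<notin> component g d\<close> that] .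
        show "h \<in> component g (d + (Suc N - d))" using h that by simp
      qed
      define F0 FN where "F0 = {b\<in>F. b \<in> component g 1}" and "FN = {b\<in>F. b \<notin> component g N}"
      define mid where "mid = {b\<in>F. b \<in> component g N \<and> b \<notin> component g 1}"
      have le1N: "component g 1 \<subseteq> component g N" using False by (intro component_mono) auto
      have split: "F = F0 \<union> (mid \<union> FN)" "F0 \<inter> (mid \<union> FN) = {}" "mid \<inter> FN = {}"
        "finite F0" "finite mid" "finite FN"
        using F(1) le1N by (auto simp: F0_def FN_def mid_def)
      define v v' where "v = (\<Sum>b\<in>FN. scale (\<epsilon> (u b)) b)" and "v' = (\<Sum>b\<in>F0. scale (\<epsilon> b) (u b))"
      have hv: "h - v \<in> component g N"
      proof -
        have "h - v = (\<Sum>b\<in>F0. scale (\<epsilon> (u b)) b) + (\<Sum>b\<in>mid. scale (\<epsilon> (u b)) b)"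
          unfolding eps(1)[symmetric] v_def using split by (simp add: sum.union_disjoint)
        also have "\<dots> \<in> component g N"
          using le1N by (intro subspace_add subspace_sum subspace_scale subspace_component)
            (auto simp: F0_def mid_def)
        finally show ?thesis .
      qed
      have hv': "h - v' \<in> component g N"
      proof -
        have "h - v' = (\<Sum>b\<in>mid. scale (\<epsilon> b) (u b)) + (\<Sum>b\<in>FN. scale (\<epsilon> b) (u b))"
          unfolding eps(2)[symmetric] v'_def using split by (simp add: sum.union_disjoint)
        also have "\<dots> \<in> component g N"
        proof -
          have "u b \<in> component g N" if "b \<in> mid \<union> FN" for b
            using low[of b 1] that le1N by (auto simp: mid_def FN_def)
          then show ?thesis by (intro subspace_add subspace_sum subspace_scale subspace_component) auto
        qed
        finally show ?thesis .
      qed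
      have b0: "b = scale (\<epsilon> b) g" if "b \<in> F0" for b
        by (rule component_one[OF g]) (use that in \<open>simp add: F0_def\<close>)
      have uN: "u b = scale (\<epsilon> (u b)) g" if "b \<in> FN" for b
        by (rule component_one[OF g]) (use that low[of b N] in \<open>simp add: FN_def\<close>)
      let ?mid = "\<Sum>b\<in>mid. gen [u b, b]"
      have \<Delta>: "\<Delta> h = (gen [v', g] + (?mid + gen [g, v])) +o tpow_rel scale 2"
        unfolding F(3)
      proof (rule tpow_two_eqI)
        fix l :: "('h list \<Rightarrow>\<^sub>0 'k) \<Rightarrow> 'k"
        assume l: "Vector_Spaces.linear fscale (*) l" and bl: "bilin (*) (\<lambda>u v. l (gen [u, v]))"
        have lr: "Vector_Spaces.linear scale (*) (\<lambda>v. l (gen [u, v]))"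
             "Vector_Spaces.linear scale (*) (\<lambda>v. l (gen [v, u]))" for u
          using bl by (simp_all add: linear_iff_homog[OF vector_space_field] bilin_def)
        have "(\<Sum>b\<in>F0. l (gen [u b, b])) = (\<Sum>b\<in>F0. \<epsilon> b * l (gen [u b, g]))"
          using b0 bilinD(4)[OF bl] by (intro sum.cong) metis+
        moreover have "(\<Sum>b\<in>FN. l (gen [u b, b])) = (\<Sum>b\<in>FN. \<epsilon> (u b) * l (gen [g, b]))"
          using uN bilinD(3)[OF bl] by (intro sum.cong) metis+
        ultimately show "l (\<Sum>b\<in>F. gen [u b, b]) = l (gen [v', g] + (?mid + gen [g, v]))"
          using split by (simp add: lin_add[OF l] lin_sum[OF l] sum.union_disjoint v_def v'_def
              lin_sum[OF lr(1)] lin_sum[OF lr(2)] lin_scale[OF lr(1)] lin_scale[OF lr(2)])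
      qed
      \<comment> \<open>For \<open>N = 1\<close> the corrections are multiples of \<open>g \<otimes> g\<close>, which are absorbed by adding a multiple
        of \<open>g\<close> to \<open>h\<close>; for \<open>N \<ge> 2\<close> they are of the form \<open>F\<^sup>1 \<otimes> F\<^sup>N\<^sup>-\<^sup>1\<close> and \<open>F\<^sup>N\<^sup>-\<^sup>1 \<otimes> F\<^sup>1\<close>.\<close>
      show ?thesis
      proof (cases "N = 1")
        case True
        then have mid: "mid = {}" by (auto simp: mid_def)
        obtain c d where cd: "v' = h + scale c g" "v = h + scale d g"
        proof
          have *: "w = h + scale (- \<epsilon> (h - w)) g" if "h - w \<in> component g N" for w
          proof -
            have "h - w = scale (\<epsilon> (h - w)) g"
              by (rule component_one[OF g]) (use that True in simp)
            then have "h + scale (- \<epsilon> (h - w)) g = h - (h - w)" by (metis scale_minus_left add_uminus_conv_diff)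
            then show ?thesis by simp
          qed
          show "v' = h + scale (- \<epsilon> (h - v')) g" "v = h + scale (- \<epsilon> (h - v)) g"
            by (rule *, rule hv') (rule *, rule hv)
        qed
        let ?h = "h + scale (c + d) g"
        have "\<Delta> ?h = (gen [v', g] + gen [g, v] + fscale (c + d) (gen [g, g])) +o tpow_rel scale 2"
          using \<Delta> mid g by (simp add: comult_add comult_scale grouplike_def free.scale_coset[OF subspace_tpow_rel]
              free.add_cosets[OF subspace_tpow_rel])
        also have "\<dots> = (gen [?h, g] + gen [g, ?h]) +o tpow_rel scale 2"
          unfolding cd
        proof (rule tpow_two_eqI)
          fix l :: "('h list \<Rightarrow>\<^sub>0 'k) \<Rightarrow> 'k"
          assume l: "Vector_Spaces.linear fscale (*) l" and bl: "bilin (*) (\<lambda>u v. l (gen [u, v]))"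
          show "l (gen [h + scale c g, g] + gen [g, h + scale d g] + fscale (c + d) (gen [g, g]))
            = l (gen [?h, g] + gen [g, ?h])"
            by (simp add: lin_add[OF l] lin_scale[OF l] bilinD[OF bl] algebra_simps)
        qed
        finally have "?h \<in> filt N"
        proof (rule in_filtI[rotated])
          have "gen [?h, g] \<in> comult_gens N ?h" "gen [g, ?h] \<in> comult_gens N ?h"
            using grouplike_filt[OF g] by (auto simp: comult_gens_def)
          then show "gen [?h, g] + gen [g, ?h] \<in> free.span (comult_gens N ?h)"
            by (intro free.span_add free.span_base)
        qed (use False in simp)
        moreover have "scale (c + d) g \<in> filt N"
          using grouplike_filt[OF g] filt_mono[of 0 N] subspace_scale[OF subspace_filt] by blast
        ultimately show ?thesis using subspace_diff[OF subspace_filt, of ?h N "scale (c + d) g"] by simp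
      next
        case N1: False
        have N: "component g N \<subseteq> filt (N - 1)" using less[of "N - 1"] False by simp
        have gf: "g \<in> filt 0" "g \<in> filt 1" using grouplike_filt[OF g] filt_Suc[of 0] by auto
        have "\<Delta> h = (gen [h, g] + gen [g, h] + (gen [v' - h, g] + ?mid + gen [g, v - h])) +o tpow_rel scale 2"
          unfolding \<Delta>
        proof (rule tpow_two_eqI)
          fix l :: "('h list \<Rightarrow>\<^sub>0 'k) \<Rightarrow> 'k"
          assume l: "Vector_Spaces.linear fscale (*) l" and bl: "bilin (*) (\<lambda>u v. l (gen [u, v]))"
          have "l (gen [h + (v' - h), g]) = l (gen [h, g]) + l (gen [v' - h, g])"
               "l (gen [g, h + (v - h)]) = l (gen [g, h]) + l (gen [g, v - h])"
            by (rule bilinD[OF bl])+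
          then show "l (gen [v', g] + (?mid + gen [g, v]))
              = l (gen [h, g] + gen [g, h] + (gen [v' - h, g] + ?mid + gen [g, v - h]))"
            by (simp add: lin_add[OF l])
        qed
        then show ?thesis
        proof (rule in_filtI[rotated])
          have m: "gen [f, f'] \<in> free.span (comult_gens N h)"
            if "f \<in> filt i" "f' \<in> filt (N - i)" "i \<in> {1..<N}" for f f' i
            using that by (intro free.span_base) (auto simp: comult_gens_def)
          have "gen [v' - h, g] \<in> free.span (comult_gens N h)"
            by (rule m[of _ "N - 1"])
              (use subsetD[OF N hv'] gf False N1 subspace_neg[OF subspace_filt, of "h - v'"] in auto)
          moreover have "gen [g, v - h] \<in> free.span (comult_gens N h)"
            by (rule m[of _ 1])
              (use subsetD[OF N hv] gf False N1 subspace_neg[OF subspace_filt, of "h - v"] in auto)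
          moreover have "?mid \<in> free.span (comult_gens N h)"
          proof (rule free.span_sum)
            fix b assume b: "b \<in> mid"
            define d where "d = (LEAST d. b \<in> component g (Suc d))"
            have N': "Suc (N - 1) = N" using False by simp
            have ex: "b \<in> component g (Suc (N - 1))" unfolding N' using b by (simp add: mid_def)
            have d1: "b \<in> component g (Suc d)" unfolding d_def using ex by (rule LeastI)
            have d2: "d \<le> N - 1" unfolding d_def using ex by (rule Least_le)
            have d0: "d \<noteq> 0"
            proof
              assume "d = 0"
              then have "b \<in> component g 1" using d1 by (simp only: One_nat_def)
              then show False using b unfolding mid_def by blast
            qed
            have "b \<notin> component g (Suc (d - 1))"
              using d0 not_less_Least[of "d - 1" "\<lambda>d. b \<in> component g (Suc d)"] by (simp add: d_def)
            then have "b \<notin> component g d" using d0 by simp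
            then have "u b \<in> component g (Suc (N - d))" using low[of b d] d2 False by (simp add: Suc_diff_le)
            then have "u b \<in> filt (N - d)" "b \<in> filt d"
              using subsetD[OF less[of "N - d"]] subsetD[OF less[of d] d1] d0 d2 False by simp_all
            then show "gen [u b, b] \<in> free.span (comult_gens N h)"
              using d0 d2 False by (intro m[of _ "N - d"]) auto
          qed
          ultimately show "gen [h, g] + gen [g, h] + (gen [v' - h, g] + ?mid + gen [g, v - h]) \<in> free.span (comult_gens N h)"
            using gf(1) by (intro free.span_add) (auto simp: comult_gens_def intro!: free.span_base)
        qed (use False in simp)
      qed
    qed
  qed
qed


subsection \<open>Decomposition into components\<close>

definition stable :: "'h set \<Rightarrow> bool"
  where "stable V \<longleftrightarrow> subspace V \<and> (\<forall>x\<in>dual. \<forall>v\<in>V. xact x v \<in> V)"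

lemma stable_image: assumes "stable V" "x \<in> dual" shows "stable (xact x ` V)" "xact x ` V \<subseteq> V"
proof -
  have "subspace (xact x ` V)"
    using assms(1) Vector_Spaces.linear.axioms linear_xact[OF assms(2)]
      module_hom.subspace_image[of scale scale "xact x" V] by (simp add: stable_def module_hom_iff_linear)
  then show "stable (xact x ` V)"
    using assms by (auto simp: stable_def xact_commute[of _ x])
  show "xact x ` V \<subseteq> V" using assms by (auto simp: stable_def)
qed

lemma xact_funpow:
  assumes "x \<in> dual"
  shows "homog scale (xact x ^^ n)" "y \<in> dual \<Longrightarrow> xact y ((xact x ^^ n) h) = (xact x ^^ n) (xact y h)"
proof -
  show "homog scale (xact x ^^ n)"
    by (induction n) (use assms in \<open>simp_all add: homog_def xact_add xact_scale\<close>)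
  show "xact y ((xact x ^^ n) h) = (xact x ^^ n) (xact y h)" if "y \<in> dual"
    by (induction n) (simp_all add: xact_commute[OF that assms])
qed

lemma stable_funpow:
  assumes "stable V" "x \<in> dual"
  shows "stable ((xact x ^^ n) ` V)" "(xact x ^^ n) ` V \<subseteq> V"
proof (induction n)
  case (Suc n)
  have "(xact x ^^ Suc n) ` V = xact x ` ((xact x ^^ n) ` V)" by (auto simp: image_image)
  then show "stable ((xact x ^^ Suc n) ` V)" "(xact x ^^ Suc n) ` V \<subseteq> V"
    using stable_image[OF Suc(1) assms(2)] Suc(2) by auto
qed (use assms in auto)

definition cyclic :: "'h \<Rightarrow> 'h set"
  where "cyclic h = {xact x h |x. x \<in> dual}"

lemma stable_cyclic: "stable (cyclic h)"
  unfolding stable_def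
proof (intro conjI ballI subspaceI)
  have "(\<lambda>h. 0) \<in> dual" by (simp add: dualI)
  moreover have "xact (\<lambda>h. 0) h = 0" using xact_lincomb[of 0 "\<lambda>h. 0" 0 "\<lambda>h. 0" h] by simp
  ultimately show "0 \<in> cyclic h" unfolding cyclic_def by force
next
  fix u v assume "u \<in> cyclic h" "v \<in> cyclic h"
  then obtain x y where "x \<in> dual" "u = xact x h" "y \<in> dual" "v = xact y h" by (auto simp: cyclic_def)
  then show "u + v \<in> cyclic h"
    unfolding cyclic_def using xact_lincomb[of 1 x 1 y h] dual_lincomb[of x y 1 1] by force
next
  fix u c assume "u \<in> cyclic h"
  then obtain x where "x \<in> dual" "u = xact x h" by (auto simp: cyclic_def)
  then show "scale c u \<in> cyclic h"
    unfolding cyclic_def using xact_lincomb[of c x 0 x h] dual_lincomb[of x x c 0] by force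
next
  fix y v assume "y \<in> dual" "v \<in> cyclic h"
  then show "xact y v \<in> cyclic h"
    unfolding cyclic_def by (auto simp: xact_mult[symmetric] intro: dual_mult_closed)
qed

lemma self_in_cyclic: "h \<in> cyclic h"
  unfolding cyclic_def using xact_counit[of h, symmetric] counit_in_dual by blast

lemma cyclic_finite: obtains A where "finite A" "cyclic h \<subseteq> span A"
proof
  let ?A = "(\<lambda>hs. hs ! 0) ` keys (rep (\<Delta> h))"
  show "finite ?A" by simp
  show "cyclic h \<subseteq> span ?A"
  proof
    fix w assume "w \<in> cyclic h"
    then obtain x where w: "w = xact x h" by (auto simp: cyclic_def)
    show "w \<in> span ?A" unfolding w xact_def swd_def
      by (rule lin_ext_in_subspace[OF subspace_span]) (intro span_scale span_base imageI)
  qed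
qed

lemma cyclic_subset: "stable V \<Longrightarrow> h \<in> V \<Longrightarrow> cyclic h \<subseteq> V"
  by (auto simp: cyclic_def stable_def)

lemma subspace_component_Union: "subspace (\<Union>n. component g n)"
  by (rule subspace_Union_chain[of "component g", OF subspace_component component_Suc])

text \<open>If the image of \<open>V\<close> were all of \<open>V\<close>, so would be the image under each power.\<close>

lemma nilpotent_image_proper:
  assumes "\<forall>v\<in>V. (xact x ^^ n) v = 0" "0 \<in> V" "V \<noteq> {0}" shows "xact x ` V \<noteq> V"
proof
  assume eq: "xact x ` V = V"
  have "(xact x ^^ m) ` V = V" for m
  proof (induction m)
    case (Suc m)
    have "(xact x ^^ Suc m) ` V = xact x ` ((xact x ^^ m) ` V)" by (simp only: funpow.simps image_comp)
    then show ?case using Suc eq by simp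
  qed simp
  from this[of n] show False using assms by auto
qed

text \<open>Here \<open>V\<close> is a finite-dimensional module over a commutative algebra whose augmentation ideal acts
  by nilpotent operators. For \<open>x\<close> vanishing at \<open>g\<close> the image \<open>x V\<close> is a proper submodule, so induction on
  the dimension places all of them in a single step \<open>n\<close> of the component, and \<open>V\<close> in the next one.\<close>

lemma nilpotent_in_component:
  assumes "stable V" "finite A" "V \<subseteq> span A"
    and "\<And>x. x \<in> dual \<Longrightarrow> x g = 0 \<Longrightarrow> \<exists>n. \<forall>v\<in>V. (xact x ^^ n) v = 0"
  shows "V \<subseteq> (\<Union>n. component g n)"
  using assms
proof (induction "dim V" arbitrary: V rule: less_induct)
  case less
  have sub: "subspace V" using less(2) by (simp add: stable_def)
  show ?case
  proof (cases "V = {0}")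
    case True
    then show ?thesis using subspace_0[OF subspace_component_Union] by auto
  next
    case False
    have img: "xact x ` V \<subseteq> (\<Union>n. component g n)" if x: "x \<in> dual" "x g = 0" for x
    proof -
      note st = stable_image[OF less(2) x(1)]
      have "xact x ` V \<noteq> V"
        using less(5)[OF x] nilpotent_image_proper[OF _ subspace_0[OF sub] False] by blast
      then have "xact x ` V \<subset> V" using st by auto
      then have "dim (xact x ` V) < dim V"
        using st sub less(3,4) by (intro dim_psubset_less) (auto simp: stable_def)
      then show ?thesis
      proof (rule less(1)[OF _ st(1) less(3)])
        show "xact x ` V \<subseteq> span A" using st(2) less(4) by blast
        fix y assume y: "y \<in> dual" "y g = 0"
        show "\<exists>n. \<forall>v\<in>xact x ` V. (xact y ^^ n) v = 0" using less(5)[OF y] st(2) by blast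
      qed
    qed
    let ?U = "V \<inter> (\<Union>n. component g n)"
    have "subspace ?U" by (rule subspace_inter[OF sub subspace_component_Union])
    moreover have "?U \<subseteq> span A" using less(4) by blast
    ultimately obtain B where B: "finite B" "span B = ?U" "B \<subseteq> ?U"
      using finite_basis_of_subspace less(3) by metis
    obtain n where n: "span B \<subseteq> component g n"
      using finite_span_in_chain[of "component g", OF subspace_component component_Suc B(1)] B(3) by blast
    have "V \<subseteq> component g (Suc n)"
    proof
      fix v assume v: "v \<in> V"
      have "xact x v \<in> component g n" if x: "x \<in> dual" "x g = 0" for x
      proof -
        have "xact x v \<in> ?U" using img[OF x] less(2) v x(1) by (auto simp: stable_def)
        then show ?thesis using n B(2) by blast
      qed
      then show "v \<in> component g (Suc n)" by simp
    qed
    then show ?thesis by blast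
  qed
qed


definition poly_act :: "('h \<Rightarrow> 'k) \<Rightarrow> 'k poly \<Rightarrow> 'h \<Rightarrow> 'h"
  where "poly_act x p h = (\<Sum>i\<le>degree p. scale (coeff p i) ((xact x ^^ i) h))"

lemma poly_act_superset:
  "degree p < n \<Longrightarrow> poly_act x p h = (\<Sum>i<n. scale (coeff p i) ((xact x ^^ i) h))"
  unfolding poly_act_def by (rule sum.mono_neutral_left) (auto simp: coeff_eq_0)

lemma poly_act_add: "poly_act x (p + q) h = poly_act x p h + poly_act x q h"
proof -
  let ?n = "Suc (max (degree p) (degree q))"
  have "degree (p + q) < ?n" using degree_add_le_max[of p q] by simp
  then show ?thesis
    by (simp add: poly_act_superset[where n = ?n] scale_left_distrib sum.distrib)
qed

lemma poly_act_smult: "poly_act x (smult c p) h = scale c (poly_act x p h)"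
  by (simp add: poly_act_superset[where n = "Suc (degree p)"] scale_sum_right order.strict_trans1[OF degree_smult_le]
      del: sum.lessThan_Suc)

lemma poly_act_pCons_0: assumes "x \<in> dual" shows "poly_act x (pCons 0 p) h = xact x (poly_act x p h)"
proof -
  let ?n = "Suc (degree p)"
  have "degree (pCons 0 p) < Suc ?n" by (simp add: le_imp_less_Suc degree_pCons_le)
  then have "poly_act x (pCons 0 p) h = (\<Sum>i<?n. scale (coeff p i) ((xact x ^^ Suc i) h))"
    by (simp only: poly_act_superset sum.lessThan_Suc_shift coeff_pCons_0 coeff_pCons_Suc) simp
  also have "\<dots> = xact x (\<Sum>i<?n. scale (coeff p i) ((xact x ^^ i) h))"
    by (simp only: lin_sum[OF linear_xact[OF assms]] xact_scale[OF assms]) simp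
  finally show ?thesis by (simp only: poly_act_superset[of p ?n] lessI)
qed

lemma poly_act_linear_factor:
  assumes "x \<in> dual"
  shows "poly_act x ([:- a, 1:] * q) h = xact (\<lambda>h. 1 * x h + (- a) * \<epsilon> h) (poly_act x q h)"
proof -
  have "[:- a, 1:] * q = pCons 0 q + smult (- a) q" by simp
  then show ?thesis
    unfolding xact_lincomb
    by (simp only: poly_act_add poly_act_smult poly_act_pCons_0[OF assms] xact_counit scale_one)
qed

lemma poly_act_commute:
  "x \<in> dual \<Longrightarrow> y \<in> dual \<Longrightarrow> xact y (poly_act x p h) = poly_act x p (xact y h)"
  unfolding poly_act_def by (simp add: lin_sum[OF linear_xact] xact_scale xact_funpow)

text \<open>The spans of the first \<open>k\<close> iterates of \<open>v\<close> form an increasing chain of bounded dimension, so some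
  iterate is a combination of the earlier ones.\<close>

lemma annihilating_polynomial:
  assumes "x \<in> dual" "finite A" "\<And>n. (xact x ^^ n) v \<in> span A"
  obtains p where "p \<noteq> 0" "poly_act x p v = 0"
proof -
  define U where "U k = {poly_act x q v |q. \<forall>i\<ge>k. coeff q i = 0}" for k
  have sub: "subspace (U k)" for k
  proof (rule subspaceI)
    show "0 \<in> U k" unfolding U_def by (rule CollectI, rule exI[of _ 0]) (simp add: poly_act_def)
    fix a b assume "a \<in> U k" "b \<in> U k"
    then obtain p q where "a = poly_act x p v" "b = poly_act x q v" "\<forall>i\<ge>k. coeff p i = 0" "\<forall>i\<ge>k. coeff q i = 0"
      by (auto simp: U_def)
    then show "a + b \<in> U k" unfolding U_def by (intro CollectI exI[of _ "p + q"]) (simp add: poly_act_add)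
  next
    fix a c assume "a \<in> U k"
    then obtain p where "a = poly_act x p v" "\<forall>i\<ge>k. coeff p i = 0"
      by (auto simp: U_def)
    then show "scale c a \<in> U k" unfolding U_def by (intro CollectI exI[of _ "smult c p"]) (simp add: poly_act_smult)
  qed
  have fin: "U k \<subseteq> span A" for k
    unfolding U_def poly_act_def using assms(3) by (auto intro!: span_sum span_scale)
  have mono: "U k \<subseteq> U (Suc k)" for k unfolding U_def by (auto intro: Suc_leD)
  have "\<exists>k. U k = U (Suc k)"
  proof (rule ccontr)
    assume "\<nexists>k. U k = U (Suc k)"
    then have less: "dim (U k) < dim (U (Suc k))" for k
      using mono by (intro dim_psubset_less[OF sub sub _ fin assms(2)]) auto
    have "k \<le> dim (U k)" for k
      by (induction k) (use less in \<open>auto intro: order.strict_trans1 simp: Suc_le_eq\<close>)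
    then show False
      using dim_le_finite[OF sub fin assms(2), of "Suc (card A)"] by (meson not_less_eq_eq order_trans)
  qed
  then obtain k where k: "U k = U (Suc k)" ..
  have "(xact x ^^ k) v = poly_act x (monom 1 k) v"
    by (simp add: poly_act_superset[where n = "Suc k"] degree_monom_eq if_distrib sum.If_cases
        scale_one cong: if_cong)
  also have "\<dots> \<in> U (Suc k)" unfolding U_def by (rule CollectI, rule exI[of _ "monom 1 k"]) (auto simp: coeff_monom)
  finally have "(xact x ^^ k) v \<in> U k" using k by simp
  then obtain q where q: "(xact x ^^ k) v = poly_act x q v" "\<forall>i\<ge>k. coeff q i = 0"
    unfolding U_def by blast
  let ?p = "monom 1 k + smult (-1) q"
  show thesis
  proof (rule that[of ?p])
    have "coeff ?p k = 1" using q(2) by simp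
    then show "?p \<noteq> 0" by force
    have "poly_act x (monom 1 k) v = poly_act x q v" using q(1) \<open>(xact x ^^ k) v = poly_act x (monom 1 k) v\<close> by simp
    then show "poly_act x ?p v = 0" unfolding poly_act_add poly_act_smult by simp
  qed
qed

text \<open>Fitting's decomposition: once the chain of images of the powers of \<open>x\<close> has become stationary,
  \<open>V\<close> is the sum of the kernel and the image of a power of \<open>x\<close>.\<close>

lemma fitting_sum:
  assumes V: "stable V" "finite A" "V \<subseteq> span A" and x: "x \<in> dual"
  obtains n where "n > 0" "\<And>v. v \<in> V \<Longrightarrow> \<exists>w\<in>V. (xact x ^^ n) (v - (xact x ^^ n) w) = 0"
proof -
  let ?I = "\<lambda>n. (xact x ^^ n) ` V"
  note st = stable_funpow[OF V(1) x]
  obtain m where m: "\<And>k. dim (?I m) \<le> dim (?I k)"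
    using ex_has_least_nat[of "\<lambda>_. True" 0 "\<lambda>k. dim (?I k)"] by blast
  \<comment> \<open>The image of least dimension is mapped onto itself.\<close>
  have SI: "?I (m + k) = (xact x ^^ k) ` ?I m" for k
    by (subst add.commute) (simp add: funpow_add image_comp)
  have eq: "?I (m + k) = ?I m" for k
  proof (rule ccontr)
    assume "?I (m + k) \<noteq> ?I m"
    moreover have "?I (m + k) \<subseteq> ?I m"
      unfolding SI by (rule stable_funpow[OF st(1) x])
    ultimately have "?I (m + k) \<subset> ?I m" by blast
    moreover have "subspace (?I i)" for i using st(1)[of i] by (simp add: stable_def)
    moreover have "?I m \<subseteq> span A" using st(2)[of m] V(3) by blast
    ultimately have "dim (?I (m + k)) < dim (?I m)"
      by (intro dim_psubset_less[OF _ _ _ _ V(2)])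
    then show False using m[of "m + k"] by simp
  qed
  show thesis
  proof (rule that[of "Suc m"])
    fix v assume v: "v \<in> V"
    have "(xact x ^^ Suc m) v \<in> ?I m" using eq[of 1] v by auto
    also have "?I m = ?I (Suc m + Suc m)" using eq[of "Suc (Suc m)"] by (simp add: add.commute)
    finally obtain w where w: "w \<in> V" "(xact x ^^ Suc m) v = (xact x ^^ (Suc m + Suc m)) w" by blast
    have "(xact x ^^ Suc m) (v - (xact x ^^ Suc m) w)
      = (xact x ^^ Suc m) v - (xact x ^^ Suc m) ((xact x ^^ Suc m) w)"
      using xact_funpow(1)[OF x, of "Suc m"] lin_diff[of scale scale "xact x ^^ Suc m"]
      by (simp only: linear_iff_homog[OF vector_space_scale])
    also have "\<dots> = 0" using w(2) by (simp only: funpow_add o_apply) simp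
    finally show "\<exists>w\<in>V. (xact x ^^ Suc m) (v - (xact x ^^ Suc m) w) = 0" using w(1) by blast
  qed simp
qed

lemma stable_kernel: assumes "stable V" "x \<in> dual" shows "stable {v\<in>V. (xact x ^^ n) v = 0}"
  using assms xact_funpow(1)[OF assms(2), of n] xact_funpow(2)[OF assms(2), of _ n, symmetric]
  by (auto simp: stable_def homog_def subspace_def xact_zero dest: spec[of _ 0])

text \<open>In the expansion of \<open>\<Delta> g\<close> the coefficient of each basis vector is a multiple of \<open>g\<close>.\<close>

lemma grouplike_of_eigenvector:
  assumes "\<And>x. x \<in> dual \<Longrightarrow> xact x g = scale (x g) g" "\<epsilon> g = 1"
  shows "g \<in> grouplike"
proof -
  obtain C where C: "independent C" "span C = UNIV"
    using independent_extend_basis[OF independent_empty] span_extend_basis[OF independent_empty] by blast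
  let ?c = "\<lambda>b v. representation C v b"
  have u: "xact (?c b) g = scale (?c b g) g" for b
    by (rule assms(1)[OF dual_basis_functional[OF C]])
  obtain F where F: "\<Delta> g = (\<Sum>b\<in>F. gen [xact (?c b) g, b]) +o tpow_rel scale 2"
    "(\<Sum>b\<in>F. scale (\<epsilon> (xact (?c b) g)) b) = g"
    by (rule comult_expansion[OF C, of g]) blast
  have g: "(\<Sum>b\<in>F. scale (?c b g) b) = g"
    using F(2) by (simp add: u counit_scale assms(2))
  have "\<Delta> g = gen [g, g] +o tpow_rel scale 2"
    unfolding F(1)
  proof (rule tpow_two_eqI)
    fix l :: "('h list \<Rightarrow>\<^sub>0 'k) \<Rightarrow> 'k"
    assume l: "Vector_Spaces.linear fscale (*) l" and bl: "bilin (*) (\<lambda>u v. l (gen [u, v]))"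
    have lr: "Vector_Spaces.linear scale (*) (\<lambda>v. l (gen [g, v]))"
      using bl by (simp add: linear_iff_homog[OF vector_space_field] bilin_def)
    have "l (\<Sum>b\<in>F. gen [xact (?c b) g, b]) = (\<Sum>b\<in>F. ?c b g * l (gen [g, b]))"
      by (simp add: lin_sum[OF l] u bilinD[OF bl])
    also have "\<dots> = l (gen [g, \<Sum>b\<in>F. scale (?c b g) b])"
      using lin_sum[OF lr, of "\<lambda>b. scale (?c b g) b" F] by (simp add: bilinD[OF bl])
    finally show "l (\<Sum>b\<in>F. gen [xact (?c b) g, b]) = l (gen [g, g])" by (simp add: g)
  qed
  then show ?thesis using assms(2) by (simp add: grouplike_def)
qed

definition component_sum :: "'h set"
  where "component_sum = span (\<Union>g\<in>grouplike. \<Union>n. component g n)"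

lemma component_sum_subset_filt: "component_sum \<subseteq> (\<Union>n. filt n)"
  unfolding component_sum_def
proof (rule span_minimal[OF _ subspace_Union_chain[of filt, OF subspace_filt filt_Suc]])
  show "(\<Union>g\<in>grouplike. \<Union>n. component g n) \<subseteq> (\<Union>n. filt n)"
  proof (intro UN_least)
    fix g n assume "g \<in> grouplike"
    then have "component g n \<subseteq> filt n"
      using component_Suc component_subset_filt by (meson order_trans)
    then show "component g n \<subseteq> (\<Union>n. filt n)" by blast
  qed
qed

end


locale closed_field_hopf_algebra = cocommutative_hopf_algebra scale \<Delta> \<epsilon> S
  for scale :: "'k::alg_closed_field \<Rightarrow> 'h::ring_1 \<Rightarrow> 'h" and \<Delta> \<epsilon> S
begin

text \<open>An annihilating polynomial of the generator \<open>v\<close> splits into linear factors and annihilates the whole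
  cyclic module, so not all of its factors can act surjectively.\<close>

lemma exists_eigenvalue:
  assumes "x \<in> dual" "v \<noteq> 0"
  obtains a where "xact (\<lambda>h. 1 * x h + (- a) * \<epsilon> h) ` cyclic v \<noteq> cyclic v"
proof (rule ccontr)
  note st = stable_cyclic[of v]
  assume "\<not> thesis"
  then have surj: "xact (\<lambda>h. 1 * x h + (- a) * \<epsilon> h) ` cyclic v = cyclic v" for a using that by blast
  obtain A where A: "finite A" "cyclic v \<subseteq> span A" by (rule cyclic_finite)
  have "(xact x ^^ n) v \<in> span A" for n
    using stable_funpow(2)[OF st assms(1), of n] self_in_cyclic[of v] A(2) by blast
  then obtain p where p: "p \<noteq> 0" "poly_act x p v = 0"
    using annihilating_polynomial[OF assms(1) A(1)] by metis
  obtain R where R: "p = smult (lead_coeff p) (\<Prod>a\<in>#R. [:-a, 1:])"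
    using alg_closed_imp_factorization[OF p(1)] by metis
  have "(\<lambda>w. poly_act x (\<Prod>a\<in>#R. [:-a, 1:]) w) ` cyclic v = cyclic v"
  proof (induction R)
    case empty
    show ?case by (simp add: poly_act_def)
  next
    case (add a R)
    have "(\<lambda>w. poly_act x (\<Prod>a\<in>#add_mset a R. [:-a, 1:]) w) ` cyclic v
      = xact (\<lambda>h. 1 * x h + (- a) * \<epsilon> h) ` (\<lambda>w. poly_act x (\<Prod>a\<in>#R. [:-a, 1:]) w) ` cyclic v"
      unfolding image_image image_mset_add_mset prod_mset.add_mset by (simp only: poly_act_linear_factor[OF assms(1)])
    then show ?case unfolding add surj .
  qed
  then have "v \<in> (\<lambda>w. poly_act x (\<Prod>a\<in>#R. [:-a, 1:]) w) ` cyclic v" using self_in_cyclic[of v] by simp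
  then obtain w where w: "w \<in> cyclic v" "v = poly_act x (\<Prod>a\<in>#R. [:-a, 1:]) w" by (rule imageE)
  obtain y where y: "y \<in> dual" "w = xact y v" using w(1) by (auto simp: cyclic_def)
  have "poly_act x p w = poly_act x (smult (lead_coeff p) (\<Prod>a\<in>#R. [:-a, 1:])) w"
    by (rule arg_cong[OF R])
  then have "scale (lead_coeff p) v = poly_act x p w"
    unfolding poly_act_smult w(2)[symmetric] by (rule sym)
  also have "\<dots> = xact y (poly_act x p v)" unfolding y(2) by (simp add: poly_act_commute assms(1) y(1))
  also have "\<dots> = 0" using p(2) y(1) by (simp add: xact_zero)
  finally show False using p(1) assms(2) by simp
qed

text \<open>Induction on the dimension. An element \<open>v\<close> of \<open>V\<close> outside the sum generates \<open>V\<close>, because all smaller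
  submodules lie in the sum. Then each functional has only one eigenvalue on \<open>V\<close>, these eigenvalues
  are the values at a group-like element \<open>g\<close>, and \<open>nilpotent_in_component\<close> places \<open>V\<close> in the
  component of \<open>g\<close> after all.\<close>

lemma finite_stable_subset_component_sum:
  assumes "stable V" "finite A" "V \<subseteq> span A"
  shows "V \<subseteq> component_sum"
  using assms
proof (induction "dim V" arbitrary: V rule: less_induct)
  case less
  note IH = less(1) and V = less(2-4)
  have smaller: "U \<subseteq> component_sum" if "stable U" "U \<subset> V" for U
    using IH[of U] that V dim_psubset_less[of U V A] by (force simp: stable_def)
  show ?case
  proof (rule ccontr)
    assume "\<not> V \<subseteq> component_sum"
    then obtain v where v: "v \<in> V" "v \<notin> component_sum" by blast
    have Vc: "V = cyclic v"
      using smaller[OF stable_cyclic] cyclic_subset[OF V(1) v(1)] self_in_cyclic v(2) by blast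
    have v0: "v \<noteq> 0" using v(2) span_zero unfolding component_sum_def by metis
    have subE: "subspace component_sum" by (simp add: component_sum_def)
    \<comment> \<open>Every functional acts with a single eigenvalue, since otherwise Fitting's decomposition would
      write \<open>V\<close> as a sum of smaller submodules.\<close>
    have eig: "\<exists>a n. \<forall>w\<in>V. (xact (\<lambda>h. 1 * x h + (- a) * \<epsilon> h) ^^ n) w = 0" if x: "x \<in> dual" for x
    proof -
      obtain a where a: "xact (\<lambda>h. 1 * x h + (- a) * \<epsilon> h) ` V \<noteq> V"
        using exists_eigenvalue[OF x v0] Vc by metis
      define y where "y = (\<lambda>h. 1 * x h + (- a) * \<epsilon> h)"
      have y: "y \<in> dual" unfolding y_def by (rule dual_lincomb[OF x counit_in_dual])
      have "xact y ` V \<subset> V" using a stable_image(2)[OF V(1) y] by (auto simp: y_def)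
      then have img: "xact y ` V \<subseteq> component_sum" using smaller stable_image(1)[OF V(1) y] by blast
      obtain n where n: "n > 0" "\<And>v. v \<in> V \<Longrightarrow> \<exists>w\<in>V. (xact y ^^ n) (v - (xact y ^^ n) w) = 0"
        using fitting_sum[OF V y] by blast
      let ?K = "{v\<in>V. (xact y ^^ n) v = 0}"
      have "?K = V"
      proof (rule ccontr)
        assume "?K \<noteq> V"
        then have K: "?K \<subseteq> component_sum" by (intro smaller stable_kernel V y) auto
        obtain w where w: "w \<in> V" "(xact y ^^ n) (v - (xact y ^^ n) w) = 0" using n(2) v(1) by blast
        have "(xact y ^^ n) w \<in> V" using stable_funpow(2)[OF V(1) y] w(1) by blast
        then have "v - (xact y ^^ n) w \<in> ?K"
          using w v(1) V(1) by (auto simp: stable_def intro: subspace_diff)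
        moreover have "(xact y ^^ n) w \<in> component_sum"
        proof -
          obtain m where "n = Suc m" using n(1) gr0_implies_Suc by blast
          moreover have "(xact y ^^ m) w \<in> V" using stable_funpow(2)[OF V(1) y] w(1) by blast
          ultimately show ?thesis using img by auto
        qed
        ultimately show False
          using K v(2) subspace_add[OF subE, of "v - (xact y ^^ n) w" "(xact y ^^ n) w"] by auto
      qed
      then show ?thesis unfolding y_def by blast
    qed
    \<comment> \<open>On a minimal nonzero submodule the functionals then act by scalars.\<close>
    have "\<exists>W. (stable W \<and> W \<subseteq> V \<and> W \<noteq> {0}) \<and> (\<forall>U. stable U \<and> U \<subseteq> V \<and> U \<noteq> {0} \<longrightarrow> dim W \<le> dim U)"
      using ex_has_least_nat[of "\<lambda>W. stable W \<and> W \<subseteq> V \<and> W \<noteq> {0}" V dim] V(1) v(1) v0 by blast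
    then obtain W where W: "stable W" "W \<subseteq> V" "W \<noteq> {0}"
      and min: "\<And>U. stable U \<Longrightarrow> U \<subseteq> V \<Longrightarrow> U \<noteq> {0} \<Longrightarrow> dim W \<le> dim U" by blast
    have subW: "subspace W" using W(1) by (simp add: stable_def)
    obtain w where w: "w \<in> W" "w \<noteq> 0" using W(3) subspace_0[OF subW] by blast
    have scalar: "\<exists>n. xact x w = scale a w \<and> (\<forall>u\<in>V. (xact (\<lambda>h. 1 * x h + (- a) * \<epsilon> h) ^^ n) u = 0)"
      if x: "x \<in> dual" and a: "\<forall>u\<in>V. (xact (\<lambda>h. 1 * x h + (- a) * \<epsilon> h) ^^ n) u = 0" for x a n
    proof -
      define y where "y = (\<lambda>h. 1 * x h + (- a) * \<epsilon> h)"
      have y: "y \<in> dual" unfolding y_def by (rule dual_lincomb[OF x counit_in_dual])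
      note st = stable_image[OF W(1) y]
      have "xact y ` W \<noteq> W"
        by (rule nilpotent_image_proper[where n = n])
          (use a W subspace_0[OF subW] in \<open>auto simp: y_def\<close>)
      then have "dim (xact y ` W) < dim W"
        using st subW W(2) V by (intro dim_psubset_less[of _ _ A]) (auto simp: stable_def)
      then have "xact y ` W = {0}" using min[of "xact y ` W"] st W(2) by fastforce
      then have "xact y w = 0" using w(1) by blast
      then have "xact x w = scale a w" unfolding y_def xact_lincomb by (simp add: xact_counit)
      then show ?thesis using a by blast
    qed
    have "\<exists>a n. xact x w = scale a w \<and> (\<forall>u\<in>V. (xact (\<lambda>h. 1 * x h + (- a) * \<epsilon> h) ^^ n) u = 0)"
      if "x \<in> dual" for x
      using eig[OF that] scalar[OF that] by blast
    then obtain ev nn where ev: "\<And>x. x \<in> dual \<Longrightarrow> xact x w = scale (ev x) w"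
      "\<And>x u. x \<in> dual \<Longrightarrow> u \<in> V \<Longrightarrow> (xact (\<lambda>h. 1 * x h + (- ev x) * \<epsilon> h) ^^ nn x) u = 0"
      by metis
    have val: "x w = ev x * \<epsilon> w" if "x \<in> dual" for x
      using counit_xact[OF that, of w] ev(1)[OF that] by (simp add: counit_scale)
    have ew: "\<epsilon> w \<noteq> 0" using separated[of w] val w(2) by auto
    define g where "g = scale (1 / \<epsilon> w) w"
    have xg: "x g = ev x" if "x \<in> dual" for x
      using ew val[OF that] that by (simp add: g_def dual_scale)
    have "xact x g = scale (x g) g" if "x \<in> dual" for x
      using ev(1)[OF that] xg[OF that] that by (simp add: g_def xact_scale mult.commute)
    then have g: "g \<in> grouplike"
      by (rule grouplike_of_eigenvector) (use ew in \<open>simp_all add: g_def counit_scale\<close>)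
    have "V \<subseteq> (\<Union>n. component g n)"
    proof (rule nilpotent_in_component[OF V])
      fix x assume "x \<in> dual" "x g = 0"
      then show "\<exists>n. \<forall>u\<in>V. (xact x ^^ n) u = 0" using ev(2)[of x] xg[of x] by auto
    qed
    also have "\<dots> \<subseteq> component_sum" unfolding component_sum_def using g by (blast intro: span_base)
    finally show False using v by blast
  qed
qed

theorem filt_exhaustive: "\<exists>n. h \<in> filt n"
proof -
  obtain A where "finite A" "cyclic h \<subseteq> span A" by (rule cyclic_finite)
  then have "cyclic h \<subseteq> component_sum" using stable_cyclic by (rule finite_stable_subset_component_sum[rotated])
  then show ?thesis using self_in_cyclic component_sum_subset_filt by blast
qed

end


section \<open>Continuity of multilinear maps on the dual algebra\<close>

text \<open>The map \<open>p\<close> replaces an argument by its expansion in the vectors \<open>e b\<close> with coefficients \<open>w\<close>. The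
  expansion is needed both for vectors of \<open>H\<close> in a basis and for the projections of functionals, where
  \<open>p\<close> is not the identity; the set \<open>C\<close> contains the arguments that occur on the way.\<close>

lemma (in vector_space) multilinear_expansion:
  assumes "\<And>us vs a. a \<in> A \<Longrightarrow> set us \<subseteq> C \<Longrightarrow> set vs \<subseteq> C \<Longrightarrow> length us + length vs + 1 = n \<Longrightarrow>
      f (us @ p a # vs) = (\<Sum>b\<in>B. scale (w a b) (f (us @ e b # vs)))"
    and "p ` A \<subseteq> C" "e ` B \<subseteq> C" "finite B" "length as = n" "set as \<subseteq> A"
  shows "f (map p as) = (\<Sum>cs\<in>{cs. set cs \<subseteq> B \<and> length cs = n}. scale (prod_list (map2 w as cs)) (f (map e cs)))"
  using assms(1,5,6)
proof (induction n arbitrary: f as)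
  case 0
  have "{cs. set cs \<subseteq> B \<and> length cs = 0} = {[]}" by auto
  then show ?case using 0 by simp
next
  case (Suc n)
  obtain a as' where as: "as = a # as'" "length as' = n" using Suc.prems(2) by (cases as) auto
  let ?L = "{cs. set cs \<subseteq> B \<and> length cs = n}"
  have IH: "f (e b # map p as') = (\<Sum>cs\<in>?L. scale (prod_list (map2 w as' cs)) (f (e b # map e cs)))"
    if "b \<in> B" for b
  proof (rule Suc.IH)
    fix us vs a assume "a \<in> A" "set us \<subseteq> C" "set vs \<subseteq> C" "length us + length vs + 1 = n"
    then show "f (e b # (us @ p a # vs)) = (\<Sum>c\<in>B. scale (w a c) (f (e b # (us @ e c # vs))))"
      using Suc.prems(1)[of a "e b # us" vs] that assms(3) by auto
  qed (use as Suc.prems in auto)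
  have "f (map p as) = (\<Sum>b\<in>B. scale (w a b) (f (e b # map p as')))"
    using Suc.prems(1)[of a "[]" "map p as'"] Suc.prems(3) as assms(2) by (auto simp: image_subset_iff subset_iff)
  also have "\<dots> = (\<Sum>b\<in>B. \<Sum>cs\<in>?L. scale (prod_list (map2 w as (b # cs))) (f (map e (b # cs))))"
    by (intro sum.cong) (simp_all add: IH as scale_sum_right)
  also have "\<dots> = (\<Sum>(b, cs)\<in>B \<times> ?L. scale (prod_list (map2 w as (b # cs))) (f (map e (b # cs))))"
    by (rule sum.cartesian_product)
  also have "\<dots> = (\<Sum>cs\<in>{cs. set cs \<subseteq> B \<and> length cs = Suc n}. scale (prod_list (map2 w as cs)) (f (map e cs)))"
  proof (rule sum.reindex_bij_witness[of _ "\<lambda>cs. (hd cs, tl cs)" "\<lambda>(b, cs). b # cs"])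
    fix cs assume "cs \<in> {cs. set cs \<subseteq> B \<and> length cs = Suc n}"
    then show "(\<lambda>(b, cs). b # cs) (hd cs, tl cs) = cs" "(hd cs, tl cs) \<in> B \<times> ?L"
      by (cases cs; auto)+
  qed auto
  finally show ?case .
qed

context cocommutative_hopf_algebra
begin

lemma dual_filt_antimono: "m \<le> n \<Longrightarrow> dual_filt n \<subseteq> dual_filt m"
  unfolding dual_filt_def using filt_mono by blast

lemma dual_filt_dual: "x \<in> dual_filt n \<Longrightarrow> x \<in> dual"
  by (simp add: dual_filt_def)

lemma dual_filt_zero: "(\<lambda>h. 0) \<in> dual_filt n"
  by (simp add: dual_filt_def dualI)

definition dual_linear :: "('k \<Rightarrow> 'v \<Rightarrow> 'v) \<Rightarrow> (('h \<Rightarrow> 'k) \<Rightarrow> 'v::ab_group_add) \<Rightarrow> bool"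
  where "dual_linear sc f \<longleftrightarrow>
    (\<forall>x\<in>dual. \<forall>y\<in>dual. f (\<lambda>h. x h + y h) = f x + f y) \<and> (\<forall>c. \<forall>x\<in>dual. f (\<lambda>h. c * x h) = sc c (f x))"

lemma
  assumes "vector_space sc" "dual_linear sc f"
  shows dual_linear_plus: "x \<in> dual \<Longrightarrow> y \<in> dual \<Longrightarrow> f (\<lambda>h. x h + y h) = f x + f y"
    and dual_linear_times: "x \<in> dual \<Longrightarrow> f (\<lambda>h. c * x h) = sc c (f x)"
    and dual_linear_zero: "f (\<lambda>h. 0) = 0"
    and dual_linear_minus: "x \<in> dual \<Longrightarrow> y \<in> dual \<Longrightarrow> f (\<lambda>h. x h - y h) = f x - f y"
proof -
  interpret V: vector_space sc by fact
  show p: "f (\<lambda>h. x h + y h) = f x + f y" if "x \<in> dual" "y \<in> dual" for x y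
    using that assms(2) unfolding dual_linear_def by blast
  show t: "f (\<lambda>h. c * x h) = sc c (f x)" if "x \<in> dual" for c x
    using that assms(2) unfolding dual_linear_def by blast
  show "f (\<lambda>h. 0) = 0" using t[OF counit_in_dual, of 0] by simp
  show "f (\<lambda>h. x h - y h) = f x - f y" if "x \<in> dual" "y \<in> dual"
  proof -
    have "f (\<lambda>h. (x h - y h) + y h) = f (\<lambda>h. x h - y h) + f y"
      by (rule p) (use that dual_minus in auto)
    then show ?thesis by simp
  qed
qed

lemma dual_linear_sum:
  assumes "vector_space sc" "dual_linear sc f" "\<And>i. i \<in> I \<Longrightarrow> g i \<in> dual"
  shows "f (\<lambda>h. \<Sum>i\<in>I. c i * g i h) = (\<Sum>i\<in>I. sc (c i) (f (g i)))"
  using assms(3)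
proof (induction I rule: infinite_finite_induct)
  case (insert i I)
  have "f (\<lambda>h. c i * g i h + (\<Sum>i\<in>I. c i * g i h)) = f (\<lambda>h. c i * g i h) + f (\<lambda>h. \<Sum>i\<in>I. c i * g i h)"
    using insert by (intro dual_linear_plus[OF assms(1,2)] dual_times dual_sum_closed) auto
  then show ?case using insert by (simp add: dual_linear_times[OF assms(1,2)])
qed (simp_all add: dual_linear_zero[OF assms(1,2)])

end


locale filtered_hopf_algebra = cocommutative_hopf_algebra scale \<Delta> \<epsilon> S
  for scale :: "'k::field \<Rightarrow> 'h::ring_1 \<Rightarrow> 'h" and \<Delta> \<epsilon> S +
  assumes exhaustive: "\<exists>n. h \<in> filt n"
    and finite_filt: "\<exists>B. finite B \<and> filt i \<subseteq> span B"
begin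

text \<open>Functionals dual to a basis of \<open>F\<^sup>m H\<close> determine the projection of \<open>X\<close> onto a complement of
  \<open>F\<^sub>m X\<close>.\<close>

lemma filt_dual_system:
  obtains B e where "finite B" "\<And>b. b \<in> B \<Longrightarrow> e b \<in> dual"
    "\<And>x. x \<in> dual \<Longrightarrow> (\<lambda>h. x h - (\<Sum>b\<in>B. x b * e b h)) \<in> dual_filt m"
proof -
  obtain A where A: "finite A" "filt m \<subseteq> span A" using finite_filt by blast
  obtain B where B: "finite B" "independent B" "span B = filt m"
    using finite_basis_of_subspace[OF subspace_filt A(2,1)] by metis
  define C where "C = extend_basis B"
  have C: "independent C" "span C = UNIV" "B \<subseteq> C"
    unfolding C_def using independent_extend_basis[OF B(2)] span_extend_basis[OF B(2)] extend_basis_superset[OF B(2)] by auto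
  show thesis
  proof (rule that[of B "\<lambda>b h. representation C h b"])
    show "finite B" by fact
    show "(\<lambda>h. representation C h b) \<in> dual" for b by (rule dual_basis_functional[OF C(1,2)])
    then have d: "(\<lambda>h. x h - (\<Sum>b\<in>B. x b * representation C h b)) \<in> dual" if "x \<in> dual" for x
      using that by (intro dual_minus dual_sum_closed) auto
    fix x assume x: "x \<in> dual"
    have "x h = (\<Sum>b\<in>B. x b * representation C h b)" if h: "h \<in> filt m" for h
    proof -
      have "representation C h = representation B h"
        using C B h by (intro representation_extend) auto
      moreover have "(\<Sum>b\<in>B. scale (representation B h b) b) = h"
        using B h by (intro sum_representation_eq) auto
      ultimately have "x h = x (\<Sum>b\<in>B. scale (representation C h b) b)" by simp
      then show ?thesis using x by (simp add: dual_sum dual_scale mult.commute)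
    qed
    then show "(\<lambda>h. x h - (\<Sum>b\<in>B. x b * representation C h b)) \<in> dual_filt m"
      using d[OF x] by (simp add: dual_filt_def)
  qed
qed

text \<open>A series whose terms lie deeper and deeper in the filtration of \<open>X\<close> converges, because each of its
  values is a finite sum. This is the completeness of \<open>X\<close>.\<close>

lemma dual_limit:
  assumes "\<And>j. w j \<in> dual" "\<And>j. (\<lambda>h. w (Suc j) h - w j h) \<in> dual_filt (m j)"
    and "\<And>j::nat. m j \<le> m (Suc j)" "\<And>j. j \<le> m j"
  obtains z where "z \<in> dual" "\<And>j. (\<lambda>h. z h - w j h) \<in> dual_filt (m j)"
proof -
  have mono: "m i \<le> m j" if "i \<le> j" for i j using lift_Suc_mono_le[of m, OF assms(3) that] .
  have stat: "w j h = w i h" if "i \<le> j" "h \<in> filt (m i)" for i j h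
    using that(1)
  proof (induction j rule: dec_induct)
    case (step j)
    have "h \<in> filt (m j)" using that(2) mono[OF step(1)] filt_mono by blast
    then have "w (Suc j) h - w j h = 0" using assms(2)[of j] by (simp add: dual_filt_def)
    then show ?case using step by simp
  qed simp
  define d where "d h = (SOME n. h \<in> filt n)" for h
  have d: "h \<in> filt (d h)" for h unfolding d_def using exhaustive by (rule someI_ex)
  define z where "z h = w (d h) h" for h
  have zw: "z h = w j h" if "h \<in> filt (m j)" for h j
  proof (cases "j \<le> d h")
    case True then show ?thesis using stat[of j "d h" h] that by (simp add: z_def)
  next
    case False
    have "h \<in> filt (m (d h))" using d[of h] filt_mono[OF assms(4)] by blast
    then show ?thesis using stat[of "d h" j h] False by (simp add: z_def)
  qed
  have zw': "z h = w j h" if "d h \<le> j" for h j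
    by (rule zw) (use that d[of h] filt_mono[of "d h" "m j"] assms(4)[of j] in auto)
  have "z \<in> dual"
  proof (rule dualI)
    fix a b c
    let ?N = "Max {d a, d b, d (a + b), d (scale c a)}"
    have N: "z a = w ?N a" "z b = w ?N b" "z (a + b) = w ?N (a + b)" "z (scale c a) = w ?N (scale c a)"
      by (rule zw', simp)+
    show "z (a + b) = z a + z b" "z (scale c a) = c * z a"
      unfolding N by (rule dual_add[OF assms(1)] dual_scale[OF assms(1)])+
  qed
  moreover from this have "(\<lambda>h. z h - w j h) \<in> dual_filt (m j)" for j
    using zw[of _ j] dual_minus[OF _ assms(1)] by (simp add: dual_filt_def)
  ultimately show thesis by (rule that)
qed

text \<open>A uniform boundedness principle for the linearly compact space \<open>X\<close>: if the maps \<open>f t\<close> are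
  continuous and at every point \<open>z\<close> vanish for all \<open>t\<close> far enough in the family, then some tail of the
  family vanishes identically. Otherwise choose \<open>t\<^sub>j\<close> and \<open>z\<^sub>j\<close> with \<open>f t\<^sub>j z\<^sub>j \<noteq> 0\<close>, each \<open>z\<^sub>j\<close> so deep
  that the earlier maps vanish at it. A subseries of \<open>\<Sum> z\<^sub>j\<close> then converges to a point at which
  no \<open>f t\<^sub>j\<close> vanishes.\<close>

lemma uniform_vanishing:
  fixes f :: "'t \<Rightarrow> ('h \<Rightarrow> 'k) \<Rightarrow> 'v::ab_group_add"
  assumes vs: "vector_space sc"
    and lin: "\<And>t. t \<in> T 0 \<Longrightarrow> dual_linear sc (f t)"
    and T: "\<And>i j. i \<le> j \<Longrightarrow> T j \<subseteq> T i"
    and cont: "\<And>t. t \<in> T 0 \<Longrightarrow> \<exists>m. \<forall>z\<in>dual_filt m. f t z = 0"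
    and pt: "\<And>z. z \<in> dual \<Longrightarrow> \<exists>K::nat. \<forall>t\<in>T K. f t z = 0"
  shows "\<exists>K. \<forall>t\<in>T K. \<forall>z\<in>dual. f t z = 0"
proof (rule ccontr)
  assume no: "\<not> ?thesis"
  interpret V: vector_space sc by (rule vs)
  have T0: "t \<in> T 0" if "t \<in> T j" for t j using T[of 0 j] that by blast
  \<comment> \<open>No \<open>F\<^sub>m X\<close> is annihilated by a tail, because \<open>F\<^sub>m X\<close> has finite codimension.\<close>
  have deep: "\<exists>t\<in>T K. \<exists>z\<in>dual_filt m. f t z \<noteq> 0" for K m
  proof (rule ccontr)
    assume *: "\<not> ?thesis"
    obtain B e where B: "finite B" "\<And>b. b \<in> B \<Longrightarrow> e b \<in> dual"
      "\<And>x. x \<in> dual \<Longrightarrow> (\<lambda>h. x h - (\<Sum>b\<in>B. x b * e b h)) \<in> dual_filt m"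
      by (rule filt_dual_system[of m]) blast
    have "\<forall>b\<in>B. \<exists>K. \<forall>t\<in>T K. f t (e b) = 0" using B(2) pt by blast
    then obtain k where k: "\<forall>b\<in>B. \<forall>t\<in>T (k b). f t (e b) = 0" by (rule bchoice[THEN exE])
    define K' where "K' = Max (insert K (k ` B))"
    have K': "K \<le> K'" "\<And>b. b \<in> B \<Longrightarrow> k b \<le> K'" using B(1) by (auto simp: K'_def)
    have "f t z = 0" if t: "t \<in> T K'" and z: "z \<in> dual" for t z
    proof -
      note l = lin[OF T0[OF t]]
      have "f t (\<lambda>h. z h - (\<Sum>b\<in>B. z b * e b h)) = 0"
        using * B(3)[OF z] T[OF K'(1)] t by blast
      then have "f t z = f t (\<lambda>h. \<Sum>b\<in>B. z b * e b h)"
        using dual_linear_minus[OF vs l z dual_sum_closed[of B e]] B(2) by simp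
      also have "\<dots> = (\<Sum>b\<in>B. sc (z b) (f t (e b)))"
        by (rule dual_linear_sum[OF vs l B(2)])
      also have "\<dots> = 0"
        using k T[OF K'(2)] t by (intro sum.neutral) (metis V.scale_zero_right subsetD)
      finally show ?thesis .
    qed
    then show False using no by blast
  qed
  define P where "P = (\<lambda>j s. case s of (t, z, m) \<Rightarrow> t \<in> T j \<and> z \<in> dual_filt m \<and> f t z \<noteq> 0 \<and> j \<le> m)"
  define Q where "Q = (\<lambda>(j::nat) s s'. case s of (t::'t, z::'h \<Rightarrow> 'k, m) \<Rightarrow> case s' of (t'::'t, z'::'h \<Rightarrow> 'k, m') \<Rightarrow>
    m \<le> m' \<and> (\<forall>y\<in>dual_filt m'. f t y = 0))"
  have "\<exists>s. \<forall>j. P j (s j) \<and> Q j (s j) (s (Suc j))"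
  proof (rule dependent_nat_choice)
    show "\<exists>s. P 0 s" using deep[of 0 0] unfolding P_def by force
    fix s j assume s: "P j s"
    obtain t z m where tzm: "s = (t, z, m)" by (cases s)
    have "t \<in> T 0" using s T0 tzm by (auto simp: P_def)
    then obtain m0 where m0: "\<forall>y\<in>dual_filt m0. f t y = 0" using cont by blast
    let ?m = "max (max m m0) (Suc j)"
    obtain t' z' where "t' \<in> T (Suc j)" "z' \<in> dual_filt ?m" "f t' z' \<noteq> 0" using deep by blast
    then have "P (Suc j) (t', z', ?m)" by (simp add: P_def)
    moreover have "Q j s (t', z', ?m)"
      using m0 dual_filt_antimono[of m0 ?m] unfolding Q_def tzm by fastforce
    ultimately show "\<exists>s'. P (Suc j) s' \<and> Q j s s'" by blast
  qed
  then obtain s where s: "\<And>j. P j (s j)" "\<And>j. Q j (s j) (s (Suc j))" by blast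
  define tt zz mm where "tt j = fst (s j)" and "zz j = fst (snd (s j))" and "mm j = snd (snd (s j))" for j
  have p: "tt j \<in> T j" "zz j \<in> dual_filt (mm j)" "f (tt j) (zz j) \<noteq> 0" "j \<le> mm j"
    and q: "mm j \<le> mm (Suc j)" "\<And>y. y \<in> dual_filt (mm (Suc j)) \<Longrightarrow> f (tt j) y = 0" for j
    using s(1)[of j] s(2)[of j] by (auto simp: P_def Q_def tt_def zz_def mm_def split: prod.splits)
  have zd: "zz j \<in> dual" for j using p(2) dual_filt_dual by blast
  \<comment> \<open>The partial sums of the subseries: \<open>z\<^sub>j\<close> is added exactly if \<open>f t\<^sub>j\<close> vanishes without it.\<close>
  define w where "w = rec_nat (\<lambda>h. 0) (\<lambda>j v. if f (tt j) v = 0 then (\<lambda>h. v h + zz j h) else v)"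
  have w0: "w 0 = (\<lambda>h. 0)" and wS: "w (Suc j) = (if f (tt j) (w j) = 0 then (\<lambda>h. w j h + zz j h) else w j)" for j
    by (simp_all add: w_def)
  have wd: "w j \<in> dual" for j
    by (induction j) (simp_all add: w0 wS dualI dual_plus zd)
  have step: "(\<lambda>h. w (Suc j) h - w j h) \<in> dual_filt (mm j)" for j
    using p(2)[of j] dual_filt_zero by (auto simp: wS)
  have ne: "f (tt j) (w (Suc j)) \<noteq> 0" for j
    using p(3)[of j] dual_linear_plus[OF vs lin[OF T0[OF p(1)]] wd zd, of j j j] by (auto simp: wS)
  obtain z where z: "z \<in> dual" "\<And>j. (\<lambda>h. z h - w j h) \<in> dual_filt (mm j)"
    using dual_limit[OF wd step q(1) p(4)] by blast
  have "f (tt j) z \<noteq> 0" for j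
  proof -
    have "f (tt j) (\<lambda>h. z h - w (Suc j) h) = 0" by (rule q(2)[OF z(2)])
    then show ?thesis
      using ne[of j] dual_linear_minus[OF vs lin[OF T0[OF p(1)]] z(1) wd, of j "Suc j"] by simp
  qed
  moreover obtain K where "\<forall>t\<in>T K. f t z = 0" using pt[OF z(1)] by blast
  ultimately show False using p(1)[of K] by blast
qed

definition dual_multilinear :: "('k \<Rightarrow> 'v \<Rightarrow> 'v) \<Rightarrow> nat \<Rightarrow> (('h \<Rightarrow> 'k) list \<Rightarrow> 'v::ab_group_add) \<Rightarrow> bool"
  where "dual_multilinear sc n f \<longleftrightarrow> (\<forall>us vs. length us + length vs + 1 = n \<and> set us \<subseteq> dual \<and> set vs \<subseteq> dual \<longrightarrow>
    dual_linear sc (\<lambda>x. f (us @ x # vs)) \<and> (\<exists>K. \<forall>x\<in>dual_filt K. f (us @ x # vs) = 0))"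

lemma dual_multilinear_Cons:
  "dual_multilinear sc (Suc n) f \<Longrightarrow> x \<in> dual \<Longrightarrow> dual_multilinear sc n (\<lambda>xs. f (x # xs))"
  unfolding dual_multilinear_def
proof (intro allI impI)
  fix us vs
  assume *: "\<forall>us vs. length us + length vs + 1 = Suc n \<and> set us \<subseteq> dual \<and> set vs \<subseteq> dual \<longrightarrow>
    dual_linear sc (\<lambda>x. f (us @ x # vs)) \<and> (\<exists>K. \<forall>x\<in>dual_filt K. f (us @ x # vs) = 0)"
    and "x \<in> dual" "length us + length vs + 1 = n \<and> set us \<subseteq> dual \<and> set vs \<subseteq> dual"
  then show "dual_linear sc (\<lambda>y. f (x # us @ y # vs)) \<and> (\<exists>K. \<forall>y\<in>dual_filt K. f (x # us @ y # vs) = 0)"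
    using *[rule_format, of "x # us" vs] by simp
qed

lemma dual_multilinear_expansion:
  assumes vs: "vector_space sc" and f: "dual_multilinear sc n f"
    and B: "finite B" "\<And>b. b \<in> B \<Longrightarrow> e b \<in> dual" and xs: "length xs = n" "set xs \<subseteq> dual"
  shows "f (map (\<lambda>x h. \<Sum>b\<in>B. x b * e b h) xs)
    = (\<Sum>cs\<in>{cs. set cs \<subseteq> B \<and> length cs = n}. sc (prod_list (map2 (\<lambda>x c. x c) xs cs)) (f (map e cs)))"
proof (rule vector_space.multilinear_expansion[OF vs _ _ _ B(1) xs])
  fix us vs a assume "a \<in> dual" "set us \<subseteq> dual" "set vs \<subseteq> dual" "length us + length vs + 1 = n"
  then have "dual_linear sc (\<lambda>x. f (us @ x # vs))" using f by (simp add: dual_multilinear_def)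
  then show "f (us @ (\<lambda>h. \<Sum>b\<in>B. a b * e b h) # vs) = (\<Sum>b\<in>B. sc (a b) (f (us @ e b # vs)))"
    using dual_linear_sum[OF assms(1), of _ B e a] B(2) by simp
qed (use B(2) dual_sum_closed in auto)

definition dual_cong :: "nat \<Rightarrow> ('h \<Rightarrow> 'k) list \<Rightarrow> ('h \<Rightarrow> 'k) list \<Rightarrow> bool"
  where "dual_cong K = list_all2 (\<lambda>x y. (\<lambda>h. x h - y h) \<in> dual_filt K)"

lemma dual_cong_antimono: "k \<le> K \<Longrightarrow> dual_cong K xs ys \<Longrightarrow> dual_cong k xs ys"
  unfolding dual_cong_def by (erule list_all2_mono) (use dual_filt_antimono in blast)

text \<open>Induction on the number of arguments. For each value of the first argument the remaining ones are
  jointly continuous by induction, and \<open>uniform_vanishing\<close>, applied to the family of differences over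
  congruent pairs of lists, makes this uniform in the first argument. The remaining arguments may then
  be replaced by combinations of finitely many functionals, for which continuity in the first
  argument holds with a common bound.\<close>

theorem multilinear_uniformly_continuous:
  assumes vs: "vector_space sc" and f: "dual_multilinear sc n f"
  shows "\<exists>K. \<forall>xs ys. length xs = n \<and> set xs \<subseteq> dual \<and> set ys \<subseteq> dual \<and> dual_cong K xs ys \<longrightarrow> f xs = f ys"
  using f
proof (induction n arbitrary: f)
  case 0
  then show ?case by (auto simp: dual_cong_def)
next
  case (Suc n)
  note f = Suc.prems
  interpret V: vector_space sc by (rule vs)
  define T where "T K = {(xs, ys). length xs = n \<and> set xs \<subseteq> dual \<and> set ys \<subseteq> dual \<and> dual_cong K xs ys}" for K
  have hd: "dual_linear sc (\<lambda>z. f (z # xs))" "\<exists>K. \<forall>z\<in>dual_filt K. f (z # xs) = 0"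
    if "length xs = n" "set xs \<subseteq> dual" for xs
    using f[unfolded dual_multilinear_def, rule_format, of "[]" xs] that by simp_all
  have len: "length ys = n" if "(xs, ys) \<in> T K" for xs ys K
    using that list_all2_lengthD unfolding T_def dual_cong_def by fastforce
  have "\<exists>K. \<forall>t\<in>T K. \<forall>z\<in>dual. f (z # fst t) - f (z # snd t) = 0"
  proof (rule uniform_vanishing[OF vs, where f = "\<lambda>t z. f (z # fst t) - f (z # snd t)"])
    fix t assume t: "t \<in> T 0"
    obtain xs ys where xy: "t = (xs, ys)" by (cases t)
    have *: "length xs = n" "length ys = n" "set xs \<subseteq> dual" "set ys \<subseteq> dual"
      using t len[of xs ys 0] by (auto simp: T_def xy)
    show "dual_linear sc (\<lambda>z. f (z # fst t) - f (z # snd t))"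
      using hd(1)[OF *(1,3)] hd(1)[OF *(2,4)]
      by (simp add: dual_linear_def xy V.scale_right_diff_distrib)
    obtain k where "\<forall>z\<in>dual_filt k. f (z # xs) = 0" using hd(2)[OF *(1,3)] by blast
    moreover obtain l where "\<forall>z\<in>dual_filt l. f (z # ys) = 0" using hd(2)[OF *(2,4)] by blast
    ultimately have "\<forall>z\<in>dual_filt (max k l). f (z # fst t) - f (z # snd t) = 0"
      using dual_filt_antimono[of k "max k l"] dual_filt_antimono[of l "max k l"] by (force simp: xy)
    then show "\<exists>m. \<forall>z\<in>dual_filt m. f (z # fst t) - f (z # snd t) = 0" ..
  next
    fix i j :: nat assume "i \<le> j" then show "T j \<subseteq> T i" unfolding T_def using dual_cong_antimono by blast
  next
    fix z assume "z \<in> dual"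
    then have "\<exists>K. \<forall>xs ys. length xs = n \<and> set xs \<subseteq> dual \<and> set ys \<subseteq> dual \<and> dual_cong K xs ys \<longrightarrow> f (z # xs) = f (z # ys)"
      by (intro Suc.IH dual_multilinear_Cons f)
    then show "\<exists>K. \<forall>t\<in>T K. f (z # fst t) - f (z # snd t) = 0" unfolding T_def by fastforce
  qed
  then obtain K0 where K0: "\<And>xs ys z. length xs = n \<Longrightarrow> set xs \<subseteq> dual \<Longrightarrow> set ys \<subseteq> dual \<Longrightarrow>
      dual_cong K0 xs ys \<Longrightarrow> z \<in> dual \<Longrightarrow> f (z # xs) = f (z # ys)"
    unfolding T_def by fastforce
  obtain B e where B: "finite B" "\<And>b. b \<in> B \<Longrightarrow> e b \<in> dual"
      "\<And>x. x \<in> dual \<Longrightarrow> (\<lambda>h. x h - (\<Sum>b\<in>B. x b * e b h)) \<in> dual_filt K0"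
    by (rule filt_dual_system[of K0]) blast
  let ?L = "{cs. set cs \<subseteq> B \<and> length cs = n}"
  have fin: "finite ?L" using finite_lists_length_eq[OF B(1)] by simp
  have "\<forall>cs\<in>?L. \<exists>K. \<forall>z\<in>dual_filt K. f (z # map e cs) = 0"
    using B(2) by (intro ballI hd(2)) auto
  then obtain k where k: "\<forall>cs\<in>?L. \<forall>z\<in>dual_filt (k cs). f (z # map e cs) = 0" by (rule bchoice[THEN exE])
  define K where "K = Max (insert K0 (k ` ?L))"
  have K: "K0 \<le> K" "\<And>cs. cs \<in> ?L \<Longrightarrow> k cs \<le> K" using fin by (auto simp: K_def)
  have head: "f (z # ys) = 0" if z: "z \<in> dual_filt K" and ys: "length ys = n" "set ys \<subseteq> dual" for z ys
  proof -
    let ?p = "\<lambda>x h. \<Sum>b\<in>B. x b * e b h"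
    have zd: "z \<in> dual" by (rule dual_filt_dual[OF z])
    have "f (z # ys) = f (z # map ?p ys)"
    proof (rule K0[OF ys _ _ zd])
      show "set (map ?p ys) \<subseteq> dual" using B(2) dual_sum_closed by auto
      show "dual_cong K0 ys (map ?p ys)"
        by (auto simp: dual_cong_def list_all2_conv_all_nth intro!: B(3) subsetD[OF ys(2)])
    qed
    also have "\<dots> = (\<Sum>cs\<in>?L. sc (prod_list (map2 (\<lambda>x c. x c) ys cs)) (f (z # map e cs)))"
      by (rule dual_multilinear_expansion[OF vs dual_multilinear_Cons[OF f zd] B(1,2) ys])
    also have "\<dots> = 0"
    proof (rule sum.neutral, rule ballI)
      fix cs assume cs: "cs \<in> ?L"
      have "z \<in> dual_filt (k cs)" using dual_filt_antimono[OF K(2)[OF cs]] z by blast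
      then show "sc (prod_list (map2 (\<lambda>x c. x c) ys cs)) (f (z # map e cs)) = 0" using k cs by simp
    qed
    finally show ?thesis .
  qed
  have "f xs = f ys"
    if xy: "length xs = Suc n" "set xs \<subseteq> dual" "set ys \<subseteq> dual" "dual_cong K xs ys" for xs ys
  proof -
    obtain x xs' where xs: "xs = x # xs'" "length xs' = n" using xy(1) by (cases xs) auto
    obtain y ys' where ys: "ys = y # ys'" using xy(4) xs by (cases ys) (auto simp: dual_cong_def)
    have c: "(\<lambda>h. x h - y h) \<in> dual_filt K" "dual_cong K xs' ys'" using xy(4) by (auto simp: dual_cong_def xs ys)
    have d: "x \<in> dual" "y \<in> dual" "set xs' \<subseteq> dual" "set ys' \<subseteq> dual" using xy xs ys by auto
    have len: "length ys' = n" using list_all2_lengthD[OF c(2)[unfolded dual_cong_def]] xs(2) by simp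
    have "f (x # xs') = f (x # ys')" by (rule K0) (use xs d c dual_cong_antimono[OF K(1)] in auto)
    moreover have "f (x # ys') - f (y # ys') = 0"
      using head[OF c(1) len d(4)] dual_linear_minus[OF vs hd(1)[OF len d(4)] d(1,2)] by simp
    ultimately show ?thesis using xs ys by simp
  qed
  then show ?case by blast
qed

end


section \<open>Tensor products with an \<open>H\<close>-module\<close>

lemma two_element_list: "length hs = 2 \<Longrightarrow> hs = [hs ! 0, hs ! 1]"
  by (auto simp: length_Suc_conv numeral_2_eq_2)

lemma prod_list_map2_slot:
  assumes "length us = length us'"
  shows "prod_list (map2 f (us' @ x # vs') (us @ h # vs))
    = prod_list (map2 f us' us) * (f x h * prod_list (map2 f vs' vs) :: 'a::comm_monoid_mult)"
  using assms by (simp add: zip_append)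

lemma split_at_length:
  assumes "length xs = length us + length vs + 1"
  obtains us' x vs' where "xs = us' @ x # vs'" "length us' = length us" "length vs' = length vs"
proof (rule that[of "take (length us) xs" "xs ! length us" "drop (Suc (length us)) xs"])
  show "xs = take (length us) xs @ xs ! length us # drop (Suc (length us)) xs"
    using assms by (simp add: id_take_nth_drop)
qed (use assms in auto)

abbreviation tens_supp :: "nat \<Rightarrow> ('h list \<times> 'm \<Rightarrow>\<^sub>0 'k::zero) \<Rightarrow> bool"
  where "tens_supp n p \<equiv> keys p \<subseteq> {hs. length hs = n} \<times> UNIV"

locale hopf_module = cocommutative_hopf_algebra scale \<Delta> \<epsilon> S + left_module act
  for scale :: "'k::field \<Rightarrow> 'h::ring_1 \<Rightarrow> 'h" and \<Delta> \<epsilon> S and act :: "'h \<Rightarrow> 'm::ab_group_add \<Rightarrow> 'm"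
begin

abbreviation "ks \<equiv> kscale act"

lemma act_scale: "act (scale c h) m = ks c (act h m)"
  by (simp add: kscale_def act_mult[symmetric] mult_scale_left)

lemma act_ks: "act h (ks c m) = ks c (act h m)"
  by (simp add: kscale_def act_mult[symmetric] mult_scale_left mult_scale_right)

lemma vector_space_ks: "vector_space ks"
  by unfold_locales
    (simp_all add: kscale_def act_add_right scale_left_distrib act_add_left act_mult[symmetric] mult_scale_left act_one)

sublocale K: vector_space ks by (rule vector_space_ks)

lemma homog_act: "homog ks (\<lambda>h. act h m)"
  by (simp add: homog_def act_add_left act_scale)

lemma subspace_tens_rel: "free.subspace (tens_rel act n)"
  unfolding tens_rel_def by (rule free.subspace_span)

lemma subspace_htens_rel: "free.subspace (htens_rel act n)"
  unfolding htens_rel_def by (rule free.subspace_span)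

lemma keys_tens_rel: "r \<in> tens_rel act n \<Longrightarrow> tens_supp n r"
  unfolding tens_rel_def
  by (rule keys_span_subset) (auto dest!: in_keys_diffD in_keys_fscaleD simp: keys_gen)

lemma keys_comult_iter: "keys (comult_iter n h) \<subseteq> {hs. length hs = n}"
proof (induction n arbitrary: h)
  case 0 show ?case by (auto dest!: in_keys_fscaleD simp: keys_gen)
next
  case (Suc n)
  have "keys (free_ext (\<lambda>ks. gen (h' # ks)) (comult_iter n h'')) \<subseteq> {hs. length hs = Suc n}" for h' h''
    by (rule keys_free_ext) (use Suc[of h''] in \<open>auto simp: keys_gen\<close>)
  then show ?case by (simp add: keys_free_ext)
qed

lemma keys_htens_rel: "r \<in> htens_rel act n \<Longrightarrow> tens_supp n r"
  unfolding htens_rel_def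
proof (rule keys_span_subset)
  fix r assume "r \<in> tens_rel act n \<union>
     {free_ext (\<lambda>ks. gen (map2 (*) hs ks, m)) (comult_iter n h) - gen (hs, act h m) |hs h m. length hs = n}"
  then show "tens_supp n r"
  proof
    assume "r \<in> {free_ext (\<lambda>ks. gen (map2 (*) hs ks, m)) (comult_iter n h) - gen (hs, act h m) |hs h m. length hs = n}"
    then obtain hs h m where r: "r = free_ext (\<lambda>ks. gen (map2 (*) hs ks, m)) (comult_iter n h) - gen (hs, act h m)"
      and len: "length hs = n" by blast
    have "tens_supp n (free_ext (\<lambda>ks. gen (map2 (*) hs ks, m)) (comult_iter n h))"
      by (rule keys_free_ext) (use keys_comult_iter[of n h] len in \<open>auto simp: keys_gen\<close>)
    then show ?thesis unfolding r by (intro keys_diff') (simp_all add: keys_gen len)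
  qed (rule keys_tens_rel)
qed

lemma rep_tens: "C \<in> tens act n \<Longrightarrow> rep C +o tens_rel act n = C"
  and keys_tens: "C \<in> tens act n \<Longrightarrow> tens_supp n (rep C)"
  unfolding tens_def
  by (rule rep_classes[OF subspace_tens_rel keys_tens_rel] keys_rep_classes[OF subspace_tens_rel keys_tens_rel]; assumption)+

lemma rep_htens: "C \<in> htens act n \<Longrightarrow> rep C +o htens_rel act n = C"
  and keys_htens: "C \<in> htens act n \<Longrightarrow> tens_supp n (rep C)"
  unfolding htens_def
  by (rule rep_classes[OF subspace_htens_rel keys_htens_rel] keys_rep_classes[OF subspace_htens_rel keys_htens_rel]; assumption)+

lemma free_ext_diff_in_subspace:
  assumes "free.subspace R" "\<And>g. g \<in> keys p \<Longrightarrow> f g - f' g \<in> R"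
  shows "free_ext f p - free_ext f' p \<in> R"
  unfolding free.lin_ext_fun_diff[symmetric] by (rule free.lin_ext_in_subspace[OF assms])


subsection \<open>Maps out of the tensor products\<close>

definition tens_multilinear :: "('k \<Rightarrow> 'v \<Rightarrow> 'v) \<Rightarrow> nat \<Rightarrow> ('h list \<Rightarrow> 'm \<Rightarrow> 'v::ab_group_add) \<Rightarrow> bool"
  where "tens_multilinear sc n F \<longleftrightarrow>
    (\<forall>us vs m. length us + length vs + 1 = n \<longrightarrow> homog sc (\<lambda>h. F (us @ h # vs) m)) \<and>
    (\<forall>hs m m'. length hs = n \<longrightarrow> F hs (m + m') = F hs m + F hs m') \<and>
    (\<forall>hs c m. length hs = n \<longrightarrow> F hs (ks c m) = sc c (F hs m))"

text \<open>Restriction to generators identifies the linear maps on \<open>H\<^sup>\<otimes>\<^sup>n \<otimes> M\<close> with the multilinear ones. One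
  direction is used to construct maps, the other to compare elements by means of functionals.\<close>

lemma tens_multilinear_iff_zero_on_rel:
  assumes l: "Vector_Spaces.linear fscale sc l"
  shows "(\<forall>r\<in>tens_rel act n. l r = 0) \<longleftrightarrow> tens_multilinear sc n (\<lambda>hs m. l (gen (hs, m)))"
proof
  assume r: "\<forall>r\<in>tens_rel act n. l r = 0"
  note simps = lin_diff[OF l] lin_scale[OF l]
  show "tens_multilinear sc n (\<lambda>hs m. l (gen (hs, m)))"
    unfolding tens_multilinear_def homog_def
  proof (intro conjI allI impI)
    fix us vs :: "'h list" and m x y c assume len: "length us + length vs + 1 = n"
    have "gen (us @ (x + y) # vs, m) - gen (us @ x # vs, m) - gen (us @ y # vs, m) \<in> tens_rel act n"
      unfolding tens_rel_def by (rule free.span_base) (use len in blast)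
    then show "l (gen (us @ (x + y) # vs, m)) = l (gen (us @ x # vs, m)) + l (gen (us @ y # vs, m))"
      using r by (force simp: lin_diff[OF l] diff_eq_eq)
    have "gen (us @ scale c x # vs, m) - fscale c (gen (us @ x # vs, m)) \<in> tens_rel act n"
      unfolding tens_rel_def by (rule free.span_base) (use len in blast)
    then show "l (gen (us @ scale c x # vs, m)) = sc c (l (gen (us @ x # vs, m)))"
      using r by (force simp: simps)
  next
    fix hs :: "'h list" and m m' c assume len: "length hs = n"
    have "gen (hs, m + m') - gen (hs, m) - gen (hs, m') \<in> tens_rel act n"
      unfolding tens_rel_def by (rule free.span_base) (use len in blast)
    then show "l (gen (hs, m + m')) = l (gen (hs, m)) + l (gen (hs, m'))"
      using r by (force simp: lin_diff[OF l] diff_eq_eq)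
    have "gen (hs, ks c m) - fscale c (gen (hs, m)) \<in> tens_rel act n"
      unfolding tens_rel_def by (rule free.span_base) (use len in blast)
    then show "l (gen (hs, ks c m)) = sc c (l (gen (hs, m)))"
      using r by (force simp: simps)
  qed
next
  assume m: "tens_multilinear sc n (\<lambda>hs m. l (gen (hs, m)))"
  show "\<forall>r\<in>tens_rel act n. l r = 0"
  proof
    fix r assume "r \<in> tens_rel act n"
    then show "l r = 0"
      unfolding tens_rel_def
      by (rule linear_vanishes_on_span[OF l, rotated])
        (use m in \<open>auto simp: lin_diff[OF l] lin_scale[OF l] tens_multilinear_def homog_def\<close>)
  qed
qed

lemma lin_ext_tens_rel:
  assumes "vector_space sc" "tens_multilinear sc n F" "r \<in> tens_rel act n"
  shows "lin_ext sc (\<lambda>(hs, m). F hs m) r = 0"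
  using tens_multilinear_iff_zero_on_rel[OF vector_space.linear_lin_ext[OF assms(1)], of n "\<lambda>(hs, m). F hs m"] assms
  by (simp add: vector_space.lin_ext_gen)

lemma lin_ext_tens_eq:
  assumes "vector_space sc" "tens_multilinear sc n F" "p - q \<in> tens_rel act n"
  shows "lin_ext sc (\<lambda>(hs, m). F hs m) p = lin_ext sc (\<lambda>(hs, m). F hs m) q"
  using lin_ext_tens_rel[OF assms] by (simp add: vector_space.lin_ext_diff[OF assms(1)])

lemma lin_ext_htens_rel:
  assumes "vector_space sc" "tens_multilinear sc n F"
    and "\<And>hs h m. length hs = n \<Longrightarrow> lin_ext sc (\<lambda>ks. F (map2 (*) hs ks) m) (comult_iter n h) = F hs (act h m)"
    and "r \<in> htens_rel act n"
  shows "lin_ext sc (\<lambda>(hs, m). F hs m) r = 0"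
  using assms(4) unfolding htens_rel_def
  by (rule linear_vanishes_on_span[OF vector_space.linear_lin_ext[OF assms(1)], rotated])
    (use assms(3) in \<open>auto simp: lin_ext_tens_rel[OF assms(1,2)] vector_space.lin_ext_diff[OF assms(1)]
      lin_ext_free_ext[OF assms(1)] vector_space.lin_ext_gen[OF assms(1)]\<close>)

text \<open>The iterated coproduct ends with a counit, so \<open>comult_iter 2\<close> agrees with \<open>\<Delta>\<close> only modulo the
  relations of \<open>H \<otimes> H\<close>.\<close>

lemma lin_ext_comult_iter_two:
  assumes vs: "vector_space sc" and F: "bilin sc F"
  shows "lin_ext sc (\<lambda>ks. F (ks ! 0) (ks ! 1)) (comult_iter 2 h) = swd sc F h"
proof -
  have "lin_ext sc (\<lambda>ks. F (ks ! 0) (ks ! 1)) (comult_iter 2 h)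
      = swd sc (\<lambda>a b. swd sc (\<lambda>c d. sc (\<epsilon> d) (F a c)) b) h"
    by (simp add: numeral_2_eq_2 lin_ext_free_ext[OF vs] vector_space.lin_ext_gen[OF vs]
        vector_space.lin_ext_scale[OF vs] swd_def)
  also have "\<dots> = swd sc F h"
    by (subst swd_counit_right[OF vs]) (use F in \<open>simp_all add: bilin_def\<close>)
  finally show ?thesis .
qed

text \<open>The condition under which a map on \<open>H \<times> H \<times> M\<close> factors through \<open>(H \<otimes> H) \<otimes>\<^sub>H M\<close>; in its last clause \<open>H\<close> acts on
  \<open>H \<otimes> H\<close> through the coproduct.\<close>

definition htens_balanced :: "('k \<Rightarrow> 'v \<Rightarrow> 'v) \<Rightarrow> ('h \<Rightarrow> 'h \<Rightarrow> 'm \<Rightarrow> 'v::ab_group_add) \<Rightarrow> bool"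
  where "htens_balanced sc F \<longleftrightarrow> (\<forall>m. bilin sc (\<lambda>a b. F a b m)) \<and>
    (\<forall>a b m m'. F a b (m + m') = F a b m + F a b m') \<and> (\<forall>a b c m. F a b (ks c m) = sc c (F a b m)) \<and>
    (\<forall>a b h m. swd sc (\<lambda>c d. F (a * c) (b * d) m) h = F a b (act h m))"

lemma lin_ext_htens_eq:
  assumes vs: "vector_space sc" and F: "htens_balanced sc F" and pq: "p - q \<in> htens_rel act 2"
  shows "lin_ext sc (\<lambda>(hs, m). F (hs ! 0) (hs ! 1) m) p = lin_ext sc (\<lambda>(hs, m). F (hs ! 0) (hs ! 1) m) q"
proof -
  have bl: "bilin sc (\<lambda>a b. F a b m)" for m using F by (simp add: htens_balanced_def)
  have "lin_ext sc (\<lambda>(hs, m). F (hs ! 0) (hs ! 1) m) (p - q) = 0"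
  proof (rule lin_ext_htens_rel[OF vs _ _ pq])
    show "tens_multilinear sc 2 (\<lambda>hs m. F (hs ! 0) (hs ! 1) m)"
      unfolding tens_multilinear_def
    proof (intro conjI allI impI)
      fix us vs :: "'h list" and m assume "length us + length vs + 1 = 2"
      then show "homog sc (\<lambda>h. F ((us @ h # vs) ! 0) ((us @ h # vs) ! 1) m)"
        by (rule length_two_slot) (use bl[of m] in \<open>simp_all add: bilin_def\<close>)
    qed (use F in \<open>simp_all add: htens_balanced_def\<close>)
    fix hs :: "'h list" and h m assume len: "length hs = 2"
    have "lin_ext sc (\<lambda>ks. F (map2 (*) hs ks ! 0) (map2 (*) hs ks ! 1) m) (comult_iter 2 h)
        = lin_ext sc (\<lambda>ks. F (hs ! 0 * ks ! 0) (hs ! 1 * ks ! 1) m) (comult_iter 2 h)"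
      by (rule lin_ext_cong) (use keys_comult_iter[of 2 h] len in auto)
    also have "\<dots> = swd sc (\<lambda>c d. F (hs ! 0 * c) (hs ! 1 * d) m) h"
      by (rule lin_ext_comult_iter_two[OF vs])
        (use bl[of m] in \<open>simp add: bilin_def homog_def distrib_left mult_scale_right\<close>)
    also have "\<dots> = F (hs ! 0) (hs ! 1) (act h m)" using F by (simp add: htens_balanced_def)
    finally show "lin_ext sc (\<lambda>ks. F (map2 (*) hs ks ! 0) (map2 (*) hs ks ! 1) m) (comult_iter 2 h)
      = F (hs ! 0) (hs ! 1) (act h m)" .
  qed
  then show ?thesis by (simp add: vector_space.lin_ext_diff[OF vs])
qed

lemma functional_htens_balanced:
  assumes l: "Vector_Spaces.linear fscale (*) l" "\<And>r. r \<in> htens_rel act 2 \<Longrightarrow> l r = 0"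
  shows "htens_balanced (*) (\<lambda>a b m. l (gen ([a, b], m)))"
proof -
  have "\<forall>r\<in>tens_rel act 2. l r = 0"
    using l(2) unfolding htens_rel_def by (auto intro: free.span_base)
  then have ml: "tens_multilinear (*) 2 (\<lambda>hs m. l (gen (hs, m)))"
    using tens_multilinear_iff_zero_on_rel[OF l(1)] by blast
  have bl: "bilin (*) (\<lambda>a b. l (gen ([a, b], m)))" for m
    using ml[unfolded tens_multilinear_def, THEN conjunct1, rule_format, of "[]" "[_]" m]
      ml[unfolded tens_multilinear_def, THEN conjunct1, rule_format, of "[_]" "[]" m]
    by (simp add: bilin_def)
  have "swd (*) (\<lambda>c d. l (gen ([a * c, b * d], m))) h = l (gen ([a, b], act h m))" for a b h m
  proof -
    have "free_ext (\<lambda>ks. gen (map2 (*) [a, b] ks, m)) (comult_iter 2 h) - gen ([a, b], act h m) \<in> htens_rel act 2"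
      unfolding htens_rel_def by (rule free.span_base, rule UnI2, rule CollectI,
          intro exI[of _ "[a, b]"] exI[of _ h] exI[of _ m]) simp
    from l(2)[OF this] have "l (gen ([a, b], act h m)) = l (free_ext (\<lambda>ks. gen (map2 (*) [a, b] ks, m)) (comult_iter 2 h))"
      by (simp add: lin_diff[OF l(1)])
    also have "\<dots> = lin_ext (*) (\<lambda>ks. l (gen (map2 (*) [a, b] ks, m))) (comult_iter 2 h)"
      by (rule lin_ext_comp[OF l(1)])
    also have "\<dots> = lin_ext (*) (\<lambda>ks. l (gen ([a * ks ! 0, b * ks ! 1], m))) (comult_iter 2 h)"
    proof (rule lin_ext_cong)
      fix ks assume "ks \<in> keys (comult_iter 2 h)"
      then have "length ks = 2" using keys_comult_iter[of 2 h] by blast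
      from two_element_list[OF this] obtain c d where "ks = [c, d]" by metis
      then show "l (gen (map2 (*) [a, b] ks, m)) = l (gen ([a * ks ! 0, b * ks ! 1], m))" by simp
    qed
    also have "\<dots> = swd (*) (\<lambda>c d. l (gen ([a * c, b * d], m))) h"
      by (rule lin_ext_comult_iter_two[OF vector_space_field])
        (use bl[of m] in \<open>simp add: bilin_def homog_def distrib_left mult_scale_right\<close>)
    finally show ?thesis ..
  qed
  then show ?thesis using bl ml by (simp add: htens_balanced_def tens_multilinear_def)
qed


subsection \<open>Straightening\<close>

text \<open>Every element of \<open>(H \<otimes> H) \<otimes>\<^sub>H M\<close> can be brought to the form \<open>\<Sum> (h\<^sub>i \<otimes> 1) \<otimes>\<^sub>H v\<^sub>i\<close>, because
  \<open>(f \<otimes> g) \<otimes>\<^sub>H v = \<Sum> (f S(g\<^sub>(\<^sub>1\<^sub>)) \<otimes> 1) \<otimes>\<^sub>H g\<^sub>(\<^sub>2\<^sub>) v\<close>.\<close>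

lemma straighten_generator:
  "free_ext (\<lambda>(h, v). gen ([h, 1], v)) (free_ext (\<lambda>ks. gen (f * S (ks ! 0), act (ks ! 1) v)) (rep (\<Delta> g)))
    - gen ([f, g], v) \<in> htens_rel act 2"
proof (rule free.mem_subspace_if_functionals_vanish[OF subspace_htens_rel])
  fix l :: "('h list \<times> 'm \<Rightarrow>\<^sub>0 'k) \<Rightarrow> 'k"
  assume l: "Vector_Spaces.linear fscale (*) l" "\<And>r. r \<in> htens_rel act 2 \<Longrightarrow> l r = 0"
  define G where "G a b m = l (gen ([a, b], m))" for a b m
  have G: "htens_balanced (*) G" unfolding G_def by (rule functional_htens_balanced[OF l])
  then have bal: "swd (*) (\<lambda>c d. G (a * c) (b * d) m) h = G a b (act h m)" for a b m h
    by (simp add: htens_balanced_def)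
  have ml: "G (x + y) z m = G x z m + G y z m" "G z (x + y) m = G z x m + G z y m"
    "G (scale c x) y m = c * G x y m" "G x (scale c y) m = c * G x y m" for x y z m c
    using G by (auto simp: htens_balanced_def bilin_def homog_def)
  have "l (free_ext (\<lambda>(h, v). gen ([h, 1], v)) (free_ext (\<lambda>ks. gen (f * S (ks ! 0), act (ks ! 1) v)) (rep (\<Delta> g))))
    = swd (*) (\<lambda>a b. G (f * S a) 1 (act b v)) g"
    unfolding free.lin_ext_gen lin_ext_free_ext[OF free.vector_space_axioms] swd_def G_def
    by (simp add: lin_ext_comp[OF l(1)])
  also have "\<dots> = swd (*) (\<lambda>a b. swd (*) (\<lambda>c d. G (f * S a * c) d v) b) g"
    by (simp add: bal[symmetric])
  also have "\<dots> = swd (*) (\<lambda>u d. swd (*) (\<lambda>a c. G (f * S a * c) d v) u) g"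
    by (rule swd_coassoc[OF vector_space_field, symmetric]) (simp_all add: mlK ml)
  also have "\<dots> = swd (*) (\<lambda>u d. \<epsilon> u * G f d v) g"
    by (subst swd_antipode_left[OF vector_space_field, where f = "\<lambda>w. G (f * w) d v" for d, unfolded mult.assoc[symmetric]])
      (simp_all add: mlK ml)
  also have "\<dots> = G f g v"
    by (subst swd_counit_left[OF vector_space_field]) (simp_all add: mlK ml)
  finally show "l (free_ext (\<lambda>(h, v). gen ([h, 1], v)) (free_ext (\<lambda>ks. gen (f * S (ks ! 0), act (ks ! 1) v)) (rep (\<Delta> g)))
    - gen ([f, g], v)) = 0"
    by (simp add: lin_diff[OF l(1)] G_def)
qed

lemma straighten_spec:
  assumes "C \<in> htens act 2"
  shows "free_ext (\<lambda>(h, v). gen ([h, 1], v)) (straighten act C) +o htens_rel act 2 = C"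
proof -
  let ?E = "\<lambda>(hs, v). free_ext (\<lambda>ks. gen (hs ! 0 * S (ks ! 0), act (ks ! 1) v)) (rep (\<Delta> (hs ! 1)))"
  let ?p = "free_ext ?E (rep C)"
  have "free_ext (\<lambda>(h, v). gen ([h, 1], v)) ?p - free_ext gen (rep C) \<in> htens_rel act 2"
    unfolding lin_ext_free_ext[OF free.vector_space_axioms, of _ ?E]
  proof (rule free_ext_diff_in_subspace[OF subspace_htens_rel])
    fix g assume "g \<in> keys (rep C)"
    then obtain hs v where g: "g = (hs, v)" "length hs = 2" using keys_htens[OF assms] by auto
    then have "g = ([hs ! 0, hs ! 1], v)" using two_element_list by metis
    then show "free_ext (\<lambda>(h, v). gen ([h, 1], v)) (?E g) - gen g \<in> htens_rel act 2"
      using straighten_generator[of "hs ! 0" v "hs ! 1"] g(1) by simp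
  qed
  then have "free_ext (\<lambda>(h, v). gen ([h, 1], v)) ?p +o htens_rel act 2 = C"
    by (simp add: free_ext_gen_id free.coset_eq_iff[OF subspace_htens_rel, symmetric] rep_htens[OF assms])
  then show ?thesis unfolding straighten_def by (rule someI)
qed

text \<open>The value \<open>\<Sum> \<langle>x, S(f S(g\<^sub>(\<^sub>1\<^sub>)))\<rangle> g\<^sub>(\<^sub>2\<^sub>) v\<close> of \<open>x \<circ> S\<close> on the first factor of the straightened form of
  \<open>(f \<otimes> g) \<otimes>\<^sub>H v\<close>, with the factors of \<open>\<Delta> g\<close> exchanged. Being defined on arbitrary representatives, it
  computes with the straightened form without reference to the choice of one.\<close>

definition straight_eval :: "('h \<Rightarrow> 'k) \<Rightarrow> 'h \<Rightarrow> 'h \<Rightarrow> 'm \<Rightarrow> 'm"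
  where "straight_eval x f g v = act (xact (\<lambda>u. x (S (f * S u))) g) v"

lemma straight_functional_dual: "x \<in> dual \<Longrightarrow> (\<lambda>u. x (S (f * S u))) \<in> dual"
  by (rule dualI) (simp_all add: S_add S_scale distrib_left mult_scale_right dual_add dual_scale)

lemma straight_eval_one: assumes "x \<in> dual" shows "straight_eval x f 1 v = ks (x (S f)) v"
proof -
  have "xact (\<lambda>u. x (S (f * S u))) 1 = scale (x (S f)) 1"
    unfolding xact_def
    by (subst swd_one[OF vector_space_scale])
      (use straight_functional_dual[OF assms] in \<open>simp_all add: mlH antipode_one dual_add[OF assms] dual_scale[OF assms]\<close>)
  then show ?thesis by (simp add: straight_eval_def kscale_def)
qed

text \<open>The only condition that is not formal is the balance over \<open>H\<close>. It amounts to
  \<open>\<Sum> a h\<^sub>(\<^sub>1\<^sub>) S(h\<^sub>(\<^sub>2\<^sub>)) S(b\<^sub>(\<^sub>1\<^sub>)) \<otimes> b\<^sub>(\<^sub>2\<^sub>) h\<^sub>(\<^sub>3\<^sub>) = \<Sum> a S(b\<^sub>(\<^sub>1\<^sub>)) \<otimes> b\<^sub>(\<^sub>2\<^sub>) h\<close>.\<close>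

lemma htens_balanced_straight_eval:
  assumes x: "x \<in> dual"
  shows "htens_balanced ks (straight_eval x)"
proof -
  note xl = dual_add[OF x] dual_scale[OF x]
  have inner: "swd scale (\<lambda>c d. xact (\<lambda>u. x (S (a * c * S u))) (b * d)) h = xact (\<lambda>u. x (S (a * S u))) b * h" for a b h
  proof -
    let ?s = "swd scale"
    have "?s (\<lambda>c d. xact (\<lambda>u. x (S (a * c * S u))) (b * d)) h
      = ?s (\<lambda>c w. ?s (\<lambda>p q. ?s (\<lambda>d e. scale (x (S (a * c * S e * S q))) (p * d)) w) b) h"
    proof -
      have "xact (\<lambda>u. x (S (a * c * S u))) (b * w)
        = ?s (\<lambda>p q. ?s (\<lambda>d e. scale (x (S (a * c * S e * S q))) (p * d)) w) b" for c w
        unfolding xact_def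
        by (subst swd_mult[OF vector_space_scale]) (simp_all add: mlH xl antipode_mult mult.commute)
      then show ?thesis by simp
    qed
    also have "\<dots> = ?s (\<lambda>p q. ?s (\<lambda>c w. ?s (\<lambda>d e. scale (x (S (a * c * S e * S q))) (p * d)) w) h) b"
      by (rule swd_swap[OF vector_space_scale])
    also have "\<dots> = ?s (\<lambda>p q. ?s (\<lambda>c w. ?s (\<lambda>e d. scale (x (S (a * c * S e * S q))) (p * d)) w) h) b"
      by (subst swd_cocommutative[OF vector_space_scale]) (simp_all add: mlH xl mult.commute)
    also have "\<dots> = ?s (\<lambda>p q. ?s (\<lambda>w d. ?s (\<lambda>c e. scale (x (S (a * c * S e * S q))) (p * d)) w) h) b"
      by (subst swd_coassoc[OF vector_space_scale, symmetric]) (simp_all add: mlH xl mult.commute)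
    also have "\<dots> = ?s (\<lambda>p q. ?s (\<lambda>w d. scale (\<epsilon> w) (scale (x (S (a * S q))) (p * d))) h) b"
      by (subst swd_antipode_right[OF vector_space_scale,
            where f = "\<lambda>v. scale (x (S (a * v * S q))) (p * d)" for p q d, unfolded mult.assoc[symmetric]])
        (simp_all add: mlH xl mult.commute)
    also have "\<dots> = ?s (\<lambda>p q. scale (x (S (a * S q))) p * h) b"
      by (subst swd_counit_left[OF vector_space_scale]) (simp_all add: mlH xl mult.commute)
    also have "\<dots> = xact (\<lambda>u. x (S (a * S u))) b * h"
      unfolding xact_def
      by (subst swd_linear[OF vector_space_scale, where L = "\<lambda>u. u * h"])
        (simp_all add: linear_iff_homog vector_space_scale mlH)
    finally show ?thesis .
  qed
  have "swd ks (\<lambda>c d. straight_eval x (a * c) (b * d) m) h = straight_eval x a b (act h m)" for a b h m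
  proof -
    have "Vector_Spaces.linear scale ks (\<lambda>u. act u m)"
      by (simp add: linear_iff_homog[OF vector_space_ks] homog_act)
    from swd_linear[OF vector_space_ks this]
    have "swd ks (\<lambda>c d. straight_eval x (a * c) (b * d) m) h
      = act (swd scale (\<lambda>c d. xact (\<lambda>u. x (S (a * c * S u))) (b * d)) h) m"
      by (simp add: straight_eval_def)
    then show ?thesis by (simp add: inner straight_eval_def act_mult)
  qed
  moreover have "bilin ks (\<lambda>a b. straight_eval x a b m)" for m
  proof -
    have "xact (\<lambda>u. x (S ((a + a') * S u))) b = xact (\<lambda>u. x (S (a * S u))) b + xact (\<lambda>u. x (S (a' * S u))) b" for a a' b
      using xact_lincomb[of 1 _ 1] by (simp add: distrib_right S_add xl)
    moreover have "xact (\<lambda>u. x (S (scale c a * S u))) b = scale c (xact (\<lambda>u. x (S (a * S u))) b)" for c a b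
      using xact_lincomb[of c "\<lambda>u. x (S (a * S u))" 0 "\<lambda>u. x (S (a * S u))"] by (simp add: mult_scale_left S_scale xl)
    ultimately show ?thesis
      using straight_functional_dual[OF x]
      by (simp add: bilin_def homog_def straight_eval_def xact_add xact_scale act_add_left act_scale)
  qed
  ultimately show ?thesis
    by (simp add: htens_balanced_def straight_eval_def act_add_right act_ks)
qed

definition htens_eval :: "('h \<Rightarrow> 'k) \<Rightarrow> ('h list \<times> 'm \<Rightarrow>\<^sub>0 'k) \<Rightarrow> 'm"
  where "htens_eval x p = lin_ext ks (\<lambda>(hs, v). straight_eval x (hs ! 0) (hs ! 1) v) p"

lemma htens_eval_eq: "x \<in> dual \<Longrightarrow> p - q \<in> htens_rel act 2 \<Longrightarrow> htens_eval x p = htens_eval x q"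
  unfolding htens_eval_def by (rule lin_ext_htens_eq[OF vector_space_ks htens_balanced_straight_eval])

lemma straighten_eval:
  assumes "x \<in> dual" "C \<in> htens act 2"
  shows "lin_ext ks (\<lambda>(h, v). ks (x (S h)) v) (straighten act C) = htens_eval x (rep C)"
proof -
  let ?p = "free_ext (\<lambda>(h, v). gen ([h, 1], v)) (straighten act C)"
  have "?p - rep C \<in> htens_rel act 2"
    using straighten_spec[OF assms(2)] rep_htens[OF assms(2)] by (metis free.coset_eq_iff[OF subspace_htens_rel])
  then have "htens_eval x (rep C) = htens_eval x ?p" using htens_eval_eq[OF assms(1)] by metis
  also have "\<dots> = lin_ext ks (\<lambda>(h, v). ks (x (S h)) v) (straighten act C)"
    unfolding htens_eval_def lin_ext_free_ext[OF vector_space_ks]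
    by (intro lin_ext_cong) (auto simp: K.lin_ext_gen straight_eval_one[OF assms(1)])
  finally show ?thesis ..
qed


subsection \<open>The pairing with functionals\<close>

text \<open>The contraction of \<open>f\<^sub>1 \<otimes> \<dots> \<otimes> f\<^sub>n \<otimes> m\<close> with the functionals \<open>x\<^sub>i \<circ> S\<close>; the antipode is part of it because
  it occurs in the action of the annihilation algebra on \<open>M\<close>.\<close>

definition pairing :: "('h \<Rightarrow> 'k) list \<Rightarrow> ('h list \<times> 'm \<Rightarrow>\<^sub>0 'k) \<Rightarrow> 'm"
  where "pairing xs = lin_ext ks (\<lambda>(hs, m). ks (eval_prod xs hs) m)"

lemma linear_pairing: "Vector_Spaces.linear fscale ks (pairing xs)"
  unfolding pairing_def by (rule K.linear_lin_ext)

lemma pairing_gen: "pairing xs (gen (hs, m)) = ks (eval_prod xs hs) m"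
  by (simp add: pairing_def K.lin_ext_gen)

lemma tens_multilinear_pairing:
  assumes "length xs = n" "set xs \<subseteq> dual"
  shows "tens_multilinear ks n (\<lambda>hs m. ks (eval_prod xs hs) m)"
  unfolding tens_multilinear_def
proof (intro conjI allI impI)
  fix us vs :: "'h list" and m assume len: "length us + length vs + 1 = n"
  obtain us' x vs' where xs: "xs = us' @ x # vs'" "length us' = length us" "length vs' = length vs"
    by (rule split_at_length[of xs us vs]) (use len assms in auto)
  have x: "x \<in> dual" using xs assms by auto
  show "homog ks (\<lambda>h. ks (eval_prod xs (us @ h # vs)) m)"
    unfolding xs(1) using xs(2) dual_antipode[OF x]
    by (simp add: prod_list_map2_slot homog_def dual_add[OF x] dual_scale[OF x] S_add S_scale
        distrib_left distrib_right K.scale_left_distrib mult.left_commute mult.assoc)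
qed (simp_all add: K.scale_right_distrib K.scale_left_commute mult.commute)

lemma pairing_eq:
  assumes "length xs = n" "set xs \<subseteq> dual" "p - q \<in> tens_rel act n"
  shows "pairing xs p = pairing xs q"
  unfolding pairing_def
  by (rule lin_ext_tens_eq[OF vector_space_ks tens_multilinear_pairing[OF assms(1,2)] assms(3)])

text \<open>The functionals \<open>b\<^sup>* \<circ> S\<close> for \<open>b\<close> in a basis of \<open>H\<close> recover the coefficients of an element of
  \<open>H\<^sup>\<otimes>\<^sup>n \<otimes> M\<close>.\<close>

lemma pairing_separates:
  assumes keys: "tens_supp n p"
    and zero: "\<And>xs. length xs = n \<Longrightarrow> set xs \<subseteq> dual \<Longrightarrow> pairing xs p = 0"
  shows "p \<in> tens_rel act n"
proof (rule free.mem_subspace_if_functionals_vanish[OF subspace_tens_rel])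
  fix l :: "('h list \<times> 'm \<Rightarrow>\<^sub>0 'k) \<Rightarrow> 'k"
  assume l: "Vector_Spaces.linear fscale (*) l" "\<And>r. r \<in> tens_rel act n \<Longrightarrow> l r = 0"
  then have ml: "tens_multilinear (*) n (\<lambda>hs m. l (gen (hs, m)))"
    using tens_multilinear_iff_zero_on_rel by blast
  interpret F: vector_space "(*) :: 'k \<Rightarrow> 'k \<Rightarrow> 'k" by (rule vector_space_field)
  define C where "C = extend_basis {}"
  have C: "independent C" "span C = UNIV"
    unfolding C_def using independent_extend_basis[OF independent_empty] span_extend_basis[OF independent_empty] by auto
  define B where "B = (\<Union>(hs, m)\<in>keys p. \<Union>h\<in>set hs. {b. representation C h b \<noteq> 0})"
  have B: "finite B" unfolding B_def by (auto simp: finite_representation)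
  let ?L = "{cs. set cs \<subseteq> B \<and> length cs = n}"
  define x where "x b = (\<lambda>h. representation C (S h) b)" for b
  have xd: "x b \<in> dual" for b unfolding x_def by (rule dual_antipode[OF dual_basis_functional[OF C]])
  have xS: "x b (S h) = representation C h b" for b h by (simp add: x_def antipode_involution)
  have gl: "l (gen (hs, m)) = (\<Sum>cs\<in>?L. l (gen (cs, ks (eval_prod (map x cs) hs) m)))"
    if k: "(hs, m) \<in> keys p" for hs m
  proof -
    have len: "length hs = n" using k keys by auto
    have "l (gen (map (\<lambda>h. h) hs, m)) = (\<Sum>cs\<in>?L. prod_list (map2 (\<lambda>h b. representation C h b) hs cs) * l (gen (map (\<lambda>h. h) cs, m)))"
    proof (rule F.multilinear_expansion[where f = "\<lambda>hs. l (gen (hs, m))" and A = "set hs" and C = UNIV])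
      fix us vs :: "'h list" and a assume a: "a \<in> set hs" and len: "length us + length vs + 1 = n"
      have "{b. representation C a b \<noteq> 0} \<subseteq> B" using a k unfolding B_def by blast
      then have a_eq: "a = (\<Sum>b\<in>B. scale (representation C a b) b)"
        using sum_nonzero_representation_eq[OF C(1), of a] C(2) B
        by (subst sum.mono_neutral_right[of B "{b. representation C a b \<noteq> 0}"]) auto
      have lin: "Vector_Spaces.linear scale (*) (\<lambda>h. l (gen (us @ h # vs, m)))"
        using ml len by (simp add: linear_iff_homog[OF vector_space_field] tens_multilinear_def)
      have "l (gen (us @ (\<Sum>b\<in>B. scale (representation C a b) b) # vs, m))
        = (\<Sum>b\<in>B. representation C a b * l (gen (us @ b # vs, m)))"
        by (simp add: lin_sum[OF lin] lin_scale[OF lin])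
      then show "l (gen (us @ a # vs, m)) = (\<Sum>b\<in>B. representation C a b * l (gen (us @ b # vs, m)))"
        using arg_cong[OF a_eq, of "\<lambda>z. l (gen (us @ z # vs, m))"] by (rule trans[rotated])
    qed (use B len in auto)
    also have "\<dots> = (\<Sum>cs\<in>?L. l (gen (cs, ks (eval_prod (map x cs) hs) m)))"
    proof (rule sum.cong[OF refl])
      fix cs assume cs: "cs \<in> ?L"
      have "map2 (\<lambda>x h. x (S h)) (map x cs) hs = map2 (\<lambda>h b. representation C h b) hs cs"
        using len cs by (intro nth_equalityI) (auto simp: xS)
      then show "prod_list (map2 (\<lambda>h b. representation C h b) hs cs) * l (gen (map (\<lambda>h. h) cs, m))
        = l (gen (cs, ks (eval_prod (map x cs) hs) m))"
        using ml cs by (simp add: tens_multilinear_def)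
    qed
    finally show ?thesis by simp
  qed
  have lin: "Vector_Spaces.linear ks (*) (\<lambda>m. l (gen (cs, m)))" if "length cs = n" for cs
    using ml that by (intro linearI_vs vector_space_ks vector_space_field) (simp_all add: tens_multilinear_def)
  have "l p = lin_ext (*) (\<lambda>g. l (gen g)) p" using lin_ext_linear[OF l(1)] by metis
  also have "\<dots> = lin_ext (*) (\<lambda>(hs, m). \<Sum>cs\<in>?L. l (gen (cs, ks (eval_prod (map x cs) hs) m))) p"
    by (rule lin_ext_cong) (use gl in auto)
  also have "\<dots> = (\<Sum>cs\<in>?L. lin_ext (*) (\<lambda>g. l (gen (cs, (\<lambda>(hs, m). ks (eval_prod (map x cs) hs) m) g))) p)"
    unfolding F.lin_ext_fun_sum[symmetric] by (rule lin_ext_cong) auto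
  also have "\<dots> = (\<Sum>cs\<in>?L. l (gen (cs, pairing (map x cs) p)))"
    unfolding pairing_def by (intro sum.cong refl lin_ext_comp[OF lin, symmetric]) auto
  also have "\<dots> = 0"
  proof (rule sum.neutral, rule ballI)
    fix cs assume cs: "cs \<in> ?L"
    have "pairing (map x cs) p = 0" by (rule zero) (use cs xd in auto)
    then show "l (gen (cs, pairing (map x cs) p)) = 0"
      using cs lin_zero[OF lin[of cs]] by simp
  qed
  finally show "l p = 0" .
qed

end


section \<open>The annihilation algebra\<close>

lemma (in vector_space) eq_minus_self_imp_zero:
  fixes x :: 'b
  shows "(2::'a) \<noteq> 0 \<Longrightarrow> x = - x \<Longrightarrow> x = 0"
proof -
  assume "(2::'a) \<noteq> 0" "x = - x"
  have "scale 2 x = x + x" using scale_left_distrib[of 1 1 x] by simp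
  also have "\<dots> = 0" using \<open>x = - x\<close> by (metis add.right_inverse)
  finally show "x = 0" using \<open>(2::'a) \<noteq> 0\<close> by simp
qed

subsection \<open>Multilinear extension\<close>

text \<open>Evaluation of a function of generators, extended linearly in every argument, at a list of
  representatives. It serves to define a cochain on cosets from its values on the elements \<open>x \<otimes>\<^sub>H a\<close>.\<close>

primrec lin_ext_list ::
  "('k::field \<Rightarrow> 'v \<Rightarrow> 'v) \<Rightarrow> ('g list \<Rightarrow> 'v) \<Rightarrow> ('g \<Rightarrow>\<^sub>0 'k) list \<Rightarrow> 'v::ab_group_add" where
  "lin_ext_list sc f [] = f []"
| "lin_ext_list sc f (p # ps) = lin_ext sc (\<lambda>g. lin_ext_list sc (\<lambda>gs. f (g # gs)) ps) p"

lemma lin_ext_list_cong: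
  assumes "\<And>gs. set gs \<subseteq> A \<Longrightarrow> length gs = length ps \<Longrightarrow> f gs = f' gs"
    and "\<And>p. p \<in> set ps \<Longrightarrow> keys p \<subseteq> A"
  shows "lin_ext_list sc f ps = lin_ext_list sc f' ps"
  using assms
proof (induction ps arbitrary: f f')
  case (Cons p ps)
  show ?case unfolding lin_ext_list.simps
  proof (rule lin_ext_cong)
    fix g assume "g \<in> keys p"
    then have "g \<in> A" using Cons.prems(2) by auto
    then show "lin_ext_list sc (\<lambda>gs. f (g # gs)) ps = lin_ext_list sc (\<lambda>gs. f' (g # gs)) ps"
      using Cons.prems by (intro Cons.IH) auto
  qed
qed simp

context vector_space
begin

lemma linear_lin_ext_list: "Vector_Spaces.linear fscale scale (\<lambda>p. lin_ext_list scale f (us @ p # vs))"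
proof (induction us arbitrary: f)
  case Nil
  show ?case by (simp add: linear_lin_ext)
next
  case (Cons u us)
  show ?case
    by (rule linearI_vs[OF free.vector_space_axioms vector_space_axioms])
      (simp_all add: lin_add[OF Cons] lin_scale[OF Cons] lin_ext_fun_add lin_ext_fun_scale)
qed

lemma lin_ext_list_minus: "lin_ext_list scale (\<lambda>gs. - f gs) ps = - lin_ext_list scale f ps"
  by (induction ps arbitrary: f) (simp_all add: lin_ext_fun_minus)

text \<open>The summation over the generators of \<open>r\<close> may be moved inside all the others.\<close>

lemma lin_ext_list_slot_zero:
  assumes "\<And>gs hs. set gs \<subseteq> A \<Longrightarrow> set hs \<subseteq> A \<Longrightarrow> length gs = length us \<Longrightarrow> length hs = length vs \<Longrightarrow>
      lin_ext scale (\<lambda>g. f (gs @ g # hs)) r = 0"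
    and "\<And>p. p \<in> set us \<union> set vs \<Longrightarrow> keys p \<subseteq> A"
  shows "lin_ext_list scale f (us @ r # vs) = 0"
  using assms
proof (induction us arbitrary: f)
  case Nil
  then show ?case
  proof (induction vs arbitrary: f)
    case Nil
    then show ?case using Nil.prems(1)[of "[]" "[]"] by simp
  next
    case (Cons v vs)
    have "lin_ext scale (\<lambda>g. lin_ext_list scale (\<lambda>gs. f (g # h # gs)) vs) r = 0" if h: "h \<in> keys v" for h
    proof -
      have "h \<in> A" using h Cons.prems(2)[of v] by auto
      have "lin_ext_list scale (\<lambda>gs. f (hd gs # h # tl gs)) ([] @ r # vs) = 0"
      proof (rule Cons.IH)
        fix gs hs assume "set gs \<subseteq> A" "set hs \<subseteq> A" "length gs = length []" "length hs = length vs"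
        then show "lin_ext scale (\<lambda>g. f (hd (gs @ g # hs) # h # tl (gs @ g # hs))) r = 0"
          using Cons.prems(1)[of "[]" "h # hs"] \<open>h \<in> A\<close> by simp
      qed (use Cons.prems(2) in auto)
      then show ?thesis by simp
    qed
    then have "lin_ext scale (\<lambda>h. lin_ext scale (\<lambda>g. lin_ext_list scale (\<lambda>gs. f (g # h # gs)) vs) r) v = 0"
      by (simp add: lin_ext_cong[of v _ "\<lambda>_. 0"] lin_ext_fun_zero)
    then show ?case by (simp add: lin_ext_swap[of _ _ r])
  qed
next
  case (Cons u us)
  have "lin_ext_list scale (\<lambda>gs. f (g # gs)) (us @ r # vs) = 0" if g: "g \<in> keys u" for g
  proof (rule Cons.IH)
    fix gs hs assume "set gs \<subseteq> A" "set hs \<subseteq> A" "length gs = length us" "length hs = length vs"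
    moreover have "g \<in> A" using g Cons.prems(2)[of u] by auto
    ultimately show "lin_ext scale (\<lambda>h. f (g # gs @ h # hs)) r = 0"
      using Cons.prems(1)[of "g # gs" hs] by simp
  qed (use Cons.prems(2) in auto)
  then show ?case by (simp add: lin_ext_cong[of u _ "\<lambda>_. 0"] lin_ext_fun_zero)
qed

lemma lin_ext_list_cong_rel:
  assumes "\<And>gs hs r. set gs \<subseteq> A \<Longrightarrow> set hs \<subseteq> A \<Longrightarrow> length gs + length hs + 1 = length ps \<Longrightarrow> r \<in> R \<Longrightarrow>
      lin_ext scale (\<lambda>g. f (gs @ g # hs)) r = 0"
    and "\<And>p. p \<in> set ps \<union> set qs \<Longrightarrow> keys p \<subseteq> A"
    and "list_all2 (\<lambda>p q. p - q \<in> R) ps qs"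
  shows "lin_ext_list scale f ps = lin_ext_list scale f qs"
  using assms(3,1,2)
proof (induction ps qs arbitrary: f rule: list_all2_induct)
  case (Cons p ps q qs)
  have "lin_ext_list scale f (p # ps) = lin_ext_list scale f (p # qs)"
    unfolding lin_ext_list.simps
  proof (rule lin_ext_cong)
    fix g assume g: "g \<in> keys p"
    show "lin_ext_list scale (\<lambda>gs. f (g # gs)) ps = lin_ext_list scale (\<lambda>gs. f (g # gs)) qs"
    proof (rule Cons.IH)
      fix gs hs r assume "set gs \<subseteq> A" "set hs \<subseteq> A" "length gs + length hs + 1 = length ps" "r \<in> R"
      moreover have "g \<in> A" using g Cons.prems(2)[of p] by auto
      ultimately show "lin_ext scale (\<lambda>h. f (g # gs @ h # hs)) r = 0"
        using Cons.prems(1)[of "g # gs" hs r] by simp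
    qed (use Cons.prems(2) in auto)
  qed
  also have "\<dots> = lin_ext_list scale f (q # qs)"
  proof -
    have len: "length ps = length qs" using Cons.hyps(2) by (rule list_all2_lengthD)
    have "lin_ext_list scale f ([] @ (p - q) # qs) = 0"
    proof (rule lin_ext_list_slot_zero[of A])
      fix gs hs :: "'c list"
      assume "set gs \<subseteq> A" "set hs \<subseteq> A" "length gs = length []" "length hs = length qs"
      then show "lin_ext scale (\<lambda>g. f (gs @ g # hs)) (p - q) = 0"
        using Cons.prems(1)[of gs hs "p - q"] Cons.hyps(1) len by simp
    qed (use Cons.prems in auto)
    then show ?thesis by (simp add: lin_ext_diff)
  qed
  finally show ?case .
qed simp

lemma lin_ext_list_gen: "lin_ext_list scale f (map gen gs) = f gs"
  by (induction gs arbitrary: f) (simp_all add: lin_ext_gen)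

lemma lin_ext_list_skew:
  assumes "\<And>gs g h hs. set gs \<subseteq> A \<Longrightarrow> set hs \<subseteq> A \<Longrightarrow> g \<in> A \<Longrightarrow> h \<in> A \<Longrightarrow> length gs = length us \<Longrightarrow>
      length hs = length vs \<Longrightarrow> f (gs @ g # h # hs) = - f (gs @ h # g # hs)"
    and "\<And>p. p \<in> set us \<union> set vs \<union> {p1, p2} \<Longrightarrow> keys p \<subseteq> A"
  shows "lin_ext_list scale f (us @ p1 # p2 # vs) = - lin_ext_list scale f (us @ p2 # p1 # vs)"
  using assms
proof (induction us arbitrary: f)
  case Nil
  have "lin_ext scale (\<lambda>g. lin_ext scale (\<lambda>h. lin_ext_list scale (\<lambda>gs. f (g # h # gs)) vs) p2) p1
    = lin_ext scale (\<lambda>g. lin_ext scale (\<lambda>h. - lin_ext_list scale (\<lambda>gs. f (h # g # gs)) vs) p2) p1"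
  proof (intro lin_ext_cong)
    fix g h assume "g \<in> keys p1" "h \<in> keys p2"
    then have "g \<in> A" "h \<in> A" using Nil.prems(2)[of p1] Nil.prems(2)[of p2] by auto
    then show "lin_ext_list scale (\<lambda>gs. f (g # h # gs)) vs = - lin_ext_list scale (\<lambda>gs. f (h # g # gs)) vs"
      unfolding lin_ext_list_minus[symmetric]
    proof (intro lin_ext_list_cong[of A])
      fix gs assume "g \<in> A" "h \<in> A" "set gs \<subseteq> A" "length gs = length vs"
      then show "f (g # h # gs) = - f (h # g # gs)" using Nil.prems(1)[of "[]" gs g h] by simp
    qed (use Nil.prems(2) in auto)
  qed
  then show ?case by (simp add: lin_ext_fun_minus lin_ext_swap[of _ p2 p1])
next
  case (Cons u us)
  have "lin_ext_list scale (\<lambda>gs. f (g # gs)) (us @ p1 # p2 # vs)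
      = - lin_ext_list scale (\<lambda>gs. f (g # gs)) (us @ p2 # p1 # vs)" if g: "g \<in> keys u" for g
  proof (rule Cons.IH)
    fix gs g' h hs
    assume "set gs \<subseteq> A" "set hs \<subseteq> A" "g' \<in> A" "h \<in> A" "length gs = length us" "length hs = length vs"
    moreover have "g \<in> A" using g Cons.prems(2)[of u] by auto
    ultimately show "f (g # gs @ g' # h # hs) = - f (g # gs @ h # g' # hs)"
      using Cons.prems(1)[of "g # gs" hs g' h] by simp
  qed (use Cons.prems(2) in auto)
  then show ?case by (simp add: lin_ext_fun_minus[symmetric] cong: lin_ext_cong)
qed

end


subsection \<open>Linear maps out of the annihilation algebra\<close>

sublocale lie_pseudoalgebra \<subseteq> HL: hopf_module scale \<Delta> \<epsilon> S actL ..

context lie_pseudoalgebra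
begin

lemma subspace_ann_rel: "free.subspace ann_rel"
  unfolding ann_rel_def by (rule free.subspace_span)

lemma keys_ann_rel: "r \<in> ann_rel \<Longrightarrow> keys r \<subseteq> dual \<times> UNIV"
  unfolding ann_rel_def
  by (rule keys_span_subset)
    (auto dest!: in_keys_diffD in_keys_fscaleD simp: keys_gen dual_plus dual_times dual_act_closed)

lemma rep_ann: "P \<in> ann \<Longrightarrow> rep P +o ann_rel = P"
  and keys_ann: "P \<in> ann \<Longrightarrow> keys (rep P) \<subseteq> dual \<times> UNIV"
  unfolding ann_def
  by (rule rep_classes[OF subspace_ann_rel keys_ann_rel] keys_rep_classes[OF subspace_ann_rel keys_ann_rel]; assumption)+

lemma coset_in_ann: "keys p \<subseteq> dual \<times> UNIV \<Longrightarrow> p +o ann_rel \<in> ann"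
  unfolding ann_def classes_def by blast

lemma ann_elem_in_ann: "x \<in> dual \<Longrightarrow> ann_elem x a \<in> ann"
  unfolding ann_elem_def by (rule coset_in_ann) (simp add: keys_gen)

lemma ann_add_rep: "P \<in> ann \<Longrightarrow> Q \<in> ann \<Longrightarrow> P + Q = (rep P + rep Q) +o ann_rel"
  using free.add_cosets[OF subspace_ann_rel, of "rep P" "rep Q"] by (simp add: rep_ann)

lemma ann_scale_rep: "P \<in> ann \<Longrightarrow> coset_scale fscale ann_rel c P = fscale c (rep P) +o ann_rel"
  using free.scale_coset[OF subspace_ann_rel, of c "rep P"] by (simp add: rep_ann)

lemma ann_add_closed: "P \<in> ann \<Longrightarrow> Q \<in> ann \<Longrightarrow> P + Q \<in> ann"
  unfolding ann_add_rep by (intro coset_in_ann keys_add' keys_ann)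

lemma ann_scale_closed: "P \<in> ann \<Longrightarrow> coset_scale fscale ann_rel c P \<in> ann"
  unfolding ann_scale_rep by (intro coset_in_ann keys_fscale' keys_ann)

lemma rep_ann_add: "P \<in> ann \<Longrightarrow> Q \<in> ann \<Longrightarrow> rep (P + Q) - (rep P + rep Q) \<in> ann_rel"
  unfolding ann_add_rep by (rule free.rep_coset[OF subspace_ann_rel])

lemma rep_ann_scale: "P \<in> ann \<Longrightarrow> rep (coset_scale fscale ann_rel c P) - fscale c (rep P) \<in> ann_rel"
  unfolding ann_scale_rep by (rule free.rep_coset[OF subspace_ann_rel])

lemma
  assumes "x \<in> dual"
  shows ann_elem_plus_left: "y \<in> dual \<Longrightarrow> ann_elem (\<lambda>h. x h + y h) a = ann_elem x a + ann_elem y a"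
    and ann_elem_times_left: "ann_elem (\<lambda>h. c * x h) a = coset_scale fscale ann_rel c (ann_elem x a)"
    and ann_elem_plus_right: "ann_elem x (a + b) = ann_elem x a + ann_elem x b"
    and ann_elem_act: "ann_elem (dual_act x h) a = ann_elem x (actL h a)"
proof -
  have rel: "g \<in> ann_rel" if "g \<in>
    ({gen (\<lambda>h. x h + y h, a) - gen (x, a) - gen (y, a) |x y a. x \<in> dual \<and> y \<in> dual} \<union>
     {gen (\<lambda>h. c * x h, a) - fscale c (gen (x, a)) |c x a. x \<in> dual} \<union>
     {gen (x, a + b) - gen (x, a) - gen (x, b) |x a b. x \<in> dual} \<union>
     {gen (dual_act x h, a) - gen (x, actL h a) |x h a. x \<in> dual})" for g
    unfolding ann_rel_def using that by (rule free.span_base)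
  note eq = free.coset_eq_iff[OF subspace_ann_rel] free.add_cosets[OF subspace_ann_rel] free.scale_coset[OF subspace_ann_rel]
  show "ann_elem (\<lambda>h. x h + y h) a = ann_elem x a + ann_elem y a" if "y \<in> dual"
    unfolding ann_elem_def eq diff_diff_eq[symmetric] by (rule rel) (use assms that in blast)
  show "ann_elem (\<lambda>h. c * x h) a = coset_scale fscale ann_rel c (ann_elem x a)"
    unfolding ann_elem_def eq by (rule rel) (use assms in blast)
  show "ann_elem x (a + b) = ann_elem x a + ann_elem x b"
    unfolding ann_elem_def eq diff_diff_eq[symmetric] by (rule rel) (use assms in blast)
  show "ann_elem (dual_act x h) a = ann_elem x (actL h a)"
    unfolding ann_elem_def eq by (rule rel) (use assms in blast)
qed

definition ann_linear ::
  "('k \<Rightarrow> 'v \<Rightarrow> 'v) \<Rightarrow> ((('h \<Rightarrow> 'k) \<times> 'l \<Rightarrow>\<^sub>0 'k) set \<Rightarrow> 'v::ab_group_add) \<Rightarrow> bool"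
  where "ann_linear sc f \<longleftrightarrow> (\<forall>P\<in>ann. \<forall>Q\<in>ann. f (P + Q) = f P + f Q) \<and>
    (\<forall>c. \<forall>P\<in>ann. f (coset_scale fscale ann_rel c P) = sc c (f P))"

text \<open>The condition under which a map on \<open>X \<times> L\<close> factors through \<open>X \<otimes>\<^sub>H L\<close>.\<close>

definition ann_balanced ::
  "('k \<Rightarrow> 'v \<Rightarrow> 'v) \<Rightarrow> (('h \<Rightarrow> 'k) \<Rightarrow> 'l \<Rightarrow> 'v::ab_group_add) \<Rightarrow> bool"
  where "ann_balanced sc F \<longleftrightarrow> (\<forall>a. dual_linear sc (\<lambda>x. F x a)) \<and>
    (\<forall>x\<in>dual. \<forall>a b. F x (a + b) = F x a + F x b) \<and> (\<forall>x\<in>dual. \<forall>h a. F (dual_act x h) a = F x (actL h a))"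

lemma ann_balanced_of_linear: "ann_linear sc f \<Longrightarrow> ann_balanced sc (\<lambda>x a. f (ann_elem x a))"
  by (simp add: ann_balanced_def ann_linear_def dual_linear_def ann_elem_in_ann ann_elem_plus_left
      ann_elem_times_left ann_elem_plus_right ann_elem_act)

context
  fixes sc :: "'k \<Rightarrow> 'v \<Rightarrow> 'v::ab_group_add"
  assumes vs: "vector_space sc"
begin

interpretation V: vector_space sc by (rule vs)

lemma lin_ext_ann_rel:
  assumes F: "ann_balanced sc F" and r: "r \<in> ann_rel"
  shows "lin_ext sc (\<lambda>(x, a). F x a) r = 0"
proof -
  have lin: "dual_linear sc (\<lambda>x. F x a)" for a using F by (simp add: ann_balanced_def)
  show ?thesis
    using r unfolding ann_rel_def
    by (rule linear_vanishes_on_span[OF V.linear_lin_ext, rotated])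
      (use F in \<open>auto simp: V.lin_ext_diff V.lin_ext_scale V.lin_ext_gen ann_balanced_def
        dual_linear_plus[OF vs lin] dual_linear_times[OF vs lin]\<close>)
qed

lemma lin_ext_ann_eq:
  assumes "ann_balanced sc F" "p - q \<in> ann_rel"
  shows "lin_ext sc (\<lambda>(x, a). F x a) p = lin_ext sc (\<lambda>(x, a). F x a) q"
  using lin_ext_ann_rel[OF assms] by (simp add: V.lin_ext_diff)

lemma ann_linear_lin_ext:
  assumes "ann_balanced sc F"
  shows "ann_linear sc (\<lambda>P. lin_ext sc (\<lambda>(x, a). F x a) (rep P))"
  using lin_ext_ann_eq[OF assms rep_ann_add] lin_ext_ann_eq[OF assms rep_ann_scale]
  by (simp add: ann_linear_def V.lin_ext_add V.lin_ext_scale)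

lemma lin_ext_ann_elem:
  assumes "ann_balanced sc F"
  shows "lin_ext sc (\<lambda>(x, a). F x a) (rep (ann_elem x a)) = F x a"
  using lin_ext_ann_eq[OF assms free.rep_coset[OF subspace_ann_rel, of "gen (x, a)"]]
  by (simp add: ann_elem_def V.lin_ext_gen)

text \<open>Linear maps are only given on the cosets in \<open>ann\<close>, that is, on representatives supported in
  \<open>dual \<times> UNIV\<close>, so the sum is built up one generator at a time.\<close>

lemma ann_linear_coset:
  assumes f: "ann_linear sc f" and p: "keys p \<subseteq> dual \<times> UNIV"
  shows "f (p +o ann_rel) = lin_ext sc (\<lambda>(x, a). f (ann_elem x a)) p"
proof -
  let ?t = "\<lambda>g. fscale (Poly_Mapping.lookup p g) (gen g)"
  have t: "keys (?t g) \<subseteq> dual \<times> UNIV" if "g \<in> keys p" for g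
    using p that by (intro keys_fscale') (auto simp: keys_gen)
  have "f ((\<Sum>g\<in>A. ?t g) +o ann_rel) = (\<Sum>g\<in>A. sc (Poly_Mapping.lookup p g) ((\<lambda>(x, a). f (ann_elem x a)) g)) \<and>
    keys (\<Sum>g\<in>A. ?t g) \<subseteq> dual \<times> UNIV"
    if "finite A" "A \<subseteq> keys p" for A
    using that
  proof (induction A rule: finite_induct)
    case empty
    have "f (ann_rel + ann_rel) = f ann_rel + f ann_rel"
      using f coset_in_ann[of 0] by (simp add: ann_linear_def sum_zero_coset)
    moreover have "ann_rel + ann_rel = ann_rel"
      using free.add_cosets[OF subspace_ann_rel, of 0 0] by (simp add: sum_zero_coset)
    ultimately show ?case by (simp add: sum_zero_coset)
  next
    case (insert g A)
    obtain x a where g: "g = (x, a)" by (cases g)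
    have x: "x \<in> dual" using insert p g by auto
    let ?s = "\<Sum>g\<in>A. ?t g"
    have IH: "f (?s +o ann_rel) = (\<Sum>g\<in>A. sc (Poly_Mapping.lookup p g) ((\<lambda>(x, a). f (ann_elem x a)) g))"
      "keys ?s \<subseteq> dual \<times> UNIV" using insert by auto
    have "?t g +o ann_rel = coset_scale fscale ann_rel (Poly_Mapping.lookup p g) (ann_elem x a)"
      by (simp add: ann_elem_def g free.scale_coset[OF subspace_ann_rel])
    then have "f (?t g +o ann_rel) = sc (Poly_Mapping.lookup p g) (f (ann_elem x a))"
      using f ann_elem_in_ann[OF x] by (simp add: ann_linear_def)
    moreover have "f ((?t g + ?s) +o ann_rel) = f (?t g +o ann_rel) + f (?s +o ann_rel)"
      unfolding free.add_cosets[OF subspace_ann_rel, symmetric]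
      using f coset_in_ann t IH(2) insert by (simp add: ann_linear_def)
    moreover have "keys (?t g + ?s) \<subseteq> dual \<times> UNIV"
      using t[of g] IH(2) insert by (intro keys_add') auto
    ultimately show ?case using insert IH by (simp add: g)
  qed
  from this[OF _ subset_refl] show ?thesis
    using free_ext_gen_id[of p] by (simp add: lin_ext_def)
qed

lemma ann_linear_rep:
  assumes f: "ann_linear sc f" and P: "P \<in> ann"
  shows "f P = lin_ext sc (\<lambda>(x, a). f (ann_elem x a)) (rep P)"
  using ann_linear_coset[OF f keys_ann[OF P]] by (simp add: rep_ann P)

lemma ann_linear_sum: "(\<And>i. i \<in> I \<Longrightarrow> ann_linear sc (f i)) \<Longrightarrow> ann_linear sc (\<lambda>P. \<Sum>i\<in>I. f i P)"
  by (simp add: ann_linear_def sum.distrib V.scale_sum_right)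

lemma ann_linear_add: "ann_linear sc f \<Longrightarrow> ann_linear sc g \<Longrightarrow> ann_linear sc (\<lambda>P. f P + g P)"
  by (simp add: ann_linear_def V.scale_right_distrib add_ac)

lemma ann_linear_scale: "ann_linear sc f \<Longrightarrow> ann_linear sc (\<lambda>P. sc c (f P))"
  by (simp add: ann_linear_def V.scale_right_distrib mult.commute)


subsection \<open>The bracket\<close>

text \<open>The value of \<open>f\<close> on \<open>[x \<otimes>\<^sub>H a, y \<otimes>\<^sub>H b]\<close>. The bracket only occurs as an argument of a cochain, so that its
  properties are needed only after applying such a linear map.\<close>

definition bracket_form ::
  "((('h \<Rightarrow> 'k) \<times> 'l \<Rightarrow>\<^sub>0 'k) set \<Rightarrow> 'v) \<Rightarrow> ('h \<Rightarrow> 'k) \<Rightarrow> 'l \<Rightarrow> ('h \<Rightarrow> 'k) \<Rightarrow> 'l \<Rightarrow> 'v"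
  where "bracket_form f x a y b = lin_ext sc (\<lambda>(hs, e).
    f (ann_elem (dual_mult (dual_act x (hs ! 0)) (dual_act y (hs ! 1))) e)) (rep (br a b))"

lemma ann_bracket_eval:
  assumes f: "ann_linear sc f" and PQ: "P \<in> ann" "Q \<in> ann"
  shows "ann_bracket P Q \<in> ann"
    and "f (ann_bracket P Q)
    = lin_ext sc (\<lambda>(x, a). lin_ext sc (\<lambda>(y, b). bracket_form f x a y b) (rep Q)) (rep P)"
proof -
  let ?g = "\<lambda>x a y b. free_ext (\<lambda>(hs, e). gen (dual_mult (dual_act x (hs ! 0)) (dual_act y (hs ! 1)), e)) (rep (br a b))"
  let ?p = "free_ext (\<lambda>(x, a). free_ext (\<lambda>(y, b). ?g x a y b) (rep Q)) (rep P)"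
  have g: "keys (?g x a y b) \<subseteq> dual \<times> UNIV" if "x \<in> dual" "y \<in> dual" for x a y b
    by (rule keys_free_ext) (use that in \<open>auto simp: keys_gen dual_mult_closed dual_act_closed\<close>)
  have p: "keys ?p \<subseteq> dual \<times> UNIV"
  proof (rule keys_free_ext)
    fix z assume "z \<in> keys (rep P)"
    then obtain x a where z: "z = (x, a)" "x \<in> dual" using keys_ann[OF PQ(1)] by auto
    have "keys (free_ext (\<lambda>(y, b). ?g x a y b) (rep Q)) \<subseteq> dual \<times> UNIV"
    proof (rule keys_free_ext)
      fix w assume "w \<in> keys (rep Q)"
      then obtain y b where w: "w = (y, b)" "y \<in> dual" using keys_ann[OF PQ(2)] by auto
      show "keys ((\<lambda>(y, b). ?g x a y b) w) \<subseteq> dual \<times> UNIV"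
        using g[OF z(2) w(2)] by (simp add: w(1))
    qed
    then show "keys ((\<lambda>(x, a). free_ext (\<lambda>(y, b). ?g x a y b) (rep Q)) z) \<subseteq> dual \<times> UNIV"
      by (simp add: z(1))
  qed
  have eq: "ann_bracket P Q = ?p +o ann_rel" by (simp add: ann_bracket_def)
  show "ann_bracket P Q \<in> ann" unfolding eq by (rule coset_in_ann[OF p])
  have "f (ann_bracket P Q) = lin_ext sc (\<lambda>(x, a). f (ann_elem x a)) ?p"
    unfolding eq by (rule ann_linear_coset[OF f p])
  also have "\<dots> = lin_ext sc (\<lambda>(x, a). lin_ext sc (\<lambda>(y, b). bracket_form f x a y b) (rep Q)) (rep P)"
    unfolding lin_ext_free_ext[OF vs] bracket_form_def
    by (intro lin_ext_cong) (auto simp: lin_ext_free_ext[OF vs] V.lin_ext_gen intro!: lin_ext_cong)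
  finally show "f (ann_bracket P Q)
    = lin_ext sc (\<lambda>(x, a). lin_ext sc (\<lambda>(y, b). bracket_form f x a y b) (rep Q)) (rep P)" .
qed

lemma dual_act_plus:
  "dual_act (\<lambda>h. x h + y h) h = (\<lambda>u. dual_act x h u + dual_act y h u)"
  "dual_act (\<lambda>h. c * x h) h = (\<lambda>u. c * dual_act x h u)"
  "x \<in> dual \<Longrightarrow> dual_act x (h + k) = (\<lambda>u. dual_act x h u + dual_act x k u)"
  "x \<in> dual \<Longrightarrow> dual_act x (scale c h) = (\<lambda>u. c * dual_act x h u)"
  by (simp_all add: dual_act_def fun_eq_iff S_add S_scale distrib_left mult_scale_right dual_add dual_scale)

lemma dual_mult_plus:
  "dual_mult (\<lambda>h. x h + x' h) y = (\<lambda>u. dual_mult x y u + dual_mult x' y u)"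
  "dual_mult y (\<lambda>h. x h + x' h) = (\<lambda>u. dual_mult y x u + dual_mult y x' u)"
  "dual_mult (\<lambda>h. c * x h) y = (\<lambda>u. c * dual_mult x y u)"
  "dual_mult y (\<lambda>h. c * x h) = (\<lambda>u. c * dual_mult y x u)"
  by (simp_all add: dual_mult_eq_swd fun_eq_iff distrib_left distrib_right mult.assoc mult.left_commute
      swd_fun_add[OF vector_space_field] swd_fun_scale[OF vector_space_field])

lemma dual_linear_swd:
  assumes g: "dual_linear sc g" and Z: "\<And>a b. Z a b \<in> dual"
  shows "swd sc (\<lambda>a b. g (Z a b)) h = g (\<lambda>u. swd (*) (\<lambda>a b. Z a b u) h)"
  using dual_linear_sum[OF vs g, of "keys (rep (\<Delta> h))" "\<lambda>hs. Z (hs ! 0) (hs ! 1)"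
      "Poly_Mapping.lookup (rep (\<Delta> h))"] Z
  by (simp add: swd_def lin_ext_def)

lemma htens_balanced_bracket:
  assumes f: "ann_linear sc f" and xy: "x \<in> dual" "y \<in> dual"
  shows "HL.htens_balanced sc (\<lambda>h k e. f (ann_elem (dual_mult (dual_act x h) (dual_act y k)) e))"
proof -
  note bal = ann_balanced_of_linear[OF f]
  have lin: "dual_linear sc (\<lambda>x. f (ann_elem x a))" for a using bal by (simp add: ann_balanced_def)
  let ?D = "\<lambda>h k. dual_mult (dual_act x h) (dual_act y k)"
  have D: "?D h k \<in> dual" for h k by (intro dual_mult_closed dual_act_closed xy)
  have add: "f (ann_elem z (a + b)) = f (ann_elem z a) + f (ann_elem z b)"
    and act: "f (ann_elem (dual_act z h) a) = f (ann_elem z (actL h a))" if "z \<in> dual" for z a b h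
    using bal that by (auto simp: ann_balanced_def)
  have ks: "f (ann_elem z (HL.ks c e)) = sc c (f (ann_elem z e))" if z: "z \<in> dual" for z c e
    using act[OF z, of "scale c 1" e] dual_linear_times[OF vs lin z]
    by (simp add: kscale_def dual_act_plus(4)[OF z] dual_act_one)
  have "swd sc (\<lambda>c d. f (ann_elem (?D (a * c) (b * d)) m)) h = f (ann_elem (?D a b) (actL h m))" for a b h m
  proof -
    have "swd sc (\<lambda>c d. f (ann_elem (?D (a * c) (b * d)) m)) h
      = f (ann_elem (\<lambda>u. swd (*) (\<lambda>c d. ?D (a * c) (b * d) u) h) m)"
      by (rule dual_linear_swd[OF lin D])
    also have "(\<lambda>u. swd (*) (\<lambda>c d. ?D (a * c) (b * d) u) h) = dual_act (?D a b) h"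
      using dual_mult_act[OF xy] by (simp add: fun_eq_iff)
    finally show ?thesis by (simp add: act[OF D])
  qed
  then show ?thesis
    by (simp add: HL.htens_balanced_def bilin_def homog_def add ks D dual_act_plus xy dual_mult_plus
        dual_linear_plus[OF vs lin] dual_linear_times[OF vs lin])
qed

lemma bracket_form_rep:
  assumes f: "ann_linear sc f" and xy: "x \<in> dual" "y \<in> dual" and p: "br a b = p +o htens_rel actL 2"
  shows "bracket_form f x a y b = lin_ext sc (\<lambda>(hs, e).
    f (ann_elem (dual_mult (dual_act x (hs ! 0)) (dual_act y (hs ! 1))) e)) p"
  unfolding bracket_form_def
  by (rule HL.lin_ext_htens_eq[OF vs htens_balanced_bracket[OF f xy]])
    (use p free.rep_coset[OF HL.subspace_htens_rel] in metis)

lemma rep_br: "rep (br a b) +o htens_rel actL 2 = br a b"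
  by (rule HL.rep_htens[OF br_closed])

text \<open>The bracket is skew because the one of \<open>L\<close> is and \<open>X\<close> is commutative.\<close>

lemma bracket_form_skew:
  assumes f: "ann_linear sc f" and xy: "x \<in> dual" "y \<in> dual"
  shows "bracket_form f y b x a = - bracket_form f x a y b"
proof -
  have "bracket_form f y b x a = lin_ext sc (\<lambda>(hs, e).
      f (ann_elem (dual_mult (dual_act y (hs ! 0)) (dual_act x (hs ! 1))) e))
      (- permute (\<lambda>hs. [hs ! 1, hs ! 0]) (rep (br a b)))"
    by (rule bracket_form_rep[OF f xy(2,1) br_skew])
  also have "\<dots> = - lin_ext sc (\<lambda>(hs, e).
      f (ann_elem (dual_mult (dual_act y (hs ! 1)) (dual_act x (hs ! 0))) e)) (rep (br a b))"
    unfolding permute_def V.lin_ext_minus lin_ext_free_ext[OF vs]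
    by (intro arg_cong[where f = uminus] lin_ext_cong) (auto simp: V.lin_ext_gen)
  also have "\<dots> = - bracket_form f x a y b"
    unfolding bracket_form_def using xy by (simp add: dual_mult_commute dual_act_closed)
  finally show ?thesis .
qed

lemma ann_balanced_bracket_form:
  assumes f: "ann_linear sc f" and y: "y \<in> dual"
  shows "ann_balanced sc (\<lambda>x a. bracket_form f x a y b)"
proof -
  note bal = ann_balanced_of_linear[OF f]
  have lin: "dual_linear sc (\<lambda>x. f (ann_elem x a))" for a using bal by (simp add: ann_balanced_def)
  have D: "dual_mult (dual_act x h) (dual_act y k) \<in> dual" if "x \<in> dual" for x h k
    using that y by (intro dual_mult_closed dual_act_closed)
  show ?thesis
    unfolding ann_balanced_def dual_linear_def
  proof (intro conjI allI ballI)
    fix x x' a assume x: "x \<in> dual" "x' \<in> dual"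
    show "bracket_form f (\<lambda>h. x h + x' h) a y b = bracket_form f x a y b + bracket_form f x' a y b"
      unfolding bracket_form_def V.lin_ext_fun_add[symmetric]
      by (intro lin_ext_cong) (auto simp: dual_act_plus dual_mult_plus dual_linear_plus[OF vs lin] D x)
  next
    fix c x a assume x: "x \<in> dual"
    show "bracket_form f (\<lambda>h. c * x h) a y b = sc c (bracket_form f x a y b)"
      unfolding bracket_form_def V.lin_ext_fun_scale[symmetric]
      by (intro lin_ext_cong) (auto simp: dual_act_plus dual_mult_plus dual_linear_times[OF vs lin] D x)
  next
    fix x a a' assume x: "x \<in> dual"
    have "br (a + a') b = (rep (br a b) + rep (br a' b)) +o htens_rel actL 2"
      unfolding free.add_cosets[OF HL.subspace_htens_rel, symmetric] rep_br by (rule br_add_left)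
    from bracket_form_rep[OF f x y this]
    show "bracket_form f x (a + a') y b = bracket_form f x a y b + bracket_form f x a' y b"
      unfolding bracket_form_def by (simp add: V.lin_ext_add)
  next
    fix x h a assume x: "x \<in> dual"
    have "br (actL h a) b = lmult [h, 1] (rep (br a b)) +o htens_rel actL 2"
      using br_hlinear[of h a 1 b] by (simp add: L.act_one)
    from bracket_form_rep[OF f x y this]
    have "bracket_form f x (actL h a) y b = lin_ext sc (\<lambda>(hs, e).
      f (ann_elem (dual_mult (dual_act (dual_act x h) (hs ! 0)) (dual_act y (hs ! 1))) e)) (rep (br a b))"
      unfolding lmult_def lin_ext_free_ext[OF vs]
    proof (rule trans, intro lin_ext_cong)
      fix z assume "z \<in> keys (rep (br a b))"
      then obtain hs e where z: "z = (hs, e)" "length hs = 2" using HL.keys_htens[OF br_closed, of a b] by auto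
      from two_element_list[OF z(2)] obtain h0 h1 where "hs = [h0, h1]" by metis
      then show "lin_ext sc (\<lambda>(hs, e). f (ann_elem (dual_mult (dual_act x (hs ! 0)) (dual_act y (hs ! 1))) e))
          ((\<lambda>(hs, m). gen (map2 (*) [h, 1] hs, m)) z)
        = (\<lambda>(hs, e). f (ann_elem (dual_mult (dual_act (dual_act x h) (hs ! 0)) (dual_act y (hs ! 1))) e)) z"
        by (simp add: z(1) V.lin_ext_gen dual_act_act)
    qed
    then show "bracket_form f (dual_act x h) a y b = bracket_form f x (actL h a) y b"
      by (simp add: bracket_form_def)
  qed
qed

lemma ann_balanced_bracket_form_right:
  assumes f: "ann_linear sc f" and x: "x \<in> dual"
  shows "ann_balanced sc (\<lambda>y b. bracket_form f x a y b)"
  using ann_balanced_bracket_form[OF f x, of a] bracket_form_skew[OF f _ x]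
  unfolding ann_balanced_def dual_linear_def
  by (simp add: dual_plus dual_times dual_act_closed)

lemma ann_linear_bracket_left:
  assumes f: "ann_linear sc f" and Q: "Q \<in> ann"
  shows "ann_linear sc (\<lambda>P. f (ann_bracket P Q))"
proof -
  let ?F = "\<lambda>x a. lin_ext sc (\<lambda>(y, b). bracket_form f x a y b) (rep Q)"
  have "ann_balanced sc ?F"
  proof -
    have *: "?F x a = lin_ext sc (\<lambda>z. bracket_form f x a (fst z) (snd z)) (rep Q)" for x a
      by (simp add: case_prod_unfold)
    have d: "fst z \<in> dual" if "z \<in> keys (rep Q)" for z using that keys_ann[OF Q] by auto
    have b: "ann_balanced sc (\<lambda>x a. bracket_form f x a (fst z) (snd z))" if "z \<in> keys (rep Q)" for z
      by (rule ann_balanced_bracket_form[OF f d[OF that]])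
    show ?thesis
      unfolding * ann_balanced_def dual_linear_def V.lin_ext_fun_add[symmetric] V.lin_ext_fun_scale[symmetric]
      using b[unfolded ann_balanced_def dual_linear_def] by (auto intro!: lin_ext_cong)
  qed
  from ann_linear_lin_ext[OF this] show ?thesis
    using ann_bracket_eval(2)[OF f _ Q] ann_add_closed ann_scale_closed by (simp add: ann_linear_def)
qed

lemma ann_bracket_skew:
  assumes f: "ann_linear sc f" and PQ: "P \<in> ann" "Q \<in> ann"
  shows "f (ann_bracket Q P) = - f (ann_bracket P Q)"
proof -
  have "f (ann_bracket Q P)
    = lin_ext sc (\<lambda>z. lin_ext sc (\<lambda>w. bracket_form f (fst z) (snd z) (fst w) (snd w)) (rep P)) (rep Q)"
    by (simp add: ann_bracket_eval(2)[OF f PQ(2,1)] case_prod_unfold)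
  also have "\<dots> = lin_ext sc (\<lambda>w. lin_ext sc (\<lambda>z. bracket_form f (fst z) (snd z) (fst w) (snd w)) (rep Q)) (rep P)"
    by (rule V.lin_ext_swap)
  also have "\<dots> = lin_ext sc (\<lambda>w. lin_ext sc (\<lambda>z. - bracket_form f (fst w) (snd w) (fst z) (snd z)) (rep Q)) (rep P)"
    by (intro lin_ext_cong bracket_form_skew[OF f]) (use keys_ann[OF PQ(1)] keys_ann[OF PQ(2)] in auto)
  also have "\<dots> = - f (ann_bracket P Q)"
    by (simp add: ann_bracket_eval(2)[OF f PQ] case_prod_unfold V.lin_ext_fun_minus)
  finally show ?thesis .
qed

lemma ann_linear_bracket_right:
  assumes f: "ann_linear sc f" and P: "P \<in> ann"
  shows "ann_linear sc (\<lambda>Q. f (ann_bracket P Q))"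
  using ann_linear_bracket_left[OF f P] ann_bracket_skew[OF f _ P] ann_add_closed ann_scale_closed
  by (simp add: ann_linear_def)

lemma ann_bracket_elem:
  assumes f: "ann_linear sc f" and xy: "x \<in> dual" "y \<in> dual"
  shows "f (ann_bracket (ann_elem x a) (ann_elem y b)) = bracket_form f x a y b"
proof -
  note e = ann_elem_in_ann[OF xy(1)] ann_elem_in_ann[OF xy(2)]
  have "f (ann_bracket (ann_elem x a) (ann_elem y b))
    = lin_ext sc (\<lambda>(x', a'). f (ann_bracket (ann_elem x' a') (ann_elem y b))) (rep (ann_elem x a))"
    by (rule ann_linear_rep[OF ann_linear_bracket_left[OF f e(2)] e(1)])
  have "f (ann_bracket (ann_elem x a) (ann_elem y b))
    = lin_ext sc (\<lambda>(x', a'). lin_ext sc (\<lambda>(y', b'). bracket_form f x' a' y' b') (rep (ann_elem y b))) (rep (ann_elem x a))"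
    by (rule ann_bracket_eval(2)[OF f e])
  also have "\<dots> = lin_ext sc (\<lambda>(x', a'). bracket_form f x' a' y b) (rep (ann_elem x a))"
  proof (rule lin_ext_cong)
    fix z assume "z \<in> keys (rep (ann_elem x a))"
    then obtain x' a' where z: "z = (x', a')" "x' \<in> dual" using keys_ann[OF e(1), of a] by auto
    show "(\<lambda>(x', a'). lin_ext sc (\<lambda>(y', b'). bracket_form f x' a' y' b') (rep (ann_elem y b))) z
      = (\<lambda>(x', a'). bracket_form f x' a' y b) z"
      using lin_ext_ann_elem[OF ann_balanced_bracket_form_right[OF f z(2)]] by (simp add: z(1))
  qed
  also have "\<dots> = bracket_form f x a y b"
    by (rule lin_ext_ann_elem[OF ann_balanced_bracket_form[OF f xy(2)]])
  finally show ?thesis .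
qed

end

end


section \<open>Cochains of the annihilation algebra\<close>

sublocale lie_pseudoalgebra_module \<subseteq> HM: hopf_module scale \<Delta> \<epsilon> S actM ..

subsection \<open>Omission and insertion in lists\<close>

lemma omit_append:
  "i < length us \<Longrightarrow> omit i (us @ vs) = omit i us @ vs"
  "length us \<le> i \<Longrightarrow> omit i (us @ vs) = us @ omit (i - length us) vs"
  by (simp_all add: omit_def Suc_diff_le)

lemma omit_zero_Cons [simp]: "omit 0 (x # xs) = xs" and omit_Suc_Cons [simp]: "omit (Suc i) (x # xs) = x # omit i xs"
  by (simp_all add: omit_def)

lemma length_omit: "i < length xs \<Longrightarrow> length (omit i xs) = length xs - 1"
  by (simp add: omit_def)

lemma set_omit: "set (omit i xs) \<subseteq> set xs"
  unfolding omit_def using set_take_subset set_drop_subset by fastforce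

lemma omit_slot_less: "i < length us \<Longrightarrow> omit i (us @ x # vs) = omit i us @ x # vs"
  by (simp add: omit_append)

lemma omit_slot_eq: "omit (length us) (us @ x # vs) = us @ vs"
  by (simp add: omit_append)

lemma omit_slot_greater: "length us < i \<Longrightarrow> omit i (us @ x # vs) = us @ x # omit (i - Suc (length us)) vs"
proof -
  assume "length us < i"
  then obtain k where "i = length us + Suc k" by (metis less_imp_Suc_add add_Suc_right)
  then show ?thesis by (simp add: omit_append)
qed

lemma omit_adjacent:
  "i \<noteq> length us \<Longrightarrow> i \<noteq> Suc (length us) \<Longrightarrow> omit i (us @ x # y # vs) =
    (if i < length us then omit i us @ x # y # vs else us @ x # y # omit (i - length us - 2) vs)"
proof (cases "i < length us")
  case False
  assume "i \<noteq> length us" "i \<noteq> Suc (length us)"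
  then obtain k where "i = length us + Suc (Suc k)"
    using False by (metis add_Suc_right less_imp_Suc_add not_less_less_Suc_eq linorder_neqE_nat add_Suc)
  then show ?thesis by (simp add: omit_append)
qed (simp add: omit_append)

lemma omit_nth_less: "i < j \<Longrightarrow> j < length xs \<Longrightarrow> omit j xs ! i = xs ! i"
  by (simp add: omit_def nth_append)

lemma omit_map2:
  assumes "length xs = length ys"
  shows "omit i (map2 f xs ys) = map2 f (omit i xs) (omit i ys)"
  using assms by (simp add: omit_def take_map drop_map take_zip drop_zip zip_append)

lemma prod_list_insert_at:
  assumes "i \<le> length t" "length xs = Suc (length t)"
  shows "prod_list (map2 f xs (insert_at i h t)) = f (xs ! i) h * (prod_list (map2 f (omit i xs) t) :: 'a::comm_monoid_mult)"
proof -
  have xs: "xs = take i xs @ xs ! i # drop (Suc i) xs"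
    using assms by (intro id_take_nth_drop) simp
  have "prod_list (map2 f (take i xs @ xs ! i # drop (Suc i) xs) (take i t @ h # drop i t))
    = prod_list (map2 f (take i xs) (take i t)) * (f (xs ! i) h * prod_list (map2 f (drop (Suc i) xs) (drop i t)))"
    by (rule prod_list_map2_slot) (use assms in simp)
  moreover have "map2 f (omit i xs) t = map2 f (take i xs) (take i t) @ map2 f (drop (Suc i) xs) (drop i t)"
    unfolding omit_def by (subst append_take_drop_id[of i t, symmetric], subst zip_append) (use assms in simp_all)
  ultimately show ?thesis
    unfolding insert_at_def by (subst xs) (simp add: mult_ac)
qed

lemma length_insert_at [simp]: "length (insert_at i x xs) = Suc (length xs)"
  by (simp add: insert_at_def)


subsection \<open>The pairing on elementary operations\<close>

context hopf_module
begin

text \<open>With all other arguments fixed, the contraction is a multiple of the value of \<open>x\<close> at one element.\<close>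

lemma dual_linear_pairing:
  assumes "tens_supp (length us + length vs + 1) p"
  shows "dual_linear ks (\<lambda>x. pairing (us @ x # vs) p)"
proof -
  have *: "\<exists>c h. \<forall>x. eval_prod (us @ x # vs) (fst z) = c * x (S h)"
    if "z \<in> keys p" for z
  proof -
    have "length (fst z) = length us + length vs + 1" using assms that by auto
    then obtain us' h vs' where "fst z = us' @ h # vs'" "length us' = length us" "length vs' = length vs"
      by (rule split_at_length)
    then show ?thesis
      by (intro exI[of _ "eval_prod us us' * eval_prod vs vs'"] exI[of _ h])
        (simp add: prod_list_map2_slot mult_ac)
  qed
  show ?thesis
    unfolding dual_linear_def pairing_def K.lin_ext_fun_add[symmetric] K.lin_ext_fun_scale[symmetric]
  proof (intro conjI allI ballI lin_ext_cong)
    fix x y z assume "z \<in> keys p"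
    from *[OF this] obtain c h where
      "\<And>x. eval_prod (us @ x # vs) (fst z) = c * x (S h)" by blast
    then show "(case z of (hs, m) \<Rightarrow> ks (eval_prod (us @ (\<lambda>h. x h + y h) # vs) hs) m)
      = (case z of (hs, m) \<Rightarrow> ks (eval_prod (us @ x # vs) hs) m)
      + (case z of (hs, m) \<Rightarrow> ks (eval_prod (us @ y # vs) hs) m)"
      by (simp only: case_prod_unfold distrib_left K.scale_left_distrib)
  next
    fix c' x z assume "z \<in> keys p"
    from *[OF this] obtain c h where
      "\<And>x. eval_prod (us @ x # vs) (fst z) = c * x (S h)" by blast
    then show "(case z of (hs, m) \<Rightarrow> ks (eval_prod (us @ (\<lambda>h. c' * x h) # vs) hs) m)
      = ks c' (case z of (hs, m) \<Rightarrow> ks (eval_prod (us @ x # vs) hs) m)"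
      by (simp only: case_prod_unfold K.scale_scale mult.left_commute)
  qed
qed

lemma pairing_free_ext:
  assumes "\<And>hs m. (hs, m) \<in> keys p \<Longrightarrow> pairing xs (f (hs, m)) = ks (eval_prod ys hs) m"
  shows "pairing xs (free_ext f p) = pairing ys p"
  unfolding lin_ext_comp[OF linear_pairing]
  unfolding pairing_def[of ys] by (intro lin_ext_cong) (use assms in auto)

lemma pairing_lmult:
  assumes "tens_supp n p" "length xs = n" "length fs = n"
  shows "pairing xs (lmult fs p) = pairing (map2 dual_act xs fs) p"
  unfolding lmult_def
proof (rule pairing_free_ext)
  fix hs m assume "(hs, m) \<in> keys p"
  then have "length hs = n" using assms(1) by auto
  then have "map2 (\<lambda>x h. x (S h)) xs (map2 (*) fs hs) = map2 (\<lambda>x h. x (S h)) (map2 dual_act xs fs) hs"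
    using assms by (intro nth_equalityI) (auto simp: dual_act_antipode)
  then show "pairing xs ((\<lambda>(hs, m). gen (map2 (*) fs hs, m)) (hs, m))
    = ks (eval_prod (map2 dual_act xs fs) hs) m"
    by (simp add: pairing_gen)
qed

lemma pairing_permute:
  assumes "\<And>hs m. (hs, m) \<in> keys p \<Longrightarrow>
    eval_prod xs (\<sigma> hs) = eval_prod ys hs"
  shows "pairing xs (permute \<sigma> p) = pairing ys p"
  unfolding permute_def by (rule pairing_free_ext) (use assms in \<open>simp add: pairing_gen\<close>)

lemma pairing_swap:
  assumes keys: "tens_supp (length us + length vs + 2) p"
  shows "pairing (us @ x # y # vs)
      (permute (\<lambda>hs. hs[length us := hs ! Suc (length us), Suc (length us) := hs ! length us]) p)
    = pairing (us @ y # x # vs) p"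
proof (rule pairing_permute)
  fix hs m assume "(hs, m) \<in> keys p"
  then have len: "length hs = length us + length (() # map (\<lambda>_. ()) vs) + 1" using keys by auto
  obtain us' h ws where 1: "hs = us' @ h # ws" "length us' = length us" "length ws = Suc (length vs)"
    using split_at_length[OF len] by auto
  obtain k vs' where 2: "ws = k # vs'" "length vs' = length vs" using 1(3) by (cases ws) auto
  have "hs[length us := hs ! Suc (length us), Suc (length us) := hs ! length us] = us' @ k # h # vs'"
    using 1 2 by (simp add: list_update_append nth_append flip: 1(2))
  then show "eval_prod (us @ x # y # vs)
      (hs[length us := hs ! Suc (length us), Suc (length us) := hs ! length us])
    = eval_prod (us @ y # x # vs) hs"
    using 1 2 by (simp add: mult_ac)
qed

lemma pairing_insert_one:
  assumes "tens_supp (Suc n) p" "length xs = Suc n" "i < Suc n"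
  shows "pairing xs (permute (\<lambda>hs. insert_at i (hd hs) (tl hs)) p) = pairing (xs ! i # omit i xs) p"
proof (rule pairing_permute)
  fix hs m assume "(hs, m) \<in> keys p"
  then have "length hs = Suc n" using assms(1) by auto
  then obtain h t where "hs = h # t" "length t = n" by (auto simp: length_Suc_conv)
  then show "eval_prod xs (insert_at i (hd hs) (tl hs))
    = eval_prod (xs ! i # omit i xs) hs"
    using assms(2,3) by (simp add: prod_list_insert_at)
qed

lemma pairing_insert_two:
  assumes "tens_supp (Suc (Suc n)) p" "length xs = Suc (Suc n)" "i < j" "j < Suc (Suc n)"
  shows "pairing xs (permute (\<lambda>hs. insert_at j (hs ! 1) (insert_at i (hs ! 0) (drop 2 hs))) p)
    = pairing (xs ! i # xs ! j # omit i (omit j xs)) p"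
proof (rule pairing_permute)
  fix hs m assume "(hs, m) \<in> keys p"
  then have "length hs = Suc (Suc n)" using assms(1) by auto
  then obtain h k t where "hs = h # k # t" "length t = n" by (auto simp: length_Suc_conv)
  then show "eval_prod xs (insert_at j (hs ! 1) (insert_at i (hs ! 0) (drop 2 hs)))
    = eval_prod (xs ! i # xs ! j # omit i (omit j xs)) hs"
    using assms(2-4) by (simp add: prod_list_insert_at length_omit omit_nth_less mult_ac)
qed

lemma tens_coset_eqI:
  assumes "tens_supp n p" "tens_supp n q"
    and "\<And>xs. length xs = n \<Longrightarrow> set xs \<subseteq> dual \<Longrightarrow> pairing xs p = pairing xs q"
  shows "p +o tens_rel act n = q +o tens_rel act n"
  unfolding free.coset_eq_iff[OF subspace_tens_rel]
  by (rule pairing_separates[OF keys_diff'[OF assms(1,2)]]) (simp add: assms(3) lin_diff[OF linear_pairing])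

lemma tens_eqI:
  assumes "C \<in> tens act n" "D \<in> tens act n"
    and "\<And>xs. length xs = n \<Longrightarrow> set xs \<subseteq> dual \<Longrightarrow> pairing xs (rep C) = pairing xs (rep D)"
  shows "C = D"
  using tens_coset_eqI[OF keys_tens[OF assms(1)] keys_tens[OF assms(2)] assms(3)] assms(1,2)
  by (simp add: rep_tens)

lemma coset_in_tens: "tens_supp n p \<Longrightarrow> p +o tens_rel act n \<in> tens act n"
  unfolding tens_def classes_def by blast

lemma pairing_rep_coset:
  "length xs = n \<Longrightarrow> set xs \<subseteq> dual \<Longrightarrow> pairing xs (rep (p +o tens_rel act n)) = pairing xs p"
  by (rule pairing_eq) (auto intro: free.rep_coset[OF subspace_tens_rel])

lemma tens_add:
  assumes "C \<in> tens act n" "D \<in> tens act n"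
  shows "C + D \<in> tens act n"
    and "length xs = n \<Longrightarrow> set xs \<subseteq> dual \<Longrightarrow> pairing xs (rep (C + D)) = pairing xs (rep C) + pairing xs (rep D)"
proof -
  have eq: "C + D = (rep C + rep D) +o tens_rel act n"
    using free.add_cosets[OF subspace_tens_rel, of "rep C" n "rep D"] assms by (simp add: rep_tens)
  show "C + D \<in> tens act n" unfolding eq by (intro coset_in_tens keys_add' keys_tens assms)
  show "pairing xs (rep (C + D)) = pairing xs (rep C) + pairing xs (rep D)"
    if "length xs = n" "set xs \<subseteq> dual"
    unfolding eq pairing_rep_coset[OF that] by (rule lin_add[OF linear_pairing])
qed

lemma tens_scale:
  assumes "C \<in> tens act n"
  shows "coset_scale fscale (tens_rel act n) c C \<in> tens act n"
    and "length xs = n \<Longrightarrow> set xs \<subseteq> dual \<Longrightarrow>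
      pairing xs (rep (coset_scale fscale (tens_rel act n) c C)) = ks c (pairing xs (rep C))"
proof -
  have eq: "coset_scale fscale (tens_rel act n) c C = fscale c (rep C) +o tens_rel act n"
    using free.scale_coset[OF subspace_tens_rel, of n c "rep C"] assms by (simp add: rep_tens)
  show "coset_scale fscale (tens_rel act n) c C \<in> tens act n"
    unfolding eq by (intro coset_in_tens keys_fscale' keys_tens assms)
  show "pairing xs (rep (coset_scale fscale (tens_rel act n) c C)) = ks c (pairing xs (rep C))"
    if "length xs = n" "set xs \<subseteq> dual"
    unfolding eq pairing_rep_coset[OF that] by (rule lin_scale[OF linear_pairing])
qed

end


subsection \<open>The action of the annihilation algebra\<close>

context lie_pseudoalgebra_module
begin

lemmas vsM = HM.vector_space_ks

text \<open>The action of \<open>x \<otimes>\<^sub>H a\<close> on \<open>M\<close>, computed on an arbitrary representative of \<open>a * m\<close>.\<close>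

definition act_form :: "('h \<Rightarrow> 'k) \<Rightarrow> 'l \<Rightarrow> 'm \<Rightarrow> 'm"
  where "act_form x a m = HM.htens_eval x (rep (pact a m))"

lemma act_form_rep:
  assumes "x \<in> dual" "pact a m = p +o htens_rel actM 2"
  shows "act_form x a m = HM.htens_eval x p"
  unfolding act_form_def
  by (rule HM.htens_eval_eq[OF assms(1)]) (simp add: assms(2) free.rep_coset[OF HM.subspace_htens_rel])

lemma rep_pact: "rep (pact a m) +o htens_rel actM 2 = pact a m"
  by (rule HM.rep_htens[OF pact_closed])

lemma htens_eval_add: "HM.htens_eval x (p + q) = HM.htens_eval x p + HM.htens_eval x q"
  and htens_eval_scale: "HM.htens_eval x (fscale c p) = HM.ks c (HM.htens_eval x p)"
  by (simp_all add: HM.htens_eval_def HM.K.lin_ext_add HM.K.lin_ext_scale)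

lemma ann_act_eval:
  assumes "P \<in> ann"
  shows "ann_act P m = lin_ext HM.ks (\<lambda>(x, a). act_form x a m) (rep P)"
  unfolding ann_act_def act_form_def
  by (intro lin_ext_cong) (use keys_ann[OF assms] in \<open>auto simp: HM.straighten_eval[OF _ pact_closed]\<close>)

lemma linear_act_form: assumes "x \<in> dual" shows "Vector_Spaces.linear HM.ks HM.ks (act_form x a)"
proof (rule linearI_vs[OF vsM vsM])
  fix m m' c
  have "pact a (m + m') = (rep (pact a m) + rep (pact a m')) +o htens_rel actM 2"
    unfolding free.add_cosets[OF HM.subspace_htens_rel, symmetric] rep_pact by (rule pact_add_right)
  from act_form_rep[OF assms this] show "act_form x a (m + m') = act_form x a m + act_form x a m'"
    by (simp add: htens_eval_add act_form_def)
  have "pact a (HM.ks c m) = fscale c (rep (pact a m)) +o htens_rel actM 2"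
    unfolding free.scale_coset[OF HM.subspace_htens_rel, symmetric] rep_pact by (rule pact_scale_right)
  from act_form_rep[OF assms this] show "act_form x a (HM.ks c m) = HM.ks c (act_form x a m)"
    by (simp add: htens_eval_scale act_form_def)
qed

lemma ann_balanced_act_form: "ann_balanced HM.ks (\<lambda>x a. act_form x a m)"
  unfolding ann_balanced_def dual_linear_def
proof (intro conjI allI ballI)
  fix x y a assume "x \<in> dual" "y \<in> dual"
  have "HM.straight_eval (\<lambda>h. x h + y h) f g v = HM.straight_eval x f g v + HM.straight_eval y f g v" for f g v
    unfolding HM.straight_eval_def using xact_lincomb[of 1 _ 1] by (simp add: M.act_add_left)
  then show "act_form (\<lambda>h. x h + y h) a m = act_form x a m + act_form y a m"
    unfolding act_form_def HM.htens_eval_def HM.K.lin_ext_fun_add[symmetric] by (simp add: case_prod_unfold)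
next
  fix c x a assume "x \<in> dual"
  have "HM.straight_eval (\<lambda>h. c * x h) f g v = HM.ks c (HM.straight_eval x f g v)" for f g v
    unfolding HM.straight_eval_def using xact_lincomb[of c _ 0 "\<lambda>u. x (S (f * S u))"] by (simp add: HM.act_scale)
  then show "act_form (\<lambda>h. c * x h) a m = HM.ks c (act_form x a m)"
    unfolding act_form_def HM.htens_eval_def HM.K.lin_ext_fun_scale[symmetric] by (simp add: case_prod_unfold)
next
  fix x a b assume x: "x \<in> dual"
  have "pact (a + b) m = (rep (pact a m) + rep (pact b m)) +o htens_rel actM 2"
    unfolding free.add_cosets[OF HM.subspace_htens_rel, symmetric] rep_pact by (rule pact_add_left)
  from act_form_rep[OF x this] show "act_form x (a + b) m = act_form x a m + act_form x b m"
    by (simp add: htens_eval_add act_form_def)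
next
  fix x h a assume x: "x \<in> dual"
  have "pact (actL h a) m = lmult [h, 1] (rep (pact a m)) +o htens_rel actM 2"
    using pact_hlinear[of h a 1 m] by (simp add: M.act_one)
  from act_form_rep[OF x this]
  have "act_form x (actL h a) m = HM.htens_eval x (lmult [h, 1] (rep (pact a m)))" .
  also have "\<dots> = HM.htens_eval (dual_act x h) (rep (pact a m))"
    unfolding HM.htens_eval_def lmult_def lin_ext_free_ext[OF vsM]
  proof (rule lin_ext_cong)
    fix z assume "z \<in> keys (rep (pact a m))"
    then obtain hs v where z: "z = (hs, v)" "length hs = 2" using HM.keys_htens[OF pact_closed, of a m] by auto
    from two_element_list[OF z(2)] obtain f g where hs: "hs = [f, g]" by metis
    have "(\<lambda>u. x (S (h * f * S u))) = (\<lambda>u. dual_act x h (S (f * S u)))"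
      by (simp add: dual_act_antipode mult.assoc)
    then show "lin_ext HM.ks (\<lambda>(hs, v). HM.straight_eval x (hs ! 0) (hs ! 1) v) ((\<lambda>(hs, m). gen (map2 (*) [h, 1] hs, m)) z)
      = (\<lambda>(hs, v). HM.straight_eval (dual_act x h) (hs ! 0) (hs ! 1) v) z"
      by (simp add: z(1) hs HM.K.lin_ext_gen HM.straight_eval_def)
  qed
  finally show "act_form (dual_act x h) a m = act_form x (actL h a) m" by (simp add: act_form_def)
qed

lemma ann_linear_act: "ann_linear HM.ks (\<lambda>P. ann_act P m)"
  using ann_linear_lin_ext[OF vsM ann_balanced_act_form, of m]
  by (simp add: ann_linear_def ann_act_eval ann_add_closed ann_scale_closed)

lemma linear_ann_act: assumes "P \<in> ann" shows "Vector_Spaces.linear HM.ks HM.ks (ann_act P)"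
proof (rule linearI_vs[OF vsM vsM])
  have x: "x \<in> dual" if "(x, a) \<in> keys (rep P)" for x a using that keys_ann[OF assms] by auto
  fix m m' c
  show "ann_act P (m + m') = ann_act P m + ann_act P m'"
    unfolding ann_act_eval[OF assms] HM.K.lin_ext_fun_add[symmetric]
    by (intro lin_ext_cong) (auto simp: lin_add[OF linear_act_form[OF x]])
  show "ann_act P (HM.ks c m) = HM.ks c (ann_act P m)"
    unfolding ann_act_eval[OF assms] HM.K.lin_ext_fun_scale[symmetric]
    by (intro lin_ext_cong) (auto simp: lin_scale[OF linear_act_form[OF x]])
qed

lemma ann_act_elem: "x \<in> dual \<Longrightarrow> ann_act (ann_elem x a) m = act_form x a m"
  using lin_ext_ann_elem[OF vsM ann_balanced_act_form] by (simp add: ann_act_eval ann_elem_in_ann)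


subsection \<open>Alternating multilinear maps\<close>

definition ann_multilinear :: "nat \<Rightarrow> ((('h \<Rightarrow> 'k) \<times> 'l \<Rightarrow>\<^sub>0 'k) set list \<Rightarrow> 'm) \<Rightarrow> bool"
  where "ann_multilinear n c \<longleftrightarrow> (\<forall>us vs. length us + length vs + 1 = n \<and> set us \<subseteq> ann \<and> set vs \<subseteq> ann \<longrightarrow>
    ann_linear HM.ks (\<lambda>P. c (us @ P # vs)))"

lemma ce_cochains_iff:
  "c \<in> ce_cochains n \<longleftrightarrow> (\<forall>Ps. \<not> (length Ps = n \<and> set Ps \<subseteq> ann) \<longrightarrow> c Ps = 0) \<and> ann_multilinear n c \<and>
    (\<forall>Ps. length Ps = n \<and> set Ps \<subseteq> ann \<and> \<not> distinct Ps \<longrightarrow> c Ps = 0)"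
  unfolding ce_cochains_def ann_multilinear_def ann_linear_def by simp blast

lemma ann_multilinearD:
  "ann_multilinear n c \<Longrightarrow> length us + length vs + 1 = n \<Longrightarrow> set us \<subseteq> ann \<Longrightarrow> set vs \<subseteq> ann \<Longrightarrow>
    ann_linear HM.ks (\<lambda>P. c (us @ P # vs))"
  by (simp add: ann_multilinear_def)

text \<open>Polarisation: expand the value at two neighbours equal to \<open>P + Q\<close>.\<close>

lemma skew_of_adjacent_zero:
  assumes c: "ann_multilinear n c"
    and zero: "\<And>us P vs. length us + length vs + 2 = n \<Longrightarrow> set us \<subseteq> ann \<Longrightarrow> set vs \<subseteq> ann \<Longrightarrow> P \<in> ann \<Longrightarrow>
      c (us @ P # P # vs) = 0"
    and len: "length us + length vs + 2 = n" and sub: "set us \<subseteq> ann" "set vs \<subseteq> ann" "P \<in> ann" "Q \<in> ann"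
  shows "c (us @ P # Q # vs) = - c (us @ Q # P # vs)"
proof -
  have l1: "ann_linear HM.ks (\<lambda>X. c (us @ X # Y # vs))" if "Y \<in> ann" for Y
    by (rule ann_multilinearD[OF c]) (use len sub that in auto)
  have l2: "ann_linear HM.ks (\<lambda>X. c (us @ Y # X # vs))" if "Y \<in> ann" for Y
    using ann_multilinearD[OF c, of "us @ [Y]" vs] len sub that by simp
  note PQ = ann_add_closed[OF sub(3,4)]
  have "0 = c (us @ (P + Q) # (P + Q) # vs)" using zero[OF len sub(1,2) PQ] by simp
  also have "\<dots> = c (us @ P # (P + Q) # vs) + c (us @ Q # (P + Q) # vs)"
    using l1[OF PQ] sub by (simp add: ann_linear_def)
  also have "\<dots> = (c (us @ P # P # vs) + c (us @ P # Q # vs)) + (c (us @ Q # P # vs) + c (us @ Q # Q # vs))"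
    using l2[OF sub(3)] l2[OF sub(4)] sub by (simp add: ann_linear_def)
  also have "\<dots> = c (us @ P # Q # vs) + c (us @ Q # P # vs)"
    using zero[OF len sub(1,2,3)] zero[OF len sub(1,2,4)] by simp
  finally show ?thesis by (simp add: eq_neg_iff_add_eq_0)
qed

lemma zero_of_adjacent_zero:
  assumes skew: "\<And>us P Q vs. length us + length vs + 2 = n \<Longrightarrow> set us \<subseteq> ann \<Longrightarrow> set vs \<subseteq> ann \<Longrightarrow> P \<in> ann \<Longrightarrow> Q \<in> ann \<Longrightarrow>
      c (us @ P # Q # vs) = - c (us @ Q # P # vs)"
    and zero: "\<And>us P vs. length us + length vs + 2 = n \<Longrightarrow> set us \<subseteq> ann \<Longrightarrow> set vs \<subseteq> ann \<Longrightarrow> P \<in> ann \<Longrightarrow>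
      c (us @ P # P # vs) = (0::'m)"
    and "length Ps = n" "set Ps \<subseteq> ann" "\<not> distinct Ps"
  shows "c Ps = 0"
proof -
  have "c (us @ P # ws @ P # vs) = 0"
    if "length us + length ws + length vs + 2 = n" "set us \<union> set ws \<union> set vs \<union> {P} \<subseteq> ann" for us ws vs P
    using that
  proof (induction ws arbitrary: us)
    case Nil
    then show ?case using zero by simp
  next
    case (Cons w ws)
    have "c (us @ P # w # (ws @ P # vs)) = - c (us @ w # P # (ws @ P # vs))"
      by (rule skew) (use Cons.prems in auto)
    moreover have "c ((us @ [w]) @ P # ws @ P # vs) = 0"
      by (rule Cons.IH) (use Cons.prems in auto)
    ultimately show ?case by simp
  qed
  moreover obtain us P ws vs where "Ps = us @ [P] @ ws @ [P] @ vs"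
    using not_distinct_decomp[OF assms(5)] by blast
  ultimately show ?thesis using assms(3,4) by auto
qed

lemma ce_skew:
  assumes "c \<in> ce_cochains n" "length us + length vs + 2 = n" "set us \<subseteq> ann" "set vs \<subseteq> ann" "P \<in> ann" "Q \<in> ann"
  shows "c (us @ P # Q # vs) = - c (us @ Q # P # vs)"
  by (rule skew_of_adjacent_zero[of n]) (use assms in \<open>auto simp: ce_cochains_iff\<close>)

lemma ce_move_front:
  assumes c: "c \<in> ce_cochains n"
    and "length us + length vs + 1 = n" "set us \<subseteq> ann" "set vs \<subseteq> ann" "P \<in> ann" "c (P # us @ vs) = 0"
  shows "c (us @ P # vs) = 0"
  using assms(2-6)
proof (induction us arbitrary: vs rule: rev_induct)
  case (snoc u us)
  have "c (us @ P # (u # vs)) = 0" by (rule snoc.IH) (use snoc.prems in auto)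
  then show ?case using ce_skew[OF c, of us vs u P] snoc.prems by simp
qed simp

text \<open>Expanding the arguments one after the other expresses a multilinear map through its values on the
  elements \<open>x \<otimes>\<^sub>H a\<close>; the prefix \<open>us\<close> carries the arguments that have been expanded already.\<close>

lemma ann_multilinear_eval:
  assumes "ann_multilinear n c" "length us + length Ps = n" "set us \<subseteq> ann" "set Ps \<subseteq> ann"
  shows "c (us @ Ps) = lin_ext_list HM.ks (\<lambda>zs. c (us @ map (\<lambda>(x, a). ann_elem x a) zs)) (map rep Ps)"
  using assms(2-4)
proof (induction Ps arbitrary: us)
  case (Cons P Ps)
  have "ann_linear HM.ks (\<lambda>P. c (us @ P # Ps))"
    by (rule ann_multilinearD[OF assms(1)]) (use Cons.prems in auto)
  then have "c (us @ P # Ps) = lin_ext HM.ks (\<lambda>(x, a). c (us @ ann_elem x a # Ps)) (rep P)"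
    by (rule ann_linear_rep[OF vsM]) (use Cons.prems in auto)
  also have "\<dots> = lin_ext HM.ks (\<lambda>z. lin_ext_list HM.ks (\<lambda>zs. c (us @ map (\<lambda>(x, a). ann_elem x a) (z # zs))) (map rep Ps)) (rep P)"
  proof (rule lin_ext_cong)
    fix z assume "z \<in> keys (rep P)"
    then obtain x a where z: "z = (x, a)" "x \<in> dual" using keys_ann[of P] Cons.prems(3) by auto
    have "c ((us @ [ann_elem x a]) @ Ps)
      = lin_ext_list HM.ks (\<lambda>zs. c ((us @ [ann_elem x a]) @ map (\<lambda>(x, a). ann_elem x a) zs)) (map rep Ps)"
      by (rule Cons.IH) (use Cons.prems z ann_elem_in_ann in auto)
    then show "(\<lambda>(x, a). c (us @ ann_elem x a # Ps)) z
      = lin_ext_list HM.ks (\<lambda>zs. c (us @ map (\<lambda>(x, a). ann_elem x a) (z # zs))) (map rep Ps)"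
      by (simp add: z(1))
  qed
  finally show ?case by simp
qed simp

lemma ce_cochains_eqI:
  assumes "c \<in> ce_cochains n" "c' \<in> ce_cochains n"
    and eq: "\<And>xs as. length xs = n \<Longrightarrow> length as = n \<Longrightarrow> set xs \<subseteq> dual \<Longrightarrow> c (map2 ann_elem xs as) = c' (map2 ann_elem xs as)"
  shows "c = c'"
proof
  fix Ps
  show "c Ps = c' Ps"
  proof (cases "length Ps = n \<and> set Ps \<subseteq> ann")
    case True
    have "c ([] @ Ps) = c' ([] @ Ps)"
    proof (subst (1 2) ann_multilinear_eval[of n])
      show "lin_ext_list HM.ks (\<lambda>zs. c ([] @ map (\<lambda>(x, a). ann_elem x a) zs)) (map rep Ps)
        = lin_ext_list HM.ks (\<lambda>zs. c' ([] @ map (\<lambda>(x, a). ann_elem x a) zs)) (map rep Ps)"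
      proof (rule lin_ext_list_cong[of "dual \<times> UNIV"])
        fix zs :: "(('h \<Rightarrow> 'k) \<times> 'l) list" assume zs: "set zs \<subseteq> dual \<times> UNIV" "length zs = length (map rep Ps)"
        have "map (\<lambda>(x, a). ann_elem x a) zs = map2 ann_elem (map fst zs) (map snd zs)"
          by (simp add: zip_map_fst_snd)
        moreover have "set (map fst zs) \<subseteq> dual" using zs(1) by auto
        ultimately show "c ([] @ map (\<lambda>(x, a). ann_elem x a) zs) = c' ([] @ map (\<lambda>(x, a). ann_elem x a) zs)"
          using eq[of "map fst zs" "map snd zs"] zs True by auto
      next
        fix p assume "p \<in> set (map rep Ps)"
        then show "keys p \<subseteq> dual \<times> UNIV" using keys_ann True by auto
      qed
    qed (use assms True in \<open>auto simp: ce_cochains_iff\<close>)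
    then show ?thesis by simp
  next
    case False
    then show ?thesis using assms by (simp add: ce_cochains_iff)
  qed
qed


subsection \<open>The differential\<close>

lemma ann_linear_compose_act:
  assumes "P \<in> ann" "ann_linear HM.ks f" shows "ann_linear HM.ks (\<lambda>X. ann_act P (f X))"
  using assms(2) by (simp add: ann_linear_def lin_add[OF linear_ann_act[OF assms(1)]] lin_scale[OF linear_ann_act[OF assms(1)]])

lemma ann_bracket_closed: "P \<in> ann \<Longrightarrow> Q \<in> ann \<Longrightarrow> ann_bracket P Q \<in> ann"
  by (rule ann_bracket_eval(1)[OF vsM ann_linear_act])

text \<open>In each term of the differential the argument \<open>X\<close> occurs exactly once: as the acting element, inside the
  bracket, or in one slot of the cochain.\<close>

lemma ann_linear_ce_d:
  assumes c: "c \<in> ce_cochains n" and len: "length us + length vs = n" and sub: "set us \<subseteq> ann" "set vs \<subseteq> ann"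
  shows "ann_linear HM.ks (\<lambda>X. ce_d n c (us @ X # vs))"
proof -
  let ?s = "length us"
  have cm: "ann_multilinear n c" using c by (simp add: ce_cochains_iff)
  have nth: "(us @ X # vs) ! i = (if i < ?s then us ! i else if i = ?s then X else vs ! (i - Suc ?s))" for X i
    by (simp add: nth_append nth_Cons' )
  define W where "W i = (if i < ?s then us ! i else vs ! (i - Suc ?s))" for i
  have in_ann: "W i \<in> ann" if "i < Suc n" "i \<noteq> ?s" for i
    using that len sub nth_mem[of i us] nth_mem[of "i - Suc ?s" vs] by (auto simp: W_def)
  have nth_const: "(us @ X # vs) ! i = W i" if "i \<noteq> ?s" for X i using that by (simp add: nth W_def)
  have T: "ann_linear HM.ks (\<lambda>X. ann_act ((us @ X # vs) ! i) (c (omit i (us @ X # vs))))" if i: "i < Suc n" for i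
  proof (cases "i = ?s")
    case True
    then show ?thesis using ann_linear_act by (simp add: nth omit_slot_eq)
  next
    case False
    have "ann_linear HM.ks (\<lambda>X. c (omit i (us @ X # vs)))"
    proof (cases "i < ?s")
      case True
      show ?thesis unfolding omit_slot_less[OF True]
        by (rule ann_multilinearD[OF cm]) (use len sub set_omit[of i us] True in \<open>auto simp: length_omit\<close>)
    next
      case False
      then have gr: "?s < i" using \<open>i \<noteq> ?s\<close> by simp
      show ?thesis unfolding omit_slot_greater[OF gr]
        by (rule ann_multilinearD[OF cm])
          (use len sub set_omit[of "i - Suc ?s" vs] gr i in \<open>auto simp: length_omit\<close>)
    qed
    from ann_linear_compose_act[OF in_ann[OF i False] this]
    show ?thesis by (simp only: nth_const[OF False])
  qed
  have U: "ann_linear HM.ks (\<lambda>X. c (ann_bracket ((us @ X # vs) ! i) ((us @ X # vs) ! j) # omit i (omit j (us @ X # vs))))"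
    if ij: "i < j" "j < Suc n" for i j
  proof -
    have head: "ann_linear HM.ks (\<lambda>P. c (P # Rs))" if "length Rs + 1 = n" "set Rs \<subseteq> ann" for Rs
      using ann_multilinearD[OF cm, of "[]" Rs] that by simp
    consider "j = ?s" | "i = ?s" | "j < ?s" | "i < ?s" "?s < j" | "?s < i" using ij by linarith
    then show ?thesis
    proof cases
      case 1
      let ?R = "omit i (us @ vs)"
      have "ann_linear HM.ks (\<lambda>P. c (P # ?R))"
        by (rule head) (use len sub ij set_omit[of i "us @ vs"] in \<open>auto simp: length_omit\<close>)
      from ann_linear_bracket_right[OF vsM this in_ann[of i]]
      show ?thesis using 1 ij nth_const[of i] by (simp add: omit_slot_eq)
    next
      case 2
      let ?R = "us @ omit (j - Suc ?s) vs"
      have "ann_linear HM.ks (\<lambda>P. c (P # ?R))"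
        by (rule head) (use len sub ij 2 set_omit[of "j - Suc ?s" vs] in \<open>auto simp: length_omit\<close>)
      from ann_linear_bracket_left[OF vsM this in_ann[of j]]
      show ?thesis using 2 ij nth_const[of j] by (simp add: omit_slot_greater omit_slot_eq)
    next
      case 3
      have eq: "omit i (omit j (us @ X # vs)) = omit i (omit j us) @ X # vs" for X
        using 3 ij by (simp add: omit_slot_less length_omit)
      have "ann_linear HM.ks (\<lambda>X. c ((B # omit i (omit j us)) @ X # vs))" if "B \<in> ann" for B
        by (rule ann_multilinearD[OF cm])
          (use len sub that 3 ij set_omit[of i "omit j us"] set_omit[of j us] in \<open>auto simp: length_omit\<close>)
      from this[OF ann_bracket_closed[OF in_ann[of i] in_ann[of j]]]
      show ?thesis unfolding eq using 3 ij nth_const[of i] nth_const[of j] by simp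
    next
      case 4
      have eq: "omit i (omit j (us @ X # vs)) = omit i us @ X # omit (j - Suc ?s) vs" for X
        using 4 ij by (simp add: omit_slot_less omit_slot_greater)
      have "ann_linear HM.ks (\<lambda>X. c ((B # omit i us) @ X # omit (j - Suc ?s) vs))" if "B \<in> ann" for B
        by (rule ann_multilinearD[OF cm])
          (use len sub that 4 ij set_omit[of i us] set_omit[of "j - Suc ?s" vs] in \<open>auto simp: length_omit\<close>)
      from this[OF ann_bracket_closed[OF in_ann[of i] in_ann[of j]]]
      show ?thesis unfolding eq using 4 ij nth_const[of i] nth_const[of j] by simp
    next
      case 5
      have eq: "omit i (omit j (us @ X # vs)) = us @ X # omit (i - Suc ?s) (omit (j - Suc ?s) vs)" for X
        using 5 ij by (simp add: omit_slot_greater)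
      have "ann_linear HM.ks (\<lambda>X. c ((B # us) @ X # omit (i - Suc ?s) (omit (j - Suc ?s) vs)))" if "B \<in> ann" for B
        by (rule ann_multilinearD[OF cm])
          (use len sub that 5 ij set_omit[of "i - Suc ?s" "omit (j - Suc ?s) vs"] set_omit[of "j - Suc ?s" vs] in \<open>auto simp: length_omit\<close>)
      from this[OF ann_bracket_closed[OF in_ann[of i] in_ann[of j]]]
      show ?thesis unfolding eq using 5 ij nth_const[of i] nth_const[of j] by simp
    qed
  qed
  let ?F = "\<lambda>X. (\<Sum>i<Suc n. HM.ks ((-1) ^ i) (ann_act ((us @ X # vs) ! i) (c (omit i (us @ X # vs))))) +
      (\<Sum>j<Suc n. \<Sum>i<j. HM.ks ((-1) ^ (i + j))
         (c (ann_bracket ((us @ X # vs) ! i) ((us @ X # vs) ! j) # omit i (omit j (us @ X # vs)))))"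
  have "ann_linear HM.ks ?F"
    by (intro ann_linear_add[OF vsM] ann_linear_sum[OF vsM] ann_linear_scale[OF vsM] T U) auto
  moreover have "ce_d n c (us @ X # vs) = ?F X" if "X \<in> ann" for X
    unfolding ce_d_def using that len sub by simp
  ultimately show ?thesis
    by (simp add: ann_linear_def ann_add_closed ann_scale_closed)
qed

text \<open>In \<open>dc\<close> evaluated at a list with two equal neighbours, the terms that keep both neighbours vanish,
  the bracket of the two vanishes, and the remaining terms cancel under exchanging the neighbours.\<close>

lemma ce_d_adjacent_zero:
  assumes two: "(2::'k) \<noteq> 0" and c: "c \<in> ce_cochains n"
    and len: "length us + length vs + 2 = Suc n" and sub: "set us \<subseteq> ann" "set vs \<subseteq> ann" "P \<in> ann"
  shows "ce_d n c (us @ P # P # vs) = 0"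
proof -
  let ?s = "length us" and ?Ps = "us @ P # P # vs"
  have cm: "ann_multilinear n c" and cz: "\<And>Ps. length Ps = n \<Longrightarrow> set Ps \<subseteq> ann \<Longrightarrow> \<not> distinct Ps \<Longrightarrow> c Ps = 0"
    using c by (auto simp: ce_cochains_iff)
  have Ps: "set ?Ps \<subseteq> ann" "length ?Ps = Suc n" using sub len by auto
  have in_ann: "?Ps ! i \<in> ann" if "i < Suc n" for i using Ps nth_mem[of i ?Ps] that by auto
  have nths: "?Ps ! ?s = P" "?Ps ! Suc ?s = P" by (simp_all add: nth_append)
  have omits: "omit (Suc ?s) ?Ps = us @ P # vs" "omit ?s ?Ps = us @ P # vs"
    using omit_slot_eq[of "us @ [P]" P vs] omit_slot_eq[of us P "P # vs"] by simp_all
  have nd: "\<exists>us' vs'. omit i ?Ps = us' @ P # P # vs'" if "i \<noteq> ?s" "i \<noteq> Suc ?s" for i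
    using omit_adjacent[OF that, of P P vs] by (cases "i < ?s") auto
  have lo: "length (omit i ?Ps) = n" "set (omit i ?Ps) \<subseteq> ann" if "i < Suc n" for i
    using that Ps set_omit[of i ?Ps] by (auto simp: length_omit)
  define T where "T i = HM.ks ((-1) ^ i) (ann_act (?Ps ! i) (c (omit i ?Ps)))" for i
  have T0: "T i = 0" if "i < Suc n" "i \<noteq> ?s" "i \<noteq> Suc ?s" for i
  proof -
    have "\<not> distinct (omit i ?Ps)" using nd[OF that(2,3)] by auto
    then have "c (omit i ?Ps) = 0" using cz lo[OF that(1)] by blast
    then show ?thesis by (simp add: T_def lin_zero[OF linear_ann_act[OF in_ann[OF that(1)]]])
  qed
  have "(\<Sum>i<Suc n. T i) = (\<Sum>i\<in>{?s, Suc ?s}. T i)"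
    by (rule sum.mono_neutral_right) (use T0 len in auto)
  also have "\<dots> = 0" by (simp add: T_def omits nths)
  finally have first: "(\<Sum>i<Suc n. T i) = 0" .
  define U where "U i j = HM.ks ((-1) ^ (i + j)) (c (ann_bracket (?Ps ! i) (?Ps ! j) # omit i (omit j ?Ps)))" for i j
  define \<tau> where "\<tau> i = (if i = ?s then Suc ?s else if i = Suc ?s then ?s else i)" for i
  \<comment> \<open>The bracket of the two equal neighbours vanishes; here \<open>2\<close> has to be invertible.\<close>
  have U0: "U ?s (Suc ?s) = 0"
  proof -
    have "ann_linear HM.ks (\<lambda>X. c (X # omit ?s (omit (Suc ?s) ?Ps)))"
      using ann_multilinearD[OF cm, of "[]" "us @ vs"] len sub by (simp add: omits omit_slot_eq)
    from ann_bracket_skew[OF vsM this sub(3) sub(3)] HM.K.eq_minus_self_imp_zero[OF two]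
    show ?thesis by (simp add: U_def nths)
  qed
  \<comment> \<open>Exchanging the two positions changes the sign of a term and nothing else.\<close>
  have Ut: "U (\<tau> i) (\<tau> j) = - U i j" if ij: "i < j" "j < Suc n" "\<not> (i = ?s \<and> j = Suc ?s)" for i j
  proof -
    consider "i = ?s" "Suc ?s < j" | "i = Suc ?s" "Suc ?s < j" | "j = ?s" "i < ?s" | "j = Suc ?s" "i < ?s"
      | "i \<noteq> ?s" "i \<noteq> Suc ?s" "j \<noteq> ?s" "j \<noteq> Suc ?s" using ij by linarith
    then show ?thesis
    proof cases
      case 1
      then obtain k where k: "j = ?s + Suc (Suc k)" by (metis less_imp_Suc_add add_Suc_right add_Suc)
      have "omit (Suc ?s) (omit j ?Ps) = us @ P # omit k vs" "omit ?s (omit j ?Ps) = us @ P # omit k vs"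
        using k omit_slot_eq[of "us @ [P]"] by (simp_all add: omit_append)
      then show ?thesis using 1 by (simp add: U_def \<tau>_def nths)
    next
      case 2
      then obtain k where k: "j = ?s + Suc (Suc k)" by (metis less_imp_Suc_add add_Suc_right add_Suc)
      have "omit (Suc ?s) (omit j ?Ps) = us @ P # omit k vs" "omit ?s (omit j ?Ps) = us @ P # omit k vs"
        using k omit_slot_eq[of "us @ [P]"] by (simp_all add: omit_append)
      then show ?thesis using 2 by (simp add: U_def \<tau>_def nths)
    next
      case 3
      then show ?thesis by (simp add: U_def \<tau>_def nths omits)
    next
      case 4
      then show ?thesis by (simp add: U_def \<tau>_def nths omits)
    next
      case 5
      obtain us' vs' where o: "omit j ?Ps = us' @ P # P # vs'" "i \<noteq> length us'" "i \<noteq> Suc (length us')"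
      proof (cases "j < ?s")
        case True
        then show thesis
          using ij(1) omit_adjacent[of j us P P vs] 5
          by (intro that[of "omit j us" vs]) (auto simp: length_omit)
      next
        case False
        then show thesis using 5 omit_adjacent[of j us P P vs] by (intro that[of us]) auto
      qed
      then obtain us'' vs'' where o': "omit i (omit j ?Ps) = us'' @ P # P # vs''"
        using omit_adjacent[of i us' P P vs'] by (cases "i < length us'") auto
      have "length (omit i (omit j ?Ps)) = n - 1" "set (omit i (omit j ?Ps)) \<subseteq> ann"
        using lo[OF ij(2)] ij set_omit[of i "omit j ?Ps"] by (auto simp: length_omit)
      then have "c (ann_bracket (?Ps ! i) (?Ps ! j) # omit i (omit j ?Ps)) = 0"
        using ij ann_bracket_closed[OF in_ann[of i] in_ann[of j]] o' by (intro cz) auto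
      then have "U i j = 0" by (simp add: U_def)
      then show ?thesis using 5 by (simp add: \<tau>_def)
    qed
  qed
  let ?A = "SIGMA j:{..<Suc n}. {..<j}"
  have "(\<Sum>j<Suc n. \<Sum>i<j. U i j) = (\<Sum>(j, i)\<in>?A. U i j)"
    by (rule sum.Sigma) auto
  also have "\<dots> = (\<Sum>(j, i)\<in>?A - {(Suc ?s, ?s)}. U i j)"
    by (rule sum.mono_neutral_right) (use U0 in auto)
  finally have eq: "(\<Sum>j<Suc n. \<Sum>i<j. U i j) = (\<Sum>(j, i)\<in>?A - {(Suc ?s, ?s)}. U i j)" .
  have "(\<Sum>(j, i)\<in>?A - {(Suc ?s, ?s)}. U i j) = (\<Sum>(j, i)\<in>?A - {(Suc ?s, ?s)}. U (\<tau> i) (\<tau> j))"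
  proof (rule sum.reindex_bij_witness[of _ "\<lambda>(j, i). (\<tau> j, \<tau> i)" "\<lambda>(j, i). (\<tau> j, \<tau> i)"])
    fix z assume z: "z \<in> ?A - {(Suc ?s, ?s)}"
    show "(\<lambda>(j, i). (\<tau> j, \<tau> i)) ((\<lambda>(j, i). (\<tau> j, \<tau> i)) z) = z"
      by (cases z) (auto simp: \<tau>_def)
    then show "(\<lambda>(j, i). (\<tau> j, \<tau> i)) ((\<lambda>(j, i). (\<tau> j, \<tau> i)) z) = z" .
    show "(\<lambda>(j, i). (\<tau> j, \<tau> i)) z \<in> ?A - {(Suc ?s, ?s)}"
      using z len by (cases z) (auto simp: \<tau>_def)
    then show "(\<lambda>(j, i). (\<tau> j, \<tau> i)) z \<in> ?A - {(Suc ?s, ?s)}" .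
    show "(\<lambda>(j, i). U (\<tau> i) (\<tau> j)) ((\<lambda>(j, i). (\<tau> j, \<tau> i)) z) = (\<lambda>(j, i). U i j) z"
      by (cases z) (auto simp: \<tau>_def)
  qed
  also have "\<dots> = (\<Sum>z\<in>?A - {(Suc ?s, ?s)}. - (\<lambda>(j, i). U i j) z)"
    by (rule sum.cong) (use Ut in auto)
  also have "\<dots> = - (\<Sum>(j, i)\<in>?A - {(Suc ?s, ?s)}. U i j)"
    by (simp add: sum_negf case_prod_unfold)
  finally have "(\<Sum>(j, i)\<in>?A - {(Suc ?s, ?s)}. U i j) = 0"
    by (rule HM.K.eq_minus_self_imp_zero[OF two])
  with eq first show ?thesis
    unfolding ce_d_def T_def U_def using Ps by simp
qed


lemma ce_d_closed:
  assumes two: "(2::'k) \<noteq> 0" and c: "c \<in> ce_cochains n"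
  shows "ce_d n c \<in> ce_cochains (Suc n)"
  unfolding ce_cochains_iff
proof (intro conjI allI impI)
  show "ce_d n c Ps = 0" if "\<not> (length Ps = Suc n \<and> set Ps \<subseteq> ann)" for Ps
    unfolding ce_d_def by (rule if_not_P[OF that])
  show ml: "ann_multilinear (Suc n) (ce_d n c)"
    unfolding ann_multilinear_def by (intro allI impI ann_linear_ce_d[OF c]) auto
  show "ce_d n c Ps = 0" if "length Ps = Suc n \<and> set Ps \<subseteq> ann \<and> \<not> distinct Ps" for Ps
  proof (rule zero_of_adjacent_zero[of "Suc n"])
    show "ce_d n c (us @ P # Q # vs) = - ce_d n c (us @ Q # P # vs)"
      if "length us + length vs + 2 = Suc n" "set us \<subseteq> ann" "set vs \<subseteq> ann" "P \<in> ann" "Q \<in> ann" for us P Q vs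
      by (rule skew_of_adjacent_zero[OF ml ce_d_adjacent_zero[OF two c] that])
    show "ce_d n c (us @ P # P # vs) = 0"
      if "length us + length vs + 2 = Suc n" "set us \<subseteq> ann" "set vs \<subseteq> ann" "P \<in> ann" for us P vs
      by (rule ce_d_adjacent_zero[OF two c that])
  qed (use that in auto)
qed

lemma ce_cochains_add: "c \<in> ce_cochains n \<Longrightarrow> c' \<in> ce_cochains n \<Longrightarrow> c + c' \<in> ce_cochains n"
  and ce_cochains_scale: "c \<in> ce_cochains n \<Longrightarrow> (\<lambda>Ps. HM.ks t (c Ps)) \<in> ce_cochains n"
  using ann_linear_add[OF vsM] ann_linear_scale[OF vsM]
  by (auto simp: ce_cochains_iff ann_multilinear_def)

lemma gf_cochainsD:
  assumes "c \<in> gf_cochains n" "set xs \<subseteq> dual" "length xs = length as" "Suc (length as) = n"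
  obtains K where "\<forall>k\<ge>K. \<forall>x\<in>dual_filt k. c (ann_elem x a # map2 ann_elem xs as) = 0"
proof -
  have "\<forall>xs a as. set xs \<subseteq> dual \<and> length xs = length as \<and> Suc (length as) = n \<longrightarrow>
      (\<exists>K. \<forall>k\<ge>K. \<forall>x\<in>dual_filt k. c (ann_elem x a # map2 ann_elem xs as) = 0)"
    using assms(1) unfolding gf_cochains_def by (elim CollectE conjE)
  from this[THEN spec, THEN spec, THEN spec, of xs as a] assms(2-4) show thesis
    by (elim impE exE) (auto intro: that)
qed

lemma gf_cochains_add: "c \<in> gf_cochains n \<Longrightarrow> c' \<in> gf_cochains n \<Longrightarrow> c + c' \<in> gf_cochains n"
proof -
  assume c: "c \<in> gf_cochains n" "c' \<in> gf_cochains n"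
  have "\<exists>K. \<forall>k\<ge>K. \<forall>x\<in>dual_filt k. (c + c') (ann_elem x a # map2 ann_elem xs as) = 0"
    if *: "set xs \<subseteq> dual \<and> length xs = length as \<and> Suc (length as) = n" for xs a as
  proof -
    obtain K where "\<forall>k\<ge>K. \<forall>x\<in>dual_filt k. c (ann_elem x a # map2 ann_elem xs as) = 0"
      by (rule gf_cochainsD[OF c(1), of xs as a]) (use * in auto)
    moreover obtain K' where "\<forall>k\<ge>K'. \<forall>x\<in>dual_filt k. c' (ann_elem x a # map2 ann_elem xs as) = 0"
      by (rule gf_cochainsD[OF c(2), of xs as a]) (use * in auto)
    ultimately show ?thesis by (intro exI[of _ "max K K'"]) auto
  qed
  then show ?thesis using c ce_cochains_add by (simp add: gf_cochains_def)
qed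

lemma gf_cochains_scale: "c \<in> gf_cochains n \<Longrightarrow> (\<lambda>Ps. HM.ks t (c Ps)) \<in> gf_cochains n"
proof -
  assume c: "c \<in> gf_cochains n"
  have "\<exists>K. \<forall>k\<ge>K. \<forall>x\<in>dual_filt k. HM.ks t (c (ann_elem x a # map2 ann_elem xs as)) = 0"
    if *: "set xs \<subseteq> dual \<and> length xs = length as \<and> Suc (length as) = n" for xs a as
  proof -
    obtain K where "\<forall>k\<ge>K. \<forall>x\<in>dual_filt k. c (ann_elem x a # map2 ann_elem xs as) = 0"
      by (rule gf_cochainsD[OF c, of xs as a]) (use * in auto)
    then show ?thesis by (intro exI[of _ K]) auto
  qed
  then show ?thesis using c ce_cochains_scale by (simp add: gf_cochains_def)
qed


section \<open>Comparison of the two complexes\<close>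

text \<open>A basic cochain and a cochain of the annihilation algebra correspond to each other if
  \<open>c(x\<^sub>1 \<otimes>\<^sub>H a\<^sub>1, \<dots>, x\<^sub>n \<otimes>\<^sub>H a\<^sub>n)\<close> is the value of \<open>S x\<^sub>1 \<otimes> \<dots> \<otimes> S x\<^sub>n\<close> on
  \<open>\<gamma>(a\<^sub>1, \<dots>, a\<^sub>n)\<close>.\<close>

definition corresponds ::
  "nat \<Rightarrow> ('l list \<Rightarrow> ('h list \<times> 'm \<Rightarrow>\<^sub>0 'k) set) \<Rightarrow> ((('h \<Rightarrow> 'k) \<times> 'l \<Rightarrow>\<^sub>0 'k) set list \<Rightarrow> 'm) \<Rightarrow> bool"
  where "corresponds n \<gamma> c \<longleftrightarrow>
    (\<forall>as. length as = n \<longrightarrow> \<gamma> as \<in> tens actM n) \<and>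
    (\<forall>as. length as \<noteq> n \<longrightarrow> \<gamma> as = tens_rel actM n) \<and>
    (\<forall>xs as. length xs = n \<and> length as = n \<and> set xs \<subseteq> dual \<longrightarrow>
      HM.pairing xs (rep (\<gamma> as)) = c (map2 ann_elem xs as))"

lemma correspondsD:
  assumes "corresponds n \<gamma> c"
  shows "length as = n \<Longrightarrow> \<gamma> as \<in> tens actM n"
    and "length as \<noteq> n \<Longrightarrow> \<gamma> as = tens_rel actM n"
    and "length xs = n \<Longrightarrow> length as = n \<Longrightarrow> set xs \<subseteq> dual \<Longrightarrow>
      HM.pairing xs (rep (\<gamma> as)) = c (map2 ann_elem xs as)"
  using assms by (auto simp: corresponds_def)

lemma corresponds_unique_left:
  assumes "corresponds n \<gamma> c" "corresponds n \<gamma>' c"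
  shows "\<gamma> = \<gamma>'"
proof
  fix as
  show "\<gamma> as = \<gamma>' as"
  proof (cases "length as = n")
    case True
    show ?thesis
      by (rule HM.tens_eqI)
        (use correspondsD(1,3)[OF assms(1)] correspondsD(1,3)[OF assms(2)] True in auto)
  next
    case False
    then show ?thesis using correspondsD(2)[OF assms(1)] correspondsD(2)[OF assms(2)] by simp
  qed
qed

lemma corresponds_unique_right:
  assumes "corresponds n \<gamma> c" "corresponds n \<gamma> c'" "c \<in> ce_cochains n" "c' \<in> ce_cochains n"
  shows "c = c'"
  by (rule ce_cochains_eqI[OF assms(3,4)])
    (use correspondsD(3)[OF assms(1)] correspondsD(3)[OF assms(2)] in metis)

lemma corresponds_add:
  assumes "corresponds n \<gamma> c" "corresponds n \<gamma>' c'"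
  shows "corresponds n (\<gamma> + \<gamma>') (c + c')"
proof -
  have "tens_rel actM n + tens_rel actM n = tens_rel actM n"
    using free.add_cosets[OF HM.subspace_tens_rel, of 0 n 0] by (simp add: sum_zero_coset)
  then show ?thesis
    using assms unfolding corresponds_def by (auto simp: HM.tens_add)
qed

lemma corresponds_scale:
  assumes "corresponds n \<gamma> c"
  shows "corresponds n (\<lambda>as. coset_scale fscale (tens_rel actM n) t (\<gamma> as)) (\<lambda>Ps. HM.ks t (c Ps))"
proof -
  have "coset_scale fscale (tens_rel actM n) t (tens_rel actM n) = tens_rel actM n"
    using free.scale_coset[OF HM.subspace_tens_rel, of n t 0] by (simp add: sum_zero_coset)
  then show ?thesis
    using assms unfolding corresponds_def by (auto simp: HM.tens_scale)
qed

lemma basic_cochainsD: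
  assumes "\<gamma> \<in> basic_cochains n"
  shows "length as = n \<Longrightarrow> \<gamma> as \<in> tens actM n"
    and "length as \<noteq> n \<Longrightarrow> \<gamma> as = tens_rel actM n"
    and "length us + length vs + 1 = n \<Longrightarrow> \<gamma> (us @ (a + b) # vs) = \<gamma> (us @ a # vs) + \<gamma> (us @ b # vs)"
    and "length hs = n \<Longrightarrow> length as = n \<Longrightarrow> \<gamma> (map2 actL hs as) = lmult hs (rep (\<gamma> as)) +o tens_rel actM n"
    and "length us + length vs + 2 = n \<Longrightarrow> \<gamma> (us @ b # a # vs) =
        (- permute (\<lambda>hs. hs[length us := hs ! Suc (length us), Suc (length us) := hs ! length us])
             (rep (\<gamma> (us @ a # b # vs)))) +o tens_rel actM n"
  using assms unfolding basic_cochains_def by blast+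


subsection \<open>From basic cochains to cochains of the annihilation algebra\<close>

text \<open>The factor \<open>h\<close> is moved from \<open>L\<close> to \<open>X\<close> by linearity over \<open>H\<^sup>\<otimes>\<^sup>n\<close>, applied with all other factors equal
  to \<open>1\<close>.\<close>

lemma pairing_cochain_balanced:
  assumes \<gamma>: "\<gamma> \<in> basic_cochains n"
    and len: "length us = length as" "length vs = length bs" "length us + length vs + 1 = n"
    and sub: "set us \<subseteq> dual" "set vs \<subseteq> dual"
  shows "ann_balanced HM.ks (\<lambda>x a. HM.pairing (us @ x # vs) (rep (\<gamma> (as @ a # bs))))"
  unfolding ann_balanced_def
proof (intro conjI allI ballI)
  have t: "\<gamma> (as @ a # bs) \<in> tens actM n" for a using len by (intro basic_cochainsD[OF \<gamma>]) auto
  show "dual_linear HM.ks (\<lambda>x. HM.pairing (us @ x # vs) (rep (\<gamma> (as @ a # bs))))" for a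
    using HM.keys_tens[OF t] len by (intro HM.dual_linear_pairing) simp
  fix x a b h assume x: "x \<in> dual"
  have xs: "length (us @ x # vs) = n" "set (us @ x # vs) \<subseteq> dual" using len sub x by auto
  have "\<gamma> (as @ (a + b) # bs) = \<gamma> (as @ a # bs) + \<gamma> (as @ b # bs)"
    using len by (intro basic_cochainsD(3)[OF \<gamma>]) simp
  then show "HM.pairing (us @ x # vs) (rep (\<gamma> (as @ (a + b) # bs)))
    = HM.pairing (us @ x # vs) (rep (\<gamma> (as @ a # bs))) + HM.pairing (us @ x # vs) (rep (\<gamma> (as @ b # bs)))"
    using HM.tens_add(2)[OF t t xs] by simp
  let ?hs = "replicate (length us) 1 @ h # replicate (length vs) (1::'h)"
  have ones: "map2 actL (replicate (length zs) 1) zs = zs" for zs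
    by (rule nth_equalityI) (auto simp: L.act_one)
  have ones': "map2 dual_act zs (replicate (length zs) 1) = zs" for zs
    by (rule nth_equalityI) (auto simp: dual_act_one)
  have "map2 actL ?hs (as @ a # bs) = as @ actL h a # bs"
    using len by (simp add: ones)
  then have "\<gamma> (as @ actL h a # bs) = lmult ?hs (rep (\<gamma> (as @ a # bs))) +o tens_rel actM n"
    using basic_cochainsD(4)[OF \<gamma>, of ?hs "as @ a # bs"] len by simp
  then have "HM.pairing (us @ x # vs) (rep (\<gamma> (as @ actL h a # bs)))
    = HM.pairing (us @ x # vs) (lmult ?hs (rep (\<gamma> (as @ a # bs))))"
    using HM.pairing_rep_coset[OF xs] by simp
  also have "\<dots> = HM.pairing (map2 dual_act (us @ x # vs) ?hs) (rep (\<gamma> (as @ a # bs)))"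
    by (rule HM.pairing_lmult[OF HM.keys_tens[OF t]]) (use len in auto)
  also have "map2 dual_act (us @ x # vs) ?hs = us @ dual_act x h # vs" by (simp add: ones')
  finally show "HM.pairing (us @ dual_act x h # vs) (rep (\<gamma> (as @ a # bs)))
    = HM.pairing (us @ x # vs) (rep (\<gamma> (as @ actL h a # bs)))" ..
qed

lemma pairing_cochain_skew:
  assumes \<gamma>: "\<gamma> \<in> basic_cochains n"
    and len: "length us = length as" "length vs = length bs" "length us + length vs + 2 = n"
    and sub: "set us \<subseteq> dual" "set vs \<subseteq> dual" "x \<in> dual" "y \<in> dual"
  shows "HM.pairing (us @ x # y # vs) (rep (\<gamma> (as @ a # b # bs)))
    = - HM.pairing (us @ y # x # vs) (rep (\<gamma> (as @ b # a # bs)))"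
proof -
  have t: "\<gamma> (as @ b # a # bs) \<in> tens actM n" using len by (intro basic_cochainsD[OF \<gamma>]) auto
  have xs: "length (us @ x # y # vs) = n" "set (us @ x # y # vs) \<subseteq> dual" using len sub by auto
  let ?p = "permute (\<lambda>hs. hs[length us := hs ! Suc (length us), Suc (length us) := hs ! length us]) (rep (\<gamma> (as @ b # a # bs)))"
  have "\<gamma> (as @ a # b # bs) = (- ?p) +o tens_rel actM n"
    using basic_cochainsD(5)[OF \<gamma>, of as bs a b] len by simp
  then have "HM.pairing (us @ x # y # vs) (rep (\<gamma> (as @ a # b # bs))) = HM.pairing (us @ x # y # vs) (- ?p)"
    using HM.pairing_rep_coset[OF xs] by simp
  also have "\<dots> = - HM.pairing (us @ x # y # vs) ?p" by (rule lin_minus[OF HM.linear_pairing])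
  also have "HM.pairing (us @ x # y # vs) ?p = HM.pairing (us @ y # x # vs) (rep (\<gamma> (as @ b # a # bs)))"
    by (rule HM.pairing_swap) (use HM.keys_tens[OF t] len in simp)
  finally show ?thesis .
qed

text \<open>The value at a list of cosets is the multilinear extension of the contraction, evaluated at chosen
  representatives. Balance makes it independent of the choice, and skewness on generators extends to
  skewness on cosets.\<close>

lemma exists_ce_cochain:
  assumes two: "(2::'k) \<noteq> 0" and \<gamma>: "\<gamma> \<in> basic_cochains n"
  obtains c where "c \<in> ce_cochains n" "corresponds n \<gamma> c"
proof -
  define f where "f zs = HM.pairing (map fst zs) (rep (\<gamma> (map snd zs)))" for zs
  let ?A = "dual \<times> (UNIV :: 'l set)"
  have slot: "lin_ext HM.ks (\<lambda>g. f (gs @ g # hs)) r = 0"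
    if "set gs \<subseteq> ?A" "set hs \<subseteq> ?A" "length gs + length hs + 1 = n" "r \<in> ann_rel" for gs hs r
  proof -
    have "ann_balanced HM.ks (\<lambda>x a. f (gs @ (x, a) # hs))"
      unfolding f_def map_append list.map fst_conv snd_conv
      by (rule pairing_cochain_balanced[OF \<gamma>]) (use that in auto)
    from lin_ext_ann_rel[OF vsM this that(4)] show ?thesis by (simp add: case_prod_unfold)
  qed
  have fskew: "f (gs @ g # h # hs) = - f (gs @ h # g # hs)"
    if "set gs \<subseteq> ?A" "set hs \<subseteq> ?A" "g \<in> ?A" "h \<in> ?A" "length gs + length hs + 2 = n" for gs g h hs
    unfolding f_def map_append list.map
    by (rule pairing_cochain_skew[OF \<gamma>]) (use that in auto)
  define c where "c Ps = (if length Ps = n \<and> set Ps \<subseteq> ann then lin_ext_list HM.ks f (map rep Ps) else 0)" for Ps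
  have keys: "keys p \<subseteq> ?A" if "p \<in> set (map rep Ps)" "set Ps \<subseteq> ann" for p Ps
    using that keys_ann by auto
  have ml: "ann_multilinear n c"
    unfolding ann_multilinear_def
  proof (intro allI impI)
    fix us vs assume *: "length us + length vs + 1 = n \<and> set us \<subseteq> ann \<and> set vs \<subseteq> ann"
    let ?L = "\<lambda>p. lin_ext_list HM.ks f (map rep us @ p # map rep vs)"
    have cL: "c (us @ P # vs) = ?L (rep P)" if "P \<in> ann" for P using that * by (auto simp: c_def)
    have zero: "?L r = 0" if "r \<in> ann_rel" for r
    proof (rule HM.K.lin_ext_list_slot_zero[of ?A])
      fix gs hs assume "set gs \<subseteq> ?A" "set hs \<subseteq> ?A" "length gs = length (map rep us)" "length hs = length (map rep vs)"
      then show "lin_ext HM.ks (\<lambda>g. f (gs @ g # hs)) r = 0" by (intro slot) (use that * in auto)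
    next
      fix p assume "p \<in> set (map rep us) \<union> set (map rep vs)"
      then show "keys p \<subseteq> ?A" using keys[of p us] keys[of p vs] * by blast
    qed
    have eq: "?L p = ?L q" if "p - q \<in> ann_rel" for p q
      using zero[OF that] by (simp add: lin_diff[OF HM.K.linear_lin_ext_list])
    show "ann_linear HM.ks (\<lambda>P. c (us @ P # vs))"
      unfolding ann_linear_def
    proof (intro conjI ballI allI)
      fix P Q t assume P: "P \<in> ann"
      show "c (us @ (P + Q) # vs) = c (us @ P # vs) + c (us @ Q # vs)" if Q: "Q \<in> ann"
        unfolding cL[OF P] cL[OF Q] cL[OF ann_add_closed[OF P Q]] eq[OF rep_ann_add[OF P Q]]
        by (rule lin_add[OF HM.K.linear_lin_ext_list])
      show "c (us @ coset_scale fscale ann_rel t P # vs) = HM.ks t (c (us @ P # vs))"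
        unfolding cL[OF P] cL[OF ann_scale_closed[OF P]] eq[OF rep_ann_scale[OF P]]
        by (rule lin_scale[OF HM.K.linear_lin_ext_list])
    qed
  qed
  have skew: "c (us @ P # Q # vs) = - c (us @ Q # P # vs)"
    if "length us + length vs + 2 = n" "set us \<subseteq> ann" "set vs \<subseteq> ann" "P \<in> ann" "Q \<in> ann" for us P Q vs
  proof -
    have "lin_ext_list HM.ks f (map rep us @ rep P # rep Q # map rep vs)
      = - lin_ext_list HM.ks f (map rep us @ rep Q # rep P # map rep vs)"
    proof (rule HM.K.lin_ext_list_skew[of ?A])
      fix gs g h hs
      assume "set gs \<subseteq> ?A" "set hs \<subseteq> ?A" "g \<in> ?A" "h \<in> ?A"
        "length gs = length (map rep us)" "length hs = length (map rep vs)"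
      then show "f (gs @ g # h # hs) = - f (gs @ h # g # hs)" using that(1) by (intro fskew) auto
    next
      fix p assume "p \<in> set (map rep us) \<union> set (map rep vs) \<union> {rep P, rep Q}"
      then show "keys p \<subseteq> ?A"
        using keys[of p us] keys[of p vs] keys_ann[of P] keys_ann[of Q] that by blast
    qed
    then show ?thesis using that by (simp add: c_def)
  qed
  have ce: "c \<in> ce_cochains n"
    unfolding ce_cochains_iff
  proof (intro conjI allI impI ml)
    show "c Ps = 0" if "\<not> (length Ps = n \<and> set Ps \<subseteq> ann)" for Ps unfolding c_def using that by (rule if_not_P)
    show "c Ps = 0" if "length Ps = n \<and> set Ps \<subseteq> ann \<and> \<not> distinct Ps" for Ps
    proof (rule zero_of_adjacent_zero[of n])
      show "c (us @ P # Q # vs) = - c (us @ Q # P # vs)"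
        if "length us + length vs + 2 = n" "set us \<subseteq> ann" "set vs \<subseteq> ann" "P \<in> ann" "Q \<in> ann" for us P Q vs
        by (rule skew[OF that])
      show "c (us @ P # P # vs) = 0"
        if "length us + length vs + 2 = n" "set us \<subseteq> ann" "set vs \<subseteq> ann" "P \<in> ann" for us P vs
        by (rule HM.K.eq_minus_self_imp_zero[OF two skew[OF that that(4)]])
    qed (use that in auto)
  qed
  have "corresponds n \<gamma> c"
    unfolding corresponds_def
  proof (intro conjI allI impI)
    fix xs and as :: "'l list" assume *: "length xs = n \<and> length as = n \<and> set xs \<subseteq> dual"
    let ?Ps = "map2 ann_elem xs as"
    have Ps: "set ?Ps \<subseteq> ann" using * ann_elem_in_ann set_zip_leftD by fastforce
    have "c ?Ps = lin_ext_list HM.ks f (map rep ?Ps)" using * Ps by (simp add: c_def)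
    also have "\<dots> = lin_ext_list HM.ks f (map gen (zip xs as))"
    proof (rule HM.K.lin_ext_list_cong_rel[of ?A _ ann_rel])
      show "list_all2 (\<lambda>p q. p - q \<in> ann_rel) (map rep ?Ps) (map gen (zip xs as))"
        by (auto simp: list_all2_conv_all_nth ann_elem_def intro!: free.rep_coset[OF subspace_ann_rel])
      fix gs hs r assume "set gs \<subseteq> ?A" "set hs \<subseteq> ?A" "length gs + length hs + 1 = length (map rep ?Ps)" "r \<in> ann_rel"
      then show "lin_ext HM.ks (\<lambda>g. f (gs @ g # hs)) r = 0" using * by (intro slot) auto
    next
      fix p assume "p \<in> set (map rep ?Ps) \<union> set (map gen (zip xs as))"
      then show "keys p \<subseteq> ?A"
      proof
        assume "p \<in> set (map gen (zip xs as))"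
        then obtain x a where "(x, a) \<in> set (zip xs as)" "p = gen (x, a)" by auto
        moreover from this have "x \<in> dual" using * set_zip_leftD by fastforce
        ultimately show ?thesis by (simp add: keys_gen)
      qed (use keys Ps in blast)
    qed
    also have "\<dots> = f (zip xs as)" by (rule HM.K.lin_ext_list_gen)
    also have "\<dots> = HM.pairing xs (rep (\<gamma> as))" using * by (simp add: f_def)
    finally show "HM.pairing xs (rep (\<gamma> as)) = c ?Ps" ..
  qed (use basic_cochainsD(1,2)[OF \<gamma>] in auto)
  with ce show thesis by (rule that)
qed


subsection \<open>The differentials\<close>

lemma pairing_act_cochain:
  assumes "x \<in> dual"
  shows "HM.pairing (x # ys) (act_cochain a p) = act_form x a (HM.pairing ys p)"
proof -
  have inner: "HM.pairing (x # ys) (free_ext (\<lambda>(h, v). gen (h # f, v)) (straighten actM (pact a m)))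
      = act_form x a (HM.ks (eval_prod ys f) m)" for f m
  proof -
    let ?r = "eval_prod ys f"
    have "HM.pairing (x # ys) (free_ext (\<lambda>(h, v). gen (h # f, v)) (straighten actM (pact a m)))
      = lin_ext HM.ks (\<lambda>z. HM.ks ?r ((\<lambda>(h, v). HM.ks (x (S h)) v) z)) (straighten actM (pact a m))"
      unfolding lin_ext_comp[OF HM.linear_pairing]
      by (intro lin_ext_cong) (auto simp: HM.pairing_gen mult.commute)
    also have "\<dots> = HM.ks ?r (act_form x a m)"
      unfolding HM.K.lin_ext_fun_scale HM.straighten_eval[OF assms pact_closed] act_form_def ..
    finally show ?thesis by (simp add: lin_scale[OF linear_act_form[OF assms]])
  qed
  have "HM.pairing (x # ys) (act_cochain a p)
    = lin_ext HM.ks (\<lambda>z. act_form x a ((\<lambda>(f, m). HM.ks (eval_prod ys f) m) z)) p"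
    unfolding act_cochain_def lin_ext_comp[OF HM.linear_pairing]
    by (intro lin_ext_cong) (auto simp: inner)
  also have "\<dots> = act_form x a (HM.pairing ys p)"
    unfolding HM.pairing_def by (rule lin_ext_comp[OF linear_act_form[OF assms], symmetric])
  finally show ?thesis .
qed

lemma pairing_eval_cochain:
  assumes xy: "x \<in> dual" "y \<in> dual"
    and q: "tens_supp 2 q"
    and \<gamma>: "\<And>b. tens_supp (Suc n) (rep (\<gamma> (b # as)))"
  shows "HM.pairing (x # y # ys) (eval_cochain \<gamma> q as) = lin_ext HM.ks (\<lambda>(g, b).
    HM.pairing (dual_mult (dual_act x (g ! 0)) (dual_act y (g ! 1)) # ys) (rep (\<gamma> (b # as)))) q"
  unfolding eval_cochain_def lin_ext_comp[OF HM.linear_pairing, of "x # y # ys" _ q]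
proof (rule lin_ext_cong)
  fix z assume "z \<in> keys q"
  then obtain g b where z: "z = (g, b)" "length g = 2" using q by auto
  from two_element_list[OF z(2)] obtain g0 g1 where g: "g = [g0, g1]" by metis
  let ?D = "dual_mult (dual_act x g0) (dual_act y g1)"
  have "HM.pairing (x # y # ys) (free_ext (\<lambda>(hs, v). free_ext (\<lambda>ks. gen (map2 (*) g ks @ tl hs, v)) (rep (\<Delta> (hd hs)))) (rep (\<gamma> (b # as))))
    = HM.pairing (?D # ys) (rep (\<gamma> (b # as)))"
  proof (rule HM.pairing_free_ext)
    fix hs m assume "(hs, m) \<in> keys (rep (\<gamma> (b # as)))"
    then have "length hs = Suc n" using \<gamma>[of b] by auto
    then obtain h t where hs: "hs = h # t" by (cases hs) auto
    let ?r = "eval_prod ys t"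
    have lin: "Vector_Spaces.linear (*) HM.ks (\<lambda>c. HM.ks (c * ?r) m)"
      by (rule linearI_vs[OF vector_space_field vsM]) (simp_all add: distrib_right HM.K.scale_left_distrib mult.assoc)
    have "HM.pairing (x # y # ys) (free_ext (\<lambda>ks. gen (map2 (*) g ks @ t, m)) (rep (\<Delta> h)))
      = lin_ext HM.ks (\<lambda>ks. HM.ks ((x (S (g0 * ks ! 0)) * y (S (g1 * ks ! 1))) * ?r) m) (rep (\<Delta> h))"
      unfolding lin_ext_comp[OF HM.linear_pairing]
    proof (rule lin_ext_cong)
      fix ks assume "ks \<in> keys (rep (\<Delta> h))"
      then have "length ks = 2" by (rule length_comult_keys)
      from two_element_list[OF this] obtain k0 k1 where "ks = [k0, k1]" by metis
      then show "HM.pairing (x # y # ys) (gen (map2 (*) g ks @ t, m))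
        = HM.ks ((x (S (g0 * ks ! 0)) * y (S (g1 * ks ! 1))) * ?r) m"
        by (simp add: g HM.pairing_gen mult.assoc)
    qed
    also have "\<dots> = HM.ks (swd (*) (\<lambda>a b. x (S (g0 * a)) * y (S (g1 * b))) h * ?r) m"
      unfolding swd_def by (rule lin_ext_comp[OF lin, symmetric])
    also have "\<dots> = HM.ks (?D (S h) * ?r) m"
      by (simp only: dual_mult_antipode[OF xy])
    finally show "HM.pairing (x # y # ys) ((\<lambda>(hs, v). free_ext (\<lambda>ks. gen (map2 (*) g ks @ tl hs, v)) (rep (\<Delta> (hd hs)))) (hs, m))
      = HM.ks (eval_prod (?D # ys) hs) m"
      by (simp add: hs)
  qed
  then show "HM.pairing (x # y # ys) ((\<lambda>(g, b). free_ext (\<lambda>(hs, v). free_ext (\<lambda>ks. gen (map2 (*) g ks @ tl hs, v)) (rep (\<Delta> (hd hs)))) (rep (\<gamma> (b # as)))) z)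
    = (\<lambda>(g, b). HM.pairing (dual_mult (dual_act x (g ! 0)) (dual_act y (g ! 1)) # ys) (rep (\<gamma> (b # as)))) z"
    by (simp add: z(1) g)
qed

lemma keys_permute:
  assumes "tens_supp n p" "\<And>hs. length hs = n \<Longrightarrow> length (\<sigma> hs) = n"
  shows "tens_supp n (permute \<sigma> p)"
  unfolding permute_def by (rule keys_free_ext) (use assms in \<open>auto simp: keys_gen\<close>)

lemma keys_act_cochain:
  assumes "tens_supp n p"
  shows "tens_supp (Suc n) (act_cochain a p)"
  unfolding act_cochain_def
proof (rule keys_free_ext)
  fix z assume "z \<in> keys p"
  then obtain f m where z: "z = (f, m)" "length f = n" using assms by auto
  show "tens_supp (Suc n) ((\<lambda>(f, m). free_ext (\<lambda>(h, v). gen (h # f, v)) (straighten actM (pact a m))) z)"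
    unfolding z(1) prod.case by (rule keys_free_ext) (use z(2) in \<open>auto simp: keys_gen\<close>)
qed

lemma keys_eval_cochain:
  assumes "tens_supp 2 q"
    and "\<And>b. tens_supp (Suc n) (rep (\<gamma> (b # as)))"
  shows "tens_supp (Suc (Suc n)) (eval_cochain \<gamma> q as)"
  unfolding eval_cochain_def
proof (rule keys_free_ext)
  fix z assume "z \<in> keys q"
  then obtain g b where z: "z = (g, b)" "length g = 2" using assms(1) by auto
  have "tens_supp (Suc (Suc n)) (free_ext (\<lambda>(hs, v). free_ext (\<lambda>ks. gen (map2 (*) g ks @ tl hs, v)) (rep (\<Delta> (hd hs)))) (rep (\<gamma> (b # as))))"
  proof (rule keys_free_ext)
    fix w assume "w \<in> keys (rep (\<gamma> (b # as)))"
    then obtain hs v where w: "w = (hs, v)" "length hs = Suc n" using assms(2)[of b] by auto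
    show "tens_supp (Suc (Suc n)) ((\<lambda>(hs, v). free_ext (\<lambda>ks. gen (map2 (*) g ks @ tl hs, v)) (rep (\<Delta> (hd hs)))) w)"
      unfolding w(1) prod.case
      by (rule keys_free_ext) (use w(2) z(2) in \<open>auto simp: keys_gen dest: length_comult_keys\<close>)
  qed
  then show "tens_supp (Suc (Suc n)) ((\<lambda>(g, b). free_ext (\<lambda>(hs, v). free_ext (\<lambda>ks. gen (map2 (*) g ks @ tl hs, v)) (rep (\<Delta> (hd hs)))) (rep (\<gamma> (b # as)))) z)" by (simp add: z(1))
qed

text \<open>The action terms of the two differentials agree term by term by
  the definition of the action on \<open>M\<close>; for the bracket terms one uses
  \<open>\<langle>(x f)(y g), S h\<rangle> = \<Sum> \<langle>x, S(f h\<^sub>(\<^sub>1\<^sub>))\<rangle> \<langle>y, S(g h\<^sub>(\<^sub>2\<^sub>))\<rangle>\<close>.\<close>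

lemma corresponds_differential:
  assumes \<gamma>c: "corresponds n \<gamma> c" and c: "c \<in> ce_cochains n"
  shows "corresponds (Suc n) (basic_d n \<gamma>) (ce_d n c)"
proof -
  note \<gamma>t = correspondsD(1)[OF \<gamma>c] and \<gamma>p = correspondsD(3)[OF \<gamma>c]
  have cm: "ann_multilinear n c" using c by (simp add: ce_cochains_iff)
  define A where "A as i = permute (\<lambda>hs. insert_at i (hd hs) (tl hs)) (act_cochain (as ! i) (rep (\<gamma> (omit i as))))" for as i
  define B where "B as i j = permute (\<lambda>hs. insert_at j (hs ! 1) (insert_at i (hs ! 0) (drop 2 hs)))
            (eval_cochain \<gamma> (rep (br (as ! i) (as ! j))) (omit i (omit j as)))" for as i j
  let ?D = "\<lambda>as. (\<Sum>i<Suc n. fscale ((-1) ^ i) (A as i)) + (\<Sum>j<Suc n. \<Sum>i<j. fscale ((-1) ^ (i + j)) (B as i j))"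
  have d: "basic_d n \<gamma> as = ?D as +o tens_rel actM (Suc n)" if "length as = Suc n" for as
    using that by (simp add: basic_d_def A_def B_def)
  have keys_act: "tens_supp (Suc n) (act_cochain (as ! i) (rep (\<gamma> (omit i as))))"
    if "length as = Suc n" "i < Suc n" for as i
    by (rule keys_act_cochain[OF HM.keys_tens[OF \<gamma>t]]) (use that in \<open>simp add: length_omit\<close>)
  have keys_A: "tens_supp (Suc n) (A as i)" if "length as = Suc n" "i < Suc n" for as i
    unfolding A_def by (rule keys_permute[OF keys_act[OF that]]) auto
  have keys_\<gamma>: "tens_supp (Suc (n - 1)) (rep (\<gamma> (b # omit i (omit j as))))"
    if "length as = Suc n" "i < j" "j < Suc n" for as i j b
  proof -
    have "length (b # omit i (omit j as)) = n" using that by (simp add: length_omit)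
    from HM.keys_tens[OF \<gamma>t[OF this]] show ?thesis using that by simp
  qed
  have keys_eval: "tens_supp (Suc (Suc (n - 1))) (eval_cochain \<gamma> (rep (br (as ! i) (as ! j))) (omit i (omit j as)))"
    if "length as = Suc n" "i < j" "j < Suc n" for as i j
    by (rule keys_eval_cochain[OF HL.keys_htens[OF br_closed]]) (rule keys_\<gamma>[OF that])
  have keys_B: "tens_supp (Suc n) (B as i j)"
    if "length as = Suc n" "i < j" "j < Suc n" for as i j
    unfolding B_def
    by (rule keys_permute) (use keys_eval[OF that] that in auto)
  have keys_D: "tens_supp (Suc n) (?D as)" if "length as = Suc n" for as
  proof -
    let ?W = "{p. keys p \<subseteq> {hs. length hs = Suc n} \<times> (UNIV :: 'm set)} :: ('h list \<times> 'm \<Rightarrow>\<^sub>0 'k) set"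
    have W: "free.subspace ?W" by (rule keys_supported_subspace)
    have "?D as \<in> ?W"
      by (intro free.subspace_add[OF W] free.subspace_sum[OF W] free.subspace_scale[OF W])
        (use keys_A keys_B that in auto)
    then show ?thesis by simp
  qed
  show ?thesis
    unfolding corresponds_def
  proof (intro conjI allI impI)
    show "basic_d n \<gamma> as \<in> tens actM (Suc n)" if "length as = Suc n" for as
      unfolding d[OF that] by (rule HM.coset_in_tens[OF keys_D[OF that]])
    show "basic_d n \<gamma> as = tens_rel actM (Suc n)" if "length as \<noteq> Suc n" for as
      using that by (simp add: basic_d_def)
    fix xs and as :: "'l list" assume *: "length xs = Suc n \<and> length as = Suc n \<and> set xs \<subseteq> dual"
    then have len: "length xs = Suc n" "length as = Suc n" and xs: "set xs \<subseteq> dual" by auto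
    let ?Ps = "map2 ann_elem xs as"
    have xd: "xs ! i \<in> dual" if "i < Suc n" for i using xs len that nth_mem[of i xs] by auto
    have Ps: "set ?Ps \<subseteq> ann" using xs ann_elem_in_ann set_zip_leftD by fastforce
    have nth: "?Ps ! i = ann_elem (xs ! i) (as ! i)" if "i < Suc n" for i using len that by simp
    have A: "HM.pairing xs (A as i) = ann_act (?Ps ! i) (c (omit i ?Ps))" if i: "i < Suc n" for i
    proof -
      have o: "length (omit i xs) = n" "length (omit i as) = n" "set (omit i xs) \<subseteq> dual"
        using len i set_omit[of i xs] xs by (auto simp: length_omit)
      have "HM.pairing xs (A as i) = HM.pairing (xs ! i # omit i xs) (act_cochain (as ! i) (rep (\<gamma> (omit i as))))"
        unfolding A_def by (rule HM.pairing_insert_one[OF keys_act[OF len(2) i] len(1) i])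
      also have "\<dots> = act_form (xs ! i) (as ! i) (c (omit i ?Ps))"
        using len o by (simp add: pairing_act_cochain[OF xd[OF i]] \<gamma>p omit_map2)
      also have "\<dots> = ann_act (?Ps ! i) (c (omit i ?Ps))"
        unfolding nth[OF i] by (rule ann_act_elem[OF xd[OF i], symmetric])
      finally show ?thesis .
    qed
    have B: "HM.pairing xs (B as i j) = c (ann_bracket (?Ps ! i) (?Ps ! j) # omit i (omit j ?Ps))"
      if ij: "i < j" "j < Suc n" for i j
    proof -
      let ?x = "omit i (omit j xs)" and ?a = "omit i (omit j as)"
      have i: "i < Suc n" using ij by simp
      have o: "length ?x = n - 1" "length ?a = n - 1" "set ?x \<subseteq> dual" "length (omit j xs) = n" "length (omit j as) = n"
        using len ij set_omit[of i "omit j xs"] set_omit[of j xs] xs by (auto simp: length_omit)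
      have oPs: "omit i (omit j ?Ps) = map2 ann_elem ?x ?a" using len o by (simp add: omit_map2)
      have "set (map2 ann_elem ?x ?a) \<subseteq> ann" using o(3) ann_elem_in_ann set_zip_leftD by fastforce
      then have lin: "ann_linear HM.ks (\<lambda>P. c (P # map2 ann_elem ?x ?a))"
        using ann_multilinearD[OF cm, of "[]" "map2 ann_elem ?x ?a"] o ij by simp
      have "HM.pairing xs (B as i j)
        = HM.pairing (xs ! i # xs ! j # ?x) (eval_cochain \<gamma> (rep (br (as ! i) (as ! j))) ?a)"
        unfolding B_def by (rule HM.pairing_insert_two[OF keys_eval[OF len(2) ij]]) (use len ij in auto)
      also have "\<dots> = lin_ext HM.ks (\<lambda>(g, b).
          HM.pairing (dual_mult (dual_act (xs ! i) (g ! 0)) (dual_act (xs ! j) (g ! 1)) # ?x) (rep (\<gamma> (b # ?a))))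
          (rep (br (as ! i) (as ! j)))"
        by (rule pairing_eval_cochain[OF xd[OF i] xd[OF ij(2)] HL.keys_htens[OF br_closed]]) (rule keys_\<gamma>[OF len(2) ij])
      also have "\<dots> = bracket_form HM.ks (\<lambda>P. c (P # map2 ann_elem ?x ?a)) (xs ! i) (as ! i) (xs ! j) (as ! j)"
        unfolding bracket_form_def[OF vsM]
      proof (rule lin_ext_cong)
        fix z :: "'h list \<times> 'l"
        obtain g b where z: "z = (g, b)" by (cases z)
        let ?D = "dual_mult (dual_act (xs ! i) (g ! 0)) (dual_act (xs ! j) (g ! 1))"
        have "?D \<in> dual" by (intro dual_mult_closed dual_act_closed xd i ij)
        then have "HM.pairing (?D # ?x) (rep (\<gamma> (b # ?a))) = c (map2 ann_elem (?D # ?x) (b # ?a))"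
          using o ij by (intro \<gamma>p) auto
        then show "(\<lambda>(g, b). HM.pairing (dual_mult (dual_act (xs ! i) (g ! 0)) (dual_act (xs ! j) (g ! 1)) # ?x) (rep (\<gamma> (b # ?a)))) z
          = (\<lambda>(hs, e). c (ann_elem (dual_mult (dual_act (xs ! i) (hs ! 0)) (dual_act (xs ! j) (hs ! 1))) e # map2 ann_elem ?x ?a)) z"
          by (simp add: z)
      qed
      also have "\<dots> = c (ann_bracket (?Ps ! i) (?Ps ! j) # omit i (omit j ?Ps))"
        unfolding nth[OF i] nth[OF ij(2)] oPs
        by (rule ann_bracket_elem[OF vsM lin xd[OF i] xd[OF ij(2)], symmetric])
      finally show ?thesis .
    qed
    note lp = lin_add[OF HM.linear_pairing] lin_sum[OF HM.linear_pairing] lin_scale[OF HM.linear_pairing]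
    have "HM.pairing xs (rep (basic_d n \<gamma> as)) = HM.pairing xs (?D as)"
      unfolding d[OF len(2)] by (rule HM.pairing_rep_coset[OF len(1) xs])
    also have "\<dots> = (\<Sum>i<Suc n. HM.ks ((-1) ^ i) (HM.pairing xs (A as i)))
        + (\<Sum>j<Suc n. \<Sum>i<j. HM.ks ((-1) ^ (i + j)) (HM.pairing xs (B as i j)))"
      by (simp only: lp)
    also have "\<dots> = (\<Sum>i<Suc n. HM.ks ((-1) ^ i) (ann_act (?Ps ! i) (c (omit i ?Ps))))
        + (\<Sum>j<Suc n. \<Sum>i<j. HM.ks ((-1) ^ (i + j)) (c (ann_bracket (?Ps ! i) (?Ps ! j) # omit i (omit j ?Ps))))"
      by (intro arg_cong2[where f = "(+)"] sum.cong refl) (simp_all only: A B lessThan_iff)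
    also have "\<dots> = ce_d n c ?Ps" using Ps len by (simp add: ce_d_def)
    finally show "HM.pairing xs (rep (basic_d n \<gamma> as)) = ce_d n c ?Ps" .
  qed
qed

end


subsection \<open>Locality\<close>

locale filtered_lie_module =
  lie_pseudoalgebra_module scale \<Delta> \<epsilon> S actL br actM pact + filtered_hopf_algebra scale \<Delta> \<epsilon> S
  for scale :: "'k::field \<Rightarrow> 'h::ring_1 \<Rightarrow> 'h" and \<Delta> \<epsilon> S
    and actL :: "'h \<Rightarrow> 'l::ab_group_add \<Rightarrow> 'l" and br
    and actM :: "'h \<Rightarrow> 'm::ab_group_add \<Rightarrow> 'm" and pact +
  assumes two_nonzero: "(2::'k) \<noteq> 0"
begin

text \<open>A cochain that corresponds to tensors is local, because the finitely many first factors of a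
  tensor lie in one step of the exhaustive filtration.\<close>

lemma pairing_local:
  assumes "tens_supp (Suc n) p"
  shows "\<exists>K. \<forall>k\<ge>K. \<forall>x\<in>dual_filt k. HM.pairing (x # xs) p = 0"
proof -
  define d where "d z = (SOME k. S (hd (fst z)) \<in> filt k)" for z :: "'h list \<times> 'm"
  have d: "S (hd (fst z)) \<in> filt (d z)" for z unfolding d_def using exhaustive by (rule someI_ex)
  define K where "K = Max (insert 0 (d ` keys p))"
  have "HM.pairing (x # xs) p = 0" if k: "k \<ge> K" and x: "x \<in> dual_filt k" for k x
  proof -
    have "HM.pairing (x # xs) p = lin_ext HM.ks (\<lambda>_. 0) p"
      unfolding HM.pairing_def
    proof (rule lin_ext_cong)
      fix z assume z: "z \<in> keys p"
      then obtain h t m where hs: "z = (h # t, m)" using assms by (auto simp: length_Suc_conv)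
      have "d z \<le> K" using z by (simp add: K_def)
      then have "S h \<in> filt k" using d[of z] filt_mono[of "d z" k] k hs by auto
      then have "x (S h) = 0" using x by (simp add: dual_filt_def)
      then show "(\<lambda>(hs, m). HM.ks (eval_prod (x # xs) hs) m) z = 0"
        by (simp add: hs)
    qed
    then show ?thesis by (simp add: HM.K.lin_ext_fun_zero)
  qed
  then show ?thesis by blast
qed

lemma corresponds_local:
  assumes "corresponds n \<gamma> c" "c \<in> ce_cochains n"
  shows "c \<in> gf_cochains n"
proof -
  have "\<exists>K. \<forall>k\<ge>K. \<forall>x\<in>dual_filt k. c (ann_elem x a # map2 ann_elem xs as) = 0"
    if *: "set xs \<subseteq> dual \<and> length xs = length as \<and> Suc (length as) = n" for xs a as
  proof -
    have t: "\<gamma> (a # as) \<in> tens actM n" using * by (intro correspondsD[OF assms(1)]) auto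
    have "tens_supp (Suc (length as)) (rep (\<gamma> (a # as)))"
      using HM.keys_tens[OF t] * by simp
    from pairing_local[OF this, of xs] obtain K where
      K: "\<forall>k\<ge>K. \<forall>x\<in>dual_filt k. HM.pairing (x # xs) (rep (\<gamma> (a # as))) = 0" by blast
    have "c (ann_elem x a # map2 ann_elem xs as) = HM.pairing (x # xs) (rep (\<gamma> (a # as)))" if "x \<in> dual" for x
      using correspondsD(3)[OF assms(1), of "x # xs" "a # as"] * that by simp
    then show ?thesis using K dual_filt_dual by metis
  qed
  then show ?thesis using assms(2) by (simp add: gf_cochains_def)
qed

text \<open>Locality is a condition on the first argument only; an alternating cochain carries it to every slot,
  since the element in that slot can be moved to the front.\<close>

lemma gf_cochain_multilinear:
  assumes c: "c \<in> gf_cochains n" and as: "length as = n"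
  shows "dual_multilinear HM.ks n (\<lambda>xs. c (map2 ann_elem xs as))"
  unfolding dual_multilinear_def
proof (intro allI impI)
  fix us vs :: "('h \<Rightarrow> 'k) list"
  assume *: "length us + length vs + 1 = n \<and> set us \<subseteq> dual \<and> set vs \<subseteq> dual"
  have ce: "c \<in> ce_cochains n" using c by (simp add: gf_cochains_def)
  obtain as1 a as2 where as': "as = as1 @ a # as2" "length as1 = length us" "length as2 = length vs"
    by (rule split_at_length[of as us vs]) (use * as in auto)
  let ?U = "map2 ann_elem us as1" and ?V = "map2 ann_elem vs as2"
  have eq: "map2 ann_elem (us @ x # vs) as = ?U @ ann_elem x a # ?V" for x
    using as' by simp
  have UV: "set ?U \<subseteq> ann" "set ?V \<subseteq> ann" "length ?U + length ?V + 1 = n"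
    using * as' by (auto intro!: ann_elem_in_ann dest: set_zip_leftD)
  have "ann_linear HM.ks (\<lambda>P. c (?U @ P # ?V))"
    using ce UV by (intro ann_multilinearD[of n]) (simp_all add: ce_cochains_iff)
  from ann_balanced_of_linear[OF this] have "dual_linear HM.ks (\<lambda>x. c (?U @ ann_elem x a # ?V))"
    unfolding ann_balanced_def by blast
  moreover have "\<exists>K. \<forall>x\<in>dual_filt K. c (?U @ ann_elem x a # ?V) = 0"
  proof -
    have "?U @ ?V = map2 ann_elem (us @ vs) (as1 @ as2)" using as' by simp
    moreover obtain K where "\<forall>k\<ge>K. \<forall>x\<in>dual_filt k. c (ann_elem x a # map2 ann_elem (us @ vs) (as1 @ as2)) = 0"
      by (rule gf_cochainsD[OF c, of "us @ vs" "as1 @ as2" a]) (use * as' in auto)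
    ultimately have "c (?U @ ann_elem x a # ?V) = 0" if "x \<in> dual_filt K" for x
      using that UV ann_elem_in_ann[OF dual_filt_dual[OF that]] by (intro ce_move_front[OF ce]) auto
    then show ?thesis by blast
  qed
  ultimately show "dual_linear HM.ks (\<lambda>x. c (map2 ann_elem (us @ x # vs) as)) \<and>
      (\<exists>K. \<forall>x\<in>dual_filt K. c (map2 ann_elem (us @ x # vs) as) = 0)"
    unfolding eq by blast
qed

text \<open>A local cochain is jointly continuous, hence depends on each argument only through its values on a
  finite-dimensional \<open>F\<^sup>K H\<close>. With a basis of that space it is the pairing with
  \<open>\<Sum> S b\<^sub>1 \<otimes> \<dots> \<otimes> S b\<^sub>n \<otimes> c(b\<^sub>1\<^sup>* \<otimes>\<^sub>H a\<^sub>1, \<dots>, b\<^sub>n\<^sup>* \<otimes>\<^sub>H a\<^sub>n)\<close>.\<close>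

lemma exists_tensor:
  assumes c: "c \<in> gf_cochains n" and as: "length as = n"
  shows "\<exists>p. tens_supp n p \<and>
    (\<forall>xs. length xs = n \<and> set xs \<subseteq> dual \<longrightarrow> HM.pairing xs p = c (map2 ann_elem xs as))"
proof -
  let ?f = "\<lambda>xs. c (map2 ann_elem xs as)"
  note ml = gf_cochain_multilinear[OF c as]
  obtain K where K: "\<And>xs ys. length xs = n \<Longrightarrow> set xs \<subseteq> dual \<Longrightarrow> set ys \<subseteq> dual \<Longrightarrow> dual_cong K xs ys \<Longrightarrow> ?f xs = ?f ys"
    using multilinear_uniformly_continuous[OF vsM ml] by blast
  obtain B e where B: "finite B" "\<And>b. b \<in> B \<Longrightarrow> e b \<in> dual"
      "\<And>x. x \<in> dual \<Longrightarrow> (\<lambda>h. x h - (\<Sum>b\<in>B. x b * e b h)) \<in> dual_filt K"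
    by (rule filt_dual_system[of K]) blast
  let ?L = "{cs. set cs \<subseteq> B \<and> length cs = n}"
  let ?p = "\<Sum>cs\<in>?L. gen (map S cs, ?f (map e cs))"
  have "tens_supp n ?p"
    using free.subspace_sum[OF keys_supported_subspace[of "{hs. length hs = n} \<times> UNIV"],
        of ?L "\<lambda>cs. gen (map S cs, ?f (map e cs))"] by (simp add: keys_gen)
  moreover have "HM.pairing xs ?p = ?f xs" if xs: "length xs = n" "set xs \<subseteq> dual" for xs
  proof -
    let ?q = "\<lambda>x h. \<Sum>b\<in>B. x b * e b h"
    have "?f xs = ?f (map ?q xs)"
    proof (rule K[OF xs])
      show "set (map ?q xs) \<subseteq> dual" using B(2) dual_sum_closed by auto
      show "dual_cong K xs (map ?q xs)"
        by (auto simp: dual_cong_def list_all2_conv_all_nth intro!: B(3) subsetD[OF xs(2)])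
    qed
    also have "\<dots> = (\<Sum>cs\<in>?L. HM.ks (prod_list (map2 (\<lambda>x c. x c) xs cs)) (?f (map e cs)))"
      by (rule dual_multilinear_expansion[OF vsM ml B(1,2) xs])
    also have "\<dots> = HM.pairing xs ?p"
      unfolding lin_sum[OF HM.linear_pairing]
    proof (rule sum.cong[OF refl])
      fix cs assume "cs \<in> ?L"
      have "map2 (\<lambda>x h. x (S h)) xs (map S cs) = map2 (\<lambda>x c. x c) xs cs"
        by (rule nth_equalityI) (auto simp: antipode_involution)
      then show "HM.ks (prod_list (map2 (\<lambda>x c. x c) xs cs)) (?f (map e cs)) = HM.pairing xs (gen (map S cs, ?f (map e cs)))"
        by (simp add: HM.pairing_gen)
    qed
    finally show ?thesis ..
  qed
  ultimately show ?thesis by blast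
qed

text \<open>The tensors of \<open>exists_tensor\<close> inherit additivity, \<open>H\<^sup>\<otimes>\<^sup>n\<close>-linearity and skewness from \<open>c\<close>, because they
  are determined by their contractions.\<close>

lemma exists_basic_cochain:
  assumes c: "c \<in> gf_cochains n"
  obtains \<gamma> where "\<gamma> \<in> basic_cochains n" "corresponds n \<gamma> c"
proof -
  have ce: "c \<in> ce_cochains n" using c by (simp add: gf_cochains_def)
  have "\<forall>as. \<exists>p. length as = n \<longrightarrow> tens_supp n p \<and>
    (\<forall>xs. length xs = n \<and> set xs \<subseteq> dual \<longrightarrow> HM.pairing xs p = c (map2 ann_elem xs as))"
    using exists_tensor[OF c] by blast
  then obtain t where t: "\<And>as. length as = n \<Longrightarrow> tens_supp n (t as)"
    "\<And>as xs. length as = n \<Longrightarrow> length xs = n \<Longrightarrow> set xs \<subseteq> dual \<Longrightarrow> HM.pairing xs (t as) = c (map2 ann_elem xs as)"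
    by metis
  define \<gamma> where "\<gamma> as = (if length as = n then t as +o tens_rel actM n else tens_rel actM n)" for as
  have cor: "corresponds n \<gamma> c"
    unfolding corresponds_def
  proof (intro conjI allI impI)
    show "\<gamma> as \<in> tens actM n" if "length as = n" for as
      using HM.coset_in_tens[OF t(1)[OF that]] that by (simp add: \<gamma>_def)
    show "\<gamma> as = tens_rel actM n" if "length as \<noteq> n" for as using that by (simp add: \<gamma>_def)
    show "HM.pairing xs (rep (\<gamma> as)) = c (map2 ann_elem xs as)" if "length xs = n \<and> length as = n \<and> set xs \<subseteq> dual" for xs as
      using that HM.pairing_rep_coset[of xs n "t as"] t(2)[of as xs] by (simp add: \<gamma>_def)
  qed
  note p = correspondsD(3)[OF cor] and cl = correspondsD(1)[OF cor]
  have elems: "set (map2 ann_elem xs as) \<subseteq> ann" if "set xs \<subseteq> dual" for xs as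
    using that by (auto intro!: ann_elem_in_ann dest: set_zip_leftD)
  have "\<gamma> \<in> basic_cochains n"
    unfolding basic_cochains_def
  proof (intro CollectI conjI allI impI)
    fix us vs :: "'l list" and a b assume len: "length us + length vs + 1 = n"
    show "\<gamma> (us @ (a + b) # vs) = \<gamma> (us @ a # vs) + \<gamma> (us @ b # vs)"
    proof (rule HM.tens_eqI[OF cl HM.tens_add(1)[OF cl cl]])
      fix xs :: "('h \<Rightarrow> 'k) list" assume xs: "length xs = n" "set xs \<subseteq> dual"
      obtain xs1 x xs2 where x: "xs = xs1 @ x # xs2" "length xs1 = length us" "length xs2 = length vs"
        by (rule split_at_length[of xs us vs]) (use len xs in auto)
      have lin: "ann_linear HM.ks (\<lambda>P. c (map2 ann_elem xs1 us @ P # map2 ann_elem xs2 vs))"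
        by (rule ann_multilinearD[of n]) (use ce len x xs elems[of xs1] elems[of xs2] in \<open>auto simp: ce_cochains_iff\<close>)
      have bal: "ann_balanced HM.ks (\<lambda>x a. c (map2 ann_elem xs1 us @ ann_elem x a # map2 ann_elem xs2 vs))"
        by (rule ann_balanced_of_linear[OF lin])
      have sum: "HM.pairing xs (rep (\<gamma> (us @ a # vs) + \<gamma> (us @ b # vs)))
        = HM.pairing xs (rep (\<gamma> (us @ a # vs))) + HM.pairing xs (rep (\<gamma> (us @ b # vs)))"
        by (rule HM.tens_add(2)[OF cl cl xs]) (use len in auto)
      show "HM.pairing xs (rep (\<gamma> (us @ (a + b) # vs))) = HM.pairing xs (rep (\<gamma> (us @ a # vs) + \<gamma> (us @ b # vs)))"
        unfolding sum using len xs x bal by (simp add: p ann_balanced_def)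
    qed (use len in auto)
  next
    fix hs :: "'h list" and as :: "'l list" assume len: "length hs = n \<and> length as = n"
    show "\<gamma> (map2 actL hs as) = lmult hs (rep (\<gamma> as)) +o tens_rel actM n"
    proof (rule HM.tens_eqI[OF cl HM.coset_in_tens])
      show "tens_supp n (lmult hs (rep (\<gamma> as)))"
        unfolding lmult_def
        by (rule keys_free_ext) (use HM.keys_tens[OF cl, of as] len in \<open>auto simp: keys_gen\<close>)
      fix xs :: "('h \<Rightarrow> 'k) list" assume xs: "length xs = n" "set xs \<subseteq> dual"
      have "map2 ann_elem xs (map2 actL hs as) = map2 ann_elem (map2 dual_act xs hs) as"
      proof (rule nth_equalityI)
        fix i assume i: "i < length (map2 ann_elem xs (map2 actL hs as))"
        then have "xs ! i \<in> dual" by (intro subsetD[OF xs(2)] nth_mem) simp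
        then show "map2 ann_elem xs (map2 actL hs as) ! i = map2 ann_elem (map2 dual_act xs hs) as ! i"
          using i len xs by (simp add: ann_elem_act)
      qed (use len xs in simp)
      moreover have "set (map2 dual_act xs hs) \<subseteq> dual"
        using xs(2) by (auto intro!: dual_act_closed dest: set_zip_leftD)
      ultimately show "HM.pairing xs (rep (\<gamma> (map2 actL hs as))) = HM.pairing xs (rep (lmult hs (rep (\<gamma> as)) +o tens_rel actM n))"
        using len xs HM.pairing_lmult[OF HM.keys_tens[OF cl], of as xs hs]
        by (simp add: HM.pairing_rep_coset p)
    qed (use len in auto)
  next
    fix us vs :: "'l list" and a b assume len: "length us + length vs + 2 = n"
    let ?p = "permute (\<lambda>hs. hs[length us := hs ! Suc (length us), Suc (length us) := hs ! length us]) (rep (\<gamma> (us @ a # b # vs)))"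
    have t: "\<gamma> (us @ a # b # vs) \<in> tens actM n" using len by (intro cl) simp
    have kp: "tens_supp n ?p"
      by (rule keys_permute[OF HM.keys_tens[OF t]]) auto
    show "\<gamma> (us @ b # a # vs) = (- ?p) +o tens_rel actM n"
    proof (rule HM.tens_eqI[OF cl HM.coset_in_tens])
      show "tens_supp n (- ?p)" using kp by simp
      fix xs :: "('h \<Rightarrow> 'k) list" assume xs: "length xs = n" "set xs \<subseteq> dual"
      have "length xs = length us + length (b # vs) + 1" using len xs(1) by simp
      then obtain xs1 x ys where x: "xs = xs1 @ x # ys" "length xs1 = length us" "length ys = Suc (length vs)"
        by (rule split_at_length[of xs us "b # vs"]) auto
      obtain y xs2 where y: "ys = y # xs2" "length xs2 = length vs" using x(3) by (cases ys) auto
      have d: "x \<in> dual" "y \<in> dual" "set xs1 \<subseteq> dual" "set xs2 \<subseteq> dual" using xs(2) x y by auto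
      have "HM.pairing xs (rep (\<gamma> (us @ b # a # vs)))
        = c (map2 ann_elem xs1 us @ ann_elem x b # ann_elem y a # map2 ann_elem xs2 vs)"
        using len xs x y by (simp add: p)
      also have "\<dots> = - c (map2 ann_elem xs1 us @ ann_elem y a # ann_elem x b # map2 ann_elem xs2 vs)"
        by (rule ce_skew[OF ce]) (use len x y d elems ann_elem_in_ann in auto)
      also have "\<dots> = - HM.pairing (xs1 @ y # x # xs2) (rep (\<gamma> (us @ a # b # vs)))"
        using len x y d by (simp add: p)
      also have "\<dots> = - HM.pairing xs ?p"
        using HM.pairing_swap[of "rep (\<gamma> (us @ a # b # vs))" xs1 xs2 x y] HM.keys_tens[OF t] len x y by simp
      finally show "HM.pairing xs (rep (\<gamma> (us @ b # a # vs))) = HM.pairing xs (rep ((- ?p) +o tens_rel actM n))"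
        using xs by (simp add: HM.pairing_rep_coset lin_minus[OF HM.linear_pairing])
    qed (use len in auto)
  qed (use correspondsD(1,2)[OF cor] in auto)
  then show thesis using cor by (rule that)
qed


subsection \<open>The isomorphism\<close>

definition comparison ::
  "nat \<Rightarrow> ('l list \<Rightarrow> ('h list \<times> 'm \<Rightarrow>\<^sub>0 'k) set) \<Rightarrow> ((('h \<Rightarrow> 'k) \<times> 'l \<Rightarrow>\<^sub>0 'k) set list \<Rightarrow> 'm)"
  where "comparison n \<gamma> = (SOME c. c \<in> gf_cochains n \<and> corresponds n \<gamma> c)"

lemma comparison:
  assumes "\<gamma> \<in> basic_cochains n"
  shows "comparison n \<gamma> \<in> gf_cochains n" "corresponds n \<gamma> (comparison n \<gamma>)"
proof -
  obtain c where "c \<in> ce_cochains n" "corresponds n \<gamma> c" using exists_ce_cochain[OF two_nonzero assms] .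
  then have "\<exists>c. c \<in> gf_cochains n \<and> corresponds n \<gamma> c" using corresponds_local by blast
  then have "comparison n \<gamma> \<in> gf_cochains n \<and> corresponds n \<gamma> (comparison n \<gamma>)"
    unfolding comparison_def by (rule someI_ex)
  then show "comparison n \<gamma> \<in> gf_cochains n" "corresponds n \<gamma> (comparison n \<gamma>)" by blast+
qed

lemma gf_ce: "c \<in> gf_cochains n \<Longrightarrow> c \<in> ce_cochains n"
  by (simp add: gf_cochains_def)

lemma comparison_eqI:
  assumes "\<gamma> \<in> basic_cochains n" "c \<in> gf_cochains n" "corresponds n \<gamma> c"
  shows "comparison n \<gamma> = c"
  by (rule corresponds_unique_right[OF comparison(2)[OF assms(1)] assms(3)])
    (use comparison(1)[OF assms(1)] assms(2) gf_ce in auto)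

lemma basic_cochain_of_corresponds:
  assumes "c \<in> gf_cochains n" "corresponds n \<gamma> c"
  shows "\<gamma> \<in> basic_cochains n"
  using exists_basic_cochain[OF assms(1)] corresponds_unique_left[OF assms(2)] by metis

lemma bij_comparison: "bij_betw (comparison n) (basic_cochains n) (gf_cochains n)"
  unfolding bij_betw_def
proof
  show "inj_on (comparison n) (basic_cochains n)"
    by (rule inj_onI) (metis comparison(2) corresponds_unique_left)
  show "comparison n ` basic_cochains n = gf_cochains n"
  proof
    show "comparison n ` basic_cochains n \<subseteq> gf_cochains n" using comparison(1) by blast
    show "gf_cochains n \<subseteq> comparison n ` basic_cochains n"
      using exists_basic_cochain comparison_eqI by (metis image_eqI subsetI)
  qed
qed

lemma comparison_add:
  assumes "\<gamma> \<in> basic_cochains n" "\<gamma>' \<in> basic_cochains n"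
  shows "\<gamma> + \<gamma>' \<in> basic_cochains n" "comparison n (\<gamma> + \<gamma>') = comparison n \<gamma> + comparison n \<gamma>'"
proof -
  note gf = gf_cochains_add[OF comparison(1)[OF assms(1)] comparison(1)[OF assms(2)]]
  note cor = corresponds_add[OF comparison(2)[OF assms(1)] comparison(2)[OF assms(2)]]
  show "\<gamma> + \<gamma>' \<in> basic_cochains n" by (rule basic_cochain_of_corresponds[OF gf cor])
  then show "comparison n (\<gamma> + \<gamma>') = comparison n \<gamma> + comparison n \<gamma>'" by (rule comparison_eqI[OF _ gf cor])
qed

lemma comparison_scale:
  fixes t :: 'k
  assumes "\<gamma> \<in> basic_cochains n"
  defines "\<gamma>' \<equiv> \<lambda>as. coset_scale fscale (tens_rel actM n) t (\<gamma> as)"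
  shows "\<gamma>' \<in> basic_cochains n" "comparison n \<gamma>' = (\<lambda>Ps. HM.ks t (comparison n \<gamma> Ps))"
proof -
  note gf = gf_cochains_scale[OF comparison(1)[OF assms(1)], of t]
  note cor = corresponds_scale[OF comparison(2)[OF assms(1)], of t, folded \<gamma>'_def]
  show "\<gamma>' \<in> basic_cochains n" by (rule basic_cochain_of_corresponds[OF gf cor])
  then show "comparison n \<gamma>' = (\<lambda>Ps. HM.ks t (comparison n \<gamma> Ps))" by (rule comparison_eqI[OF _ gf cor])
qed

text \<open>The cochain \<open>ce_d n (comparison n \<gamma>)\<close> is alternating, and it is local since it corresponds to the
  tensors \<open>basic_d n \<gamma>\<close>. It therefore comes from a basic cochain, which is \<open>basic_d n \<gamma>\<close> by uniqueness.\<close>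

lemma comparison_differential:
  assumes "\<gamma> \<in> basic_cochains n"
  shows "basic_d n \<gamma> \<in> basic_cochains (Suc n)" "comparison (Suc n) (basic_d n \<gamma>) = ce_d n (comparison n \<gamma>)"
proof -
  note ce = gf_ce[OF comparison(1)[OF assms]]
  note cor = corresponds_differential[OF comparison(2)[OF assms] ce]
  note gf = corresponds_local[OF cor ce_d_closed[OF two_nonzero ce]]
  show "basic_d n \<gamma> \<in> basic_cochains (Suc n)" by (rule basic_cochain_of_corresponds[OF gf cor])
  then show "comparison (Suc n) (basic_d n \<gamma>) = ce_d n (comparison n \<gamma>)" by (rule comparison_eqI[OF _ gf cor])
qed

lemma comparison_zero: "(\<lambda>_. tens_rel actM n) \<in> basic_cochains n" "comparison n (\<lambda>_. tens_rel actM n) = (\<lambda>_. 0)"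
proof -
  have gf: "(\<lambda>_. 0) \<in> gf_cochains n"
    by (simp add: gf_cochains_def ce_cochains_iff ann_multilinear_def ann_linear_def)
  have cor: "corresponds n (\<lambda>_. tens_rel actM n) (\<lambda>_. 0)"
    unfolding corresponds_def
  proof (intro conjI allI impI)
    show "tens_rel actM n \<in> tens actM n" using HM.coset_in_tens[of 0 n] by (simp add: sum_zero_coset)
    show "HM.pairing xs (rep (tens_rel actM n)) = 0" if "length xs = n \<and> length as = n \<and> set xs \<subseteq> dual"
      for xs and as :: "'l list"
      using HM.pairing_rep_coset[of xs n 0] that by (simp add: sum_zero_coset lin_zero[OF HM.linear_pairing])
  qed simp
  show "(\<lambda>_. tens_rel actM n) \<in> basic_cochains n" by (rule basic_cochain_of_corresponds[OF gf cor])
  then show "comparison n (\<lambda>_. tens_rel actM n) = (\<lambda>_. 0)" by (rule comparison_eqI[OF _ gf cor])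
qed

lemma comparison_cocycles: "comparison n ` basic_cocycles n = gf_cocycles n"
proof -
  have eq: "basic_d n \<gamma> = (\<lambda>_. tens_rel actM (Suc n)) \<longleftrightarrow> ce_d n (comparison n \<gamma>) = (\<lambda>_. 0)"
    if "\<gamma> \<in> basic_cochains n" for \<gamma>
  proof -
    have "basic_d n \<gamma> = (\<lambda>_. tens_rel actM (Suc n)) \<longleftrightarrow>
      comparison (Suc n) (basic_d n \<gamma>) = comparison (Suc n) (\<lambda>_. tens_rel actM (Suc n))"
      using bij_comparison[of "Suc n"] comparison_differential(1)[OF that] comparison_zero(1)[of "Suc n"]
      by (metis bij_betw_def inj_on_eq_iff)
    then show ?thesis by (simp add: comparison_differential(2)[OF that] comparison_zero(2))
  qed
  have img: "comparison n ` basic_cochains n = gf_cochains n" using bij_comparison by (simp add: bij_betw_def)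
  show ?thesis
  proof
    show "comparison n ` basic_cocycles n \<subseteq> gf_cocycles n"
      by (auto simp: basic_cocycles_def gf_cocycles_def eq[symmetric] comparison(1))
    show "gf_cocycles n \<subseteq> comparison n ` basic_cocycles n"
    proof
      fix c assume c: "c \<in> gf_cocycles n"
      then have "c \<in> comparison n ` basic_cochains n" by (simp add: img gf_cocycles_def)
      then obtain \<gamma> where \<gamma>: "\<gamma> \<in> basic_cochains n" "c = comparison n \<gamma>" by blast
      then have "\<gamma> \<in> basic_cocycles n" using c eq[OF \<gamma>(1)] by (simp add: basic_cocycles_def gf_cocycles_def)
      then show "c \<in> comparison n ` basic_cocycles n" using \<gamma>(2) by blast
    qed
  qed
qed

lemma comparison_coboundaries:
  "basic_coboundaries n \<subseteq> basic_cochains n" "comparison n ` basic_coboundaries n = gf_coboundaries n"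
proof -
  show "basic_coboundaries n \<subseteq> basic_cochains n"
    using comparison_zero(1)[of 0] comparison_differential(1)
    by (cases n) (auto simp: basic_coboundaries_def)
  show "comparison n ` basic_coboundaries n = gf_coboundaries n"
  proof (cases n)
    case 0
    then show ?thesis using comparison_zero(2)[of 0] by (simp add: basic_coboundaries_def gf_coboundaries_def)
  next
    case (Suc k)
    have "comparison (Suc k) ` basic_d k ` basic_cochains k = ce_d k ` comparison k ` basic_cochains k"
      using comparison_differential(2)[of _ k] by (auto simp: image_image)
    also have "comparison k ` basic_cochains k = gf_cochains k" using bij_comparison by (simp add: bij_betw_def)
    finally show ?thesis using Suc by (simp add: basic_coboundaries_def gf_coboundaries_def)
  qed
qed

end


text \<open>The isomorphism of quotients is the image map on cosets, which is injective because all cosets of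
  \<open>B\<close> by elements of \<open>Z\<close> are subsets of \<open>C\<close>.\<close>

lemma isomorphic_quotient_spaces:
  fixes \<phi> :: "'v::comm_monoid_add \<Rightarrow> 'w::comm_monoid_add"
  assumes inj: "inj_on \<phi> C" and Z: "Z \<subseteq> C" and B: "B \<subseteq> C"
    and add: "\<And>u v. u \<in> C \<Longrightarrow> v \<in> C \<Longrightarrow> u + v \<in> C" "\<And>u v. u \<in> C \<Longrightarrow> v \<in> C \<Longrightarrow> \<phi> (u + v) = \<phi> u + \<phi> v"
    and scale: "\<And>c v. v \<in> C \<Longrightarrow> sV c v \<in> C" "\<And>c v. v \<in> C \<Longrightarrow> \<phi> (sV c v) = sW c (\<phi> v)"
    and ZB: "\<phi> ` Z = Z'" "\<phi> ` B = B'"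
  shows "isomorphic_spaces (quotient_space Z B) (coset_scale sV B) (quotient_space Z' B') (coset_scale sW B')"
proof -
  have plus: "\<phi> ` (P + Q) = \<phi> ` P + \<phi> ` Q" if "P \<subseteq> C" "Q \<subseteq> C" for P Q
  proof
    show "\<phi> ` (P + Q) \<subseteq> \<phi> ` P + \<phi> ` Q"
      using that add(2) by (fastforce simp: set_plus_def)
    show "\<phi> ` P + \<phi> ` Q \<subseteq> \<phi> ` (P + Q)"
    proof
      fix w assume "w \<in> \<phi> ` P + \<phi> ` Q"
      then obtain p q where pq: "p \<in> P" "q \<in> Q" "w = \<phi> p + \<phi> q" by (auto simp: set_plus_def)
      then have "w = \<phi> (p + q)" using add(2)[OF subsetD[OF that(1) pq(1)] subsetD[OF that(2) pq(2)]] by simp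
      then show "w \<in> \<phi> ` (P + Q)" using pq(1,2) by (auto simp: set_plus_def)
    qed
  qed
  have coset: "\<phi> ` (z +o B) = \<phi> z +o B'" if "z \<in> C" for z
  proof -
    have "\<phi> (z + b) = \<phi> z + \<phi> b" if "b \<in> B" for b using \<open>z \<in> C\<close> that B add(2) by blast
    then show ?thesis unfolding elt_set_plus_def ZB(2)[symmetric] by force
  qed
  have sub: "P \<subseteq> C" if "P \<in> quotient_space Z B" for P
    using that Z B add(1) unfolding quotient_space_def elt_set_plus_def by blast
  have sc: "\<phi> ` coset_scale sV B c P = coset_scale sW B' c (\<phi> ` P)" if "P \<subseteq> C" for c P
  proof -
    have "sV c ` P \<subseteq> C" using that scale(1) by blast
    then have "\<phi> ` (sV c ` P + B) = \<phi> ` sV c ` P + B'" using plus[OF _ B] ZB(2) by simp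
    moreover have "\<phi> ` sV c ` P = sW c ` \<phi> ` P"
      unfolding image_image by (rule image_cong) (use that scale(2) in auto)
    ultimately show ?thesis by (simp add: coset_scale_def)
  qed
  show ?thesis
    unfolding isomorphic_spaces_def
  proof (intro exI[of _ "image \<phi>"] conjI ballI allI)
    show "bij_betw (image \<phi>) (quotient_space Z B) (quotient_space Z' B')"
      unfolding bij_betw_def
    proof
      show "inj_on (image \<phi>) (quotient_space Z B)"
      proof (rule inj_onI)
        fix P Q assume "P \<in> quotient_space Z B" "Q \<in> quotient_space Z B" "\<phi> ` P = \<phi> ` Q"
        then show "P = Q" using inj_on_image_eq_iff[OF inj sub sub] by simp
      qed
      have "image \<phi> ` quotient_space Z B = (\<lambda>z. \<phi> z +o B') ` Z"
        unfolding quotient_space_def image_image by (rule image_cong) (use coset Z in auto)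
      then show "image \<phi> ` quotient_space Z B = quotient_space Z' B'"
        unfolding quotient_space_def ZB(1)[symmetric] image_image .
    qed
    fix P Q c assume P: "P \<in> quotient_space Z B"
    show "\<phi> ` coset_scale sV B c P = coset_scale sW B' c (\<phi> ` P)" by (rule sc[OF sub[OF P]])
    show "\<phi> ` (P + Q) = \<phi> ` P + \<phi> ` Q" if "Q \<in> quotient_space Z B"
      by (rule plus[OF sub[OF P] sub[OF that]])
  qed
qed

context filtered_lie_module
begin

theorem cohomology_isomorphic:
  "isomorphic_spaces (basic_cohomology n) (basic_scale n) (gf_cohomology n) (gf_scale n)"
  unfolding basic_cohomology_def gf_cohomology_def basic_scale_def gf_scale_def
proof (rule isomorphic_quotient_spaces[where \<phi> = "comparison n" and C = "basic_cochains n"])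
  show "inj_on (comparison n) (basic_cochains n)" using bij_comparison by (simp add: bij_betw_def)
  show "basic_cocycles n \<subseteq> basic_cochains n" by (auto simp: basic_cocycles_def)
qed (simp_all add: comparison_coboundaries comparison_cocycles comparison_add comparison_scale)

end


theorem corollary15p3:
  fixes scale :: "'k::{alg_closed_field, field_char_0} \<Rightarrow> 'h::ring_1 \<Rightarrow> 'h"
    and \<Delta> :: "'h \<Rightarrow> ('h list \<Rightarrow>\<^sub>0 'k) set"
    and \<epsilon> :: "'h \<Rightarrow> 'k"
    and S :: "'h \<Rightarrow> 'h"
    and actL :: "'h \<Rightarrow> 'l::ab_group_add \<Rightarrow> 'l"
    and br :: "'l \<Rightarrow> 'l \<Rightarrow> ('h list \<times> 'l \<Rightarrow>\<^sub>0 'k) set"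
    and actM :: "'h \<Rightarrow> 'm::ab_group_add \<Rightarrow> 'm"
    and pact :: "'l \<Rightarrow> 'm \<Rightarrow> ('h list \<times> 'm \<Rightarrow>\<^sub>0 'k) set"
    and n :: nat
  assumes H: "cocommutative_hopf_algebra scale \<Delta> \<epsilon> S"
    and H_filt_finite_dim:
      "\<And>i. \<exists>B. finite B \<and> cocommutative_hopf_algebra.filt scale \<Delta> \<epsilon> i \<subseteq> module.span scale B"
    and L: "lie_pseudoalgebra scale \<Delta> \<epsilon> S actL br"
    and M: "lie_pseudoalgebra_module scale \<Delta> \<epsilon> S actL br actM pact"
  shows "isomorphic_spaces
    (lie_pseudoalgebra_module.basic_cohomology scale \<Delta> \<epsilon> actL br actM pact n)
    (lie_pseudoalgebra_module.basic_scale scale \<Delta> \<epsilon> actL br actM pact n)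
    (lie_pseudoalgebra_module.gf_cohomology scale \<Delta> \<epsilon> S actL br actM pact n)
    (lie_pseudoalgebra_module.gf_scale scale \<Delta> \<epsilon> S actL br actM pact n)"
proof -
  interpret closed_field_hopf_algebra scale \<Delta> \<epsilon> S
    by (simp add: closed_field_hopf_algebra_def H)
  interpret M: lie_pseudoalgebra_module scale \<Delta> \<epsilon> S actL br actM pact by (rule M)
  interpret F: filtered_lie_module scale \<Delta> \<epsilon> S actL br actM pact
    by unfold_locales (use filt_exhaustive H_filt_finite_dim in simp_all)
  show ?thesis by (rule F.cohomology_isomorphic)
qed

end
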